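(* Let $(A_n,B_n)$, $n \in \mathbb{N}$, be Cartan pairs with normalizers $N_n := N_{A_n}(B_n)$ and faithful conditional expectations $P_n: A_n \to B_n$. Let $\varphi_n: A_n \to A_{n+1}$ be injective *-homomorphisms with $\varphi_n(B_n) \subseteq B_{n+1}$, $\varphi_n(N_n) \subseteq N_{n+1}$ and $P_{n+1} \circ \varphi_n = \varphi_n \circ P_n$ for all $n$. Then $\varinjlim \{B_n;\varphi_n\}$ is a Cartan subalgebra of $\varinjlim \{A_n;\varphi_n\}$. If all $B_n$ are C*-diagonals, then $\varinjlim \{B_n;\varphi_n\}$ is a C*-diagonal of $\varinjlim \{A_n;\varphi_n\}$.
   Context: A Cartan pair $(A,B)$ consists of a (not necessarily separable) C*-algebra $A$ and a Cartan subalgebra $B$ of $A$, i.e. a maximal abelian sub-C*-algebra $B \subseteq A$ containing an approximate unit for $A$, such that the set of normalizers $N_A(B) := \{n \in A : nBn^* \subseteq B,\ n^*Bn \subseteq B\}$ generates $A$ as a C*-algebra, and such that there is a faithful conditional expectation $P: A \to B$ (which is then unique). A Cartan subalgebra $B$ is a C*-diagonal if in addition every pure state of $B$ extends uniquely to a state of $A$; equivalently, the étale groupoid underlying the Weyl twist of $(A,B)$ is principal. *)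

theory Defs
  imports Complex_Main
begin

section \<open>C*-algebras on explicit carriers\<close>

text \<open>
  The algebras of an inductive system vary with the index, so a C*-algebra is a record of operations
  on a carrier set; nothing is said about elements outside the carrier. Algebras need not be unital.
\<close>

record 'a star_alg =
  car :: "'a set"
  nul :: 'a  (\<open>\<zero>\<index>\<close>)
  add :: "'a \<Rightarrow> 'a \<Rightarrow> 'a"  (infixl \<open>\<oplus>\<index>\<close> 65)
  scl :: "complex \<Rightarrow> 'a \<Rightarrow> 'a"  (infixr \<open>\<odot>\<index>\<close> 75)
  mul :: "'a \<Rightarrow> 'a \<Rightarrow> 'a"  (infixl \<open>\<otimes>\<index>\<close> 70)
  adj :: "'a \<Rightarrow> 'a"
  nrm :: "'a \<Rightarrow> real"

definition sub :: "'a star_alg \<Rightarrow> 'a \<Rightarrow> 'a \<Rightarrow> 'a"  (infixl \<open>\<ominus>\<index>\<close> 65)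
  where "sub A x y = x \<oplus>\<^bsub>A\<^esub> (-1) \<odot>\<^bsub>A\<^esub> y"

locale cstar_algebra =
  fixes A :: "'a star_alg" (structure)
  assumes nul_closed: "\<zero> \<in> car A"
    and add_closed: "\<lbrakk>x \<in> car A; y \<in> car A\<rbrakk> \<Longrightarrow> x \<oplus> y \<in> car A"
    and scl_closed: "x \<in> car A \<Longrightarrow> c \<odot> x \<in> car A"
    and mul_closed: "\<lbrakk>x \<in> car A; y \<in> car A\<rbrakk> \<Longrightarrow> x \<otimes> y \<in> car A"
    and adj_closed: "x \<in> car A \<Longrightarrow> adj A x \<in> car A"
    and add_assoc: "\<lbrakk>x \<in> car A; y \<in> car A; z \<in> car A\<rbrakk> \<Longrightarrow> (x \<oplus> y) \<oplus> z = x \<oplus> (y \<oplus> z)"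
    and add_commute: "\<lbrakk>x \<in> car A; y \<in> car A\<rbrakk> \<Longrightarrow> x \<oplus> y = y \<oplus> x"
    and nul_add: "x \<in> car A \<Longrightarrow> \<zero> \<oplus> x = x"
    and add_inverse: "x \<in> car A \<Longrightarrow> x \<oplus> (-1) \<odot> x = \<zero>"
    and scl_add_right: "\<lbrakk>x \<in> car A; y \<in> car A\<rbrakk> \<Longrightarrow> c \<odot> (x \<oplus> y) = c \<odot> x \<oplus> c \<odot> y"
    and scl_add_left: "x \<in> car A \<Longrightarrow> (c + d) \<odot> x = c \<odot> x \<oplus> d \<odot> x"
    and scl_scl: "x \<in> car A \<Longrightarrow> c \<odot> (d \<odot> x) = (c * d) \<odot> x"
    and scl_one: "x \<in> car A \<Longrightarrow> 1 \<odot> x = x"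
    and mul_assoc: "\<lbrakk>x \<in> car A; y \<in> car A; z \<in> car A\<rbrakk> \<Longrightarrow> (x \<otimes> y) \<otimes> z = x \<otimes> (y \<otimes> z)"
    and mul_add_left: "\<lbrakk>x \<in> car A; y \<in> car A; z \<in> car A\<rbrakk> \<Longrightarrow> (x \<oplus> y) \<otimes> z = x \<otimes> z \<oplus> y \<otimes> z"
    and mul_add_right: "\<lbrakk>x \<in> car A; y \<in> car A; z \<in> car A\<rbrakk> \<Longrightarrow> x \<otimes> (y \<oplus> z) = x \<otimes> y \<oplus> x \<otimes> z"
    and scl_mul_left: "\<lbrakk>x \<in> car A; y \<in> car A\<rbrakk> \<Longrightarrow> (c \<odot> x) \<otimes> y = c \<odot> (x \<otimes> y)"
    and scl_mul_right: "\<lbrakk>x \<in> car A; y \<in> car A\<rbrakk> \<Longrightarrow> x \<otimes> (c \<odot> y) = c \<odot> (x \<otimes> y)"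
    and adj_adj: "x \<in> car A \<Longrightarrow> adj A (adj A x) = x"
    and adj_add: "\<lbrakk>x \<in> car A; y \<in> car A\<rbrakk> \<Longrightarrow> adj A (x \<oplus> y) = adj A x \<oplus> adj A y"
    and adj_scl: "x \<in> car A \<Longrightarrow> adj A (c \<odot> x) = cnj c \<odot> adj A x"
    and adj_mul: "\<lbrakk>x \<in> car A; y \<in> car A\<rbrakk> \<Longrightarrow> adj A (x \<otimes> y) = adj A y \<otimes> adj A x"
    and nrm_nonneg: "x \<in> car A \<Longrightarrow> 0 \<le> nrm A x"
    and nrm_eq_0: "x \<in> car A \<Longrightarrow> nrm A x = 0 \<longleftrightarrow> x = \<zero>"
    and nrm_scl: "x \<in> car A \<Longrightarrow> nrm A (c \<odot> x) = cmod c * nrm A x"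
    and nrm_triangle: "\<lbrakk>x \<in> car A; y \<in> car A\<rbrakk> \<Longrightarrow> nrm A (x \<oplus> y) \<le> nrm A x + nrm A y"
    and nrm_mul: "\<lbrakk>x \<in> car A; y \<in> car A\<rbrakk> \<Longrightarrow> nrm A (x \<otimes> y) \<le> nrm A x * nrm A y"
    and cstar_identity: "x \<in> car A \<Longrightarrow> nrm A (adj A x \<otimes> x) = (nrm A x)\<^sup>2"
    and complete: "\<lbrakk>\<And>n::nat. s n \<in> car A;
          \<And>e. 0 < e \<Longrightarrow> \<exists>N. \<forall>m\<ge>N. \<forall>n\<ge>N. nrm A (s m \<ominus> s n) < e\<rbrakk>
        \<Longrightarrow> \<exists>l\<in>car A. (\<lambda>n. nrm A (s n \<ominus> l)) \<longlonglongrightarrow> 0"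

definition closure_in :: "'a star_alg \<Rightarrow> 'a set \<Rightarrow> 'a set"
  where "closure_in A S = {x \<in> car A. \<forall>e>0. \<exists>y\<in>S. nrm A (x \<ominus>\<^bsub>A\<^esub> y) < e}"

definition sub_cstar :: "'a star_alg \<Rightarrow> 'a set \<Rightarrow> bool"
  where "sub_cstar A B \<longleftrightarrow>
    B \<subseteq> car A \<and> \<zero>\<^bsub>A\<^esub> \<in> B \<and>
    (\<forall>x\<in>B. \<forall>y\<in>B. x \<oplus>\<^bsub>A\<^esub> y \<in> B) \<and>
    (\<forall>c. \<forall>x\<in>B. c \<odot>\<^bsub>A\<^esub> x \<in> B) \<and>
    (\<forall>x\<in>B. \<forall>y\<in>B. x \<otimes>\<^bsub>A\<^esub> y \<in> B) \<and>
    (\<forall>x\<in>B. adj A x \<in> B) \<and>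
    closure_in A B \<subseteq> B"

definition abelian_sub_cstar :: "'a star_alg \<Rightarrow> 'a set \<Rightarrow> bool"
  where "abelian_sub_cstar A B \<longleftrightarrow>
    sub_cstar A B \<and> (\<forall>x\<in>B. \<forall>y\<in>B. x \<otimes>\<^bsub>A\<^esub> y = y \<otimes>\<^bsub>A\<^esub> x)"

definition maximal_abelian :: "'a star_alg \<Rightarrow> 'a set \<Rightarrow> bool"
  where "maximal_abelian A B \<longleftrightarrow>
    abelian_sub_cstar A B \<and> (\<forall>C. abelian_sub_cstar A C \<and> B \<subseteq> C \<longrightarrow> C = B)"

definition generated_cstar :: "'a star_alg \<Rightarrow> 'a set \<Rightarrow> 'a set"
  where "generated_cstar A S = \<Inter>{C. sub_cstar A C \<and> S \<subseteq> C}"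

definition positive :: "'a star_alg \<Rightarrow> 'a \<Rightarrow> bool"
  where "positive A x \<longleftrightarrow> (\<exists>y\<in>car A. x = adj A y \<otimes>\<^bsub>A\<^esub> y)"

text \<open>
  An approximate unit is a net of positive elements of norm at most one; \<open>F\<close> is the filter
  of tails of the net. Every proper filter arises from a net, so no index type has to be chosen.
\<close>

definition contains_approx_unit :: "'a star_alg \<Rightarrow> 'a set \<Rightarrow> bool"
  where "contains_approx_unit A B \<longleftrightarrow>
    (\<exists>F. F \<noteq> bot \<and> (\<forall>\<^sub>F e in F. e \<in> B \<and> positive A e \<and> nrm A e \<le> 1) \<and>
      (\<forall>a\<in>car A. ((\<lambda>e. nrm A (e \<otimes>\<^bsub>A\<^esub> a \<ominus>\<^bsub>A\<^esub> a)) \<longlongrightarrow> 0) F \<and>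
                 ((\<lambda>e. nrm A (a \<otimes>\<^bsub>A\<^esub> e \<ominus>\<^bsub>A\<^esub> a)) \<longlongrightarrow> 0) F))"

definition star_hom :: "'a star_alg \<Rightarrow> 'b star_alg \<Rightarrow> ('a \<Rightarrow> 'b) \<Rightarrow> bool"
  where "star_hom A C f \<longleftrightarrow>
    (\<forall>x\<in>car A. f x \<in> car C) \<and>
    (\<forall>x\<in>car A. \<forall>y\<in>car A. f (x \<oplus>\<^bsub>A\<^esub> y) = f x \<oplus>\<^bsub>C\<^esub> f y) \<and>
    (\<forall>c. \<forall>x\<in>car A. f (c \<odot>\<^bsub>A\<^esub> x) = c \<odot>\<^bsub>C\<^esub> f x) \<and>
    (\<forall>x\<in>car A. \<forall>y\<in>car A. f (x \<otimes>\<^bsub>A\<^esub> y) = f x \<otimes>\<^bsub>C\<^esub> f y) \<and>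
    (\<forall>x\<in>car A. f (adj A x) = adj C (f x))"


section \<open>Cartan subalgebras and C*-diagonals\<close>

definition normalizers :: "'a star_alg \<Rightarrow> 'a set \<Rightarrow> 'a set"
  where "normalizers A B = {n \<in> car A. \<forall>b\<in>B.
    n \<otimes>\<^bsub>A\<^esub> b \<otimes>\<^bsub>A\<^esub> adj A n \<in> B \<and> adj A n \<otimes>\<^bsub>A\<^esub> b \<otimes>\<^bsub>A\<^esub> n \<in> B}"

definition cond_exp :: "'a star_alg \<Rightarrow> 'a set \<Rightarrow> ('a \<Rightarrow> 'a) \<Rightarrow> bool"
  where "cond_exp A B P \<longleftrightarrow>
    (\<forall>x\<in>car A. P x \<in> B) \<and>
    (\<forall>x\<in>car A. \<forall>y\<in>car A. P (x \<oplus>\<^bsub>A\<^esub> y) = P x \<oplus>\<^bsub>A\<^esub> P y) \<and>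
    (\<forall>c. \<forall>x\<in>car A. P (c \<odot>\<^bsub>A\<^esub> x) = c \<odot>\<^bsub>A\<^esub> P x) \<and>
    (\<forall>x\<in>car A. nrm A (P x) \<le> nrm A x) \<and>
    (\<forall>x\<in>car A. positive A x \<longrightarrow> positive A (P x)) \<and>
    (\<forall>b\<in>B. P b = b) \<and>
    (\<forall>b\<in>B. \<forall>x\<in>car A. P (b \<otimes>\<^bsub>A\<^esub> x) = b \<otimes>\<^bsub>A\<^esub> P x \<and> P (x \<otimes>\<^bsub>A\<^esub> b) = P x \<otimes>\<^bsub>A\<^esub> b)"

definition faithful_cond_exp :: "'a star_alg \<Rightarrow> 'a set \<Rightarrow> ('a \<Rightarrow> 'a) \<Rightarrow> bool"
  where "faithful_cond_exp A B P \<longleftrightarrow> cond_exp A B P \<and>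
    (\<forall>x\<in>car A. P (adj A x \<otimes>\<^bsub>A\<^esub> x) = \<zero>\<^bsub>A\<^esub> \<longrightarrow> x = \<zero>\<^bsub>A\<^esub>)"

definition cartan_pair :: "'a star_alg \<Rightarrow> 'a set \<Rightarrow> bool"
  where "cartan_pair A B \<longleftrightarrow>
    cstar_algebra A \<and> maximal_abelian A B \<and> contains_approx_unit A B \<and>
    generated_cstar A (normalizers A B) = car A \<and> (\<exists>P. faithful_cond_exp A B P)"

text \<open>The last two conjuncts say that the functional has operator norm exactly one.\<close>

definition state :: "'a star_alg \<Rightarrow> ('a \<Rightarrow> complex) \<Rightarrow> bool"
  where "state A f \<longleftrightarrow>
    (\<forall>x\<in>car A. \<forall>y\<in>car A. f (x \<oplus>\<^bsub>A\<^esub> y) = f x + f y) \<and>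
    (\<forall>c. \<forall>x\<in>car A. f (c \<odot>\<^bsub>A\<^esub> x) = c * f x) \<and>
    (\<forall>x\<in>car A. positive A x \<longrightarrow> Im (f x) = 0 \<and> 0 \<le> Re (f x)) \<and>
    (\<forall>x\<in>car A. cmod (f x) \<le> nrm A x) \<and>
    (\<forall>c. (\<forall>x\<in>car A. cmod (f x) \<le> c * nrm A x) \<longrightarrow> 1 \<le> c)"

definition pure_state :: "'a star_alg \<Rightarrow> ('a \<Rightarrow> complex) \<Rightarrow> bool"
  where "pure_state A f \<longleftrightarrow> state A f \<and>
    (\<forall>g h t. state A g \<and> state A h \<and> 0 < t \<and> t < 1 \<and>
       (\<forall>x\<in>car A. f x = complex_of_real t * g x + complex_of_real (1 - t) * h x)
       \<longrightarrow> (\<forall>x\<in>car A. g x = f x \<and> h x = f x))"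

definition extends_uniquely :: "'a star_alg \<Rightarrow> 'a set \<Rightarrow> ('a \<Rightarrow> complex) \<Rightarrow> bool"
  where "extends_uniquely A B f \<longleftrightarrow>
    (\<exists>g. state A g \<and> (\<forall>b\<in>B. g b = f b) \<and>
       (\<forall>h. state A h \<and> (\<forall>b\<in>B. h b = f b) \<longrightarrow> (\<forall>x\<in>car A. h x = g x)))"

definition cstar_diagonal :: "'a star_alg \<Rightarrow> 'a set \<Rightarrow> bool"
  where "cstar_diagonal A B \<longleftrightarrow>
    cartan_pair A B \<and> (\<forall>f. pure_state (A\<lparr>car := B\<rparr>) f \<longrightarrow> extends_uniquely A B f)"


section \<open>Inductive limits\<close>

text \<open>
  The limit of a sequence of C*-algebras \<open>A n\<close> with connecting maps \<open>\<phi> n\<close> is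
  the closure of the union of the images of the \<open>A n\<close> in the quotient of the algebra of bounded
  sequences by the ideal of null sequences. Elements are therefore equivalence classes of sequences.
\<close>

definition bounded_seqs :: "(nat \<Rightarrow> 'a star_alg) \<Rightarrow> (nat \<Rightarrow> 'a) set"
  where "bounded_seqs A = {x. (\<forall>n. x n \<in> car (A n)) \<and> (\<exists>K. \<forall>n. nrm (A n) (x n) \<le> K)}"

definition null_rel :: "(nat \<Rightarrow> 'a star_alg) \<Rightarrow> ((nat \<Rightarrow> 'a) \<times> (nat \<Rightarrow> 'a)) set"
  where "null_rel A = {(x, y). x \<in> bounded_seqs A \<and> y \<in> bounded_seqs A \<and>
    (\<lambda>n. nrm (A n) (x n \<ominus>\<^bsub>A n\<^esub> y n)) \<longlonglongrightarrow> 0}"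

definition cls :: "(nat \<Rightarrow> 'a star_alg) \<Rightarrow> (nat \<Rightarrow> 'a) \<Rightarrow> (nat \<Rightarrow> 'a) set"
  where "cls A x = null_rel A `` {x}"

definition seq_quotient :: "(nat \<Rightarrow> 'a star_alg) \<Rightarrow> (nat \<Rightarrow> 'a) set star_alg"
  where "seq_quotient A = \<lparr>
    car = bounded_seqs A // null_rel A,
    nul = cls A (\<lambda>n. \<zero>\<^bsub>A n\<^esub>),
    add = (\<lambda>X Y. \<Union>x\<in>X. \<Union>y\<in>Y. cls A (\<lambda>n. x n \<oplus>\<^bsub>A n\<^esub> y n)),
    scl = (\<lambda>c X. \<Union>x\<in>X. cls A (\<lambda>n. c \<odot>\<^bsub>A n\<^esub> x n)),
    mul = (\<lambda>X Y. \<Union>x\<in>X. \<Union>y\<in>Y. cls A (\<lambda>n. x n \<otimes>\<^bsub>A n\<^esub> y n)),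
    adj = (\<lambda>X. \<Union>x\<in>X. cls A (\<lambda>n. adj (A n) (x n))),
    nrm = (\<lambda>X. INF x\<in>X. SUP n. nrm (A n) (x n))\<rparr>"

text \<open>\<open>connect \<phi> m k\<close> is the composite from stage \<open>m\<close> to stage \<open>m + k\<close>.\<close>

primrec connect :: "(nat \<Rightarrow> 'a \<Rightarrow> 'a) \<Rightarrow> nat \<Rightarrow> nat \<Rightarrow> 'a \<Rightarrow> 'a"
  where "connect \<phi> m 0 a = a"
  | "connect \<phi> m (Suc k) a = \<phi> (m + k) (connect \<phi> m k a)"

definition canon :: "(nat \<Rightarrow> 'a star_alg) \<Rightarrow> (nat \<Rightarrow> 'a \<Rightarrow> 'a) \<Rightarrow> nat \<Rightarrow> 'a \<Rightarrow> (nat \<Rightarrow> 'a) set"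
  where "canon A \<phi> m a = cls A (\<lambda>n. if n < m then \<zero>\<^bsub>A n\<^esub> else connect \<phi> m (n - m) a)"

definition ind_lim :: "(nat \<Rightarrow> 'a star_alg) \<Rightarrow> (nat \<Rightarrow> 'a \<Rightarrow> 'a) \<Rightarrow> (nat \<Rightarrow> 'a) set star_alg"
  where "ind_lim A \<phi> = (seq_quotient A)
    \<lparr>car := closure_in (seq_quotient A) (\<Union>n. canon A \<phi> n ` car (A n))\<rparr>"

text \<open>
  For subalgebras \<open>B n\<close> of \<open>A n\<close> respected by the connecting maps, the limit of the \<open>B n\<close> is
  regarded as a subset of the limit of the \<open>A n\<close> through the canonical map, which sends the class
  of a sequence among sequences in the \<open>B n\<close> to its class among sequences in the \<open>A n\<close>. As the
  former class is contained in the latter, the image of \<open>X\<close> is the \<open>Y\<close> with \<open>X \<subseteq> Y\<close>.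
\<close>

definition ind_lim_sub ::
    "(nat \<Rightarrow> 'a star_alg) \<Rightarrow> (nat \<Rightarrow> 'a set) \<Rightarrow> (nat \<Rightarrow> 'a \<Rightarrow> 'a) \<Rightarrow> (nat \<Rightarrow> 'a) set set"
  where "ind_lim_sub A B \<phi> = {Y \<in> car (ind_lim A \<phi>).
    \<exists>X \<in> car (ind_lim (\<lambda>n. (A n)\<lparr>car := B n\<rparr>) \<phi>). X \<subseteq> Y}"

end

theory Submission
  imports Defs "HOL-Analysis.Analysis"
begin

text \<open>
  The expectations \<open>P n\<close> are contractive and compatible, so they extend to an expectation \<open>P\<close> of the limit
  \<open>A\<close> onto the limit \<open>B\<close>. It is faithful: as \<open>P\<close> intertwines conjugation by normalizers,
  \<open>J = {x. P (star x * x) = 0}\<close> is an ideal, and if \<open>a\<close> in some \<open>A n\<close> is a positive element near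
  \<open>star x * x\<close> with \<open>x\<close> in \<open>J\<close>, then the faithful \<open>P n\<close> kills the part of \<open>a\<close> above the distance. It
  remains to see that an element \<open>y\<close> commuting with \<open>B\<close> and with \<open>P y = 0\<close> vanishes. Normalizers
  \<open>n\<close> of the finite stages span a dense subspace, so by faithfulness it suffices that \<open>P (star n * y) = 0\<close>.
  At a late stage, \<open>z \<mapsto> P (z * a)\<close> for an approximant \<open>a\<close> of \<open>y\<close> is almost a bimodule map that vanishes
  on \<open>B n\<close>, and since \<open>B n\<close> is maximal abelian such a map is almost zero on normalizers.

  For diagonals: a pure state of \<open>B\<close> is a character, so its restriction to \<open>B n\<close> is zero or a character,
  and in both cases it has at most one extension to each \<open>A n\<close>, hence to \<open>A\<close>.
\<close>

section \<open>Unital C*-algebras as a type class\<close>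

text \<open>The obstacle is that an element commuting with the limit \<open>B\<close> is only
  approximated by elements of the stages, and these commute with \<open>B n\<close> only up to an
  error, while maximality of \<open>B n\<close> is an exact statement. A quantitative form of
  maximality bridges the gap: \<open>key_estimate\<close> bounds a left-linear map that vanishes on
  \<open>B n\<close>, evaluated at a normalizer, by its defect of right linearity. With defect 0 the
  same estimate shows that an expectation onto \<open>B n\<close> is determined by the bimodule
  property, and this is why \<open>P\<close> intertwines conjugation by normalizers. The bound
  carries a factor \<open>star n * n\<close>, which need not be invertible;
  \<open>cancel_square\<close> removes it by a limit. Positivity is a norm condition and square
  roots are power series, so roots and positive parts of an element stay in every closed real
  subalgebra that contains it; applied to commutants and unitizations, this takes the place of
  functional calculus. Everything happens inside a single type, into which the limit, and with it
  every stage, is embedded isometrically; there the stages form an increasing sequence of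
  sets.\<close>

text \<open>
  \<open>cx\<close> embeds the scalars, and \<open>aug\<close> is a character whose kernel plays the role of the non-unital
  algebra of which the whole type is a unitization.
\<close>

class cstar1 = real_normed_algebra_1 + banach +
  fixes star :: "'a \<Rightarrow> 'a" and cx :: "complex \<Rightarrow> 'a" and aug :: "'a \<Rightarrow> complex"
  assumes star_add: "star (x + y) = star x + star y"
    and star_mult: "star (x * y) = star y * star x"
    and star_star [simp]: "star (star x) = x"
    and norm_star_mult: "norm (star x * x) = (norm x)\<^sup>2"
    and cx_add: "cx (c + d) = cx c + cx d"
    and cx_mult: "cx (c * d) = cx c * cx d"
    and cx_real: "cx (complex_of_real r) = r *\<^sub>R 1"
    and cx_commute: "x * cx c = cx c * x"
    and star_cx: "star (cx c) = cx (cnj c)"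
    and aug_add: "aug (x + y) = aug x + aug y"
    and aug_mult: "aug (x * y) = aug x * aug y"
    and aug_cx: "aug (cx c) = c"
    and aug_star: "aug (star x) = cnj (aug x)"
    and aug_le: "cmod (aug x) \<le> norm x"

section \<open>Scalars, involution and augmentation\<close>

lemma cx_of_real: "cx (complex_of_real r) = (of_real r::'a::cstar1)"
  unfolding of_real_def[where 'a='a] by (rule cx_real)

lemma cx_0 [simp]: "cx 0 = (0::'a::cstar1)"
  using cx_of_real[of 0] by simp

lemma cx_1 [simp]: "cx 1 = (1::'a::cstar1)"
  using cx_of_real[of 1] by simp

lemma cx_minus: "cx (- c) = - (cx c :: 'a::cstar1)"
  using cx_add[of c "-c", where 'a='a] by (simp add: eq_neg_iff_add_eq_0 add.commute)

lemma cx_diff: "cx (c - d) = cx c - (cx d :: 'a::cstar1)"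
  using cx_add[of c "-d", where 'a='a] cx_minus[of d, where 'a='a] by simp

lemma scaleR_cx: "scaleR r x = cx (complex_of_real r) * (x::'a::cstar1)"
  by (simp add: cx_of_real scaleR_conv_of_real)

lemma star_0 [simp]: "star 0 = (0::'a::cstar1)"
  using star_add[of "0::'a" 0] by simp

lemma star_1 [simp]: "star 1 = (1::'a::cstar1)"
  using star_cx[of 1, where 'a='a] by simp

lemma star_minus: "star (- x) = - star (x::'a::cstar1)"
  using star_add[of x "-x"] by (simp add: eq_neg_iff_add_eq_0 add.commute)

lemma star_diff: "star (x - y) = star x - star (y::'a::cstar1)"
  using star_add[of x "-y"] star_minus[of y] by simp

lemma star_scaleR: "star (r *\<^sub>R x) = r *\<^sub>R star (x::'a::cstar1)"
  by (simp add: scaleR_cx star_mult star_cx cx_commute)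

lemma star_of_real [simp]: "star (of_real r) = (of_real r::'a::cstar1)"
  by (metis cx_of_real star_cx complex_cnj_complex_of_real)

lemma star_power: "star (x ^ k) = star (x::'a::cstar1) ^ k"
  by (induction k) (simp_all add: star_mult power_commutes)

lemma norm_star [simp]: "norm (star x) = norm (x::'a::cstar1)"
proof -
  have *: "norm y \<le> norm (star y)" for y :: 'a
  proof (cases "y = 0")
    case False
    have "norm y * norm y \<le> norm (star y) * norm y"
      using norm_star_mult[of y] norm_mult_ineq[of "star y" y] by (simp add: power2_eq_square)
    then show ?thesis using False by simp
  qed simp
  show ?thesis using *[of x] *[of "star x"] by simp
qed

lemma norm_mult_star: "norm (x * star x) = (norm (x::'a::cstar1))\<^sup>2"
  using norm_star_mult[of "star x"] by simp

lemma star_mult_eq_0: "star x * x = 0 \<longleftrightarrow> (x::'a::cstar1) = 0"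
  using norm_star_mult[of x] by auto

text \<open>The norm of the class is homogeneous for real scalars; the complex case follows from the
  C*-identity, since \<open>cx (cnj c) * cx c\<close> is the real number |c|^2.\<close>

lemma norm_cx_mult: "norm (cx c * x) = cmod c * norm (x::'a::cstar1)"
proof -
  have "star (cx c * x) * (cx c * x) = star x * (cx (cnj c) * cx c) * x"
    by (simp add: star_mult star_cx mult.assoc)
  also have "cx (cnj c) * cx c = (of_real ((cmod c)\<^sup>2) :: 'a)"
    unfolding cx_mult[symmetric] cx_of_real[symmetric] by (metis complex_norm_square mult.commute)
  also have "star x * of_real ((cmod c)\<^sup>2) * x = (cmod c)\<^sup>2 *\<^sub>R (star x * x)"
    by (simp add: of_real_def)
  finally have "(norm (cx c * x))\<^sup>2 = (cmod c * norm x)\<^sup>2"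
    by (metis norm_star_mult norm_scaleR abs_power2 power_mult_distrib abs_norm_cancel)
  then show ?thesis by (simp add: power2_eq_iff_nonneg)
qed

lemma norm_cx [simp]: "norm (cx c :: 'a::cstar1) = cmod c"
  using norm_cx_mult[of c "1::'a"] by simp

lemma bounded_linear_star: "bounded_linear (star :: 'a::cstar1 \<Rightarrow> 'a)"
  by (rule bounded_linear_intro[where K=1]) (simp_all add: star_add star_scaleR)

lemmas tendsto_star [tendsto_intros] = bounded_linear.tendsto[OF bounded_linear_star]
lemmas continuous_on_star [continuous_intros] = bounded_linear.continuous_on[OF bounded_linear_star]

lemma aug_0 [simp]: "aug (0::'a::cstar1) = 0"
  using aug_add[of "0::'a" 0] by simp

lemma aug_minus: "aug (- x) = - aug (x::'a::cstar1)"
  using aug_add[of x "-x"] by (simp add: eq_neg_iff_add_eq_0 add.commute)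

lemma aug_diff: "aug (x - y) = aug x - aug (y::'a::cstar1)"
  using aug_add[of x "-y"] aug_minus[of y] by simp

lemma aug_scaleR: "aug (r *\<^sub>R x) = r *\<^sub>R aug (x::'a::cstar1)"
  by (simp add: scaleR_cx aug_mult aug_cx scaleR_conv_of_real)

lemma bounded_linear_aug: "bounded_linear (aug :: 'a::cstar1 \<Rightarrow> complex)"
  by (rule bounded_linear_intro[where K=1]) (simp_all add: aug_add aug_scaleR aug_le)

lemmas tendsto_aug [tendsto_intros] = bounded_linear.tendsto[OF bounded_linear_aug]

lemma bounded_linear_cx: "bounded_linear (cx :: complex \<Rightarrow> 'a::cstar1)"
  by (rule bounded_linear_intro[where K=1])
    (simp_all add: cx_add scaleR_cx scaleR_conv_of_real cx_mult)

definition sa :: "'a::cstar1 \<Rightarrow> bool" where "sa x \<longleftrightarrow> star x = x"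

lemma norm_sa_square: "sa x \<Longrightarrow> norm (x * x) = (norm x)\<^sup>2"
  using norm_star_mult[of x] by (simp add: sa_def)

lemma sa_intros:
  "sa x \<Longrightarrow> sa y \<Longrightarrow> sa (x + y)" "sa x \<Longrightarrow> sa y \<Longrightarrow> sa (x - y)" "sa x \<Longrightarrow> sa (- x)"
  "sa x \<Longrightarrow> sa (r *\<^sub>R x)" "sa (of_real r)" "sa 1" "sa 0" "sa (star y * y)" "sa (y * star y)"
  "sa x \<Longrightarrow> sa y \<Longrightarrow> x * y = y * x \<Longrightarrow> sa (x * y)" "sa x \<Longrightarrow> sa (x ^ k)" "sa x \<Longrightarrow> sa (star y * x * y)"
  "sa (y + star y)"
  for x y :: "'a::cstar1"
  by (auto simp: sa_def star_add star_diff star_minus star_scaleR star_mult star_power mult.assoc add.commute)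

text \<open>Closed real unital subalgebras. Square roots and positive parts are constructed so that
  they lie in every \<open>rsub\<close> containing the given element. The two instances that matter
  are the commutant of an element, which yields commutation, and the unitization
  \<open>u1 S\<close>, which yields membership.\<close>

definition rsub :: "'a::cstar1 set \<Rightarrow> bool" where
  "rsub T \<longleftrightarrow> closed T \<and> 1 \<in> T \<and> (\<forall>x\<in>T. \<forall>y\<in>T. x + y \<in> T \<and> x * y \<in> T) \<and> (\<forall>r. \<forall>x\<in>T. r *\<^sub>R x \<in> T)"

lemma rsubD:
  assumes "rsub T"
  shows "closed T" "1 \<in> T" "x \<in> T \<Longrightarrow> y \<in> T \<Longrightarrow> x + y \<in> T" "x \<in> T \<Longrightarrow> y \<in> T \<Longrightarrow> x * y \<in> T"
    "x \<in> T \<Longrightarrow> r *\<^sub>R x \<in> T" "x \<in> T \<Longrightarrow> y \<in> T \<Longrightarrow> x - y \<in> T" "0 \<in> T" "x \<in> T \<Longrightarrow> x ^ k \<in> T"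
    "of_real r \<in> T" "x \<in> T \<Longrightarrow> - x \<in> T"
proof -
  show *: "closed T" "1 \<in> T" and a: "\<And>x y. x \<in> T \<Longrightarrow> y \<in> T \<Longrightarrow> x + y \<in> T"
    and m: "\<And>x y. x \<in> T \<Longrightarrow> y \<in> T \<Longrightarrow> x * y \<in> T" and s: "\<And>r x. x \<in> T \<Longrightarrow> r *\<^sub>R x \<in> T"
    using assms by (auto simp: rsub_def)
  show n: "\<And>x. x \<in> T \<Longrightarrow> - x \<in> T" using s[of _ "-1"] by simp
  show "\<And>x y. x \<in> T \<Longrightarrow> y \<in> T \<Longrightarrow> x - y \<in> T" using a n by (metis diff_conv_add_uminus)
  show "0 \<in> T" using s[OF *(2), of 0] by simp
  show "of_real r \<in> T" using s[OF *(2), of r] by (simp add: of_real_def)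
  show "x \<in> T \<Longrightarrow> x ^ k \<in> T" by (induction k) (auto intro: * m)
qed

lemma rsub_commutant: "rsub {x. y * x = x * (y::'a::cstar1)}"
proof -
  have "closed {x. y * x = x * y}"
    by (intro closed_Collect_eq continuous_intros)
  moreover have "y * (a * b) = a * b * y" if "y * a = a * y" "y * b = b * y" for a b
    using that by (metis mult.assoc)
  ultimately show ?thesis unfolding rsub_def by (auto simp: algebra_simps)
qed

text \<open>When \<open>s * s + t * t\<close> is a scalar, this determines the norm of
  \<open>s + cx \<i> * t\<close>, and thereby bounds \<open>s\<close> and \<open>t\<close>, its real
  and imaginary part. When the scalar is 1, it produces unitaries with prescribed real part.\<close>

lemma cartesian_form:
  fixes s t :: "'a::cstar1"
  assumes "sa s" "sa t" "s * t = t * s"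
  shows "star (s + cx \<i> * t) = s - cx \<i> * t"
    and "star (s + cx \<i> * t) * (s + cx \<i> * t) = s * s + t * t"
proof -
  have sas: "star s = s" "star t = t" using assms by (auto simp: sa_def)
  show su: "star (s + cx \<i> * t) = s - cx \<i> * t"
    using sas by (simp add: star_add star_mult star_cx cx_minus cx_commute)
  have ii: "cx \<i> * t * (cx \<i> * t) = - (t * t)"
  proof -
    have "cx \<i> * t * (cx \<i> * t) = cx \<i> * cx \<i> * (t * t)" by (metis cx_commute mult.assoc)
    also have "cx \<i> * cx \<i> = (- 1 :: 'a)"
      unfolding cx_mult[symmetric] by (simp only: i_times_eq_iff i_squared complex_i_mult_minus cx_minus cx_1 flip: power2_eq_square)
        (simp add: cx_minus)
    finally show ?thesis by simp
  qed
  have si: "s * (cx \<i> * t) = cx \<i> * t * s" by (metis cx_commute mult.assoc assms(3))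
  have "star (s + cx \<i> * t) * (s + cx \<i> * t)
      = s * s + (s * (cx \<i> * t) - cx \<i> * t * s) - cx \<i> * t * (cx \<i> * t)"
    unfolding su by (simp only: distrib_left left_diff_distrib) simp
  then show "star (s + cx \<i> * t) * (s + cx \<i> * t) = s * s + t * t" by (simp add: si ii)
qed

text \<open>The power series of \<open>\<surd>(1 - c)\<close>: its coefficients after the first are non-positive and sum up
  to at least \<open>-1\<close>, so it converges absolutely on the whole closed unit ball.\<close>

definition rc :: "nat \<Rightarrow> real" where "rc n = (1/2 gchoose n) * (-1) ^ n"

lemma rc_0 [simp]: "rc 0 = 1" by (simp add: rc_def)

lemma rc_pochhammer: "rc n = pochhammer (-1/2) n / fact n"
  by (simp add: rc_def gbinomial_pochhammer mult_ac flip: power_add mult_2)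

lemma rc_Suc_nonpos: "rc (Suc n) \<le> 0"
proof -
  have "pochhammer (1/2::real) n \<ge> 0" by (rule pochhammer_nonneg) simp
  then show ?thesis by (simp add: rc_pochhammer pochhammer_rec divide_nonpos_nonneg)
qed

text \<open>Summing coefficients divides the series by 1 - x, so the partial sums are the
  coefficients of (1 - x) to the power -1/2, which are non-negative.\<close>

lemma sum_rc_nonneg: "0 \<le> (\<Sum>k\<le>m. rc k)"
proof -
  have "(\<Sum>k\<le>m. rc k) = (-1) ^ m * ((1/2 - 1) gchoose m)"
    unfolding rc_def by (rule gbinomial_sum_lower_neg)
  also have "\<dots> = pochhammer (1/2) m / fact m"
    by (simp add: gbinomial_pochhammer flip: power_add mult_2)
  also have "\<dots> \<ge> 0" by (intro divide_nonneg_nonneg pochhammer_nonneg) auto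
  finally show ?thesis .
qed

lemma sum_abs_rc_Suc: "(\<Sum>k<n. \<bar>rc (Suc k)\<bar>) \<le> 1"
proof -
  have "(\<Sum>k<n. \<bar>rc (Suc k)\<bar>) = 1 - (\<Sum>k<Suc n. rc k)"
    unfolding sum.lessThan_Suc_shift using rc_Suc_nonpos by (simp add: abs_of_nonpos sum_negf)
  then show ?thesis using sum_rc_nonneg[of n] by (simp add: lessThan_Suc_atMost)
qed

lemma summable_abs_rc_Suc: "summable (\<lambda>n. \<bar>rc (Suc n)\<bar>)"
  by (rule summableI_nonneg_bounded[where x=1]) (use sum_abs_rc_Suc in auto)

lemma summable_abs_rc: "summable (\<lambda>n. \<bar>rc n\<bar>)"
  using summable_abs_rc_Suc summable_Suc_iff by blast

text \<open>Vandermonde's identity with exponents 1/2 and 1/2: the square of the series has the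
  coefficients of 1 - x.\<close>

lemma rc_convolution: "(\<Sum>i\<le>k. rc i * rc (k - i)) = (if k = 0 then 1 else if k = 1 then -1 else 0)"
proof -
  have "(\<Sum>i\<le>k. rc i * rc (k - i)) = (-1) ^ k * (\<Sum>i\<le>k. (1/2 gchoose i) * (1/2 gchoose (k - i)))"
    unfolding sum_distrib_left
    by (rule sum.cong) (auto simp: rc_def simp flip: power_add)
  also have "(\<Sum>i\<le>k. ((1/2::real) gchoose i) * (1/2 gchoose (k - i))) = (1/2 + 1/2) gchoose k"
    using gbinomial_Vandermonde[of "1/2::real" "1/2" k] by (simp only: atLeast0AtMost)
  also have "(1/2 + 1/2 :: real) gchoose k = of_nat (1 choose k)"
    by (simp add: binomial_gbinomial)
  finally show ?thesis by (cases k rule: nat.exhaust; cases "k - 1") auto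
qed

definition sqt :: "'a::cstar1 \<Rightarrow> 'a" where "sqt c = (\<Sum>n. rc n *\<^sub>R c ^ n)"

context
  fixes c :: "'a::cstar1"
  assumes c: "norm c \<le> 1"
begin

lemma norm_rc_power_le: "norm (rc n *\<^sub>R c ^ n) \<le> \<bar>rc n\<bar>"
proof -
  have "norm (c ^ n) \<le> 1"
    by (meson c norm_ge_zero norm_power_ineq order_trans power_le_one)
  then show ?thesis by (simp add: mult_left_le)
qed

lemma summable_norm_sqt: "summable (\<lambda>n. norm (rc n *\<^sub>R c ^ n))"
  by (rule summable_comparison_test'[OF summable_abs_rc, of 0]) (use norm_rc_power_le in auto)

lemma sqt_sums: "(\<lambda>n. rc n *\<^sub>R c ^ n) sums sqt c"
  unfolding sqt_def by (rule summable_sums[OF summable_norm_cancel[OF summable_norm_sqt]])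

lemma sqt_mult: "sqt c * sqt c = 1 - c"
proof -
  have "sqt c * sqt c = (\<Sum>k. \<Sum>i\<le>k. (rc i *\<^sub>R c ^ i) * (rc (k - i) *\<^sub>R c ^ (k - i)))"
    unfolding sqt_def by (rule Cauchy_product[OF summable_norm_sqt summable_norm_sqt])
  also have "\<dots> = (\<Sum>k. (\<Sum>i\<le>k. rc i * rc (k - i)) *\<^sub>R c ^ k)"
  proof (rule suminf_cong)
    fix k
    show "(\<Sum>i\<le>k. (rc i *\<^sub>R c ^ i) * (rc (k - i) *\<^sub>R c ^ (k - i))) =
      (\<Sum>i\<le>k. rc i * rc (k - i)) *\<^sub>R c ^ k"
      unfolding scaleR_sum_left by (rule sum.cong) (auto simp flip: power_add)
  qed
  also have "\<dots> = (\<Sum>k\<in>{0,1}. (\<Sum>i\<le>k. rc i * rc (k - i)) *\<^sub>R c ^ k)"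
    by (rule suminf_finite) (auto simp: rc_convolution)
  also have "\<dots> = 1 - c" by (simp add: rc_convolution)
  finally show ?thesis .
qed

lemma sqt_in:
  assumes T: "rsub T" "c \<in> T"
  shows "sqt c \<in> T"
proof -
  have "(\<Sum>k<n. rc k *\<^sub>R c ^ k) \<in> T" for n
    by (induction n) (auto intro!: rsubD[OF T(1)] T(2))
  moreover have "(\<lambda>n. \<Sum>k<n. rc k *\<^sub>R c ^ k) \<longlonglongrightarrow> sqt c"
    using sqt_sums by (simp add: sums_def)
  ultimately show ?thesis by (rule closed_sequentially[OF rsubD(1)[OF T(1)]])
qed

text \<open>The coefficients after the first have absolute sum at most 1. The bound 1 is exactly
  what makes \<open>sqt c\<close> positive in the sense of \<open>pos\<close>, with radius
  1.\<close>

lemma norm_one_minus_sqt: "norm (1 - sqt c) \<le> 1"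
proof -
  have s: "(\<lambda>n. rc (Suc n) *\<^sub>R c ^ Suc n) sums (sqt c - 1)"
    using sqt_sums by (subst sums_Suc_iff) simp
  have "norm (sqt c - 1) \<le> (\<Sum>n. \<bar>rc (Suc n)\<bar>)"
    unfolding sums_unique[OF s]
    by (rule norm_suminf_le[OF norm_rc_power_le summable_abs_rc_Suc])
  also have "\<dots> \<le> 1"
    by (rule suminf_le_const[OF summable_abs_rc_Suc sum_abs_rc_Suc])
  finally show ?thesis by (simp add: norm_minus_commute)
qed

lemma sa_sqt: "sa c \<Longrightarrow> sa (sqt c)"
proof -
  assume "sa c"
  then have "(\<lambda>n. star (rc n *\<^sub>R c ^ n)) = (\<lambda>n. rc n *\<^sub>R c ^ n)"
    by (auto simp: sa_def star_scaleR star_power)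
  moreover have "(\<lambda>n. star (rc n *\<^sub>R c ^ n)) sums star (sqt c)"
    by (rule bounded_linear.sums[OF bounded_linear_star sqt_sums])
  ultimately show ?thesis using sqt_sums sums_unique2 by (auto simp: sa_def)
qed

end

section \<open>Positivity, square roots and order\<close>

text \<open>For self-adjoint \<open>a\<close> the norm condition says that the spectrum lies in the
  interval from 0 to 2 r. In this form sums of positive elements are immediate, and it is the form
  that the power series of the root delivers.\<close>

definition pos :: "'a::cstar1 \<Rightarrow> bool" where
  "pos a \<longleftrightarrow> sa a \<and> (\<exists>r\<ge>0. norm (of_real r - a) \<le> r)"

lemma pos_sa: "pos a \<Longrightarrow> sa a" by (simp add: pos_def)

text \<open>After scaling by R the root is the binomial series in 1 - a / R, so it is a limit of
  real polynomials in \<open>a\<close>. This is the source of the last property, by which the root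
  commutes with whatever commutes with \<open>a\<close>.\<close>

lemma pos_sqrt:
  assumes "pos a"
  obtains s where "pos s" "s * s = a" "\<And>T. rsub T \<Longrightarrow> a \<in> T \<Longrightarrow> s \<in> T"
proof -
  obtain r where r: "norm (of_real r - a) \<le> r" "r \<ge> 0" using assms by (auto simp: pos_def)
  \<comment> \<open>The radius may be 0; enlarging it by 1 preserves the norm condition and allows
    division.\<close>
  define R where "R = r + 1"
  have R: "R > 0" "norm (of_real R - a) \<le> R"
    using r norm_triangle_ineq[of "of_real r - a" 1] by (auto simp: R_def algebra_simps)
  define c where "c = 1 - (1/R) *\<^sub>R a"
  have "c = (1/R) *\<^sub>R (of_real R - a)" using R by (simp add: c_def of_real_def algebra_simps)
  then have c: "norm c \<le> 1" using R by (simp add: divide_le_eq)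
  have sac: "sa c" using assms by (auto simp: c_def pos_def intro!: sa_intros)
  define s where "s = sqrt R *\<^sub>R sqt c"
  have "norm (of_real (sqrt R) - s) \<le> sqrt R"
  proof -
    have "of_real (sqrt R) - s = sqrt R *\<^sub>R (1 - sqt c)"
      by (simp add: s_def of_real_def algebra_simps)
    then show ?thesis using R norm_one_minus_sqt[OF c] by (simp add: mult_left_le)
  qed
  then have 1: "pos s" using R by (auto simp: pos_def s_def intro!: exI[of _ "sqrt R"] sa_intros sa_sqt c sac)
  have 2: "s * s = a" using R by (simp add: s_def sqt_mult[OF c]) (simp add: c_def)
  have 3: "s \<in> T" if "rsub T" "a \<in> T" for T
    unfolding s_def by (intro rsubD(5)[OF that(1)] sqt_in c that(1))
      (auto simp: c_def intro!: rsubD[OF that(1)] that(2))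
  show ?thesis by (rule that[OF 1 2 3])
qed

text \<open>With \<open>t\<close> the root of \<open>1 - s * s\<close>, the element s + i t
  satisfies \<open>star u * u = 1\<close>, so its imaginary part \<open>t\<close> has norm at most
  1, and \<open>1 - s * s\<close> is \<open>t * t\<close>.\<close>

lemma norm_one_minus_square:
  assumes s: "sa s" "norm s \<le> 1"
  shows "norm (1 - s * s) \<le> (1::real)"
proof -
  have ns: "norm (s * s) \<le> 1" using norm_sa_square[OF s(1)] s(2) by (simp add: power_le_one)
  define t where "t = sqt (s * s)"
  have t2: "t * t = 1 - s * s" unfolding t_def by (rule sqt_mult[OF ns])
  have t: "sa t" unfolding t_def by (intro sa_sqt ns sa_intros s refl)
  have "t \<in> {x. s * x = x * s}"
    unfolding t_def by (rule sqt_in[OF ns rsub_commutant]) (simp add: mult.assoc)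
  then have ts: "s * t = t * s" by simp
  define u where "u = s + cx \<i> * t"
  have su: "star u = s - cx \<i> * t" and "star u * u = s * s + t * t"
    unfolding u_def by (rule cartesian_form[OF s(1) t ts])+
  then have "(norm u)\<^sup>2 = 1" using norm_star_mult[of u] t2 by simp
  then have "norm u = 1" by (metis norm_ge_zero one_power2 power2_eq_iff_nonneg zero_le_one)
  moreover have "cx (2 * \<i>) = (cx \<i> + cx \<i> :: 'a)" unfolding cx_add[symmetric] by simp
  then have "cx (2 * \<i>) * t = u - star u"
    unfolding su by (simp add: u_def distrib_right)
  ultimately have "norm (cx (2 * \<i>) * t) \<le> 2"
    using norm_triangle_ineq4[of u "star u"] by simp
  then have "norm t \<le> 1" by (simp add: norm_cx_mult norm_mult)
  then show ?thesis using norm_sa_square[OF t] by (simp add: t2 power_le_one)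
qed

text \<open>A rescaled \<open>norm_one_minus_square\<close>. Since any bound R of the norm serves,
  the existential radius in \<open>pos\<close> can be replaced by \<open>norm a\<close>, and this
  turns positivity into a closed condition.\<close>

lemma pos_square_norm:
  assumes s: "sa s" and R: "norm (s * s) \<le> R"
  shows "norm (of_real R - s * s) \<le> R"
proof (cases "R = 0")
  case False
  then have R0: "R > 0" using R norm_ge_zero[of "s * s"] by linarith
  define s' where "s' = (1 / sqrt R) *\<^sub>R s"
  have "(norm s)\<^sup>2 \<le> R" using R norm_sa_square[OF s] by simp
  then have "norm s \<le> sqrt R" by (rule real_le_rsqrt)
  then have "norm (1 - s' * s') \<le> 1"
    using R0 by (intro norm_one_minus_square) (auto simp: s'_def divide_le_eq intro!: sa_intros s)
  moreover have "of_real R - s * s = R *\<^sub>R (1 - s' * s')"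
    using R0 by (simp add: s'_def of_real_def algebra_simps)
  ultimately show ?thesis using R0 by (simp add: mult_left_le)
qed (use R in auto)

lemma pos_square: "sa s \<Longrightarrow> pos (s * s)"
  unfolding pos_def using pos_square_norm[of s "norm (s * s)"]
  by (auto intro!: sa_intros exI[of _ "norm (s * s)"])

lemma pos_iff_sqrt: "pos a \<longleftrightarrow> (\<exists>s. sa s \<and> a = s * s)"
  by (metis pos_sa pos_sqrt pos_square)

lemma pos_norm_le: "pos a \<Longrightarrow> norm a \<le> R \<Longrightarrow> norm (of_real R - a) \<le> R"
  by (metis pos_iff_sqrt pos_square_norm)

lemma pos_add: "pos a \<Longrightarrow> pos b \<Longrightarrow> pos (a + b)"
proof -
  assume "pos a" "pos b"
  then obtain r q where "r \<ge> 0" "q \<ge> 0" "norm (of_real r - a) \<le> r" "norm (of_real q - b) \<le> q"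
    "sa a" "sa b" by (auto simp: pos_def)
  then have "norm (of_real (r + q) - (a + b)) \<le> r + q" "r + q \<ge> 0" "sa (a + b)"
    using norm_triangle_ineq[of "of_real r - a" "of_real q - b"]
    by (auto simp: algebra_simps intro: sa_intros)
  then show ?thesis unfolding pos_def by blast
qed

lemma pos_scaleR: "pos a \<Longrightarrow> c \<ge> 0 \<Longrightarrow> pos (c *\<^sub>R a)"
proof -
  assume a: "pos a" "c \<ge> 0"
  then obtain s where s: "sa s" "a = s * s" by (auto simp: pos_iff_sqrt)
  then have "c *\<^sub>R a = (sqrt c *\<^sub>R s) * (sqrt c *\<^sub>R s)" using a by simp
  then show ?thesis using s by (metis pos_square sa_intros(4))
qed

lemma pos_of_real: "r \<ge> 0 \<Longrightarrow> pos (of_real r)"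
  unfolding pos_def by (auto intro!: sa_intros exI[of _ r])

lemma pos_0 [simp]: "pos 0" and pos_1 [simp]: "pos 1"
  using pos_of_real[of 0] pos_of_real[of 1] by auto

lemma pos_sum: "(\<And>i. i \<in> I \<Longrightarrow> pos (f i)) \<Longrightarrow> pos (sum f I)"
  by (induction I rule: infinite_finite_induct) (auto intro: pos_add)

lemma closed_pos: "closed {a::'a::cstar1. pos a}"
proof -
  have "{a::'a. pos a} = {a. star a = a \<and> norm (of_real (norm a) - a) \<le> norm a}"
    by (auto simp: pos_sa[unfolded sa_def] pos_norm_le) (auto simp: pos_def sa_def intro: exI[of _ "norm _"])
  also have "closed \<dots>"
    by (intro closed_Collect_conj closed_Collect_eq closed_Collect_le continuous_intros)
  finally show ?thesis .
qed

lemma pos_norm_minus: "sa a \<Longrightarrow> norm a \<le> R \<Longrightarrow> pos (of_real R - a)"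
  unfolding pos_def by (auto intro!: sa_intros exI[of _ R]) (metis norm_ge_zero order_trans)

text \<open>The roots lie in all commutants that contain \<open>a\<close> and \<open>b\<close>;
  hence they commute with each other, and \<open>a * b\<close> is the square of the self-adjoint
  \<open>s * t\<close>.\<close>

lemma pos_mult_commute:
  assumes "pos a" "pos b" "a * b = b * a"
  shows "pos (a * b)"
proof -
  obtain s where s: "pos s" "s * s = a" "\<And>T. rsub T \<Longrightarrow> a \<in> T \<Longrightarrow> s \<in> T"
    using pos_sqrt[OF assms(1)] by metis
  have sb: "b * s = s * b" using s(3)[OF rsub_commutant[of b]] assms(3) by simp
  obtain t where t: "pos t" "t * t = b" "\<And>T. rsub T \<Longrightarrow> b \<in> T \<Longrightarrow> t \<in> T"
    using pos_sqrt[OF assms(2)] by metis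
  have st: "s * t = t * s" using t(3)[OF rsub_commutant[of s]] sb by simp
  have "a * b = (s * t) * (s * t)" using s(2) t(2) st by (metis mult.assoc)
  moreover have "sa (s * t)" using s t st by (intro sa_intros pos_sa)
  ultimately show ?thesis by (metis pos_square)
qed

text \<open>Commuting roots s of \<open>a\<close> and t of \<open>M - a\<close> give u = s + i t
  with \<open>star u * u = M\<close>; the real part s has norm at most \<open>norm u\<close>, and
  \<open>a = s * s\<close>.\<close>

lemma norm_le_of_pos:
  assumes a: "pos a" and M: "pos (of_real M - a)" "M \<ge> 0"
  shows "norm a \<le> M"
proof -
  obtain s where s: "pos s" "s * s = a" "\<And>T. rsub T \<Longrightarrow> a \<in> T \<Longrightarrow> s \<in> T"
    using pos_sqrt[OF a] by metis
  obtain t where t: "pos t" "t * t = of_real M - a" "\<And>T. rsub T \<Longrightarrow> of_real M - a \<in> T \<Longrightarrow> t \<in> T"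
    using pos_sqrt[OF M(1)] by metis
  have "a * s = s * a" using s(2) by (metis mult.assoc)
  then have "(of_real M - a) * s = s * (of_real M - a)"
    by (simp add: algebra_simps) (simp add: of_real_def)
  then have st: "s * t = t * s"
    using t(3)[OF rsub_commutant[of s]] by simp
  define u where "u = s + cx \<i> * t"
  have su: "star u = s - cx \<i> * t" and "star u * u = s * s + t * t"
    unfolding u_def by (rule cartesian_form[OF pos_sa[OF s(1)] pos_sa[OF t(1)] st])+
  then have "star u * u = of_real M" using s(2) t(2) by simp
  then have nu: "(norm u)\<^sup>2 = M" using norm_star_mult[of u] M by simp
  have "2 *\<^sub>R s = u + star u" unfolding su by (simp add: u_def scaleR_2)
  then have "2 * norm s \<le> 2 * norm u"
    using norm_triangle_ineq[of u "star u"] by (metis norm_scaleR norm_star mult_2 abs_numeral)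
  then have "(norm s)\<^sup>2 \<le> (norm u)\<^sup>2" by (intro power_mono) auto
  then show ?thesis using norm_sa_square[OF pos_sa[OF s(1)]] s(2) nu by simp
qed

lemma pos_minus_imp_0: "pos a \<Longrightarrow> pos (- a) \<Longrightarrow> a = 0"
  using norm_le_of_pos[of a 0] by simp

lemma pos_add_eq_0: "pos a \<Longrightarrow> pos b \<Longrightarrow> a + b = 0 \<Longrightarrow> a = 0"
  by (metis pos_minus_imp_0 add_eq_0_iff)

lemma sa_square_eq_0: "sa x \<Longrightarrow> x * x = 0 \<Longrightarrow> x = 0"
  using norm_sa_square[of x] by simp

text \<open>For \<open>d = a - b\<close> the product of \<open>d * d\<close> with
  \<open>a + b\<close> is 0 and a sum of two positive terms. Both vanish, so the cube of
  \<open>d\<close> is 0, and a self-adjoint nilpotent element is 0.\<close>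

lemma pos_sqrt_unique:
  assumes "pos a" "pos b" "a * b = b * a" "a * a = b * b"
  shows "a = b"
proof -
  define d where "d = a - b"
  have da: "d * a = a * d" "d * b = b * d" using assms(3) by (auto simp: d_def algebra_simps)
  have sd: "sa d" unfolding d_def by (intro sa_intros pos_sa assms)
  have pd: "pos (d * d)" by (rule pos_square[OF sd])
  have "d * d * a = a * (d * d)" "d * d * b = b * (d * d)" by (metis da mult.assoc)+
  then have "pos (d * d * a)" "pos (d * d * b)"
    using pos_mult_commute[OF pd] assms(1,2) by auto
  moreover have "d * (a + b) = 0" using assms(3,4) by (simp add: d_def algebra_simps)
  then have "d * d * a + d * d * b = 0" by (metis distrib_left mult.assoc mult_zero_right)
  ultimately have "d * d * a = 0" "d * d * b = 0"
    using pos_add_eq_0 by (blast, metis pos_add_eq_0 add.commute)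
  then have "d * d * d = 0" by (simp add: d_def right_diff_distrib)
  then have "(d * d) * (d * d) = 0" by (simp flip: mult.assoc)
  then have "d = 0" using sa_square_eq_0 sd pos_sa[OF pd] by blast
  then show ?thesis by (simp add: d_def)
qed

text \<open>With \<open>m\<close> the root of \<open>h * h\<close>, twice the parts are p = m + h
  and q = m - h, and \<open>p * q = 0\<close>. Their positivity is seen by comparing them with the
  roots P, Q of their squares: P + Q and p + q are positive with the same square, hence equal, and
  multiplication by P gives P = p.\<close>

lemma pos_part:
  assumes h: "sa h"
  obtains p q where "pos p" "pos q" "p * q = 0" "q * p = 0" "h = p - q"
    "\<And>T. rsub T \<Longrightarrow> h \<in> T \<Longrightarrow> p \<in> T \<and> q \<in> T"
proof -
  obtain m where m: "pos m" "m * m = h * h" "\<And>T. rsub T \<Longrightarrow> h * h \<in> T \<Longrightarrow> m \<in> T"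
    using pos_sqrt[OF pos_square[OF h]] by metis
  have mT: "m \<in> T" if "rsub T" "h \<in> T" for T using m(3) that rsubD(4) by blast
  \<comment> \<open>The commutant of \<open>h\<close> contains \<open>h\<close>, hence also
    \<open>y\<close>; so the commutant of \<open>y\<close> contains \<open>h\<close>, hence also
    \<open>x\<close>.\<close>
  have com: "y * x = x * y"
    if "\<And>T. rsub T \<Longrightarrow> h \<in> T \<Longrightarrow> x \<in> T" "\<And>T. rsub T \<Longrightarrow> h \<in> T \<Longrightarrow> y \<in> T" for x y
  proof -
    have "y * h = h * y" using that(2)[OF rsub_commutant[of h]] by simp
    then show ?thesis using that(1)[OF rsub_commutant[of y]] by simp
  qed
  define p q where "p = m + h" "q = m - h"
  have pT: "p \<in> T" and qT: "q \<in> T" if "rsub T" "h \<in> T" for T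
    using mT[OF that] that rsubD by (auto simp: p_q_def)
  have sp: "sa p" "sa q" unfolding p_q_def by (intro sa_intros h pos_sa[OF m(1)])+
  obtain P where P: "pos P" "P * P = p * p" "\<And>T. rsub T \<Longrightarrow> p * p \<in> T \<Longrightarrow> P \<in> T"
    using pos_sqrt[OF pos_square[OF sp(1)]] by metis
  obtain Q where Q: "pos Q" "Q * Q = q * q" "\<And>T. rsub T \<Longrightarrow> q * q \<in> T \<Longrightarrow> Q \<in> T"
    using pos_sqrt[OF pos_square[OF sp(2)]] by metis
  have PT: "P \<in> T" and QT: "Q \<in> T" if "rsub T" "h \<in> T" for T
    using P(3) Q(3) that pT qT rsubD(4) by blast+
  have "m * h = h * m" by (rule com) (use mT in auto)
  then have pq: "p * q = 0" by (simp add: p_q_def algebra_simps m(2))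
  have comm: "p * q = q * p" "P * Q = Q * P" "P * q = q * P" "P * p = p * P" "Q * p = p * Q"
    using com pT qT PT QT by blast+
  have z: "x * y = 0" if "x * x * (y * y) = 0" "x * y = y * x" "sa x" "sa y" for x y
    by (rule sa_square_eq_0) (use that in \<open>auto intro: sa_intros\<close>, metis mult.assoc)
  have ppqq: "p * p * (q * q) = 0" "q * q * (p * p) = 0"
    using pq comm by (metis mult.assoc mult_zero_left mult_zero_right)+
  have PQ: "P * Q = 0" by (rule z) (use ppqq P Q comm pos_sa in auto)
  have Pq: "P * q = 0" by (rule z) (use ppqq P Q comm sp pos_sa in auto)
  have "P + Q = p + q"
  proof (rule pos_sqrt_unique)
    show "pos (p + q)" using pos_add[OF m(1) m(1)] by (simp add: p_q_def)
    show "(P + Q) * (P + Q) = (p + q) * (p + q)"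
      using comm by (simp add: distrib_left distrib_right PQ pq P(2) Q(2) flip: comm)
    show "(P + Q) * (p + q) = (p + q) * (P + Q)"
      by (rule com) (use pT qT PT QT rsubD(3) in blast)+
  qed (intro pos_add P Q)
  then have Q': "Q = p + q - P" by (simp add: algebra_simps)
  have PP: "P * P = P * p" using PQ Pq by (simp add: Q' algebra_simps)
  have "(P - p) * (P - p) = 0"
    using PP P(2) by (simp add: algebra_simps comm)
  then have "P - p = 0" by (rule sa_square_eq_0[rotated]) (intro sa_intros sp pos_sa P)
  then have "P = p" by simp
  then have pp: "pos p" "pos q" using P Q Q' by auto
  show ?thesis
  proof (rule that[of "(1/2) *\<^sub>R p" "(1/2) *\<^sub>R q"])
    show "h = (1/2) *\<^sub>R p - (1/2) *\<^sub>R q" by (simp add: p_q_def algebra_simps flip: scaleR_add_left)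
    show "(1/2) *\<^sub>R p \<in> T \<and> (1/2) *\<^sub>R q \<in> T" if "rsub T" "h \<in> T" for T
      using rsubD(5)[OF that(1) pT[OF that]] rsubD(5)[OF that(1) qT[OF that]] by blast
  qed (use pp pq comm in \<open>auto intro: pos_scaleR\<close>)
qed

text \<open>This element is twice the sum of the squares of the real and the imaginary part of
  \<open>z\<close>.\<close>

lemma pos_star_sum: "pos (star z * z + z * star (z::'a::cstar1))"
proof -
  define s where "s = z + star z"
  define t where "t = cx \<i> * (z - star z)"
  have s: "sa s" by (simp add: s_def sa_def star_add add.commute)
  have "star t = (star z - z) * cx (- \<i>)" by (simp add: t_def star_mult star_cx star_diff)
  also have "\<dots> = t" unfolding cx_commute t_def by (simp add: cx_minus right_diff_distrib)
  finally have t: "sa t" by (simp add: sa_def)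
  have tt: "cx \<i> * x * (cx \<i> * x) = cx \<i> * cx \<i> * (x * x)" for x :: 'a
    by (metis cx_commute mult.assoc)
  have "cx \<i> * cx \<i> = (-1 :: 'a)"
    unfolding cx_mult[symmetric] by (simp add: cx_minus)
  then have "t * t = - ((z - star z) * (z - star z))"
    using mult_minus1 by (simp add: t_def tt)
  then have "s * s + t * t = 2 *\<^sub>R (star z * z + z * star z)"
    by (simp add: s_def algebra_simps scaleR_2)
  then have "(1/2) *\<^sub>R (s * s + t * t) = star z * z + z * star z"
    by simp
  then show ?thesis
    by (metis pos_scaleR pos_add pos_square s t divide_nonneg_nonneg zero_le_one zero_le_numeral)
qed

text \<open>By \<open>pos_star_sum\<close> the element \<open>X = z * star z\<close> is positive.
  For y = z r with r the root of \<open>k\<close>, the products \<open>star y * y\<close> and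
  \<open>y * star y\<close> are \<open>- (k * k)\<close> and \<open>- (X * X)\<close>, and a second
  use of \<open>pos_star_sum\<close> forces both to vanish.\<close>

lemma star_mult_neg_imp_0:
  assumes k: "pos k" and z: "star z * z = - k"
  shows "z = 0"
proof -
  obtain r where r: "pos r" "r * r = k" using pos_sqrt[OF k] by metis
  define X where "X = z * star z"
  have "X = (star z * z + z * star z) + k" by (simp add: X_def z)
  then have X: "pos X" using pos_add pos_star_sum k by metis
  define y where "y = z * r"
  have rs: "star r = r" using pos_sa[OF r(1)] by (simp add: sa_def)
  have "star y * y = r * (star z * z) * r" by (simp add: y_def star_mult rs mult.assoc)
  then have 1: "star y * y = - (k * k)" by (simp add: z r(2)[symmetric] mult.assoc)
  have "y * star y = z * (r * r) * star z" by (simp add: y_def star_mult rs mult.assoc)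
  also have "\<dots> = - (X * X)"
    unfolding r(2) X_def using z by (metis mult.assoc minus_minus mult_minus_left mult_minus_right)
  finally have "pos (- (k * k + X * X))" using pos_star_sum[of y] 1 by simp
  then have "k * k + X * X = 0"
    by (metis pos_minus_imp_0 pos_add pos_square pos_sa k X)
  then have "k * k = 0" by (metis pos_add_eq_0 pos_square pos_sa k X)
  then have "k = 0" using sa_square_eq_0 pos_sa[OF k] by blast
  then show ?thesis using z by (simp add: star_mult_eq_0)
qed

text \<open>Multiplying \<open>y\<close> by the negative part \<open>q\<close> of
  \<open>star y * y\<close> produces a \<open>z\<close> with \<open>star z * z\<close> equal to
  minus the cube of \<open>q\<close>; by the preceding lemma this cube is 0.\<close>

lemma pos_star_mult: "pos (star y * y)"
proof -
  obtain p q where pq: "pos p" "pos q" "p * q = 0" "q * p = 0" "star y * y = p - q"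
    using pos_part[OF sa_intros(8)[of y]] by metis
  define z where "z = y * q"
  have qs: "star q = q" using pos_sa[OF pq(2)] by (simp add: sa_def)
  have "star z * z = q * (star y * y) * q" by (simp add: z_def star_mult qs mult.assoc)
  also have "\<dots> = - (q * (q * q))"
    unfolding pq(5) right_diff_distrib pq(4) by (simp add: mult.assoc)
  finally have z: "star z * z = - (q * (q * q))" .
  have "pos (q * (q * q))"
    by (auto intro!: pos_mult_commute pq simp: mult.assoc)
  from star_mult_neg_imp_0[OF this z] z have "q * (q * q) = 0" by simp
  then have "(q * q) * (q * q) = 0" by (simp add: mult.assoc)
  then have "q = 0" using sa_square_eq_0 pos_sa pq(2) pos_square by blast
  then show ?thesis using pq by simp
qed

lemma pos_conj: "pos a \<Longrightarrow> pos (star x * a * x)"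
proof -
  assume "pos a"
  then obtain s where "pos s" "s * s = a" using pos_sqrt by metis
  then have "star x * a * x = star (s * x) * (s * x)"
    using pos_sa[of s] by (auto simp: sa_def star_mult mult.assoc)
  then show ?thesis by (metis pos_star_mult)
qed

lemma norm_mono_pos:
  assumes "pos a" "pos (b - a)"
  shows "norm a \<le> norm b"
proof (rule norm_le_of_pos[OF assms(1)])
  have "pos b" using pos_add[OF assms] by simp
  then have "pos (of_real (norm b) - b)" by (intro pos_norm_minus pos_sa) auto
  from pos_add[OF this assms(2)] show "pos (of_real (norm b) - a)" by simp
qed simp

lemma pos_power: "pos a \<Longrightarrow> pos (a ^ k)"
  by (induction k) (auto intro!: pos_mult_commute simp: power_commutes)

lemma pos_diff_trans: "pos (a - b) \<Longrightarrow> pos (b - c) \<Longrightarrow> pos (a - c)"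
  using pos_add[of "a - b" "b - c"] by simp

text \<open>The elements w (1 - w)^i decrease in i, and their sum up to k telescopes to 1 - (1 -
  w)^(k+1). So k + 1 times the last of them lies below 1.\<close>

lemma norm_mult_power_le:
  assumes w: "pos w" "pos (1 - w)"
  shows "real (Suc k) * norm (w * (1 - w) ^ k) \<le> 1"
proof -
  define a where "a i = w * (1 - w) ^ i" for i
  have wc: "w * (1 - w) ^ i = (1 - w) ^ i * w" for i
    by (rule power_commuting_commutes[symmetric]) (simp add: algebra_simps)
  have pa: "pos (a i)" for i unfolding a_def by (intro pos_mult_commute w pos_power wc)
  have step: "pos (a i - a (Suc i))" for i
  proof -
    have "a i - a (Suc i) = a i * w"
      by (simp add: a_def power_Suc2 mult.assoc right_diff_distrib del: power_Suc)
    moreover have "a i * w = w * a i" unfolding a_def by (metis wc mult.assoc)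
    ultimately show ?thesis using pos_mult_commute[OF pa w(1)] by simp
  qed
  have mono: "pos (a i - a (i + j))" for i j
    by (induction j) (use step pos_diff_trans in force)+
  have "(\<Sum>i\<le>k. a i) = 1 - (1 - w) ^ Suc k"
  proof (induction k)
    case (Suc k)
    have "(\<Sum>i\<le>Suc k. a i) = 1 - (1 - w) ^ Suc k + a (Suc k)" using Suc by simp
    also have "\<dots> = 1 - (1 - w) ^ Suc (Suc k)"
      unfolding a_def power_Suc[of _ "Suc k"] by (simp add: left_diff_distrib del: power_Suc)
    finally show ?case .
  qed (simp add: a_def)
  moreover have "(\<Sum>i\<le>k. a i) = (\<Sum>i\<le>k. (a i - a k)) + real (Suc k) *\<^sub>R a k"
    by (simp add: sum_subtractf scaleR_conv_of_real del: of_nat_Suc)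
  ultimately have "1 - real (Suc k) *\<^sub>R a k = (1 - w) ^ Suc k + (\<Sum>i\<le>k. (a i - a k))"
    by (simp add: algebra_simps)
  also have "pos \<dots>"
  proof (intro pos_add pos_power w pos_sum)
    fix i assume "i \<in> {..k}"
    then show "pos (a i - a k)" using mono[of i "k - i"] by simp
  qed
  finally have "norm (real (Suc k) *\<^sub>R a k) \<le> 1"
    by (intro norm_le_of_pos pos_scaleR pa) auto
  then show ?thesis by (simp add: a_def)
qed

text \<open>In the absence of polar decompositions this is what allows to cancel \<open>star x * x\<close>.\<close>

lemma power_mult_star_tendsto_0:
  assumes x: "norm x \<le> 1"
  shows "(\<lambda>j. (1 - star x * x) ^ j * star x) \<longlonglongrightarrow> 0"
proof -
  define w where "w = star x * x"
  have nw: "norm w \<le> 1" using x by (simp add: w_def norm_star_mult power_le_one)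
  have w: "pos w" "pos (1 - w)"
    using pos_norm_minus[of w 1] nw by (auto simp: w_def pos_star_mult sa_intros)
  \<comment> \<open>The C*-identity turns the factor \<open>star x\<close> into \<open>w\<close>, to
    which \<open>norm_mult_power_le\<close> applies together with one of the two powers of
    \<open>1 - w\<close>; the other power has norm at most 1.\<close>
  have b: "(norm ((1 - w) ^ j * star x))\<^sup>2 \<le> inverse (real (Suc j))" for j
  proof -
    have sw: "star (1 - w) = 1 - w" using pos_sa[OF w(2)] by (simp add: sa_def)
    have "(1 - w) ^ j * star x * star ((1 - w) ^ j * star x) = (1 - w) ^ j * w * (1 - w) ^ j"
      by (simp add: star_mult star_power sw) (simp add: w_def mult.assoc)
    then have "(norm ((1 - w) ^ j * star x))\<^sup>2 = norm ((1 - w) ^ j * w * (1 - w) ^ j)"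
      by (metis norm_mult_star)
    also have "(1 - w) ^ j * w = w * (1 - w) ^ j"
      by (rule power_commuting_commutes) (simp add: algebra_simps)
    also have "norm (w * (1 - w) ^ j * (1 - w) ^ j) \<le> norm (w * (1 - w) ^ j) * 1"
    proof (rule order_trans[OF norm_mult_ineq mult_left_mono])
      have "norm (1 - w) \<le> 1"
        by (rule norm_le_of_pos) (use w in auto)
      then show "norm ((1 - w) ^ j) \<le> 1"
        by (meson norm_ge_zero norm_power_ineq order_trans power_le_one)
    qed simp
    also have "\<dots> \<le> inverse (real (Suc j))"
      using norm_mult_power_le[OF w, of j] by (simp add: field_simps del: of_nat_Suc)
    finally show ?thesis .
  qed
  have "(\<lambda>j. (norm ((1 - w) ^ j * star x))\<^sup>2) \<longlonglongrightarrow> 0"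
    by (rule tendsto_sandwich[OF _ _ tendsto_const LIMSEQ_inverse_real_of_nat]) (use b in auto)
  then have "(\<lambda>j. norm ((1 - w) ^ j * star x)) \<longlonglongrightarrow> 0"
    using tendsto_real_sqrt by fastforce
  then show ?thesis by (simp add: w_def tendsto_norm_zero_iff)
qed

section \<open>Subalgebras and their unitizations\<close>

definition csub :: "'a::cstar1 set \<Rightarrow> bool" where
  "csub S \<longleftrightarrow> closed S \<and> 0 \<in> S \<and> (\<forall>x\<in>S. \<forall>y\<in>S. x + y \<in> S) \<and> (\<forall>x\<in>S. \<forall>y\<in>S. x * y \<in> S) \<and>
    (\<forall>c. \<forall>x\<in>S. cx c * x \<in> S) \<and> (\<forall>x\<in>S. star x \<in> S)"

lemma csubD:
  assumes "csub S"
  shows "closed S" "0 \<in> S" "x \<in> S \<Longrightarrow> y \<in> S \<Longrightarrow> x + y \<in> S" "x \<in> S \<Longrightarrow> y \<in> S \<Longrightarrow> x * y \<in> S"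
    "x \<in> S \<Longrightarrow> cx c * x \<in> S" "x \<in> S \<Longrightarrow> star x \<in> S" "x \<in> S \<Longrightarrow> r *\<^sub>R x \<in> S"
    "x \<in> S \<Longrightarrow> - x \<in> S" "x \<in> S \<Longrightarrow> y \<in> S \<Longrightarrow> x - y \<in> S"
proof -
  show "closed S" "0 \<in> S" and a: "\<And>x y. x \<in> S \<Longrightarrow> y \<in> S \<Longrightarrow> x + y \<in> S"
    and "x \<in> S \<Longrightarrow> y \<in> S \<Longrightarrow> x * y \<in> S"
    and c: "\<And>x c. x \<in> S \<Longrightarrow> cx c * x \<in> S" and "x \<in> S \<Longrightarrow> star x \<in> S"
    using assms by (auto simp: csub_def)
  show "x \<in> S \<Longrightarrow> r *\<^sub>R x \<in> S" by (simp add: scaleR_cx c)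
  show n: "\<And>x. x \<in> S \<Longrightarrow> - x \<in> S" using c[of _ "-1"] by (simp add: cx_minus)
  show "x \<in> S \<Longrightarrow> y \<in> S \<Longrightarrow> x - y \<in> S" using a n by (metis diff_conv_add_uminus)
qed

text \<open>The unitization of \<open>S\<close>, its scalar part being read off by
  \<open>aug\<close>. Written as a preimage of \<open>S\<close> under a continuous map, it is closed
  when \<open>S\<close> is.\<close>

definition u1 :: "'a::cstar1 set \<Rightarrow> 'a set" where "u1 S = {z. z - cx (aug z) \<in> S}"

text \<open>The Cartesian decomposition 2 x = h - i k reduces a property stable under complex linear
  combinations to self-adjoint elements.\<close>

lemma sa_spanning:
  assumes S: "csub S" and add: "\<And>x y. x \<in> Z \<Longrightarrow> y \<in> Z \<Longrightarrow> x + y \<in> Z"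
    and cx: "\<And>c x. x \<in> Z \<Longrightarrow> cx c * x \<in> Z" and sa: "\<And>h. h \<in> S \<Longrightarrow> sa h \<Longrightarrow> h \<in> Z" and x: "x \<in> S"
  shows "x \<in> Z"
proof -
  note m = csubD[OF S]
  define h where "h = x + star x"
  define k where "k = cx \<i> * (x - star x)"
  have "h \<in> Z" by (rule sa) (use x m in \<open>auto simp: h_def sa_intros\<close>)
  moreover have "k \<in> Z"
  proof (rule sa)
    show "k \<in> S" using x m by (simp add: k_def)
    have "star k = (star x - x) * cx (- \<i>)" by (simp add: k_def star_mult star_cx star_diff)
    also have "\<dots> = k" unfolding cx_commute k_def by (simp add: cx_minus right_diff_distrib)
    finally show "sa k" by (simp add: sa_def)
  qed
  moreover have "h + cx (- \<i>) * k = 2 *\<^sub>R x"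
  proof -
    have "cx (- \<i>) * k = cx (- \<i> * \<i>) * (x - star x)" by (simp only: k_def mult.assoc cx_mult)
    then show ?thesis by (simp add: h_def scaleR_2)
  qed
  then have "cx (1/2) * (h + cx (- \<i>) * k) = x" using scaleR_cx[of "1/2" "2 *\<^sub>R x"] by simp
  ultimately show ?thesis using cx add by metis
qed

text \<open>Inside the kernel of \<open>aug\<close> there is no unit of the type, since
  \<open>aug 1 = 1\<close>. So the scalars and \<open>S\<close> are independent in
  \<open>u1 S\<close>, and \<open>S\<close> consists of the elements of \<open>u1 S\<close> with
  augmentation 0.\<close>

locale aug_csub =
  fixes S :: "'a::cstar1 set"
  assumes csub: "csub S" and aug: "x \<in> S \<Longrightarrow> aug x = 0"
begin

lemma subset_u1: "x \<in> S \<Longrightarrow> x \<in> u1 S" by (simp add: u1_def aug)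

lemma u1_aug_0: "x \<in> u1 S \<Longrightarrow> aug x = 0 \<Longrightarrow> x \<in> S" by (simp add: u1_def)

lemma cx_u1: "cx c \<in> u1 S" by (simp add: u1_def aug_cx csubD(2)[OF csub])

lemma u1_cases: assumes "x \<in> u1 S" obtains c b where "x = cx c + b" "b \<in> S" "c = aug x"
  using assms by (auto simp: u1_def intro: that[of "aug x" "x - cx (aug x)"])

lemma u1_mult: assumes "x \<in> u1 S" "y \<in> u1 S" shows "x * y \<in> u1 S"
proof -
  obtain c b d e where *: "x = cx c + b" "b \<in> S" "y = cx d + e" "e \<in> S"
    using assms u1_cases by metis
  then have "aug x = c" "aug y = d" by (auto simp: aug_add aug_cx aug)
  then have "aug (x * y) = c * d" by (simp add: aug_mult)
  then have "x * y - cx (aug (x * y)) = cx c * e + cx d * b + b * e"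
    by (simp add: cx_mult distrib_left distrib_right *(1,3) cx_commute[of b])
  then show ?thesis using * csubD[OF csub] by (auto simp: u1_def)
qed

lemma u1_mult_left: assumes "x \<in> u1 S" "y \<in> S" shows "x * y \<in> S"
  using u1_mult[OF assms(1) subset_u1[OF assms(2)]] by (rule u1_aug_0) (simp add: aug_mult aug assms)

lemma u1_mult_right: assumes "x \<in> u1 S" "y \<in> S" shows "y * x \<in> S"
  using u1_mult[OF subset_u1[OF assms(2)] assms(1)] by (rule u1_aug_0) (simp add: aug_mult aug assms)

lemma u1_star: "x \<in> u1 S \<Longrightarrow> star x \<in> u1 S"
  using csubD(6)[OF csub, of "x - cx (aug x)"] by (simp add: u1_def star_diff star_cx aug_star)

lemma u1_add: "x \<in> u1 S \<Longrightarrow> y \<in> u1 S \<Longrightarrow> x + y \<in> u1 S"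
  using csubD(3)[OF csub, of "x - cx (aug x)" "y - cx (aug y)"]
  by (simp add: u1_def aug_add cx_add algebra_simps)

lemma rsub_u1: "rsub (u1 S)"
  unfolding rsub_def
proof (intro conjI ballI allI)
  have "u1 S = (\<lambda>z. z - cx (aug z)) -` S" by (auto simp: u1_def)
  moreover have "continuous_on UNIV (\<lambda>z::'a. z - cx (aug z))"
    by (intro continuous_intros bounded_linear.continuous_on[OF bounded_linear_cx]
        bounded_linear.continuous_on[OF bounded_linear_aug])
  ultimately show "closed (u1 S)" using csubD(1)[OF csub] by (metis closed_vimage)
  show "1 \<in> u1 S" using cx_u1[of 1] by simp
  show "r *\<^sub>R x \<in> u1 S" if "x \<in> u1 S" for r x
    unfolding scaleR_cx by (rule u1_mult[OF cx_u1 that])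
qed (auto intro: u1_mult u1_add)

lemmas u1_rsub = rsubD[OF rsub_u1]

text \<open>The root lies in \<open>u1 S\<close>, and the square of its augmentation is
  \<open>aug a = 0\<close>.\<close>

lemma pos_sqrt_mem:
  assumes "pos a" "a \<in> S"
  obtains s where "pos s" "s * s = a" "s \<in> S"
proof -
  obtain s where s: "pos s" "s * s = a" "\<And>T. rsub T \<Longrightarrow> a \<in> T \<Longrightarrow> s \<in> T"
    using pos_sqrt[OF assms(1)] by metis
  have "s \<in> u1 S" using s(3)[OF rsub_u1] subset_u1 assms(2) by blast
  moreover have "aug s = 0" using aug[OF assms(2)] s(2)[symmetric] by (simp add: aug_mult)
  ultimately show ?thesis using that s u1_aug_0 by blast
qed

end

locale abelian_csub = aug_csub B for B :: "'a::cstar1 set" +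
  assumes comm: "x \<in> B \<Longrightarrow> y \<in> B \<Longrightarrow> x * y = y * x"
begin

lemma u1_comm: assumes "x \<in> u1 B" "y \<in> u1 B" shows "x * y = y * x"
proof -
  obtain c b d e where *: "x = cx c + b" "b \<in> B" "y = cx d + e" "e \<in> B"
    using assms u1_cases by metis
  have "cx c * cx d = cx d * (cx c :: 'a)" by (rule cx_commute)
  then show ?thesis unfolding * using comm[OF *(2,4)]
    by (simp add: distrib_left distrib_right cx_commute[of b] cx_commute[of e])
qed

lemma u1_lcomm: "x \<in> u1 B \<Longrightarrow> y \<in> u1 B \<Longrightarrow> x * (y * z) = y * (x * z)"
  using u1_comm by (metis mult.assoc)

end

section \<open>Norms of star-homomorphisms\<close>

locale star_hom_on = aug_csub S for S :: "'a::cstar1 set" +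
  fixes \<pi> :: "'a \<Rightarrow> 'b::cstar1"
  assumes add: "x \<in> S \<Longrightarrow> y \<in> S \<Longrightarrow> \<pi> (x + y) = \<pi> x + \<pi> y"
    and mult: "x \<in> S \<Longrightarrow> y \<in> S \<Longrightarrow> \<pi> (x * y) = \<pi> x * \<pi> y"
    and scal: "x \<in> S \<Longrightarrow> \<pi> (cx c * x) = cx c * \<pi> x"
    and star: "x \<in> S \<Longrightarrow> \<pi> (star x) = star (\<pi> x)"
begin

text \<open>The unital extension of \<open>\<pi>\<close> to \<open>u1 S\<close>, so that it can be
  applied to differences with multiples of 1.\<close>

definition ext :: "'a \<Rightarrow> 'b" where "ext z = cx (aug z) + \<pi> (z - cx (aug z))"

lemma hom_0: "\<pi> 0 = 0" using scal[of 0 0] csubD(2)[OF csub] by simp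

lemma hom_diff: "x \<in> S \<Longrightarrow> y \<in> S \<Longrightarrow> \<pi> (x - y) = \<pi> x - \<pi> y"
  using add[of x "cx (-1) * y"] scal[of y "-1"] csubD(5)[OF csub, of y "-1"] by (simp add: cx_minus)

lemma ext_hom: "x \<in> S \<Longrightarrow> ext x = \<pi> x" by (simp add: ext_def aug)

lemma ext_cx: "ext (cx c) = cx c" by (simp add: ext_def aug_cx hom_0)

lemma ext_form: "b \<in> S \<Longrightarrow> ext (cx c + b) = cx c + \<pi> b"
  by (simp add: ext_def aug_add aug_cx aug)

lemma ext_mult: assumes "x \<in> u1 S" "y \<in> u1 S" shows "ext (x * y) = ext x * ext y"
proof -
  obtain c b d e where *: "x = cx c + b" "b \<in> S" "y = cx d + e" "e \<in> S"
    using assms u1_cases by metis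
  have m: "cx c * e \<in> S" "cx d * b \<in> S" "b * e \<in> S" using * csubD[OF csub] by auto
  have "x * y = cx (c * d) + (cx c * e + cx d * b + b * e)"
    using * by (simp add: cx_mult distrib_left distrib_right cx_commute[of b])
  then have "ext (x * y) = cx (c * d) + (cx c * \<pi> e + cx d * \<pi> b + \<pi> b * \<pi> e)"
    using * m csubD(3)[OF csub] by (simp add: ext_form add mult scal)
  also have "\<dots> = ext x * ext y"
    using * by (simp add: ext_form cx_mult distrib_left distrib_right cx_commute[of "\<pi> b"])
  finally show ?thesis .
qed

lemma ext_diff: assumes "x \<in> u1 S" "y \<in> u1 S" shows "ext (x - y) = ext x - ext y"
proof -
  obtain c b d e where *: "x = cx c + b" "b \<in> S" "y = cx d + e" "e \<in> S"
    using assms u1_cases by metis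
  then have "ext (cx (c - d) + (b - e)) = cx (c - d) + \<pi> (b - e)"
    using * csubD(9)[OF csub] by (intro ext_form)
  moreover have "x - y = cx (c - d) + (b - e)" using * by (simp add: cx_diff)
  ultimately have "ext (x - y) = cx (c - d) + \<pi> (b - e)" by simp
  then show ?thesis using * by (simp add: ext_form cx_diff hom_diff)
qed

lemma ext_star: assumes "x \<in> u1 S" shows "ext (star x) = star (ext x)"
proof -
  obtain c b where *: "x = cx c + b" "b \<in> S" using assms u1_cases by metis
  then show ?thesis using csubD(6)[OF csub] by (simp add: star_add star_cx ext_form star)
qed

lemma ext_pos: assumes "z \<in> u1 S" "pos z" shows "pos (ext z)"
proof -
  obtain s where s: "pos s" "s * s = z" "\<And>T. rsub T \<Longrightarrow> z \<in> T \<Longrightarrow> s \<in> T"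
    using pos_sqrt[OF assms(2)] by metis
  have "s \<in> u1 S" using s(3)[OF rsub_u1 assms(1)] .
  moreover have "star s = s" using pos_sa[OF s(1)] by (simp add: sa_def)
  ultimately have "ext z = star (ext s) * ext s"
    using s(2)[symmetric] by (simp add: ext_mult flip: ext_star)
  then show ?thesis by (simp add: pos_star_mult)
qed

text \<open>The extension preserves positivity because it maps roots to roots; so it carries h \<le>
  norm h over to \<open>\<pi> h\<close>, where \<open>h = star x * x\<close>.\<close>

lemma contractive: assumes x: "x \<in> S" shows "norm (\<pi> x) \<le> norm x"
proof -
  define h where "h = star x * x"
  have h: "h \<in> S" "\<pi> h = star (\<pi> x) * \<pi> x"
    using x csubD[OF csub] by (auto simp: h_def mult star)
  have 1: "of_real (norm h) - h \<in> u1 S" using subset_u1[OF h(1)] u1_rsub(6,9) by blast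
  have "pos (ext (of_real (norm h) - h))"
    by (rule ext_pos[OF 1 pos_norm_minus]) (auto simp: h_def sa_intros)
  also have "ext (of_real (norm h) - h) = of_real (norm h) - \<pi> h"
    using ext_diff[OF u1_rsub(9) subset_u1[OF h(1)], of "norm h"]
    by (simp add: ext_hom h(1) ext_cx flip: cx_of_real)
  finally have "norm (\<pi> h) \<le> norm h"
    by (intro norm_le_of_pos) (auto simp: h(2) pos_star_mult)
  then have "(norm (\<pi> x))\<^sup>2 \<le> (norm x)\<^sup>2" unfolding h(2) by (simp add: h_def norm_star_mult)
  then show ?thesis by simp
qed

text \<open>If \<open>\<pi>\<close> shrank \<open>h = star x * x\<close> to norm \<open>r < norm h\<close>, it would kill \<open>x\<close> times the positive part
  of \<open>h - r\<close>.\<close>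

lemma isometric:
  assumes inj: "inj_on \<pi> S" and x: "x \<in> S"
  shows "norm (\<pi> x) = norm x"
proof -
  define h where "h = star x * x"
  have h: "h \<in> S" "\<pi> h = star (\<pi> x) * \<pi> x"
    using x csubD[OF csub] by (auto simp: h_def mult star)
  define r where "r = norm (\<pi> h)"
  have hr: "h - of_real r \<in> u1 S" using subset_u1[OF h(1)] u1_rsub(6,9) by blast
  have "sa (h - of_real r)" by (auto simp: h_def intro!: sa_intros)
  then obtain p q where pq: "pos p" "pos q" "p * q = 0" "q * p = 0" "h - of_real r = p - q"
    "\<And>T. rsub T \<Longrightarrow> h - of_real r \<in> T \<Longrightarrow> p \<in> T \<and> q \<in> T"
    using pos_part by metis
  have u: "p \<in> u1 S" "q \<in> u1 S" using pq(6)[OF rsub_u1 hr] by auto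
  have e: "ext p - ext q = \<pi> h - of_real r"
    using ext_diff[OF u] ext_diff[OF subset_u1[OF h(1)] u1_rsub(9), of r]
    by (simp add: pq(5)[symmetric] ext_hom h(1) ext_cx flip: cx_of_real)
  have e0: "ext p * ext q = 0" "ext q * ext p = 0"
    using ext_mult[of p q] ext_mult[of q p] u pq hom_0 by (auto simp: ext_def)
  \<comment> \<open>By the choice of \<open>r\<close> the element \<open>of_real r - \<pi> h\<close>
    is positive, so the square of \<open>ext p\<close> and its product with this element are
    positive with sum 0.\<close>
  have "ext p * ext p = ext p * (\<pi> h - of_real r)" by (simp add: e[symmetric] algebra_simps e0)
  then have "ext p * ext p + ext p * (of_real r - \<pi> h) = 0" by (simp add: algebra_simps)
  moreover have "of_real r - \<pi> h = ext q - ext p" using e by (simp add: algebra_simps)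
  then have "ext p * (of_real r - \<pi> h) = (of_real r - \<pi> h) * ext p"
    by (simp only: left_diff_distrib right_diff_distrib e0)
  moreover have pe: "pos (ext p)" by (rule ext_pos[OF u(1) pq(1)])
  moreover have "pos (of_real r - \<pi> h)"
    unfolding r_def by (rule pos_norm_minus) (auto simp: h(2) sa_intros)
  ultimately have "ext p * ext p = 0"
    by (intro pos_add_eq_0[OF pos_square[OF pos_sa[OF pe]] pos_mult_commute])
  then have "ext p = 0" by (rule sa_square_eq_0[OF pos_sa[OF pe]])
  then have "\<pi> (x * p) = 0"
    using ext_mult[OF subset_u1[OF x] u(1)] by (simp add: ext_hom u1_mult_right u(1) x)
  then have "x * p = 0"
    using inj hom_0 u1_mult_right[OF u(1) x] csubD(2)[OF csub] by (metis inj_onD)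
  then have hp: "h * p = 0" by (simp add: h_def mult.assoc)
  \<comment> \<open>Now \<open>p\<close> is the positive part of \<open>h - of_real r\<close>, but
    \<open>h\<close> vanishes on it; so its square equals - r p, and both sides are 0.\<close>
  have "p * p = (p - q) * p" by (simp add: algebra_simps pq)
  also have "\<dots> = - (r *\<^sub>R p)" unfolding pq(5)[symmetric]
    by (simp add: left_diff_distrib hp scaleR_conv_of_real)
  finally have "p * p + r *\<^sub>R p = 0" by simp
  then have "p * p = 0"
    by (intro pos_add_eq_0[OF pos_square[OF pos_sa[OF pq(1)]] pos_scaleR[OF pq(1)]]) (auto simp: r_def)
  then have "p = 0" by (rule sa_square_eq_0[OF pos_sa[OF pq(1)]])
  then have "pos (of_real r - h)" using pq(2,5) by (metis diff_0 minus_diff_eq minus_minus)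
  then have "norm h \<le> norm (\<pi> h)"
    unfolding r_def by (intro norm_le_of_pos) (auto simp: h_def pos_star_mult)
  then have "(norm x)\<^sup>2 \<le> (norm (\<pi> x))\<^sup>2" unfolding h(2) by (simp add: h_def norm_star_mult)
  then show ?thesis using contractive[OF x] by simp
qed

end

lemma null_squeeze:
  fixes f g :: "nat \<Rightarrow> real"
  assumes "g \<longlonglongrightarrow> 0" "\<And>n. 0 \<le> f n" "\<And>n. f n \<le> g n"
  shows "f \<longlonglongrightarrow> 0"
  using assms by (intro tendsto_sandwich[of "\<lambda>_. 0" f _ g 0]) auto

section \<open>Arithmetic in a C*-algebra on a carrier\<close>

context cstar_algebra
begin

lemma sub_closed: "\<lbrakk>x \<in> car A; y \<in> car A\<rbrakk> \<Longrightarrow> x \<ominus> y \<in> car A"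
  by (simp add: sub_def add_closed scl_closed)

lemmas op_closed [simp] = nul_closed add_closed scl_closed mul_closed adj_closed sub_closed

lemma add_nul [simp]: "x \<in> car A \<Longrightarrow> x \<oplus> \<zero> = x"
  using add_commute nul_add nul_closed by metis

lemma add_left_commute: "\<lbrakk>x \<in> car A; y \<in> car A; z \<in> car A\<rbrakk> \<Longrightarrow> x \<oplus> (y \<oplus> z) = y \<oplus> (x \<oplus> z)"
  by (metis add_assoc add_commute)

lemma scl_0 [simp]: "x \<in> car A \<Longrightarrow> 0 \<odot> x = \<zero>"
  using scl_add_left[of x 1 "-1"] add_inverse[of x] by (simp add: scl_one)

lemma scl_nul [simp]: "c \<odot> \<zero> = \<zero>"
  using scl_scl[of \<zero> c 0] by simp

lemma mul_nul [simp]: "x \<in> car A \<Longrightarrow> x \<otimes> \<zero> = \<zero>"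
  using scl_mul_right[of x \<zero> 0] by simp

lemma nul_mul [simp]: "x \<in> car A \<Longrightarrow> \<zero> \<otimes> x = \<zero>"
  using scl_mul_left[of \<zero> x 0] by simp

lemma adj_nul [simp]: "adj A \<zero> = \<zero>"
  using adj_scl[of \<zero> 0] by simp

lemma nrm_nul [simp]: "nrm A \<zero> = 0" by (simp add: nrm_eq_0)

lemma sub_self [simp]: "x \<in> car A \<Longrightarrow> x \<ominus> x = \<zero>" by (simp add: sub_def add_inverse)

lemma sub_nul [simp]: "x \<in> car A \<Longrightarrow> x \<ominus> \<zero> = x" by (simp add: sub_def)

lemma add_sub_cancel: "\<lbrakk>x \<in> car A; y \<in> car A\<rbrakk> \<Longrightarrow> (x \<ominus> y) \<oplus> y = x"
  by (simp add: sub_def add_assoc add_commute[of "(-1) \<odot> y" y] add_inverse)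

lemma sub_eq_nul: "\<lbrakk>x \<in> car A; y \<in> car A\<rbrakk> \<Longrightarrow> x \<ominus> y = \<zero> \<longleftrightarrow> x = y"
  using add_sub_cancel[of x y] by (auto simp: nul_add)

lemma mul_sub_right: "\<lbrakk>x \<in> car A; y \<in> car A; z \<in> car A\<rbrakk> \<Longrightarrow> x \<otimes> (y \<ominus> z) = x \<otimes> y \<ominus> x \<otimes> z"
  by (simp add: sub_def mul_add_right scl_mul_right)

lemma mul_sub_left: "\<lbrakk>x \<in> car A; y \<in> car A; z \<in> car A\<rbrakk> \<Longrightarrow> (x \<ominus> y) \<otimes> z = x \<otimes> z \<ominus> y \<otimes> z"
  by (simp add: sub_def mul_add_left scl_mul_left)

lemma adj_sub: "\<lbrakk>x \<in> car A; y \<in> car A\<rbrakk> \<Longrightarrow> adj A (x \<ominus> y) = adj A x \<ominus> adj A y"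
  by (simp add: sub_def adj_add adj_scl)

lemma sub_triangle:
  "\<lbrakk>x \<in> car A; y \<in> car A; z \<in> car A\<rbrakk> \<Longrightarrow> (x \<ominus> y) \<oplus> (y \<ominus> z) = x \<ominus> z"
  by (metis add_assoc add_sub_cancel scl_closed sub_closed sub_def)

lemma nrm_sub_triangle:
  "\<lbrakk>x \<in> car A; y \<in> car A; z \<in> car A\<rbrakk> \<Longrightarrow> nrm A (x \<ominus> z) \<le> nrm A (x \<ominus> y) + nrm A (y \<ominus> z)"
  using nrm_triangle[of "x \<ominus> y" "y \<ominus> z"] by (simp add: sub_triangle)

lemma scl_sub: "\<lbrakk>x \<in> car A; y \<in> car A\<rbrakk> \<Longrightarrow> c \<odot> (x \<ominus> y) = c \<odot> x \<ominus> c \<odot> y"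
  by (simp add: sub_def scl_add_right scl_scl mult.commute)

lemma neg_sub: "\<lbrakk>x \<in> car A; y \<in> car A\<rbrakk> \<Longrightarrow> (-1) \<odot> (x \<ominus> y) = y \<ominus> x"
  by (simp add: sub_def scl_add_right scl_scl scl_one add_commute)

lemma nrm_sub_commute: "\<lbrakk>x \<in> car A; y \<in> car A\<rbrakk> \<Longrightarrow> nrm A (x \<ominus> y) = nrm A (y \<ominus> x)"
  using nrm_scl[of "x \<ominus> y" "-1"] by (simp add: neg_sub)

lemma nrm_le_sub: "\<lbrakk>x \<in> car A; y \<in> car A\<rbrakk> \<Longrightarrow> nrm A x \<le> nrm A (x \<ominus> y) + nrm A y"
  using nrm_triangle[of "x \<ominus> y" y] by (simp add: add_sub_cancel)

lemma sub_sub_add: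
  "\<lbrakk>x \<in> car A; y \<in> car A; z \<in> car A; w \<in> car A\<rbrakk> \<Longrightarrow> (x \<oplus> y) \<ominus> (z \<oplus> w) = (x \<ominus> z) \<oplus> (y \<ominus> w)"
  by (simp add: sub_def scl_add_right add_assoc add_left_commute)

lemma nrm_adj [simp]: "x \<in> car A \<Longrightarrow> nrm A (adj A x) = nrm A x"
proof -
  have *: "nrm A y \<le> nrm A (adj A y)" if "y \<in> car A" for y
  proof (cases "nrm A y = 0")
    case False
    have "nrm A y * nrm A y \<le> nrm A (adj A y) * nrm A y"
      using cstar_identity[OF that] nrm_mul[of "adj A y" y] that by (simp add: power2_eq_square)
    then show ?thesis using False nrm_nonneg[OF that] by simp
  qed (use that in \<open>simp add: nrm_nonneg\<close>)
  show "x \<in> car A \<Longrightarrow> nrm A (adj A x) = nrm A x"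
    using *[of x] *[of "adj A x"] by (simp add: adj_adj)
qed

text \<open>The choice \<open>z = x \<ominus> y\<close> and the C*-identity. In other words,
  \<open>adj A z \<otimes> x\<close> is a nondegenerate inner product, so an element can be
  identified by its products with all others.\<close>

lemma adj_mul_cancel:
  assumes "x \<in> car A" "y \<in> car A" "\<And>z. z \<in> car A \<Longrightarrow> adj A z \<otimes> x = adj A z \<otimes> y"
  shows "x = y"
proof -
  have "adj A (x \<ominus> y) \<otimes> (x \<ominus> y) = \<zero>"
    using assms by (simp add: mul_sub_right)
  then have "nrm A (x \<ominus> y) = 0"
    using cstar_identity[of "x \<ominus> y"] assms by simp
  then show ?thesis using assms by (simp add: nrm_eq_0 sub_eq_nul)
qed

lemma lim_unique:
  assumes "\<And>n. s n \<in> car A" "l \<in> car A" "k \<in> car A"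
    "(\<lambda>n. nrm A (s n \<ominus> l)) \<longlonglongrightarrow> 0" "(\<lambda>n. nrm A (s n \<ominus> k)) \<longlonglongrightarrow> 0"
  shows "l = k"
proof -
  have "(\<lambda>n. nrm A (s n \<ominus> l) + nrm A (s n \<ominus> k)) \<longlonglongrightarrow> 0 + 0"
    by (intro tendsto_add assms)
  moreover have "nrm A (l \<ominus> k) \<le> nrm A (s n \<ominus> l) + nrm A (s n \<ominus> k)" for n
    using nrm_sub_triangle[of l "s n" k] nrm_sub_commute[of l "s n"] assms by simp
  ultimately have "nrm A (l \<ominus> k) \<le> 0"
    using LIMSEQ_le_const[of "\<lambda>n. nrm A (s n \<ominus> l) + nrm A (s n \<ominus> k)" 0] by auto
  then show ?thesis using nrm_nonneg[of "l \<ominus> k"] assms by (simp add: nrm_eq_0 sub_eq_nul)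
qed

lemma nrm_lim_le:
  assumes "\<And>n. s n \<in> car A" "l \<in> car A" "(\<lambda>n. nrm A (s n \<ominus> l)) \<longlonglongrightarrow> 0"
    "\<exists>N. \<forall>n\<ge>N. nrm A (s n) \<le> K"
  shows "nrm A l \<le> K"
proof (rule LIMSEQ_le_const)
  show "(\<lambda>n. nrm A (s n \<ominus> l) + K) \<longlonglongrightarrow> K" using tendsto_add[OF assms(3) tendsto_const] by simp
  obtain N where N: "\<forall>n\<ge>N. nrm A (s n) \<le> K" using assms(4) by blast
  have "nrm A l \<le> nrm A (s n \<ominus> l) + K" if "n \<ge> N" for n
    using nrm_le_sub[of l "s n"] nrm_sub_commute[of l "s n"] N that assms(1)[of n] assms(2) by fastforce
  then show "\<exists>N. \<forall>n\<ge>N. nrm A l \<le> nrm A (s n \<ominus> l) + K" by blast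
qed

end

section \<open>A unital C*-algebra type containing every C*-algebra on a given type\<close>

text \<open>
  An element is a uniformly bounded family of adjointable operators, one on every C*-algebra with
  elements in \<open>'a\<close>, together with its family of adjoints and a scalar. So the type is a product of
  multiplier algebras, and it turns questions about carriers into questions about a type that is an
  instance of the classes of the analysis library.
\<close>

definition ok :: "'a star_alg \<Rightarrow> 'a \<Rightarrow> bool" where "ok A x \<longleftrightarrow> cstar_algebra A \<and> x \<in> car A"

text \<open>Adjointness for the inner product that makes \<open>A\<close> a Hilbert module over
  itself. Linearity of the operators (\<open>opr_add\<close>, \<open>opr_scl\<close>) and
  boundedness of \<open>S\<close> (\<open>adjp_sym\<close>) are consequences.\<close>

definition adjp :: "('a star_alg \<Rightarrow> 'a \<Rightarrow> 'a) \<Rightarrow> ('a star_alg \<Rightarrow> 'a \<Rightarrow> 'a) \<Rightarrow> bool" where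
  "adjp T S \<longleftrightarrow> (\<forall>A x. ok A x \<longrightarrow> T A x \<in> car A \<and> S A x \<in> car A) \<and>
    (\<forall>A x y. ok A x \<longrightarrow> ok A y \<longrightarrow> adj A (T A x) \<otimes>\<^bsub>A\<^esub> y = adj A x \<otimes>\<^bsub>A\<^esub> S A y) \<and>
    (\<exists>K. \<forall>A x. ok A x \<longrightarrow> nrm A (T A x) \<le> K * nrm A x)"

lemma adjp_intro:
  assumes "\<And>A x. cstar_algebra A \<Longrightarrow> x \<in> car A \<Longrightarrow> T A x \<in> car A"
    "\<And>A x. cstar_algebra A \<Longrightarrow> x \<in> car A \<Longrightarrow> S A x \<in> car A"
    "\<And>A x y. cstar_algebra A \<Longrightarrow> x \<in> car A \<Longrightarrow> y \<in> car A \<Longrightarrow>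
      adj A (T A x) \<otimes>\<^bsub>A\<^esub> y = adj A x \<otimes>\<^bsub>A\<^esub> S A y"
    "\<And>A x. cstar_algebra A \<Longrightarrow> x \<in> car A \<Longrightarrow> nrm A (T A x) \<le> K * nrm A x"
  shows "adjp T S"
  using assms unfolding adjp_def ok_def by blast

text \<open>The square of the norm of \<open>S A x\<close> is the norm of the inner product of
  \<open>T A (S A x)\<close> with \<open>x\<close>, which is at most K times the norms of
  \<open>S A x\<close> and \<open>x\<close>; one factor cancels.\<close>

lemma adjp_sym: assumes "adjp T S" shows "adjp S T"
proof -
  obtain K where K: "\<And>A x. ok A x \<Longrightarrow> nrm A (T A x) \<le> K * nrm A x"
    using assms unfolding adjp_def by blast
  show ?thesis
  proof (rule adjp_intro[where K=K])
    fix A :: "'a star_alg" and x assume A: "cstar_algebra A" "x \<in> car A"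
    then interpret cstar_algebra A by simp
    have c: "\<And>y. y \<in> car A \<Longrightarrow> T A y \<in> car A" "\<And>y. y \<in> car A \<Longrightarrow> S A y \<in> car A"
      using assms A unfolding adjp_def ok_def by blast+
    have a: "\<And>x y. x \<in> car A \<Longrightarrow> y \<in> car A \<Longrightarrow> adj A (T A x) \<otimes>\<^bsub>A\<^esub> y = adj A x \<otimes>\<^bsub>A\<^esub> S A y"
      using assms A unfolding adjp_def ok_def by blast
    show "S A x \<in> car A" "T A x \<in> car A" using c A by auto
    show "adj A (S A x) \<otimes>\<^bsub>A\<^esub> y = adj A x \<otimes>\<^bsub>A\<^esub> T A y" if "y \<in> car A" for y
    proof -
      have "adj A (adj A (T A y) \<otimes>\<^bsub>A\<^esub> x) = adj A (adj A y \<otimes>\<^bsub>A\<^esub> S A x)" using a[OF that A(2)] by simp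
      then show ?thesis using that A c by (simp add: adj_mul adj_adj)
    qed
    have "(nrm A (S A x))\<^sup>2 = nrm A (adj A (T A (S A x)) \<otimes>\<^bsub>A\<^esub> x)"
      using a[of "S A x" x] c A cstar_identity[of "S A x"] by simp
    also have "\<dots> \<le> nrm A (T A (S A x)) * nrm A x"
      using nrm_mul[of "adj A (T A (S A x))" x] c A by simp
    also have "\<dots> \<le> K * nrm A (S A x) * nrm A x"
      using K[of A "S A x"] A c by (intro mult_right_mono) (auto simp: ok_def nrm_nonneg)
    finally have *: "nrm A (S A x) * nrm A (S A x) \<le> K * nrm A x * nrm A (S A x)"
      by (simp add: power2_eq_square mult_ac)
    have "0 \<le> K * nrm A x" using K[of A x] A c nrm_nonneg[of "T A x"] by (auto simp: ok_def)
    then show "nrm A (S A x) \<le> K * nrm A x"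
      using * nrm_nonneg[of "S A x"] A c by (cases "nrm A (S A x) = 0") auto
  qed
qed

text \<open>A fixed value on meaningless arguments, so that two operators agreeing on all meaningful
  ones are equal as functions.\<close>

definition ext0 :: "('a star_alg \<Rightarrow> 'a \<Rightarrow> 'a) \<Rightarrow> 'a star_alg \<Rightarrow> 'a \<Rightarrow> 'a" where
  "ext0 T A x = (if ok A x then T A x else undefined)"

text \<open>Storing the adjoint makes the involution a mere exchange of components. The scalar is an
  independent coordinate: it gives the character \<open>aug\<close>, which vanishes on embedded
  algebras even if these have a unit of their own.\<close>

typedef 'a univ = "{(T :: 'a star_alg \<Rightarrow> 'a \<Rightarrow> 'a, S, c :: complex). adjp T S \<and> ext0 T = T \<and> ext0 S = S}"
proof -
  have "adjp (ext0 (\<lambda>A x. x)) (ext0 (\<lambda>A x. x))"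
    by (rule adjp_intro[where K=1]) (auto simp: ext0_def ok_def)
  moreover have "ext0 (ext0 T) = ext0 T" for T by (auto simp: ext0_def fun_eq_iff)
  ultimately show ?thesis by auto
qed

definition opr :: "'a univ \<Rightarrow> 'a star_alg \<Rightarrow> 'a \<Rightarrow> 'a" where "opr u = fst (Rep_univ u)"
definition opa :: "'a univ \<Rightarrow> 'a star_alg \<Rightarrow> 'a \<Rightarrow> 'a" where "opa u = fst (snd (Rep_univ u))"
definition sca :: "'a univ \<Rightarrow> complex" where "sca u = snd (snd (Rep_univ u))"

definition mkU :: "('a star_alg \<Rightarrow> 'a \<Rightarrow> 'a) \<Rightarrow> ('a star_alg \<Rightarrow> 'a \<Rightarrow> 'a) \<Rightarrow> complex \<Rightarrow> 'a univ" where
  "mkU T S c = Abs_univ (ext0 T, ext0 S, c)"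

lemma adjp_opr: "adjp (opr u) (opa u)"
  using Rep_univ[of u] by (auto simp: opr_def opa_def)

lemma adjp_ext0: "adjp T S \<Longrightarrow> adjp (ext0 T) (ext0 S)"
  by (auto simp: adjp_def ext0_def ok_def)

lemma mkU:
  assumes "adjp T S"
  shows "ok A x \<Longrightarrow> opr (mkU T S c) A x = T A x" "ok A x \<Longrightarrow> opa (mkU T S c) A x = S A x"
    "sca (mkU T S c) = c"
proof -
  have "Rep_univ (mkU T S c) = (ext0 T, ext0 S, c)"
    unfolding mkU_def
    by (rule Abs_univ_inverse) (use adjp_ext0[OF assms] in \<open>auto simp: ext0_def fun_eq_iff\<close>)
  then show "ok A x \<Longrightarrow> opr (mkU T S c) A x = T A x" "ok A x \<Longrightarrow> opa (mkU T S c) A x = S A x"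
    "sca (mkU T S c) = c"
    by (simp_all add: opr_def opa_def sca_def ext0_def)
qed

lemma opr_closed: "ok A x \<Longrightarrow> opr u A x \<in> car A" and opa_closed: "ok A x \<Longrightarrow> opa u A x \<in> car A"
  and opr_adj: "ok A x \<Longrightarrow> ok A y \<Longrightarrow> adj A (opr u A x) \<otimes>\<^bsub>A\<^esub> y = adj A x \<otimes>\<^bsub>A\<^esub> opa u A y"
  and opa_adj: "ok A x \<Longrightarrow> ok A y \<Longrightarrow> adj A (opa u A x) \<otimes>\<^bsub>A\<^esub> y = adj A x \<otimes>\<^bsub>A\<^esub> opr u A y"
  using adjp_opr[of u] adjp_sym[OF adjp_opr[of u]] unfolding adjp_def by blast+

lemma opa_determined:
  assumes "\<And>A x. ok A x \<Longrightarrow> opr u A x = opr v A x" "ok A y"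
  shows "opa u A y = opa v A y"
proof -
  interpret cstar_algebra A using assms by (simp add: ok_def)
  show ?thesis
  proof (rule adj_mul_cancel)
    fix z assume z: "z \<in> car A"
    then have "ok A z" by (simp add: ok_def cstar_algebra_axioms)
    then show "adj A z \<otimes>\<^bsub>A\<^esub> opa u A y = adj A z \<otimes>\<^bsub>A\<^esub> opa v A y"
      using opr_adj[of A z y u] opr_adj[of A z y v] assms by simp
  qed (use opa_closed[OF assms(2)] in auto)
qed

lemma univ_eqI:
  assumes "\<And>A x. ok A x \<Longrightarrow> opr u A x = opr v A x" "sca u = sca v"
  shows "u = v"
proof -
  have ext: "ext0 (opr w) = opr w" "ext0 (opa w) = opa w" for w :: "'a univ"
    using Rep_univ[of w] by (auto simp: opr_def opa_def)
  have undef: "opr w A x = undefined" "opa w A x = undefined" if "\<not> ok A x" for w :: "'a univ" and A x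
    by (subst ext[symmetric], simp add: ext0_def that)+
  have "opr u A x = opr v A x" for A x
    using assms(1) undef by (cases "ok A x") auto
  then have "opr u = opr v" by blast
  moreover have "opa u A x = opa v A x" for A x
    using opa_determined[OF assms(1)] undef by (cases "ok A x") auto
  then have "opa u = opa v" by blast
  ultimately have "Rep_univ u = Rep_univ v"
    using assms(2) by (simp add: opr_def opa_def sca_def prod_eq_iff)
  then show ?thesis by (simp add: Rep_univ_inject)
qed

lemma opr_bounded: "\<exists>K\<ge>0. \<forall>A x. ok A x \<longrightarrow> nrm A (opr u A x) \<le> K * nrm A x"
proof -
  obtain K where K: "\<And>A x. ok A x \<Longrightarrow> nrm A (opr u A x) \<le> K * nrm A x"
    using adjp_opr[of u] unfolding adjp_def by blast
  have "nrm A (opr u A x) \<le> \<bar>K\<bar> * nrm A x" if "ok A x" for A x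
  proof -
    have "0 \<le> nrm A x" using that by (auto simp: ok_def intro: cstar_algebra.nrm_nonneg)
    then have "K * nrm A x \<le> \<bar>K\<bar> * nrm A x" by (intro mult_right_mono) auto
    then show ?thesis using K[OF that] by simp
  qed
  then show ?thesis by (intro exI[of _ "\<bar>K\<bar>"]) auto
qed

lemma opr_add:
  assumes "cstar_algebra A" "x \<in> car A" "y \<in> car A"
  shows "opr u A (x \<oplus>\<^bsub>A\<^esub> y) = opr u A x \<oplus>\<^bsub>A\<^esub> opr u A y"
proof -
  interpret cstar_algebra A by fact
  have o: "ok A z \<longleftrightarrow> z \<in> car A" for z by (simp add: ok_def cstar_algebra_axioms)
  show ?thesis
  proof (rule adj_mul_cancel)
    fix z assume z: "z \<in> car A"
    have "adj A (opa u A z) \<otimes>\<^bsub>A\<^esub> (x \<oplus>\<^bsub>A\<^esub> y) = adj A (opa u A z) \<otimes>\<^bsub>A\<^esub> x \<oplus>\<^bsub>A\<^esub> adj A (opa u A z) \<otimes>\<^bsub>A\<^esub> y"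
      using assms z opa_closed[of A z u] by (simp add: o mul_add_right)
    then show "adj A z \<otimes>\<^bsub>A\<^esub> opr u A (x \<oplus>\<^bsub>A\<^esub> y) = adj A z \<otimes>\<^bsub>A\<^esub> (opr u A x \<oplus>\<^bsub>A\<^esub> opr u A y)"
      using assms z opr_closed[of A _ u] by (simp add: opa_adj o mul_add_right)
  qed (use opr_closed[of A _ u] assms in \<open>auto simp: o\<close>)
qed

lemma opr_scl:
  assumes "cstar_algebra A" "x \<in> car A"
  shows "opr u A (c \<odot>\<^bsub>A\<^esub> x) = c \<odot>\<^bsub>A\<^esub> opr u A x"
proof -
  interpret cstar_algebra A by fact
  have o: "ok A z \<longleftrightarrow> z \<in> car A" for z by (simp add: ok_def cstar_algebra_axioms)
  show ?thesis
  proof (rule adj_mul_cancel)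
    fix z assume z: "z \<in> car A"
    have "adj A (opa u A z) \<otimes>\<^bsub>A\<^esub> (c \<odot>\<^bsub>A\<^esub> x) = c \<odot>\<^bsub>A\<^esub> (adj A (opa u A z) \<otimes>\<^bsub>A\<^esub> x)"
      using assms z opa_closed[of A z u] by (simp add: o scl_mul_right)
    then show "adj A z \<otimes>\<^bsub>A\<^esub> opr u A (c \<odot>\<^bsub>A\<^esub> x) = adj A z \<otimes>\<^bsub>A\<^esub> (c \<odot>\<^bsub>A\<^esub> opr u A x)"
      using assms z opr_closed[of A _ u] by (simp add: opa_adj o scl_mul_right)
  qed (use opr_closed[of A _ u] assms in \<open>auto simp: o\<close>)
qed

definition cxU :: "complex \<Rightarrow> 'a univ" where
  "cxU c = mkU (\<lambda>A x. c \<odot>\<^bsub>A\<^esub> x) (\<lambda>A x. cnj c \<odot>\<^bsub>A\<^esub> x) c"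

lemma cxU:
  fixes x :: 'a
  shows "ok A x \<Longrightarrow> opr (cxU c) A x = c \<odot>\<^bsub>A\<^esub> x" "ok A x \<Longrightarrow> opa (cxU c) A x = cnj c \<odot>\<^bsub>A\<^esub> x" "sca (cxU c :: 'a univ) = c"
proof -
  have *: "adjp (\<lambda>A x. c \<odot>\<^bsub>A\<^esub> x) (\<lambda>A (x::'a). cnj c \<odot>\<^bsub>A\<^esub> x)"
  proof (rule adjp_intro[where K="cmod c"])
    fix A :: "'a star_alg" and x y assume "cstar_algebra A" "x \<in> car A" "y \<in> car A"
    then interpret cstar_algebra A by simp
    show "adj A (c \<odot>\<^bsub>A\<^esub> x) \<otimes>\<^bsub>A\<^esub> y = adj A x \<otimes>\<^bsub>A\<^esub> (cnj c \<odot>\<^bsub>A\<^esub> y)"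
      using \<open>x \<in> car A\<close> \<open>y \<in> car A\<close> by (simp add: adj_scl scl_mul_left scl_mul_right)
  qed (auto simp: cstar_algebra.scl_closed cstar_algebra.nrm_scl)
  show "ok A x \<Longrightarrow> opr (cxU c) A x = c \<odot>\<^bsub>A\<^esub> x" "ok A x \<Longrightarrow> opa (cxU c) A x = cnj c \<odot>\<^bsub>A\<^esub> x" "sca (cxU c :: 'a univ) = c"
    unfolding cxU_def by (simp_all add: mkU[OF *])
qed

section \<open>Algebraic and normed structure of the universal algebra\<close>

instantiation univ :: (type) ring_1
begin

definition "0 = cxU 0"
definition "1 = cxU 1"
definition "u + v = mkU (\<lambda>A x. opr u A x \<oplus>\<^bsub>A\<^esub> opr v A x) (\<lambda>A x. opa u A x \<oplus>\<^bsub>A\<^esub> opa v A x) (sca u + sca v)"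
definition "u * v = mkU (\<lambda>A x. opr u A (opr v A x)) (\<lambda>A x. opa v A (opa u A x)) (sca u * sca v)"
definition "- u = cxU (-1) * (u :: 'a univ)"
definition "u - v = u + - (v :: 'a univ)"

lemma adjp_plus: "adjp (\<lambda>A x. opr u A x \<oplus>\<^bsub>A\<^esub> opr v A x) (\<lambda>A (x::'a). opa u A x \<oplus>\<^bsub>A\<^esub> opa v A x)"
proof -
  obtain K L where K: "\<And>A x. ok A x \<Longrightarrow> nrm A (opr u A x) \<le> K * nrm A x"
    and L: "\<And>A x. ok A x \<Longrightarrow> nrm A (opr v A x) \<le> L * nrm A x"
    using opr_bounded[of u] opr_bounded[of v] by metis
  show ?thesis
  proof (rule adjp_intro[where K="K + L"])
    fix A :: "'a star_alg" and x assume A: "cstar_algebra A" and x: "x \<in> car A"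
    interpret cstar_algebra A by fact
    have o: "ok A z \<longleftrightarrow> z \<in> car A" for z by (simp add: ok_def A)
    note c = opr_closed[of A, unfolded o] opa_closed[of A, unfolded o]
    show "opr u A x \<oplus>\<^bsub>A\<^esub> opr v A x \<in> car A" "opa u A x \<oplus>\<^bsub>A\<^esub> opa v A x \<in> car A" using c x by auto
    show "adj A (opr u A x \<oplus>\<^bsub>A\<^esub> opr v A x) \<otimes>\<^bsub>A\<^esub> y = adj A x \<otimes>\<^bsub>A\<^esub> (opa u A y \<oplus>\<^bsub>A\<^esub> opa v A y)" if "y \<in> car A" for y
      using c x that by (simp add: adj_add mul_add_left mul_add_right opr_adj o)
    show "nrm A (opr u A x \<oplus>\<^bsub>A\<^esub> opr v A x) \<le> (K + L) * nrm A x"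
      using nrm_triangle[of "opr u A x" "opr v A x"] K[of A x] L[of A x] c x by (simp add: o distrib_right)
  qed
qed

lemma adjp_times: "adjp (\<lambda>A x. opr u A (opr v A x)) (\<lambda>A (x::'a). opa v A (opa u A x))"
proof -
  obtain K L where K: "\<And>A x. ok A x \<Longrightarrow> nrm A (opr u A x) \<le> K * nrm A x" "K \<ge> 0"
    and L: "\<And>A x. ok A x \<Longrightarrow> nrm A (opr v A x) \<le> L * nrm A x"
    using opr_bounded[of u] opr_bounded[of v] by metis
  show ?thesis
  proof (rule adjp_intro[where K="K * L"])
    fix A :: "'a star_alg" and x assume A: "cstar_algebra A" and x: "x \<in> car A"
    have o: "ok A z \<longleftrightarrow> z \<in> car A" for z by (simp add: ok_def A)
    note c = opr_closed[of A, unfolded o] opa_closed[of A, unfolded o]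
    show "opr u A (opr v A x) \<in> car A" "opa v A (opa u A x) \<in> car A" using c x by auto
    show "adj A (opr u A (opr v A x)) \<otimes>\<^bsub>A\<^esub> y = adj A x \<otimes>\<^bsub>A\<^esub> opa v A (opa u A y)" if "y \<in> car A" for y
      using c x that by (simp add: opr_adj o)
    show "nrm A (opr u A (opr v A x)) \<le> (K * L) * nrm A x"
      using K(1)[of A "opr v A x"] mult_left_mono[OF L[of A x] K(2)] c x by (simp add: o mult.assoc)
  qed
qed

lemma univ_plus:
  "ok A x \<Longrightarrow> opr (u + v) A x = opr u A x \<oplus>\<^bsub>A\<^esub> opr v A x" "sca (u + v) = sca u + sca v"
  by (simp_all add: plus_univ_def mkU[OF adjp_plus])

lemma univ_times:
  "ok A x \<Longrightarrow> opr (u * v) A x = opr u A (opr v A x)" "sca (u * v) = sca u * sca v"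
  by (simp_all add: times_univ_def mkU[OF adjp_times])

lemma univ_minus: "ok A x \<Longrightarrow> opr (- u) A x = (-1) \<odot>\<^bsub>A\<^esub> opr u A x" "sca (- u) = - sca u"
  by (auto simp: uminus_univ_def univ_times cxU opr_closed ok_def)

lemma univ_diff: "ok A x \<Longrightarrow> opr (u - v) A x = opr u A x \<ominus>\<^bsub>A\<^esub> opr v A x" "sca (u - v) = sca u - sca v"
  by (simp_all add: minus_univ_def univ_plus univ_minus sub_def)

instance
proof
  fix a b c :: "'a univ"
  show "a + b + c = a + (b + c)"
    by (rule univ_eqI) (auto simp: univ_plus opr_closed ok_def cstar_algebra.add_assoc)
  show "a + b = b + a"
    by (rule univ_eqI) (auto simp: univ_plus opr_closed ok_def cstar_algebra.add_commute)
  show "0 + a = a"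
    by (rule univ_eqI) (auto simp: univ_plus zero_univ_def cxU opr_closed ok_def cstar_algebra.scl_0 cstar_algebra.nul_add)
  show "- a + a = 0"
  proof (rule univ_eqI)
    fix A x assume ok: "ok A (x::'a)"
    then interpret cstar_algebra A by (simp add: ok_def)
    show "opr (- a + a) A x = opr 0 A x"
      using ok add_commute[of "(-1) \<odot>\<^bsub>A\<^esub> opr a A x" "opr a A x"] opr_closed[OF ok, of a]
      by (simp add: univ_plus univ_minus zero_univ_def cxU add_inverse) (simp add: ok_def)
  qed (simp add: univ_plus univ_minus zero_univ_def cxU)
  show "a - b = a + - b" by (simp add: minus_univ_def)
  show "a * b * c = a * (b * c)"
    by (rule univ_eqI) (auto simp: univ_times opr_closed ok_def)
  show "1 * a = a"
    by (rule univ_eqI) (auto simp: univ_times one_univ_def cxU opr_closed ok_def cstar_algebra.scl_one)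
  show "a * 1 = a"
    by (rule univ_eqI) (auto simp: univ_times one_univ_def cxU opr_closed ok_def cstar_algebra.scl_one)
  show "(a + b) * c = a * c + b * c"
    by (rule univ_eqI) (auto simp: univ_times univ_plus opr_closed ok_def distrib_right)
  show "a * (b + c) = a * b + a * c"
    by (rule univ_eqI) (auto simp: univ_times univ_plus opr_closed ok_def opr_add cstar_algebra.add_closed distrib_left)
  have "sca (0::'a univ) \<noteq> sca (1::'a univ)" by (simp add: zero_univ_def one_univ_def cxU)
  then show "(0::'a univ) \<noteq> 1" by metis
qed

end

lemma sca_simps: "sca 0 = 0" "sca 1 = 1" "sca (u + v) = sca u + sca v" "sca (u * v) = sca u * sca v"
  "sca (- u) = - sca u" "sca (u - v) = sca u - sca v" "sca (cxU c) = c"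
  by (simp_all add: univ_plus univ_times zero_univ_def one_univ_def cxU univ_minus univ_diff)

lemma opr_0: "ok A x \<Longrightarrow> opr 0 A x = \<zero>\<^bsub>A\<^esub>" and opr_1: "ok A x \<Longrightarrow> opr 1 A x = x"
  by (auto simp: zero_univ_def one_univ_def cxU ok_def cstar_algebra.scl_0 cstar_algebra.scl_one)

lemma opr_cxU_times: "ok A x \<Longrightarrow> opr (cxU c * u) A x = c \<odot>\<^bsub>A\<^esub> opr u A x"
  by (simp add: univ_times cxU opr_closed ok_def)

instantiation univ :: (type) real_algebra_1
begin

definition "r *\<^sub>R (u::'a univ) = cxU (complex_of_real r) * u"

instance
proof
  fix r s :: real and u v :: "'a univ"
  note d = scaleR_univ_def
  show "r *\<^sub>R (u + v) = r *\<^sub>R u + r *\<^sub>R v" by (simp add: d distrib_left)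
  show "(r + s) *\<^sub>R u = r *\<^sub>R u + s *\<^sub>R u"
    unfolding d distrib_right[symmetric]
    by (rule univ_eqI) (auto simp: d opr_cxU_times univ_plus univ_times sca_simps opr_closed ok_def cxU cstar_algebra.scl_add_left)
  show "r *\<^sub>R s *\<^sub>R u = (r * s) *\<^sub>R u"
    by (rule univ_eqI) (auto simp: d opr_cxU_times sca_simps opr_closed ok_def cstar_algebra.scl_scl)
  show "1 *\<^sub>R u = u" by (simp add: d flip: one_univ_def)
  show "r *\<^sub>R u * v = r *\<^sub>R (u * v)" by (simp add: d mult.assoc)
  show "u * r *\<^sub>R v = r *\<^sub>R (u * v)"
    by (rule univ_eqI) (auto simp: d opr_cxU_times univ_times sca_simps opr_closed ok_def cxU opr_scl cstar_algebra.scl_closed)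
qed

end

definition starU :: "'a univ \<Rightarrow> 'a univ" where "starU u = mkU (opa u) (opr u) (cnj (sca u))"

lemma starU:
  "ok A x \<Longrightarrow> opr (starU u) A x = opa u A x" "ok A x \<Longrightarrow> opa (starU u) A x = opr u A x"
  "sca (starU u) = cnj (sca u)"
  by (simp_all add: starU_def mkU[OF adjp_sym[OF adjp_opr]])

lemma opa_plus: "ok A x \<Longrightarrow> opa (u + v) A x = opa u A x \<oplus>\<^bsub>A\<^esub> opa v A x"
  and opa_times: "ok A x \<Longrightarrow> opa (u * v) A x = opa v A (opa u A x)"
  by (simp_all add: plus_univ_def times_univ_def mkU[OF adjp_plus] mkU[OF adjp_times])

lemma starU_starU [simp]: "starU (starU u) = u"
  by (rule univ_eqI) (auto simp: starU)

text \<open>The norm is the supremum of the operator norms on all components and of the modulus of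
  the scalar. Where \<open>nrm A x = 0\<close> the quotient is 0 by the convention for division and
  does not affect the supremum; the scalar keeps the set nonempty.\<close>

definition ratios :: "'a univ \<Rightarrow> real set" where
  "ratios u = insert (cmod (sca u)) {nrm A (opr u A x) / nrm A x | A x. ok A x}"

instantiation univ :: (type) real_normed_algebra_1
begin

definition "norm (u::'a univ) = Sup (ratios u)"
definition "sgn (u::'a univ) = u /\<^sub>R norm u"
definition "dist (u::'a univ) v = norm (u - v)"
definition uniformity_univ_def [code del]:
  "(uniformity :: ('a univ \<times> 'a univ) filter) = (INF e\<in>{0<..}. principal {(x, y). dist x y < e})"
definition open_univ_def [code del]:
  "open (U :: 'a univ set) \<longleftrightarrow> (\<forall>x\<in>U. \<forall>\<^sub>F (x', y) in uniformity. x' = x \<longrightarrow> y \<in> U)"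

lemma norm_univ_le_iff:
  "norm (u::'a univ) \<le> K \<longleftrightarrow> cmod (sca u) \<le> K \<and> (\<forall>A x. ok A x \<longrightarrow> nrm A (opr u A x) \<le> K * nrm A x)"
proof -
  have q: "nrm A (opr u A x) / nrm A x \<le> L \<longleftrightarrow> nrm A (opr u A x) \<le> L * nrm A x"
    if "ok A x" "L \<ge> 0" for A x L
  proof -
    interpret cstar_algebra A using that by (simp add: ok_def)
    have x: "x \<in> car A" using that by (simp add: ok_def)
    show ?thesis
    proof (cases "nrm A x = 0")
      case True
      then have "x = \<zero>\<^bsub>A\<^esub>" using x by (simp add: nrm_eq_0)
      moreover have "opr u A (0 \<odot>\<^bsub>A\<^esub> \<zero>\<^bsub>A\<^esub>) = \<zero>\<^bsub>A\<^esub>"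
        using opr_closed[of A "\<zero>\<^bsub>A\<^esub>" u] by (subst opr_scl) (auto simp: cstar_algebra_axioms ok_def)
      ultimately show ?thesis using that by simp
    next
      case False
      then have "nrm A x > 0" using nrm_nonneg[OF x] by simp
      then show ?thesis by (simp add: divide_le_eq)
    qed
  qed
  obtain L where L: "L \<ge> 0" "\<And>A x. ok A x \<Longrightarrow> nrm A (opr u A x) \<le> L * nrm A x"
    using opr_bounded by metis
  have "bdd_above (ratios u)"
    unfolding bdd_above_def ratios_def
    by (rule exI[of _ "max L (cmod (sca u))"]) (use q L in fastforce)
  then have "norm u \<le> K \<longleftrightarrow> (\<forall>r\<in>ratios u. r \<le> K)"
    unfolding norm_univ_def by (subst cSup_le_iff) (auto simp: ratios_def)
  also have "\<dots> \<longleftrightarrow> cmod (sca u) \<le> K \<and> (\<forall>A x. ok A x \<longrightarrow> nrm A (opr u A x) / nrm A x \<le> K)"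
    by (auto simp: ratios_def)
  also have "\<dots> \<longleftrightarrow> cmod (sca u) \<le> K \<and> (\<forall>A x. ok A x \<longrightarrow> nrm A (opr u A x) \<le> K * nrm A x)"
    using q norm_ge_zero order_trans by meson
  finally show ?thesis .
qed

lemma sca_le: "cmod (sca u) \<le> norm (u::'a univ)"
  and opr_le: "ok A x \<Longrightarrow> nrm A (opr u A x) \<le> norm (u::'a univ) * nrm A x"
  using norm_univ_le_iff[of u "norm u"] by auto

lemma norm_univ_nonneg: "0 \<le> norm (u::'a univ)"
  using sca_le norm_ge_zero order_trans by blast

instance
proof
  fix r :: real and u v :: "'a univ"
  show "dist u v = norm (u - v)" by (simp add: dist_univ_def)
  show "sgn u = u /\<^sub>R norm u" by (simp add: sgn_univ_def)
  show "(uniformity :: ('a univ \<times> 'a univ) filter) = (INF e\<in>{0<..}. principal {(x, y). dist x y < e})"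
    by (rule uniformity_univ_def)
  show "open U \<longleftrightarrow> (\<forall>x\<in>U. \<forall>\<^sub>F (x', y) in uniformity. x' = x \<longrightarrow> y \<in> U)" for U :: "'a univ set"
    by (rule open_univ_def)
  show "norm u = 0 \<longleftrightarrow> u = 0"
  proof
    assume 0: "norm u = 0"
    show "u = 0"
    proof (rule univ_eqI)
      show "sca u = sca 0" using sca_le[of u] 0 by (simp add: sca_simps)
      fix A x assume ok: "ok A (x::'a)"
      then interpret cstar_algebra A by (simp add: ok_def)
      show "opr u A x = opr 0 A x"
        using opr_le[OF ok, of u] 0 opr_closed[OF ok, of u] nrm_nonneg[of "opr u A x"]
        by (simp add: opr_0 ok nrm_eq_0)
    qed
  next
    assume "u = 0"
    then have "norm u \<le> 0"
      unfolding norm_univ_le_iff by (auto simp: sca_simps opr_0) (auto simp: ok_def cstar_algebra.nrm_nul)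
    then show "norm u = 0" using norm_univ_nonneg[of u] by simp
  qed
  show "norm (u + v) \<le> norm u + norm v"
    unfolding norm_univ_le_iff
  proof (intro conjI allI impI)
    show "cmod (sca (u + v)) \<le> norm u + norm v"
      using sca_le[of u] sca_le[of v] norm_triangle_ineq[of "sca u" "sca v"] by (simp add: sca_simps)
    fix A x assume ok: "ok A (x::'a)"
    then interpret cstar_algebra A by (simp add: ok_def)
    show "nrm A (opr (u + v) A x) \<le> (norm u + norm v) * nrm A x"
      using opr_le[OF ok, of u] opr_le[OF ok, of v] nrm_triangle[OF opr_closed[OF ok] opr_closed[OF ok], of u v]
      by (simp add: univ_plus ok distrib_right)
  qed
  show "norm (u * v) \<le> norm u * norm v"
    unfolding norm_univ_le_iff
  proof (intro conjI allI impI)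
    show "cmod (sca (u * v)) \<le> norm u * norm v"
      using sca_le[of u] sca_le[of v] by (simp add: sca_simps norm_mult mult_mono norm_univ_nonneg)
    fix A x assume ok: "ok A (x::'a)"
    then have ok2: "ok A (opr v A x)" using opr_closed[of A x v] by (simp add: ok_def)
    have "nrm A (opr (u * v) A x) \<le> norm u * nrm A (opr v A x)"
      using opr_le[OF ok2] ok by (simp add: univ_times)
    also have "\<dots> \<le> norm u * (norm v * nrm A x)"
      by (intro mult_left_mono opr_le ok norm_univ_nonneg)
    finally show "nrm A (opr (u * v) A x) \<le> norm u * norm v * nrm A x" by (simp add: mult.assoc)
  qed
  have le: "norm (r *\<^sub>R u) \<le> \<bar>r\<bar> * norm u" for r and u :: "'a univ"
    unfolding norm_univ_le_iff
  proof (intro conjI allI impI)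
    show "cmod (sca (r *\<^sub>R u)) \<le> \<bar>r\<bar> * norm u"
      using sca_le[of u] by (simp add: scaleR_univ_def sca_simps norm_mult mult_left_mono)
    fix A x assume ok: "ok A (x::'a)"
    then interpret cstar_algebra A by (simp add: ok_def)
    show "nrm A (opr (r *\<^sub>R u) A x) \<le> \<bar>r\<bar> * norm u * nrm A x"
      using mult_left_mono[OF opr_le[OF ok, of u], of "\<bar>r\<bar>"] opr_closed[OF ok, of u]
      by (simp add: scaleR_univ_def opr_cxU_times ok nrm_scl mult.assoc)
  qed
  show "norm (r *\<^sub>R u) = \<bar>r\<bar> * norm u"
  proof (cases "r = 0")
    case True
    then show ?thesis using le[of 0 u] norm_univ_nonneg[of "0 *\<^sub>R u"] by simp
  next
    case False
    have "\<bar>r\<bar> * norm u = \<bar>r\<bar> * norm ((1/r) *\<^sub>R r *\<^sub>R u)" using False by simp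
    also have "\<dots> \<le> norm (r *\<^sub>R u)"
      using mult_left_mono[OF le[of "1/r" "r *\<^sub>R u"], of "\<bar>r\<bar>"] False by simp
    finally show ?thesis using le[of r u] by simp
  qed
  have "norm (1::'a univ) \<le> 1"
    unfolding norm_univ_le_iff by (auto simp: sca_simps opr_1)
  then show "norm (1::'a univ) = 1" using sca_le[of "1::'a univ"] by (simp add: sca_simps)
qed

end

lemma starU_simps: "starU (u + v) = starU u + starU v" "starU (u * v) = starU v * starU u"
  "starU (cxU c) = cxU (cnj c)" "starU (u - v) = starU u - starU v"
proof -
  show 1: "starU (u + v) = starU u + starU v" for u v :: "'a univ"
    by (rule univ_eqI) (auto simp: starU univ_plus opa_plus sca_simps)
  show "starU (u * v) = starU v * starU u"
    by (rule univ_eqI) (auto simp: starU univ_times opa_times opa_closed sca_simps ok_def)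
  show "starU (cxU c) = cxU (cnj c)"
    by (rule univ_eqI) (auto simp: starU cxU sca_simps)
  show "starU (u - v) = starU u - starU v" using 1[of "u - v" v] by (simp add: algebra_simps)
qed

text \<open>As in \<open>adjp_sym\<close>, the adjoint inherits the bound of the operator; applied
  to \<open>u\<close> and \<open>starU u\<close> this gives equality.\<close>

lemma norm_starU [simp]: "norm (starU u) = norm u"
proof -
  have *: "norm (starU u) \<le> norm u" for u :: "'a univ"
    unfolding norm_univ_le_iff
  proof (intro conjI allI impI)
    show "cmod (sca (starU u)) \<le> norm u" using sca_le[of u] by (simp add: starU)
    fix A x assume ok: "ok A (x::'a)"
    then interpret cstar_algebra A by (simp add: ok_def)
    let ?y = "opa u A x"
    have c: "x \<in> car A" "?y \<in> car A" "opr u A ?y \<in> car A" "ok A ?y"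
      using ok opa_closed[OF ok] opr_closed[of A ?y] by (auto simp: ok_def)
    have "(nrm A ?y)\<^sup>2 = nrm A (adj A (opr u A ?y) \<otimes>\<^bsub>A\<^esub> x)"
      using cstar_identity[OF c(2)] opr_adj[OF c(4) ok, of u] by simp
    also have "\<dots> \<le> nrm A (opr u A ?y) * nrm A x"
      using nrm_mul[of "adj A (opr u A ?y)" x] c by simp
    also have "\<dots> \<le> norm u * nrm A ?y * nrm A x"
      using c by (intro mult_right_mono opr_le) (auto simp: nrm_nonneg)
    finally have "nrm A ?y * nrm A ?y \<le> norm u * nrm A x * nrm A ?y"
      by (simp add: power2_eq_square mult_ac)
    then have "nrm A ?y \<le> norm u * nrm A x"
      using nrm_nonneg[OF c(2)] nrm_nonneg[OF c(1)] by (cases "nrm A ?y = 0") auto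
    then show "nrm A (opr (starU u) A x) \<le> norm u * nrm A x" by (simp add: starU ok)
  qed
  show ?thesis using *[of u] *[of "starU u"] by simp
qed

instance univ :: (type) banach
proof
  fix X :: "nat \<Rightarrow> 'a univ" assume X: "Cauchy X"
  have "\<exists>l\<in>car A. (\<lambda>n. nrm A (opr (Y n) A x \<ominus>\<^bsub>A\<^esub> l)) \<longlonglongrightarrow> 0"
    if Y: "Cauchy Y" and ok: "ok A x" for A x and Y :: "nat \<Rightarrow> 'a univ"
  proof -
    interpret cstar_algebra A using ok by (simp add: ok_def)
    have x: "x \<in> car A" using ok by (simp add: ok_def)
    show ?thesis
    proof (rule complete)
      show "opr (Y n) A x \<in> car A" for n by (rule opr_closed[OF ok])
      fix e :: real assume e: "e > 0"
      have n0: "0 < nrm A x + 1" using nrm_nonneg[OF x] by simp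
      then obtain N where N: "\<And>m n. m \<ge> N \<Longrightarrow> n \<ge> N \<Longrightarrow> norm (Y m - Y n) < e / (nrm A x + 1)"
        using Y e unfolding Cauchy_iff by (meson divide_pos_pos)
      have "nrm A (opr (Y m) A x \<ominus>\<^bsub>A\<^esub> opr (Y n) A x) < e" if "m \<ge> N" "n \<ge> N" for m n
      proof -
        have "nrm A (opr (Y m) A x \<ominus>\<^bsub>A\<^esub> opr (Y n) A x) \<le> norm (Y m - Y n) * nrm A x"
          using opr_le[OF ok, of "Y m - Y n"] by (simp add: univ_diff ok)
        also have "\<dots> \<le> norm (Y m - Y n) * (nrm A x + 1)" by (simp add: mult_left_mono)
        also have "\<dots> < e" using N[OF that] n0 by (simp add: less_divide_eq)
        finally show ?thesis .
      qed
      then show "\<exists>N. \<forall>m\<ge>N. \<forall>n\<ge>N. nrm A (opr (Y m) A x \<ominus>\<^bsub>A\<^esub> opr (Y n) A x) < e" by blast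
    qed
  qed
  then have ex: "\<exists>T. \<forall>A x. ok A x \<longrightarrow> T A x \<in> car A \<and> (\<lambda>n. nrm A (opr (Y n) A x \<ominus>\<^bsub>A\<^esub> T A x)) \<longlonglongrightarrow> 0"
    if "Cauchy Y" for Y :: "nat \<Rightarrow> 'a univ"
    using that by meson
  obtain T where T: "\<And>A x. ok A x \<Longrightarrow> T A x \<in> car A"
      "\<And>A x. ok A x \<Longrightarrow> (\<lambda>n. nrm A (opr (X n) A x \<ominus>\<^bsub>A\<^esub> T A x)) \<longlonglongrightarrow> 0"
    using ex[OF X] by blast
  \<comment> \<open>The adjoints form a Cauchy sequence as well, and their pointwise limit
    \<open>S\<close> is the candidate for the adjoint of the pointwise limit
    \<open>T\<close>.\<close>
  have "Cauchy (\<lambda>n. starU (X n))" using X unfolding Cauchy_iff by (simp flip: starU_simps)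
  from ex[OF this] obtain S where S: "\<And>A x. ok A x \<Longrightarrow> S A x \<in> car A"
      "\<And>A x. ok A x \<Longrightarrow> (\<lambda>n. nrm A (opa (X n) A x \<ominus>\<^bsub>A\<^esub> S A x)) \<longlonglongrightarrow> 0"
    by (auto simp: starU)
  obtain K where K: "\<And>n. norm (X n) \<le> K" using Cauchy_Bseq[OF X] by (auto simp: Bseq_def)
  have "convergent sca_seq" if "sca_seq = (\<lambda>n. sca (X n))" for sca_seq
    unfolding that Cauchy_convergent_iff[symmetric] Cauchy_iff
  proof (intro allI impI)
    fix e :: real assume "e > 0"
    then obtain N where "\<forall>m\<ge>N. \<forall>n\<ge>N. norm (X m - X n) < e" using X unfolding Cauchy_iff by blast
    then show "\<exists>M. \<forall>m\<ge>M. \<forall>n\<ge>M. cmod (sca (X m) - sca (X n)) < e"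
      by (metis sca_le sca_simps(6) order_le_less_trans)
  qed
  then obtain c where c: "(\<lambda>n. sca (X n)) \<longlonglongrightarrow> c" unfolding convergent_def by blast
  have TS: "adjp T S"
  proof (rule adjp_intro[where K=K])
    fix A :: "'a star_alg" and x assume A: "cstar_algebra A" and x: "x \<in> car A"
    interpret cstar_algebra A by fact
    have o: "ok A z \<longleftrightarrow> z \<in> car A" for z by (simp add: ok_def A)
    note cl = T(1)[of A, unfolded o] S(1)[of A, unfolded o]
      opr_closed[of A, unfolded o] opa_closed[of A, unfolded o]
    show "T A x \<in> car A" "S A x \<in> car A" using cl x by auto
    show "nrm A (T A x) \<le> K * nrm A x"
    proof (rule nrm_lim_le[of "\<lambda>n. opr (X n) A x"])
      have "nrm A (opr (X n) A x) \<le> K * nrm A x" for n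
        using opr_le[of A x "X n"] mult_right_mono[OF K[of n] nrm_nonneg[OF x]] x by (simp add: o)
      then show "\<exists>N. \<forall>n\<ge>N. nrm A (opr (X n) A x) \<le> K * nrm A x" by blast
    qed (use cl x T(2) in \<open>auto simp: o\<close>)
    fix y assume y: "y \<in> car A"
    show "adj A (T A x) \<otimes>\<^bsub>A\<^esub> y = adj A x \<otimes>\<^bsub>A\<^esub> S A y"
    proof (rule lim_unique[of "\<lambda>n. adj A (opr (X n) A x) \<otimes>\<^bsub>A\<^esub> y"])
      have "nrm A (adj A (opr (X n) A x) \<otimes>\<^bsub>A\<^esub> y \<ominus>\<^bsub>A\<^esub> adj A (T A x) \<otimes>\<^bsub>A\<^esub> y) \<le> nrm A (opr (X n) A x \<ominus>\<^bsub>A\<^esub> T A x) * nrm A y" for n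
        using nrm_mul[of "adj A (opr (X n) A x \<ominus>\<^bsub>A\<^esub> T A x)" y] cl x y
        by (simp add: mul_sub_left adj_sub) (simp flip: adj_sub)
      moreover have "(\<lambda>n. nrm A (opr (X n) A x \<ominus>\<^bsub>A\<^esub> T A x) * nrm A y) \<longlonglongrightarrow> 0"
        using tendsto_mult_right[OF T(2)[of A x], of "nrm A y"] x by (simp add: o)
      ultimately show "(\<lambda>n. nrm A (adj A (opr (X n) A x) \<otimes>\<^bsub>A\<^esub> y \<ominus>\<^bsub>A\<^esub> adj A (T A x) \<otimes>\<^bsub>A\<^esub> y)) \<longlonglongrightarrow> 0"
        by (rule null_squeeze[rotated 2]) (use cl x y in \<open>auto intro!: nrm_nonneg\<close>)
      have "nrm A (adj A (opr (X n) A x) \<otimes>\<^bsub>A\<^esub> y \<ominus>\<^bsub>A\<^esub> adj A x \<otimes>\<^bsub>A\<^esub> S A y) \<le> nrm A x * nrm A (opa (X n) A y \<ominus>\<^bsub>A\<^esub> S A y)" for n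
        using nrm_mul[of "adj A x" "opa (X n) A y \<ominus>\<^bsub>A\<^esub> S A y"] cl x y
        by (simp add: mul_sub_right opr_adj o)
      moreover have "(\<lambda>n. nrm A x * nrm A (opa (X n) A y \<ominus>\<^bsub>A\<^esub> S A y)) \<longlonglongrightarrow> 0"
        using tendsto_mult_left[OF S(2)[of A y], of "nrm A x"] y by (simp add: o)
      ultimately show "(\<lambda>n. nrm A (adj A (opr (X n) A x) \<otimes>\<^bsub>A\<^esub> y \<ominus>\<^bsub>A\<^esub> adj A x \<otimes>\<^bsub>A\<^esub> S A y)) \<longlonglongrightarrow> 0"
        by (rule null_squeeze[rotated 2]) (use cl x y in \<open>auto intro!: nrm_nonneg\<close>)
    qed (use cl x y in auto)
  qed
  define L where "L = mkU T S c"
  have "X \<longlonglongrightarrow> L"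
    unfolding LIMSEQ_iff
  proof (intro allI impI)
    fix e :: real assume e: "e > 0"
    then obtain N where N: "\<And>m n. m \<ge> N \<Longrightarrow> n \<ge> N \<Longrightarrow> norm (X m - X n) < e / 2"
      using X unfolding Cauchy_iff by (meson half_gt_zero)
    \<comment> \<open>The Cauchy bound passes to the limit in \<open>m\<close> at each argument
      separately, which suffices by \<open>norm_univ_le_iff\<close>.\<close>
    have "norm (X n - L) \<le> e / 2" if n: "n \<ge> N" for n
      unfolding norm_univ_le_iff
    proof (intro conjI allI impI)
      have "(\<lambda>m. cmod (sca (X n) - sca (X m))) \<longlonglongrightarrow> cmod (sca (X n) - c)"
        by (intro tendsto_intros c)
      moreover have "cmod (sca (X n) - sca (X m)) \<le> e / 2" if "m \<ge> N" for m
        using sca_le[of "X n - X m"] N[OF n that] by (simp add: sca_simps)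
      ultimately have "cmod (sca (X n) - c) \<le> e / 2" by (intro LIMSEQ_le_const2) auto
      then show "cmod (sca (X n - L)) \<le> e / 2" by (simp add: sca_simps L_def mkU[OF TS])
      fix A x assume ok: "ok A (x::'a)"
      then interpret cstar_algebra A by (simp add: ok_def)
      have x: "x \<in> car A" using ok by (simp add: ok_def)
      note cl = T(1)[OF ok] opr_closed[OF ok]
      have "nrm A (opr (X n) A x \<ominus>\<^bsub>A\<^esub> T A x) \<le> e / 2 * nrm A x"
      proof (rule nrm_lim_le[of "\<lambda>m. opr (X n) A x \<ominus>\<^bsub>A\<^esub> opr (X m) A x"])
        have "nrm A (opr (X n) A x \<ominus>\<^bsub>A\<^esub> opr (X m) A x) \<le> e / 2 * nrm A x" if "m \<ge> N" for m
        proof -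
          have "nrm A (opr (X n) A x \<ominus>\<^bsub>A\<^esub> opr (X m) A x) \<le> norm (X n - X m) * nrm A x"
            using opr_le[OF ok, of "X n - X m"] by (simp add: univ_diff ok)
          also have "\<dots> \<le> e / 2 * nrm A x"
            using N[OF n that] nrm_nonneg[OF x] by (intro mult_right_mono) auto
          finally show ?thesis .
        qed
        then show "\<exists>N. \<forall>m\<ge>N. nrm A (opr (X n) A x \<ominus>\<^bsub>A\<^esub> opr (X m) A x) \<le> e / 2 * nrm A x" by blast
        have "(opr (X n) A x \<ominus>\<^bsub>A\<^esub> opr (X m) A x) \<ominus>\<^bsub>A\<^esub> (opr (X n) A x \<ominus>\<^bsub>A\<^esub> T A x) = T A x \<ominus>\<^bsub>A\<^esub> opr (X m) A x" for m
        proof -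
          have "(opr (X n) A x \<ominus>\<^bsub>A\<^esub> opr (X m) A x) = (opr (X n) A x \<ominus>\<^bsub>A\<^esub> T A x) \<oplus>\<^bsub>A\<^esub> (T A x \<ominus>\<^bsub>A\<^esub> opr (X m) A x)"
            using cl by (simp add: sub_triangle)
          then show ?thesis
            using cl sub_sub_add[of "opr (X n) A x \<ominus>\<^bsub>A\<^esub> T A x" "T A x \<ominus>\<^bsub>A\<^esub> opr (X m) A x" "opr (X n) A x \<ominus>\<^bsub>A\<^esub> T A x" "\<zero>\<^bsub>A\<^esub>"]
            by (simp add: nul_add)
        qed
        then have "nrm A ((opr (X n) A x \<ominus>\<^bsub>A\<^esub> opr (X m) A x) \<ominus>\<^bsub>A\<^esub> (opr (X n) A x \<ominus>\<^bsub>A\<^esub> T A x)) = nrm A (opr (X m) A x \<ominus>\<^bsub>A\<^esub> T A x)" for m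
          using cl nrm_sub_commute by simp
        then show "(\<lambda>m. nrm A ((opr (X n) A x \<ominus>\<^bsub>A\<^esub> opr (X m) A x) \<ominus>\<^bsub>A\<^esub> (opr (X n) A x \<ominus>\<^bsub>A\<^esub> T A x))) \<longlonglongrightarrow> 0"
          using T(2)[OF ok] by simp
      qed (use cl in auto)
      then show "nrm A (opr (X n - L) A x) \<le> e / 2 * nrm A x"
        by (simp add: univ_diff ok L_def mkU[OF TS])
    qed
    then show "\<exists>no. \<forall>n\<ge>no. norm (X n - L) < e"
      using e by (intro exI[of _ N]) (force intro: order_le_less_trans)
  qed
  then show "convergent X" unfolding convergent_def by blast
qed

instantiation univ :: (type) cstar1
begin

definition "star = (starU :: 'a univ \<Rightarrow> 'a univ)"
definition "cx = (cxU :: complex \<Rightarrow> 'a univ)"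
definition "aug = (sca :: 'a univ \<Rightarrow> complex)"

instance
proof
  fix u v :: "'a univ" and c d :: complex and r :: real
  show "star (u + v) = star u + star v" "star (u * v) = star v * star u" "star (star u) = u"
    "star (cx c :: 'a univ) = cx (cnj c)"
    by (simp_all add: star_univ_def cx_univ_def starU_simps)
  show "cx (c + d) = cx c + (cx d :: 'a univ)"
    unfolding cx_univ_def
    by (rule univ_eqI) (auto simp: cxU sca_simps univ_plus ok_def cstar_algebra.scl_add_left)
  show "cx (c * d) = cx c * (cx d :: 'a univ)"
    unfolding cx_univ_def
    by (rule univ_eqI) (auto simp: cxU sca_simps opr_cxU_times ok_def cstar_algebra.scl_scl)
  show "cx (complex_of_real r) = r *\<^sub>R (1::'a univ)" by (simp add: cx_univ_def scaleR_univ_def)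
  show "u * cx c = cx c * u"
    unfolding cx_univ_def
    by (rule univ_eqI) (auto simp: cxU sca_simps opr_cxU_times univ_times ok_def opr_scl opr_closed)
  show "aug (u + v) = aug u + aug v" "aug (u * v) = aug u * aug v" "aug (cx c :: 'a univ) = c"
    "aug (star u) = cnj (aug u)"
    by (simp_all add: aug_univ_def cx_univ_def star_univ_def sca_simps starU)
  show "cmod (aug u) \<le> norm u" by (simp add: aug_univ_def sca_le)
  \<comment> \<open>At each argument the squared norm of u x is the norm of the inner product of x
    with \<open>starU u * u\<close> applied to x; the supremum over all arguments gives the
    nontrivial half of the C*-identity.\<close>
  have "norm u \<le> sqrt (norm (starU u * u))"
    unfolding norm_univ_le_iff
  proof (intro conjI allI impI)
    have "(cmod (sca u))\<^sup>2 \<le> norm (starU u * u)"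
      using sca_le[of "starU u * u"] by (simp add: sca_simps starU norm_mult power2_eq_square)
    then show "cmod (sca u) \<le> sqrt (norm (starU u * u))" by (rule real_le_rsqrt)
    fix A x assume ok: "ok A (x::'a)"
    then interpret cstar_algebra A by (simp add: ok_def)
    let ?y = "opr u A x"
    have c: "x \<in> car A" "?y \<in> car A" "opa u A ?y \<in> car A" "ok A ?y"
      using ok opr_closed[OF ok] opa_closed[of A ?y] by (auto simp: ok_def)
    have "(nrm A ?y)\<^sup>2 = nrm A (adj A x \<otimes>\<^bsub>A\<^esub> opa u A ?y)"
      using cstar_identity[OF c(2)] opr_adj[OF ok c(4), of u] by simp
    also have "\<dots> \<le> nrm A x * nrm A (opr (starU u * u) A x)"
      using nrm_mul[of "adj A x" "opa u A ?y"] c ok by (simp add: univ_times starU)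
    also have "\<dots> \<le> nrm A x * (norm (starU u * u) * nrm A x)"
      using c ok by (intro mult_left_mono opr_le) (auto simp: nrm_nonneg)
    also have "\<dots> = (sqrt (norm (starU u * u)) * nrm A x)\<^sup>2"
      by (simp add: power_mult_distrib norm_univ_nonneg) (simp add: power2_eq_square)
    finally show "nrm A ?y \<le> sqrt (norm (starU u * u)) * nrm A x"
      by (rule power2_le_imp_le) (use c in \<open>auto intro!: mult_nonneg_nonneg simp: nrm_nonneg\<close>)
  qed
  then have "(norm u)\<^sup>2 \<le> norm (starU u * u)"
    by (metis norm_univ_nonneg real_sqrt_le_iff real_sqrt_abs abs_of_nonneg real_sqrt_pow2 power_mono)
  moreover have "norm (starU u * u) \<le> (norm u)\<^sup>2"
    using norm_mult_ineq[of "starU u" u] by (simp add: power2_eq_square)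
  ultimately show "norm (star u * u) = (norm u)\<^sup>2" by (simp add: star_univ_def)
qed

end

section \<open>The embedding of a C*-algebra into the universal one\<close>

text \<open>The left regular representation on the component \<open>A\<close>, and 0 on every other
  component. The scalar 0 places the image in the kernel of \<open>aug\<close>.\<close>

definition emb :: "'a star_alg \<Rightarrow> 'a \<Rightarrow> 'a univ" where
  "emb A a = mkU (\<lambda>C x. if C = A then a \<otimes>\<^bsub>A\<^esub> x else \<zero>\<^bsub>C\<^esub>) (\<lambda>C x. if C = A then adj A a \<otimes>\<^bsub>A\<^esub> x else \<zero>\<^bsub>C\<^esub>) 0"

context cstar_algebra
begin

lemma adjp_emb:
  assumes a: "a \<in> car A"
  shows "adjp (\<lambda>C x. if C = A then a \<otimes> x else \<zero>\<^bsub>C\<^esub>) (\<lambda>C x. if C = A then adj A a \<otimes> x else \<zero>\<^bsub>C\<^esub>)"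
proof (rule adjp_intro[where K="nrm A a"])
  fix C :: "'a star_alg" and x assume C: "cstar_algebra C" and x: "x \<in> car C"
  interpret C: cstar_algebra C by fact
  show "(if C = A then a \<otimes> x else \<zero>\<^bsub>C\<^esub>) \<in> car C" "(if C = A then adj A a \<otimes> x else \<zero>\<^bsub>C\<^esub>) \<in> car C"
    using a x by auto
  show "nrm C (if C = A then a \<otimes> x else \<zero>\<^bsub>C\<^esub>) \<le> nrm A a * nrm C x"
    using nrm_mul[of a x] a x nrm_nonneg[OF a] C.nrm_nonneg[OF x] by auto
  show "adj C (if C = A then a \<otimes> x else \<zero>\<^bsub>C\<^esub>) \<otimes>\<^bsub>C\<^esub> y = adj C x \<otimes>\<^bsub>C\<^esub> (if C = A then adj A a \<otimes> y else \<zero>\<^bsub>C\<^esub>)"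
    if "y \<in> car C" for y
    using a x that by (auto simp: adj_mul mul_assoc)
qed

lemma opr_emb: "a \<in> car A \<Longrightarrow> ok C x \<Longrightarrow> opr (emb A a) C x = (if C = A then a \<otimes> x else \<zero>\<^bsub>C\<^esub>)"
  and opa_emb: "a \<in> car A \<Longrightarrow> ok C x \<Longrightarrow> opa (emb A a) C x = (if C = A then adj A a \<otimes> x else \<zero>\<^bsub>C\<^esub>)"
  and aug_emb: "a \<in> car A \<Longrightarrow> aug (emb A a) = 0"
  by (simp_all add: emb_def aug_univ_def mkU[OF adjp_emb])

lemma sca_emb: "a \<in> car A \<Longrightarrow> sca (emb A a) = 0"
  using aug_emb by (simp add: aug_univ_def)

lemma emb_add: "a \<in> car A \<Longrightarrow> b \<in> car A \<Longrightarrow> emb A (a \<oplus> b) = emb A a + emb A b"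
  by (rule univ_eqI)
    (auto simp: opr_emb univ_plus sca_emb mul_add_left ok_def cstar_algebra.add_nul cstar_algebra.nul_closed)

lemma emb_scl: "a \<in> car A \<Longrightarrow> emb A (c \<odot> a) = cx c * emb A a"
  by (rule univ_eqI)
    (auto simp: cx_univ_def opr_emb opr_cxU_times sca_emb sca_simps scl_mul_left ok_def cstar_algebra.scl_nul)

lemma emb_mul: "a \<in> car A \<Longrightarrow> b \<in> car A \<Longrightarrow> emb A (a \<otimes> b) = emb A a * emb A b"
  by (rule univ_eqI)
    (auto simp: opr_emb univ_times sca_emb sca_simps mul_assoc ok_def cstar_algebra.nul_closed)

lemma emb_adj: "a \<in> car A \<Longrightarrow> emb A (adj A a) = star (emb A a)"
  by (rule univ_eqI) (auto simp: star_univ_def opr_emb starU opa_emb sca_emb)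

text \<open>Left multiplication attains the norm of \<open>a\<close> at \<open>adj A a\<close>, by
  the C*-identity for the adjoint.\<close>

lemma norm_emb: assumes a: "a \<in> car A" shows "norm (emb A a) = nrm A a"
proof (rule antisym)
  show "norm (emb A a) \<le> nrm A a"
    unfolding norm_univ_le_iff
  proof (intro conjI allI impI)
    show "cmod (sca (emb A a)) \<le> nrm A a" using a by (simp add: sca_emb nrm_nonneg)
    fix C x assume ok: "ok C (x::'a)"
    then interpret C: cstar_algebra C by (simp add: ok_def)
    show "nrm C (opr (emb A a) C x) \<le> nrm A a * nrm C x"
      using ok nrm_mul[of a x] a nrm_nonneg[OF a] C.nrm_nonneg[of x] by (auto simp: opr_emb ok_def)
  qed
  have ok: "ok A (adj A a)" using a by (simp add: ok_def cstar_algebra_axioms)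
  have "(nrm A a)\<^sup>2 = nrm A (opr (emb A a) A (adj A a))"
    using a ok cstar_identity[of "adj A a"] by (simp add: opr_emb adj_adj)
  also have "\<dots> \<le> norm (emb A a) * nrm A a"
    using opr_le[OF ok] a by simp
  finally show "nrm A a \<le> norm (emb A a)"
    using nrm_nonneg[OF a] by (cases "nrm A a = 0") (auto simp: power2_eq_square)
qed

end

lemma cx_left_commute: "x * (cx c * y) = cx c * (x * (y::'a::cstar1))"
  by (metis cx_commute mult.assoc)

section \<open>Cartan pairs inside a unital C*-algebra\<close>

definition nz :: "'a::cstar1 set \<Rightarrow> 'a set \<Rightarrow> 'a set" where
  "nz A B = {n \<in> A. \<forall>b\<in>B. n * b * star n \<in> B \<and> star n * b * n \<in> B}"

definition cexp :: "'a::cstar1 set \<Rightarrow> 'a set \<Rightarrow> ('a \<Rightarrow> 'a) \<Rightarrow> bool" where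
  "cexp A B P \<longleftrightarrow> (\<forall>x\<in>A. P x \<in> B) \<and> (\<forall>x\<in>A. \<forall>y\<in>A. P (x + y) = P x + P y) \<and>
    (\<forall>c. \<forall>x\<in>A. P (cx c * x) = cx c * P x) \<and> (\<forall>x\<in>A. norm (P x) \<le> norm x) \<and>
    (\<forall>x\<in>A. pos x \<longrightarrow> pos (P x)) \<and> (\<forall>b\<in>B. P b = b) \<and>
    (\<forall>b\<in>B. \<forall>x\<in>A. P (b * x) = b * P x \<and> P (x * b) = P x * b)"

definition faithful :: "'a::cstar1 set \<Rightarrow> ('a \<Rightarrow> 'a) \<Rightarrow> bool" where
  "faithful A P \<longleftrightarrow> (\<forall>x\<in>A. P (star x * x) = 0 \<longrightarrow> x = 0)"

text \<open>Maximality in commutant form, which can be applied to single elements. The passage to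
  and from maximality among abelian subalgebras is \<open>masa_if_maximal\<close> and
  \<open>masa_imp_maximal_abelian\<close>.\<close>

definition masa :: "'a::cstar1 set \<Rightarrow> 'a set \<Rightarrow> bool" where
  "masa A B \<longleftrightarrow> csub B \<and> B \<subseteq> A \<and> (\<forall>x\<in>B. \<forall>y\<in>B. x * y = y * x) \<and>
    (\<forall>x\<in>A. (\<forall>b\<in>B. x * b = b * x) \<longrightarrow> x \<in> B)"

text \<open>The approximate unit in finite form: it speaks of finitely many elements and a tolerance
  instead of a filter, and so passes to closures of increasing unions by approximation.\<close>

definition apx :: "'a::cstar1 set \<Rightarrow> 'a set \<Rightarrow> bool" where
  "apx A B \<longleftrightarrow> (\<forall>F \<epsilon>. finite F \<longrightarrow> F \<subseteq> A \<longrightarrow> \<epsilon> > 0 \<longrightarrow> (\<exists>e\<in>B. pos e \<and> norm e \<le> 1 \<and>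
    (\<forall>a\<in>F. norm (e * a - a) < \<epsilon> \<and> norm (a * e - a) < \<epsilon>)))"

text \<open>Generation is expressed by a closed linear span, which is a C*-algebra because
  normalizers are closed under products and the involution (\<open>generated_iff\<close>). This
  suits statements about continuous linear maps.\<close>

definition cartan :: "'a::cstar1 set \<Rightarrow> 'a set \<Rightarrow> ('a \<Rightarrow> 'a) \<Rightarrow> bool" where
  "cartan A B P \<longleftrightarrow> aug_csub A \<and> masa A B \<and> apx A B \<and> A \<subseteq> closure (span (nz A B)) \<and>
    cexp A B P \<and> faithful A P"

lemma csub_closure:
  assumes z: "0 \<in> S" and a: "\<And>x y. x \<in> S \<Longrightarrow> y \<in> S \<Longrightarrow> x + y \<in> S"
    and m: "\<And>x y. x \<in> S \<Longrightarrow> y \<in> S \<Longrightarrow> x * y \<in> S"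
    and c: "\<And>c x. x \<in> S \<Longrightarrow> cx c * x \<in> S" and s: "\<And>x. x \<in> S \<Longrightarrow> star x \<in> S"
  shows "csub (closure S)"
proof -
  have bin: "op x y \<in> closure S"
    if x: "x \<in> closure S" and y: "y \<in> closure S" and op: "\<And>x y. x \<in> S \<Longrightarrow> y \<in> S \<Longrightarrow> op x y \<in> S"
      and lim: "\<And>f g. f \<longlonglongrightarrow> x \<Longrightarrow> g \<longlonglongrightarrow> y \<Longrightarrow> (\<lambda>n. op (f n) (g n)) \<longlonglongrightarrow> op x y"
    for x y and op :: "'a \<Rightarrow> 'a \<Rightarrow> 'a"
  proof -
    obtain f g where "\<And>n. f n \<in> S" "f \<longlonglongrightarrow> x" "\<And>n. g n \<in> S" "g \<longlonglongrightarrow> y"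
      using x y unfolding closure_sequential by blast
    then show ?thesis unfolding closure_sequential using op lim
      by (intro exI[of _ "\<lambda>n. op (f n) (g n)"]) auto
  qed
  show ?thesis
    unfolding csub_def
  proof (intro conjI ballI allI)
    show "0 \<in> closure S" using z closure_subset by blast
    show "x + y \<in> closure S" "x * y \<in> closure S" if "x \<in> closure S" "y \<in> closure S" for x y
      by (rule bin[OF that]; auto intro!: a m tendsto_intros)+
    show "cx c * x \<in> closure S" if "x \<in> closure S" for c x
      by (rule bin[OF that that, of "\<lambda>x y. cx c * x"]) (auto intro!: c tendsto_intros)
    show "star x \<in> closure S" if "x \<in> closure S" for x
      by (rule bin[OF that that, of "\<lambda>x y. star x"]) (auto intro!: s tendsto_intros)
  qed simp
qed

lemma csub_closure_span:
  assumes m: "\<And>x y. x \<in> N \<Longrightarrow> y \<in> N \<Longrightarrow> x * y \<in> N"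
    and c: "\<And>c x. x \<in> N \<Longrightarrow> cx c * x \<in> N" and s: "\<And>x. x \<in> N \<Longrightarrow> star x \<in> N"
  shows "csub (closure (span N))"
proof (rule csub_closure)
  have lin: "f x \<in> span N" if "linear f" "\<And>x. x \<in> N \<Longrightarrow> f x \<in> span N" "x \<in> span N" for f :: "'a \<Rightarrow> 'a" and x
    using that(3)
  proof (induction rule: span_induct_alt)
    case base then show ?case using linear_0[OF that(1)] span_0 by metis
  next
    case (step c x y)
    then show ?case using that(1,2) by (simp add: linear_add linear_scale span_add span_scale)
  qed
  have 1: "x * y \<in> span N" if "x \<in> span N" "y \<in> N" for x y
    by (rule lin[of "\<lambda>x. x * y", OF _ _ that(1)])
      (use that m in \<open>auto intro!: linearI span_base simp: distrib_right\<close>)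
  show "x * y \<in> span N" if "x \<in> span N" "y \<in> span N" for x y
    by (rule lin[of "\<lambda>y. x * y", OF _ _ that(2)])
      (use that 1 in \<open>auto intro!: linearI simp: distrib_left\<close>)
  show "cx c * x \<in> span N" if "x \<in> span N" for c x
    by (rule lin[of "\<lambda>y. cx c * y", OF _ _ that])
      (use c in \<open>auto intro!: linearI span_base simp: distrib_left\<close>)
  show "star x \<in> span N" if "x \<in> span N" for x
    by (rule lin[of star, OF _ _ that])
      (use s in \<open>auto intro!: linearI span_base simp: star_add star_scaleR\<close>)
qed (auto intro: span_0 span_add)

lemma closure_span_subset:
  assumes "csub C" "N \<subseteq> C"
  shows "closure (span N) \<subseteq> C"
proof (rule closure_minimal[OF _ csubD(1)[OF assms(1)]])
  have "subspace C" unfolding subspace_def using csubD[OF assms(1)] by auto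
  then show "span N \<subseteq> C" using assms(2) by (rule span_minimal[rotated])
qed

lemma nz_closed:
  assumes A: "csub A" and B: "csub B" and xy: "x \<in> nz A B" "y \<in> nz A B"
  shows "x * y \<in> nz A B" "cx c * x \<in> nz A B" "star x \<in> nz A B"
proof -
  have x: "x \<in> A" "\<And>b. b \<in> B \<Longrightarrow> x * b * star x \<in> B" "\<And>b. b \<in> B \<Longrightarrow> star x * b * x \<in> B"
    and y: "y \<in> A" "\<And>b. b \<in> B \<Longrightarrow> y * b * star y \<in> B" "\<And>b. b \<in> B \<Longrightarrow> star y * b * y \<in> B"
    using xy by (auto simp: nz_def)
  show "star x \<in> nz A B" using x csubD(6)[OF A] by (simp add: nz_def)
  have "x * y * b * star (x * y) = x * (y * b * star y) * star x"
    "star (x * y) * b * (x * y) = star y * (star x * b * x) * y" for b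
    by (simp_all add: star_mult mult.assoc)
  then show "x * y \<in> nz A B" using x y csubD(4)[OF A x(1) y(1)] by (simp add: nz_def)
  have 1: "star (cx c * x) = cx (cnj c) * star x" by (simp only: star_mult star_cx cx_commute)
  have "cx c * x * b * star (cx c * x) = cx (c * cnj c) * (x * b * star x)" for b
  proof -
    have "cx c * x * b * star (cx c * x) = cx c * (x * b * (cx (cnj c) * star x))"
      by (simp only: 1 mult.assoc)
    then show ?thesis unfolding cx_left_commute[of "x * b"] by (simp only: cx_mult mult.assoc)
  qed
  moreover have "star (cx c * x) * b * (cx c * x) = cx (cnj c * c) * (star x * b * x)" for b
  proof -
    have "star (cx c * x) * b * (cx c * x) = cx (cnj c) * (star x * b * (cx c * x))"
      by (simp only: 1 mult.assoc)
    then show ?thesis unfolding cx_left_commute[of "star x * b"] by (simp only: cx_mult mult.assoc)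
  qed
  ultimately show "cx c * x \<in> nz A B" using x csubD(5)[OF A x(1)] csubD(5)[OF B] by (simp add: nz_def)
qed

text \<open>The relative bicommutant of \<open>B\<close> and a self-adjoint element commuting with \<open>B\<close> is abelian.\<close>

lemma masa_if_maximal:
  assumes A: "csub A" and B: "csub B" "B \<subseteq> A" "\<forall>x\<in>B. \<forall>y\<in>B. x * y = y * x"
    and max: "\<And>C. csub C \<Longrightarrow> C \<subseteq> A \<Longrightarrow> \<forall>x\<in>C. \<forall>y\<in>C. x * y = y * x \<Longrightarrow> B \<subseteq> C \<Longrightarrow> C = B"
  shows "masa A B"
proof -
  have sa_case: "h \<in> B" if h: "h \<in> A" "sa h" and hB: "\<forall>b\<in>B. h * b = b * h" for h
  proof -
    define M where "M = insert h B"
    \<comment> \<open>Elements of \<open>M\<close> commute with each other, so \<open>M\<close> lies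
      in its commutant \<open>M'\<close>. The commutant \<open>C\<close> of \<open>M'\<close> then
      commutes with \<open>M\<close>, hence lies in \<open>M'\<close>, and is therefore
      abelian.\<close>
    define M' where "M' = {y \<in> A. \<forall>m\<in>M. y * m = m * y}"
    define C where "C = {x \<in> A. \<forall>y\<in>M'. x * y = y * x}"
    have MM': "M \<subseteq> M'" using B h hB by (auto simp: M_def M'_def)
    have MC: "M \<subseteq> C" using B h by (auto simp: M_def C_def M'_def)
    have sM: "star y \<in> M'" if y: "y \<in> M'" for y
    proof -
      have "star y * m = m * star y" if "m \<in> M" for m
      proof -
        have "star m \<in> M" using that h csubD(6)[OF B(1)] by (auto simp: M_def sa_def)
        then have "star (y * star m) = star (star m * y)" using y by (simp add: M'_def)
        then show ?thesis by (simp add: star_mult)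
      qed
      then show ?thesis using y csubD(6)[OF A] by (simp add: M'_def)
    qed
    have "csub C"
      unfolding csub_def
    proof (intro conjI ballI allI)
      have "C = A \<inter> (\<Inter>y\<in>M'. {x. x * y = y * x})" by (auto simp: C_def)
      then show "closed C"
        using csubD(1)[OF A] by (auto intro!: closed_Int closed_INT closed_Collect_eq continuous_intros)
      show "0 \<in> C" using csubD(2)[OF A] by (simp add: C_def)
      show "x + y \<in> C" if "x \<in> C" "y \<in> C" for x y
        using that csubD(3)[OF A] by (simp add: C_def distrib_left distrib_right)
      show "x * y \<in> C" if "x \<in> C" "y \<in> C" for x y
      proof -
        have "x * y * m = m * (x * y)" if "m \<in> M'" for m
        proof -
          have "x * m = m * x" "y * m = m * y" using \<open>x \<in> C\<close> \<open>y \<in> C\<close> that by (auto simp: C_def)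
          then show ?thesis by (metis mult.assoc)
        qed
        then show ?thesis using that csubD(4)[OF A] by (simp add: C_def)
      qed
      show "cx c * x \<in> C" if "x \<in> C" for c x
      proof -
        have "cx c * x * m = m * (cx c * x)" if "m \<in> M'" for m
          using \<open>x \<in> C\<close> that by (simp add: C_def cx_left_commute mult.assoc)
        then show ?thesis using that csubD(5)[OF A] by (simp add: C_def)
      qed
      show "star x \<in> C" if x: "x \<in> C" for x
      proof -
        have "star x * y = y * star x" if y: "y \<in> M'" for y
        proof -
          have "star (x * star y) = star (star y * x)" using x sM[OF y] by (simp add: C_def)
          then show ?thesis by (simp add: star_mult)
        qed
        then show ?thesis using x csubD(6)[OF A] by (simp add: C_def)
      qed
    qed
    moreover have "C \<subseteq> M'" using MM' MC by (auto simp: C_def M'_def)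
    then have "\<forall>x\<in>C. \<forall>y\<in>C. x * y = y * x" by (auto simp: C_def)
    moreover have "C \<subseteq> A" "B \<subseteq> C" "h \<in> C" using MC by (auto simp: C_def M_def)
    ultimately show ?thesis using max[of C] by blast
  qed
  have "x \<in> B" if x: "x \<in> A" and xB: "\<forall>b\<in>B. x * b = b * x" for x
  proof -
    have sB: "star x * b = b * star x" if b: "b \<in> B" for b
    proof -
      have "star (x * star b) = star (star b * x)" using xB csubD(6)[OF B(1) b] by simp
      then show ?thesis by (simp add: star_mult)
    qed
    define h where "h = x + star x"
    define k where "k = cx \<i> * (x - star x)"
    have "h \<in> B"
      by (rule sa_case) (use x xB sB csubD[OF A] in \<open>auto simp: h_def sa_intros distrib_left distrib_right\<close>)
    moreover have "k \<in> B"
    proof (rule sa_case)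
      show "k \<in> A" using x csubD[OF A] by (simp add: k_def)
      have "star k = (star x - x) * cx (- \<i>)" by (simp add: k_def star_mult star_cx star_diff)
      also have "\<dots> = k" unfolding cx_commute k_def by (simp add: cx_minus right_diff_distrib)
      finally show "sa k" by (simp add: sa_def)
      have "k * b = b * k" if "b \<in> B" for b
      proof -
        have "(x - star x) * b = b * (x - star x)"
          using xB sB that by (simp add: left_diff_distrib right_diff_distrib)
        then show ?thesis by (simp add: k_def cx_left_commute mult.assoc)
      qed
      then show "\<forall>b\<in>B. k * b = b * k" by blast
    qed
    moreover have "h - cx \<i> * k = 2 *\<^sub>R x"
    proof -
      have "cx \<i> * k = cx (\<i> * \<i>) * (x - star x)" by (simp only: k_def mult.assoc cx_mult)
      then show ?thesis by (simp add: cx_minus h_def scaleR_2)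
    qed
    ultimately have "2 *\<^sub>R x \<in> B" using csubD[OF B(1)] by metis
    then have "(1/2) *\<^sub>R (2 *\<^sub>R x) \<in> B" by (rule csubD(7)[OF B(1)])
    then show ?thesis by simp
  qed
  then show ?thesis unfolding masa_def using B by blast
qed

section \<open>Transfer of Cartan pairs along isometric representations\<close>

text \<open>The dictionary between notions on records and notions inside the type. It is used for
  \<open>emb\<close> and also for the maps from the stages into the represented limit, so it is not
  tied to one particular map.\<close>

locale iso_rep = cstar_algebra A for A :: "'a star_alg" (structure) +
  fixes f :: "'a \<Rightarrow> 'u::cstar1"
  assumes f_add: "x \<in> car A \<Longrightarrow> y \<in> car A \<Longrightarrow> f (x \<oplus> y) = f x + f y"
    and f_scl: "x \<in> car A \<Longrightarrow> f (c \<odot> x) = cx c * f x"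
    and f_mul: "x \<in> car A \<Longrightarrow> y \<in> car A \<Longrightarrow> f (x \<otimes> y) = f x * f y"
    and f_adj: "x \<in> car A \<Longrightarrow> f (adj A x) = star (f x)"
    and norm_f: "x \<in> car A \<Longrightarrow> norm (f x) = nrm A x"
    and aug_f: "x \<in> car A \<Longrightarrow> aug (f x) = 0"
begin

lemma f_nul [simp]: "f \<zero> = 0" using f_scl[of \<zero> 0] by simp

lemma f_sub: "x \<in> car A \<Longrightarrow> y \<in> car A \<Longrightarrow> f (x \<ominus> y) = f x - f y"
  by (simp add: sub_def f_add f_scl cx_minus)

lemma f_eq_iff: "x \<in> car A \<Longrightarrow> y \<in> car A \<Longrightarrow> f x = f y \<longleftrightarrow> x = y"
  using norm_f[of "x \<ominus> y"] by (auto simp: f_sub nrm_eq_0 sub_eq_nul)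

lemma f_mem_iff: "S \<subseteq> car A \<Longrightarrow> x \<in> car A \<Longrightarrow> f x \<in> f ` S \<longleftrightarrow> x \<in> S"
  using f_eq_iff by blast

lemma norm_f_sub: "x \<in> car A \<Longrightarrow> y \<in> car A \<Longrightarrow> norm (f x - f y) = nrm A (x \<ominus> y)"
  by (metis f_sub norm_f sub_closed)

text \<open>That limits do not leave the image rests on completeness of \<open>A\<close>: preimages
  of a convergent sequence are Cauchy because \<open>f\<close> is isometric.\<close>

lemma image_closure:
  assumes S: "S \<subseteq> car A"
  shows "f ` closure_in A S = closure (f ` S)"
proof (intro equalityI subsetI)
  fix z assume "z \<in> f ` closure_in A S"
  then obtain x where x: "z = f x" "x \<in> car A" "\<And>e. e > 0 \<Longrightarrow> \<exists>y\<in>S. nrm A (x \<ominus> y) < e"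
    by (auto simp: closure_in_def)
  show "z \<in> closure (f ` S)"
    unfolding closure_approachable
  proof (intro allI impI)
    fix e :: real assume "e > 0"
    then obtain y where "y \<in> S" "nrm A (x \<ominus> y) < e" using x by blast
    then show "\<exists>y\<in>f ` S. dist y z < e"
      using S x(1,2) norm_f_sub[of x y] by (intro bexI[of _ "f y"]) (auto simp: dist_norm norm_minus_commute[of "f y"])
  qed
next
  fix z assume "z \<in> closure (f ` S)"
  then obtain g where g: "\<And>n. g n \<in> f ` S" "g \<longlonglongrightarrow> z" unfolding closure_sequential by blast
  then obtain s where s: "\<And>n. s n \<in> S" "\<And>n. g n = f (s n)" unfolding image_iff by metis
  have sc: "s n \<in> car A" for n using s S by blast
  have "\<exists>l\<in>car A. (\<lambda>n. nrm A (s n \<ominus> l)) \<longlonglongrightarrow> 0"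
  proof (rule complete[OF sc])
    fix e :: real assume "0 < e"
    then show "\<exists>N. \<forall>m\<ge>N. \<forall>n\<ge>N. nrm A (s m \<ominus> s n) < e"
      using LIMSEQ_imp_Cauchy[OF g(2)] sc unfolding Cauchy_iff s(2) by (simp add: norm_f_sub)
  qed
  then obtain l where l: "l \<in> car A" "(\<lambda>n. nrm A (s n \<ominus> l)) \<longlonglongrightarrow> 0" by blast
  then have "(\<lambda>n. norm (f (s n) - f l)) \<longlonglongrightarrow> 0" using sc by (simp add: norm_f_sub)
  then have "g \<longlonglongrightarrow> f l" unfolding s(2)[symmetric] by (simp add: tendsto_norm_zero_iff LIM_zero_iff)
  then have "z = f l" using g(2) LIMSEQ_unique by blast
  moreover have "l \<in> closure_in A S"
    unfolding closure_in_def
  proof (clarsimp simp: l(1))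
    fix e :: real assume "e > 0"
    then obtain n where "nrm A (s n \<ominus> l) < e" using order_tendstoD(2)[OF l(2)] eventually_happens by fastforce
    then show "\<exists>y\<in>S. nrm A (l \<ominus> y) < e" using s(1)[of n] sc[of n] l(1) nrm_sub_commute by metis
  qed
  ultimately show "z \<in> f ` closure_in A S" by blast
qed

lemma sub_cstar_iff:
  assumes S: "S \<subseteq> car A"
  shows "sub_cstar A S \<longleftrightarrow> csub (f ` S)"
proof -
  have cl: "closure_in A S \<subseteq> S \<longleftrightarrow> closed (f ` S)"
  proof -
    have "closure_in A S \<subseteq> car A" by (auto simp: closure_in_def)
    then have "closure_in A S \<subseteq> S \<longleftrightarrow> f ` closure_in A S \<subseteq> f ` S"
      using f_mem_iff[OF S] by (blast dest: subsetD)
    then show ?thesis unfolding image_closure[OF S]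
      using closure_subset closed_closure by (metis closure_closed order_antisym order_refl)
  qed
  have m: "f x \<in> f ` S \<longleftrightarrow> x \<in> S" if "x \<in> car A" for x by (rule f_mem_iff[OF S that])
  have c: "x \<in> S \<Longrightarrow> x \<in> car A" for x using S by blast
  show ?thesis
    unfolding sub_cstar_def csub_def cl ball_simps
    using S m[of \<zero>] m[of "_ \<oplus> _"] m[of "_ \<otimes> _"] m[of "_ \<odot> _"] m[of "adj A _"]
    by (auto simp: c f_add[symmetric] f_mul[symmetric] f_scl[symmetric] f_adj[symmetric])
qed

lemma csub_car: "csub (f ` car A)"
proof -
  have "sub_cstar A (car A)" unfolding sub_cstar_def closure_in_def by auto
  then show ?thesis by (simp add: sub_cstar_iff)
qed

sublocale image: aug_csub "f ` car A"
  by standard (use csub_car aug_f in auto)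

text \<open>The image of \<open>A\<close> is closed and hence contains the root of each of its
  positive elements. So positivity, defined by a norm condition in the large type, is already
  visible in \<open>A\<close>.\<close>

lemma positive_iff: assumes x: "x \<in> car A" shows "Defs.positive A x \<longleftrightarrow> pos (f x)"
proof
  assume "Defs.positive A x"
  then show "pos (f x)" by (auto simp: Defs.positive_def f_mul f_adj pos_star_mult)
next
  assume "pos (f x)"
  then obtain s where s: "pos s" "s * s = f x" "s \<in> f ` car A"
    using image.pos_sqrt_mem x by blast
  then obtain y where y: "y \<in> car A" "s = f y" by blast
  have "f x = f (adj A y \<otimes> y)" using s pos_sa[OF s(1)] y by (simp add: f_mul f_adj sa_def)
  then show "Defs.positive A x" using x y f_eq_iff unfolding Defs.positive_def by (metis adj_closed mul_closed)
qed

lemma image_normalizers: assumes B: "B \<subseteq> car A" shows "f ` normalizers A B = nz (f ` car A) (f ` B)"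
proof -
  have "f n \<in> nz (f ` car A) (f ` B) \<longleftrightarrow> n \<in> normalizers A B" if n: "n \<in> car A" for n
  proof -
    have "f n * f b * star (f n) \<in> f ` B \<longleftrightarrow> n \<otimes> b \<otimes> adj A n \<in> B"
      "star (f n) * f b * f n \<in> f ` B \<longleftrightarrow> adj A n \<otimes> b \<otimes> n \<in> B" if "b \<in> B" for b
      using f_mem_iff[OF B, of "n \<otimes> b \<otimes> adj A n"] f_mem_iff[OF B, of "adj A n \<otimes> b \<otimes> n"] n B that
      by (auto simp: f_mul f_adj subset_iff)
    then show ?thesis using n by (auto simp: nz_def normalizers_def)
  qed
  moreover have "normalizers A B \<subseteq> car A" "nz (f ` car A) (f ` B) \<subseteq> f ` car A"
    by (auto simp: normalizers_def nz_def)
  ultimately show ?thesis by blast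
qed

lemma commute_iff:
  assumes B: "B \<subseteq> car A"
  shows "(\<forall>x\<in>B. \<forall>y\<in>B. x \<otimes> y = y \<otimes> x) \<longleftrightarrow> (\<forall>x\<in>f ` B. \<forall>y\<in>f ` B. x * y = y * x)"
  using B by (auto simp: f_mul[symmetric] f_eq_iff subset_iff)

lemma preimage: assumes "C \<subseteq> f ` car A" shows "f ` {x \<in> car A. f x \<in> C} = C"
  using assms by auto

lemma maximal_abelian_imp_masa:
  assumes "maximal_abelian A B"
  shows "masa (f ` car A) (f ` B)"
proof -
  have B: "sub_cstar A B" "\<forall>x\<in>B. \<forall>y\<in>B. x \<otimes> y = y \<otimes> x" "B \<subseteq> car A"
    and max: "\<And>C. abelian_sub_cstar A C \<Longrightarrow> B \<subseteq> C \<Longrightarrow> C = B"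
    using assms by (auto simp: maximal_abelian_def abelian_sub_cstar_def sub_cstar_def)
  show ?thesis
  proof (rule masa_if_maximal[OF csub_car])
    show "csub (f ` B)" "f ` B \<subseteq> f ` car A" using B sub_cstar_iff by auto
    show "\<forall>x\<in>f ` B. \<forall>y\<in>f ` B. x * y = y * x" using B commute_iff by blast
    fix C assume C: "csub C" "C \<subseteq> f ` car A" "\<forall>x\<in>C. \<forall>y\<in>C. x * y = y * x" "f ` B \<subseteq> C"
    let ?C = "{x \<in> car A. f x \<in> C}"
    have sub: "?C \<subseteq> car A" by blast
    have "abelian_sub_cstar A ?C"
      unfolding abelian_sub_cstar_def sub_cstar_iff[OF sub] commute_iff[OF sub] preimage[OF C(2)]
      using C by blast
    then have "?C = B" using max C(4) B(3) by blast
    then show "C = f ` B" using preimage[OF C(2)] by simp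
  qed
qed

lemma masa_imp_maximal_abelian:
  assumes B: "B \<subseteq> car A" and m: "masa (f ` car A) (f ` B)"
  shows "maximal_abelian A B"
  unfolding maximal_abelian_def abelian_sub_cstar_def
proof (intro conjI allI impI)
  show "sub_cstar A B" using m B by (simp add: masa_def sub_cstar_iff)
  show "\<forall>x\<in>B. \<forall>y\<in>B. x \<otimes> y = y \<otimes> x" using m commute_iff[OF B] unfolding masa_def by blast
  fix C assume C: "(sub_cstar A C \<and> (\<forall>x\<in>C. \<forall>y\<in>C. x \<otimes> y = y \<otimes> x)) \<and> B \<subseteq> C"
  then have sub: "C \<subseteq> car A" by (simp add: sub_cstar_def)
  then have "\<forall>x\<in>f ` C. \<forall>y\<in>f ` C. x * y = y * x" using C commute_iff by blast
  moreover have "f x \<in> f ` car A" "f ` B \<subseteq> f ` C" if "x \<in> C" for x using C sub that by auto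
  ultimately have "f x \<in> f ` B" if "x \<in> C" for x
    using m that unfolding masa_def by (meson image_eqI subsetD)
  then have "x \<in> B" if "x \<in> C" for x using that sub f_mem_iff[OF B, of x] by blast
  then show "C = B" using C by blast
qed

lemma generated_iff:
  assumes B: "B \<subseteq> car A" "csub (f ` B)"
  shows "generated_cstar A (normalizers A B) = car A \<longleftrightarrow>
    f ` car A \<subseteq> closure (span (nz (f ` car A) (f ` B)))" (is "_ \<longleftrightarrow> _ \<subseteq> closure (span ?N)")
proof
  have Nsub: "?N \<subseteq> f ` car A" by (auto simp: nz_def)
  assume g: "generated_cstar A (normalizers A B) = car A"
  have c: "csub (closure (span ?N))"
    by (rule csub_closure_span) (use nz_closed[OF csub_car B(2)] in auto)
  have sub: "closure (span ?N) \<subseteq> f ` car A" by (rule closure_span_subset[OF csub_car Nsub])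
  let ?C = "{x \<in> car A. f x \<in> closure (span ?N)}"
  have "sub_cstar A ?C"
    by (subst sub_cstar_iff) (use c preimage[OF sub] in auto)
  moreover have "normalizers A B \<subseteq> ?C"
    using image_normalizers[OF B(1)] span_superset closure_subset by (fastforce simp: normalizers_def)
  ultimately have "car A \<subseteq> ?C" using g unfolding generated_cstar_def by blast
  then show "f ` car A \<subseteq> closure (span ?N)" by blast
next
  assume g: "f ` car A \<subseteq> closure (span ?N)"
  have "car A \<subseteq> C" if C: "sub_cstar A C" "normalizers A B \<subseteq> C" for C
  proof -
    have sub: "C \<subseteq> car A" using C by (simp add: sub_cstar_def)
    have "closure (span ?N) \<subseteq> f ` C"
      by (rule closure_span_subset) (use C sub_cstar_iff[OF sub] in \<open>auto simp: image_normalizers[OF B(1), symmetric]\<close>)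
    then show ?thesis using g f_mem_iff[OF sub] by blast
  qed
  moreover have "sub_cstar A (car A)" "normalizers A B \<subseteq> car A"
    using csub_car by (auto simp: sub_cstar_iff normalizers_def)
  ultimately show "generated_cstar A (normalizers A B) = car A"
    unfolding generated_cstar_def by blast
qed

lemma approx_unit_imp_apx:
  assumes B: "B \<subseteq> car A" and u: "contains_approx_unit A B"
  shows "apx (f ` car A) (f ` B)"
  unfolding apx_def
proof (intro allI impI)
  fix F and \<epsilon> :: real assume F: "finite F" "F \<subseteq> f ` car A" and e: "\<epsilon> > 0"
  obtain G where G: "finite G" "G \<subseteq> car A" "F = f ` G" using finite_subset_image[OF F] by metis
  obtain U where U: "U \<noteq> bot" "\<forall>\<^sub>F e in U. e \<in> B \<and> Defs.positive A e \<and> nrm A e \<le> 1"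
    "\<And>a. a \<in> car A \<Longrightarrow> ((\<lambda>e. nrm A (e \<otimes> a \<ominus> a)) \<longlongrightarrow> 0) U"
    "\<And>a. a \<in> car A \<Longrightarrow> ((\<lambda>e. nrm A (a \<otimes> e \<ominus> a)) \<longlongrightarrow> 0) U"
    using u unfolding contains_approx_unit_def by blast
  have "\<forall>\<^sub>F e in U. \<forall>a\<in>G. nrm A (e \<otimes> a \<ominus> a) < \<epsilon> \<and> nrm A (a \<otimes> e \<ominus> a) < \<epsilon>"
  proof (rule eventually_ball_finite[OF G(1)], rule ballI)
    fix a assume "a \<in> G"
    then have "a \<in> car A" using G by blast
    then show "\<forall>\<^sub>F e in U. nrm A (e \<otimes> a \<ominus> a) < \<epsilon> \<and> nrm A (a \<otimes> e \<ominus> a) < \<epsilon>"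
      using U(3,4) e by (intro eventually_conj order_tendstoD(2)) auto
  qed
  from eventually_happens[OF eventually_conj[OF U(2) this]] U(1)
  obtain e where e: "e \<in> B" "Defs.positive A e" "nrm A e \<le> 1"
    "\<forall>a\<in>G. nrm A (e \<otimes> a \<ominus> a) < \<epsilon> \<and> nrm A (a \<otimes> e \<ominus> a) < \<epsilon>" by auto
  then have "e \<in> car A" using B by blast
  moreover have "norm (f e * f a - f a) = nrm A (e \<otimes> a \<ominus> a)"
    "norm (f a * f e - f a) = nrm A (a \<otimes> e \<ominus> a)" if "a \<in> G" for a
    using that G \<open>e \<in> car A\<close> by (auto simp: subset_iff f_mul[symmetric] norm_f_sub)
  ultimately show "\<exists>e\<in>f ` B. pos e \<and> norm e \<le> 1 \<and> (\<forall>a\<in>F. norm (e * a - a) < \<epsilon> \<and> norm (a * e - a) < \<epsilon>)"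
    using e G by (intro bexI[of _ "f e"]) (auto simp: positive_iff norm_f)
qed

text \<open>The filter is generated by the sets of those elements of \<open>B\<close> that serve a
  given finite set within a given tolerance; these sets are directed by unions and minima, and
  nonempty by \<open>apx\<close>.\<close>

lemma apx_imp_approx_unit:
  assumes B: "B \<subseteq> car A" and u: "apx (f ` car A) (f ` B)"
  shows "contains_approx_unit A B"
proof -
  define E where "E = (\<lambda>(F, \<epsilon>::real). {e \<in> B. Defs.positive A e \<and> nrm A e \<le> 1 \<and>
    (\<forall>a\<in>F. nrm A (e \<otimes> a \<ominus> a) < \<epsilon> \<and> nrm A (a \<otimes> e \<ominus> a) < \<epsilon>)})"
  define K where "K = {(F, \<epsilon>::real). finite F \<and> F \<subseteq> car A \<and> \<epsilon> > 0}"
  define U where "U = (INF k\<in>K. principal (E k))"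
  have ne: "E k \<noteq> {}" if kK: "k \<in> K" for k
  proof -
    obtain F \<epsilon> where k: "k = (F, \<epsilon>)" "finite F" "F \<subseteq> car A" "\<epsilon> > 0" using kK by (cases k) (auto simp: K_def)
    have "f ` F \<subseteq> f ` car A" using k by blast
    then obtain e' where "e' \<in> f ` B" "pos e'" "norm e' \<le> 1"
      "\<forall>a\<in>f ` F. norm (e' * a - a) < \<epsilon> \<and> norm (a * e' - a) < \<epsilon>"
      using u k(2,4) unfolding apx_def by (meson finite_imageI)
    then obtain e where e: "e \<in> B" "pos (f e)" "norm (f e) \<le> 1"
      "\<And>a. a \<in> F \<Longrightarrow> norm (f e * f a - f a) < \<epsilon> \<and> norm (f a * f e - f a) < \<epsilon>" by auto
    then have ec: "e \<in> car A" using B by blast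
    have "norm (f e * f a - f a) = nrm A (e \<otimes> a \<ominus> a)"
      "norm (f a * f e - f a) = nrm A (a \<otimes> e \<ominus> a)" if "a \<in> F" for a
      using that k ec by (auto simp: subset_iff f_mul[symmetric] norm_f_sub)
    then have "e \<in> E k" using e ec k by (simp add: E_def positive_iff norm_f)
    then show ?thesis by blast
  qed
  have ev: "eventually Q U \<longleftrightarrow> (\<exists>k\<in>K. \<forall>e\<in>E k. Q e)" for Q
    unfolding U_def
  proof (subst eventually_INF_base)
    show "K \<noteq> {}" by (auto simp: K_def intro!: exI[of _ "{}"] exI[of _ "1::real"])
    fix k l assume "k \<in> K" "l \<in> K"
    then obtain F \<epsilon> G \<delta> where kl: "k = (F, \<epsilon>)" "l = (G, \<delta>)" "finite F" "finite G"
      "F \<subseteq> car A" "G \<subseteq> car A" "\<epsilon> > 0" "\<delta> > 0" by (auto simp: K_def)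
    have "(F \<union> G, min \<epsilon> \<delta>) \<in> K" using kl by (auto simp: K_def)
    moreover have "E (F \<union> G, min \<epsilon> \<delta>) \<subseteq> E k \<inter> E l" using kl by (auto simp: E_def)
    ultimately show "\<exists>x\<in>K. principal (E x) \<le> inf (principal (E k)) (principal (E l))"
      by (intro bexI[of _ "(F \<union> G, min \<epsilon> \<delta>)"]) auto
  qed (simp add: eventually_principal)
  have "U \<noteq> bot" unfolding trivial_limit_def ev using ne by blast
  moreover have "\<forall>\<^sub>F e in U. e \<in> B \<and> Defs.positive A e \<and> nrm A e \<le> 1"
    unfolding ev by (rule bexI[of _ "({}, 1)"]) (auto simp: E_def K_def)
  moreover have "((\<lambda>e. nrm A (e \<otimes> a \<ominus> a)) \<longlongrightarrow> 0) U \<and> ((\<lambda>e. nrm A (a \<otimes> e \<ominus> a)) \<longlongrightarrow> 0) U"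
    if a: "a \<in> car A" for a
  proof -
    have *: "\<forall>\<^sub>F e in U. e \<in> B \<and> nrm A (e \<otimes> a \<ominus> a) < \<epsilon> \<and> nrm A (a \<otimes> e \<ominus> a) < \<epsilon>" if "\<epsilon> > 0" for \<epsilon>
      unfolding ev by (rule bexI[of _ "({a}, \<epsilon>)"]) (use a that in \<open>auto simp: E_def K_def\<close>)
    have "0 \<le> nrm A (e \<otimes> a \<ominus> a)" "0 \<le> nrm A (a \<otimes> e \<ominus> a)" if "e \<in> B" for e
      using that a B by (auto intro!: nrm_nonneg)
    then show ?thesis
      unfolding tendsto_iff dist_real_def by (auto elim!: eventually_mono[OF *])
  qed
  ultimately show ?thesis unfolding contains_approx_unit_def by blast
qed

lemma cexp_iff:
  assumes B: "B \<subseteq> car A" and P: "\<And>x. x \<in> car A \<Longrightarrow> Q x \<in> car A" "\<And>x. x \<in> car A \<Longrightarrow> P (f x) = f (Q x)"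
  shows "cond_exp A B Q \<longleftrightarrow> cexp (f ` car A) (f ` B) P"
    "faithful_cond_exp A B Q \<longleftrightarrow> cexp (f ` car A) (f ` B) P \<and> faithful (f ` car A) P"
proof -
  have Bc: "\<And>b. b \<in> B \<Longrightarrow> b \<in> car A" using B by blast
  have "(\<forall>x\<in>car A. Q x \<in> B) \<longleftrightarrow> (\<forall>x\<in>f ` car A. P x \<in> f ` B)"
    using P f_mem_iff[OF B] by auto
  moreover have "(\<forall>x\<in>car A. \<forall>y\<in>car A. Q (x \<oplus> y) = Q x \<oplus> Q y) \<longleftrightarrow>
    (\<forall>x\<in>f ` car A. \<forall>y\<in>f ` car A. P (x + y) = P x + P y)"
    using P by (auto simp: f_add[symmetric] f_eq_iff)
  moreover have "(\<forall>c. \<forall>x\<in>car A. Q (c \<odot> x) = c \<odot> Q x) \<longleftrightarrow>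
    (\<forall>c. \<forall>x\<in>f ` car A. P (cx c * x) = cx c * P x)"
    using P by (auto simp: f_scl[symmetric] f_eq_iff)
  moreover have "(\<forall>x\<in>car A. nrm A (Q x) \<le> nrm A x) \<longleftrightarrow> (\<forall>x\<in>f ` car A. norm (P x) \<le> norm x)"
    using P by (auto simp: norm_f)
  moreover have "(\<forall>x\<in>car A. Defs.positive A x \<longrightarrow> Defs.positive A (Q x)) \<longleftrightarrow> (\<forall>x\<in>f ` car A. pos x \<longrightarrow> pos (P x))"
    using P by (auto simp: positive_iff)
  moreover have "(\<forall>b\<in>B. Q b = b) \<longleftrightarrow> (\<forall>b\<in>f ` B. P b = b)"
    using P by (auto simp: Bc f_eq_iff)
  moreover have "(\<forall>b\<in>B. \<forall>x\<in>car A. Q (b \<otimes> x) = b \<otimes> Q x \<and> Q (x \<otimes> b) = Q x \<otimes> b) \<longleftrightarrow>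
    (\<forall>b\<in>f ` B. \<forall>x\<in>f ` car A. P (b * x) = b * P x \<and> P (x * b) = P x * b)"
    using P by (auto simp: Bc f_mul[symmetric] f_eq_iff)
  ultimately show 1: "cond_exp A B Q \<longleftrightarrow> cexp (f ` car A) (f ` B) P"
    unfolding cond_exp_def cexp_def by (simp only:)
  have "f x = 0 \<longleftrightarrow> x = \<zero>" if "x \<in> car A" for x using f_eq_iff[OF that nul_closed] by simp
  then have "(\<forall>x\<in>car A. Q (adj A x \<otimes> x) = \<zero> \<longrightarrow> x = \<zero>) \<longleftrightarrow> faithful (f ` car A) P"
    using P by (auto simp: faithful_def f_adj[symmetric] f_mul[symmetric])
  then show "faithful_cond_exp A B Q \<longleftrightarrow> cexp (f ` car A) (f ` B) P \<and> faithful (f ` car A) P"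
    unfolding faithful_cond_exp_def 1 by simp
qed

lemma cartan_image:
  assumes "cartan_pair A B" "faithful_cond_exp A B Q" "\<And>x. x \<in> car A \<Longrightarrow> P (f x) = f (Q x)"
  shows "cartan (f ` car A) (f ` B) P"
proof -
  have c: "maximal_abelian A B" "contains_approx_unit A B" "generated_cstar A (normalizers A B) = car A"
    using assms by (auto simp: cartan_pair_def)
  have B: "B \<subseteq> car A" using c by (auto simp: maximal_abelian_def abelian_sub_cstar_def sub_cstar_def)
  have m: "masa (f ` car A) (f ` B)" by (rule maximal_abelian_imp_masa[OF c(1)])
  have "\<And>x. x \<in> car A \<Longrightarrow> Q x \<in> car A"
    using assms(2) B by (auto simp: faithful_cond_exp_def cond_exp_def)
  then have "cexp (f ` car A) (f ` B) P" "faithful (f ` car A) P"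
    using cexp_iff(2)[OF B, of Q P] assms(2,3) by auto
  moreover have "csub (f ` B)" using m by (simp add: masa_def)
  ultimately show ?thesis
    unfolding cartan_def
    using m approx_unit_imp_apx[OF B c(2)] generated_iff[OF B] c(3) image.aug_csub_axioms by blast
qed

lemma cartan_pair_if_cartan:
  assumes B: "B \<subseteq> car A" and c: "cartan (f ` car A) (f ` B) P"
  shows "cartan_pair A B"
proof -
  define Q where "Q x = inv_into (car A) f (P (f x))" for x
  have "P (f x) \<in> f ` car A" if "x \<in> car A" for x
    using c B that by (fastforce simp: cartan_def cexp_def)
  then have "Q x \<in> car A" "P (f x) = f (Q x)" if "x \<in> car A" for x
    using that by (auto simp: Q_def inv_into_into f_inv_into_f)
  then have "faithful_cond_exp A B Q"
    using cexp_iff(2)[OF B, of Q P] c by (simp add: cartan_def)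
  then show ?thesis
    unfolding cartan_pair_def
    using cstar_algebra_axioms masa_imp_maximal_abelian[OF B] apx_imp_approx_unit[OF B] generated_iff[OF B] c
    by (auto simp: cartan_def masa_def)
qed

end

lemma iso_rep_emb: "cstar_algebra A \<Longrightarrow> iso_rep A (emb A)"
  by (intro iso_rep.intro iso_rep_axioms.intro)
    (auto simp: cstar_algebra.emb_add cstar_algebra.emb_scl cstar_algebra.emb_mul cstar_algebra.emb_adj
      cstar_algebra.norm_emb cstar_algebra.aug_emb)

section \<open>Sequence quotients and inductive limits\<close>

text \<open>Between the embedded copies of the two algebras \<open>h\<close> becomes a
  \<open>star_hom_on\<close>, to which \<open>isometric\<close> applies.\<close>

lemma star_hom_isometric:
  assumes A: "cstar_algebra A" and C: "cstar_algebra C" and h: "star_hom A C h" and inj: "inj_on h (car A)"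
    and x: "x \<in> car A"
  shows "nrm C (h x) = nrm A x"
proof -
  interpret a: iso_rep A "emb A" by (rule iso_rep_emb[OF A])
  interpret c: iso_rep C "emb C" by (rule iso_rep_emb[OF C])
  define \<pi> where "\<pi> z = emb C (h (inv_into (car A) (emb A) z))" for z
  have inv: "inv_into (car A) (emb A) (emb A y) = y" if "y \<in> car A" for y
    by (rule inv_into_f_f[OF _ that]) (auto simp: inj_on_def a.f_eq_iff)
  have p: "\<pi> (emb A y) = emb C (h y)" if "y \<in> car A" for y by (simp add: \<pi>_def inv that)
  have hc: "\<And>y. y \<in> car A \<Longrightarrow> h y \<in> car C"
    and hom: "\<And>y z. y \<in> car A \<Longrightarrow> z \<in> car A \<Longrightarrow> h (y \<oplus>\<^bsub>A\<^esub> z) = h y \<oplus>\<^bsub>C\<^esub> h z"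
      "\<And>y z. y \<in> car A \<Longrightarrow> z \<in> car A \<Longrightarrow> h (y \<otimes>\<^bsub>A\<^esub> z) = h y \<otimes>\<^bsub>C\<^esub> h z"
      "\<And>y c. y \<in> car A \<Longrightarrow> h (c \<odot>\<^bsub>A\<^esub> y) = c \<odot>\<^bsub>C\<^esub> h y"
      "\<And>y. y \<in> car A \<Longrightarrow> h (adj A y) = adj C (h y)"
    using h by (auto simp: star_hom_def)
  interpret star_hom_on "emb A ` car A" \<pi>
  proof
    fix z w c assume z: "z \<in> emb A ` car A"
    then show "\<pi> (cx c * z) = cx c * \<pi> z" "\<pi> (star z) = star (\<pi> z)"
      by (auto simp: p hc hom c.f_scl c.f_adj simp flip: a.f_scl a.f_adj)
    assume w: "w \<in> emb A ` car A"
    show "\<pi> (z + w) = \<pi> z + \<pi> w" "\<pi> (z * w) = \<pi> z * \<pi> w"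
      using z w by (auto simp: p hc hom c.f_add c.f_mul simp flip: a.f_add a.f_mul)
  qed
  have "inj_on \<pi> (emb A ` car A)"
    using inj by (auto simp: inj_on_def p c.f_eq_iff hc)
  from isometric[OF this, of "emb A x"] x show ?thesis by (simp add: p hc a.norm_f c.norm_f)
qed

lemma cstar_algebra_sub:
  assumes Q: "cstar_algebra Q" and S: "sub_cstar Q S"
  shows "cstar_algebra (Q\<lparr>car := S\<rparr>)"
proof -
  interpret cstar_algebra Q by fact
  have sc: "\<And>x. x \<in> S \<Longrightarrow> x \<in> car Q" using S by (auto simp: sub_cstar_def)
  show ?thesis
  proof (unfold_locales, simp_all add: sc add_assoc nul_add add_inverse scl_add_right scl_add_left
      scl_scl scl_one mul_assoc mul_add_left mul_add_right scl_mul_left scl_mul_right adj_adj adj_add adj_scl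
      adj_mul nrm_nonneg nrm_eq_0 nrm_scl nrm_triangle nrm_mul cstar_identity)
    show "\<zero>\<^bsub>Q\<^esub> \<in> S" "\<And>x y. x \<in> S \<Longrightarrow> y \<in> S \<Longrightarrow> x \<oplus>\<^bsub>Q\<^esub> y \<in> S" "\<And>x c. x \<in> S \<Longrightarrow> c \<odot>\<^bsub>Q\<^esub> x \<in> S"
      "\<And>x y. x \<in> S \<Longrightarrow> y \<in> S \<Longrightarrow> x \<otimes>\<^bsub>Q\<^esub> y \<in> S" "\<And>x. x \<in> S \<Longrightarrow> adj Q x \<in> S"
      using S by (auto simp: sub_cstar_def)
    show "\<And>x y. x \<in> S \<Longrightarrow> y \<in> S \<Longrightarrow> x \<oplus>\<^bsub>Q\<^esub> y = y \<oplus>\<^bsub>Q\<^esub> x" by (simp add: sc add_commute)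
    fix s :: "nat \<Rightarrow> 'a"
    have eq: "x \<ominus>\<^bsub>Q\<lparr>car := S\<rparr>\<^esub> y = x \<ominus>\<^bsub>Q\<^esub> y" for x y by (simp add: sub_def)
    assume s: "\<And>n. s n \<in> S"
      and cauchy: "\<And>e. 0 < e \<Longrightarrow> \<exists>N. \<forall>m\<ge>N. \<forall>n\<ge>N. nrm Q (s m \<ominus>\<^bsub>Q\<lparr>car := S\<rparr>\<^esub> s n) < e"
    obtain l where l: "l \<in> car Q" "(\<lambda>n. nrm Q (s n \<ominus>\<^bsub>Q\<^esub> l)) \<longlonglongrightarrow> 0"
      using complete[of s] sc[OF s] cauchy unfolding eq by blast
    have "l \<in> closure_in Q S"
      unfolding closure_in_def
    proof (clarsimp simp: l(1))
      fix e :: real assume "e > 0"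
      then obtain n where "nrm Q (s n \<ominus>\<^bsub>Q\<^esub> l) < e"
        using order_tendstoD(2)[OF l(2)] eventually_happens by fastforce
      then show "\<exists>y\<in>S. nrm Q (l \<ominus>\<^bsub>Q\<^esub> y) < e" using s[of n] sc[OF s, of n] l(1) nrm_sub_commute by metis
    qed
    then show "\<exists>l\<in>S. (\<lambda>n. nrm Q (s n \<ominus>\<^bsub>Q\<lparr>car := S\<rparr>\<^esub> l)) \<longlonglongrightarrow> 0"
      using l S unfolding eq by (auto simp: sub_cstar_def)
  qed
qed

section \<open>Bounded sequences modulo null sequences\<close>

locale seq_alg =
  fixes A :: "nat \<Rightarrow> 'a star_alg"
  assumes A: "cstar_algebra (A n)"
begin

interpretation A: cstar_algebra "A n" for n by (rule A)

abbreviation "bs \<equiv> bounded_seqs A"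
abbreviation "Q \<equiv> seq_quotient A"

lemma bsD: "x \<in> bs \<Longrightarrow> x n \<in> car (A n)" by (simp add: bounded_seqs_def)

lemma bsE: assumes "x \<in> bs" obtains K where "K \<ge> 0" "\<And>n. nrm (A n) (x n) \<le> K"
proof -
  obtain K where K: "\<And>n. nrm (A n) (x n) \<le> K" using assms by (auto simp: bounded_seqs_def)
  moreover have "0 \<le> K" using K[of 0] A.nrm_nonneg[OF bsD[OF assms, of 0]] by simp
  ultimately show ?thesis using that by blast
qed

lemma bsI: "(\<And>n. x n \<in> car (A n)) \<Longrightarrow> (\<And>n. nrm (A n) (x n) \<le> K) \<Longrightarrow> x \<in> bs"
  by (auto simp: bounded_seqs_def)

lemma bs_nul: "(\<lambda>n. \<zero>\<^bsub>A n\<^esub>) \<in> bs" by (rule bsI[where K=0]) auto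

lemma bs_add: assumes x: "x \<in> bs" and y: "y \<in> bs" shows "(\<lambda>n. x n \<oplus>\<^bsub>A n\<^esub> y n) \<in> bs"
proof -
  obtain K L where "\<And>n. nrm (A n) (x n) \<le> K" "\<And>n. nrm (A n) (y n) \<le> L" using bsE x y by metis
  then show ?thesis
    by (intro bsI[where K="K + L"]) (auto intro!: order_trans[OF A.nrm_triangle] add_mono simp: bsD x y)
qed

lemma bs_scl: assumes x: "x \<in> bs" shows "(\<lambda>n. c \<odot>\<^bsub>A n\<^esub> x n) \<in> bs"
proof -
  obtain K where "\<And>n. nrm (A n) (x n) \<le> K" using bsE x by metis
  then show ?thesis by (intro bsI[where K="cmod c * K"]) (auto simp: A.nrm_scl bsD x mult_left_mono)
qed

lemma bs_mul: assumes x: "x \<in> bs" and y: "y \<in> bs" shows "(\<lambda>n. x n \<otimes>\<^bsub>A n\<^esub> y n) \<in> bs"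
proof -
  obtain K L where "K \<ge> 0" "\<And>n. nrm (A n) (x n) \<le> K" "\<And>n. nrm (A n) (y n) \<le> L" using bsE x y by metis
  then show ?thesis
    by (intro bsI[where K="K * L"]) (auto intro!: order_trans[OF A.nrm_mul] mult_mono simp: bsD x y A.nrm_nonneg)
qed

lemma bs_adj: "x \<in> bs \<Longrightarrow> (\<lambda>n. adj (A n) (x n)) \<in> bs"
  by (auto simp: bounded_seqs_def)

lemma bs_sub: "x \<in> bs \<Longrightarrow> y \<in> bs \<Longrightarrow> (\<lambda>n. x n \<ominus>\<^bsub>A n\<^esub> y n) \<in> bs"
  using bs_add[OF _ bs_scl[of y "-1"]] by (simp add: sub_def)

lemma null_add:
  assumes "(\<lambda>n. nrm (A n) (x n \<ominus>\<^bsub>A n\<^esub> y n)) \<longlonglongrightarrow> 0" "(\<lambda>n. nrm (A n) (y n \<ominus>\<^bsub>A n\<^esub> z n)) \<longlonglongrightarrow> 0"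
    "x \<in> bs" "y \<in> bs" "z \<in> bs"
  shows "(\<lambda>n. nrm (A n) (x n \<ominus>\<^bsub>A n\<^esub> z n)) \<longlonglongrightarrow> 0"
proof (rule null_squeeze)
  show "(\<lambda>n. nrm (A n) (x n \<ominus>\<^bsub>A n\<^esub> y n) + nrm (A n) (y n \<ominus>\<^bsub>A n\<^esub> z n)) \<longlonglongrightarrow> 0"
    using tendsto_add[OF assms(1,2)] by simp
qed (use assms bsD in \<open>auto intro!: A.nrm_nonneg A.nrm_sub_triangle\<close>)

lemma equiv_null_rel: "equiv bs (null_rel A)"
proof (rule equivI)
  show "null_rel A \<subseteq> bs \<times> bs" by (auto simp: null_rel_def)
  show "refl_on bs (null_rel A)" by (auto simp: refl_on_def null_rel_def bsD)
  show "sym (null_rel A)"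
    by (rule symI) (auto simp: null_rel_def A.nrm_sub_commute[OF bsD bsD])
  show "trans (null_rel A)"
    by (rule transI) (auto simp: null_rel_def intro: null_add)
qed

lemma mem_cls: "x \<in> bs \<Longrightarrow> y \<in> cls A x \<longleftrightarrow> y \<in> bs \<and> (\<lambda>n. nrm (A n) (x n \<ominus>\<^bsub>A n\<^esub> y n)) \<longlonglongrightarrow> 0"
  by (auto simp: cls_def null_rel_def)

lemma cls_refl: "x \<in> bs \<Longrightarrow> x \<in> cls A x" by (simp add: mem_cls bsD)

lemma cls_eq_iff:
  "x \<in> bs \<Longrightarrow> y \<in> bs \<Longrightarrow> cls A x = cls A y \<longleftrightarrow> (\<lambda>n. nrm (A n) (x n \<ominus>\<^bsub>A n\<^esub> y n)) \<longlonglongrightarrow> 0"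
  using eq_equiv_class_iff[OF equiv_null_rel] by (simp add: cls_def null_rel_def)

lemma car_Q: "car Q = cls A ` bs"
  by (auto simp: seq_quotient_def quotient_def cls_def)

lemma Q_cases: assumes "X \<in> car Q" obtains x where "x \<in> bs" "X = cls A x"
  using assms by (auto simp: car_Q)

text \<open>Operations of \<open>seq_quotient\<close> are unions over representatives; as classes
  are nonempty, a union of sets that do not depend on the representative is that common set.\<close>

lemma cls_UN: assumes "x \<in> bs" "\<And>x'. x' \<in> cls A x \<Longrightarrow> f x' = c" shows "(\<Union>x'\<in>cls A x. f x') = c"
  using assms cls_refl[OF assms(1)] by auto

lemma Q_nul: "\<zero>\<^bsub>Q\<^esub> = cls A (\<lambda>n. \<zero>\<^bsub>A n\<^esub>)" by (simp add: seq_quotient_def)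

lemma Q_raw:
  "X \<oplus>\<^bsub>Q\<^esub> Y = (\<Union>x\<in>X. \<Union>y\<in>Y. cls A (\<lambda>n. x n \<oplus>\<^bsub>A n\<^esub> y n))"
  "X \<otimes>\<^bsub>Q\<^esub> Y = (\<Union>x\<in>X. \<Union>y\<in>Y. cls A (\<lambda>n. x n \<otimes>\<^bsub>A n\<^esub> y n))"
  "c \<odot>\<^bsub>Q\<^esub> X = (\<Union>x\<in>X. cls A (\<lambda>n. c \<odot>\<^bsub>A n\<^esub> x n))"
  "adj Q X = (\<Union>x\<in>X. cls A (\<lambda>n. adj (A n) (x n)))"
  by (simp_all only: seq_quotient_def star_alg.simps)

lemma Q_add:
  assumes x: "x \<in> bs" and y: "y \<in> bs"
  shows "cls A x \<oplus>\<^bsub>Q\<^esub> cls A y = cls A (\<lambda>n. x n \<oplus>\<^bsub>A n\<^esub> y n)"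
proof -
  have "cls A (\<lambda>n. x' n \<oplus>\<^bsub>A n\<^esub> y' n) = cls A (\<lambda>n. x n \<oplus>\<^bsub>A n\<^esub> y n)"
    if "x' \<in> cls A x" "y' \<in> cls A y" for x' y'
  proof -
    have *: "x' \<in> bs" "y' \<in> bs" "(\<lambda>n. nrm (A n) (x n \<ominus>\<^bsub>A n\<^esub> x' n)) \<longlonglongrightarrow> 0"
      "(\<lambda>n. nrm (A n) (y n \<ominus>\<^bsub>A n\<^esub> y' n)) \<longlonglongrightarrow> 0" using that x y by (auto simp: mem_cls)
    have "(\<lambda>n. nrm (A n) ((x n \<oplus>\<^bsub>A n\<^esub> y n) \<ominus>\<^bsub>A n\<^esub> (x' n \<oplus>\<^bsub>A n\<^esub> y' n))) \<longlonglongrightarrow> 0"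
    proof (rule null_squeeze)
      show "(\<lambda>n. nrm (A n) (x n \<ominus>\<^bsub>A n\<^esub> x' n) + nrm (A n) (y n \<ominus>\<^bsub>A n\<^esub> y' n)) \<longlonglongrightarrow> 0"
        using tendsto_add[OF *(3,4)] by simp
    qed (use * x y bsD in \<open>auto intro!: A.nrm_nonneg A.nrm_triangle simp: A.sub_sub_add\<close>)
    then show ?thesis using * x y by (subst eq_commute) (simp add: cls_eq_iff bs_add)
  qed
  then show ?thesis
    unfolding Q_raw by (intro cls_UN x y) blast
qed

lemma Q_scl:
  assumes x: "x \<in> bs"
  shows "c \<odot>\<^bsub>Q\<^esub> cls A x = cls A (\<lambda>n. c \<odot>\<^bsub>A n\<^esub> x n)"
proof -
  have "cls A (\<lambda>n. c \<odot>\<^bsub>A n\<^esub> x' n) = cls A (\<lambda>n. c \<odot>\<^bsub>A n\<^esub> x n)"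
    if "x' \<in> cls A x" for x'
  proof -
    have *: "x' \<in> bs" "(\<lambda>n. nrm (A n) (x n \<ominus>\<^bsub>A n\<^esub> x' n)) \<longlonglongrightarrow> 0"
      using that x by (auto simp: mem_cls)
    have "(\<lambda>n. nrm (A n) (c \<odot>\<^bsub>A n\<^esub> x n \<ominus>\<^bsub>A n\<^esub> c \<odot>\<^bsub>A n\<^esub> x' n)) \<longlonglongrightarrow> 0"
      using tendsto_mult_left[OF *(2), of "cmod c"] * x by (simp add: bsD A.nrm_scl flip: A.scl_sub)
    then show ?thesis using * x by (subst eq_commute) (simp add: cls_eq_iff bs_scl)
  qed
  then show ?thesis
    unfolding Q_raw by (intro cls_UN x) blast
qed

lemma Q_adj:
  assumes x: "x \<in> bs"
  shows "adj Q (cls A x) = cls A (\<lambda>n. adj (A n) (x n))"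
proof -
  have "cls A (\<lambda>n. adj (A n) (x' n)) = cls A (\<lambda>n. adj (A n) (x n))"
    if "x' \<in> cls A x" for x'
  proof -
    have *: "x' \<in> bs" "(\<lambda>n. nrm (A n) (x n \<ominus>\<^bsub>A n\<^esub> x' n)) \<longlonglongrightarrow> 0"
      using that x by (auto simp: mem_cls)
    then have "(\<lambda>n. nrm (A n) (adj (A n) (x n) \<ominus>\<^bsub>A n\<^esub> adj (A n) (x' n))) \<longlonglongrightarrow> 0"
      using x by (simp add: bsD flip: A.adj_sub)
    then show ?thesis using * x by (subst eq_commute) (simp add: cls_eq_iff bs_adj)
  qed
  then show ?thesis
    unfolding Q_raw by (intro cls_UN x) blast
qed

lemma Q_mul:
  assumes x: "x \<in> bs" and y: "y \<in> bs"
  shows "cls A x \<otimes>\<^bsub>Q\<^esub> cls A y = cls A (\<lambda>n. x n \<otimes>\<^bsub>A n\<^esub> y n)"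
proof -
  have "cls A (\<lambda>n. x' n \<otimes>\<^bsub>A n\<^esub> y' n) = cls A (\<lambda>n. x n \<otimes>\<^bsub>A n\<^esub> y n)"
    if "x' \<in> cls A x" "y' \<in> cls A y" for x' y'
  proof -
    have *: "x' \<in> bs" "y' \<in> bs" "(\<lambda>n. nrm (A n) (x n \<ominus>\<^bsub>A n\<^esub> x' n)) \<longlonglongrightarrow> 0"
      "(\<lambda>n. nrm (A n) (y n \<ominus>\<^bsub>A n\<^esub> y' n)) \<longlonglongrightarrow> 0" using that x y by (auto simp: mem_cls)
    obtain K where K: "\<And>n. nrm (A n) (y n) \<le> K" using bsE[OF y] by metis
    obtain L where L: "\<And>n. nrm (A n) (x' n) \<le> L" using bsE[OF *(1)] by metis
    have "(\<lambda>n. nrm (A n) (x n \<otimes>\<^bsub>A n\<^esub> y n \<ominus>\<^bsub>A n\<^esub> x' n \<otimes>\<^bsub>A n\<^esub> y n)) \<longlonglongrightarrow> 0"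
    proof (rule null_squeeze)
      show "(\<lambda>n. nrm (A n) (x n \<ominus>\<^bsub>A n\<^esub> x' n) * K) \<longlonglongrightarrow> 0" using tendsto_mult_left_zero[OF *(3)] .
      show "nrm (A n) (x n \<otimes>\<^bsub>A n\<^esub> y n \<ominus>\<^bsub>A n\<^esub> x' n \<otimes>\<^bsub>A n\<^esub> y n) \<le> nrm (A n) (x n \<ominus>\<^bsub>A n\<^esub> x' n) * K" for n
        using A.nrm_mul[of "x n \<ominus>\<^bsub>A n\<^esub> x' n" n "y n"] mult_left_mono[OF K[of n] A.nrm_nonneg[of "x n \<ominus>\<^bsub>A n\<^esub> x' n" n]] * x y bsD
        by (simp add: A.mul_sub_left)
    qed (use * x y bsD in \<open>auto intro!: A.nrm_nonneg\<close>)
    moreover have "(\<lambda>n. nrm (A n) (x' n \<otimes>\<^bsub>A n\<^esub> y n \<ominus>\<^bsub>A n\<^esub> x' n \<otimes>\<^bsub>A n\<^esub> y' n)) \<longlonglongrightarrow> 0"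
    proof (rule null_squeeze)
      show "(\<lambda>n. L * nrm (A n) (y n \<ominus>\<^bsub>A n\<^esub> y' n)) \<longlonglongrightarrow> 0" using tendsto_mult_right_zero[OF *(4)] .
      show "nrm (A n) (x' n \<otimes>\<^bsub>A n\<^esub> y n \<ominus>\<^bsub>A n\<^esub> x' n \<otimes>\<^bsub>A n\<^esub> y' n) \<le> L * nrm (A n) (y n \<ominus>\<^bsub>A n\<^esub> y' n)" for n
        using A.nrm_mul[of "x' n" n "y n \<ominus>\<^bsub>A n\<^esub> y' n"] mult_right_mono[OF L[of n] A.nrm_nonneg[of "y n \<ominus>\<^bsub>A n\<^esub> y' n" n]] * x y bsD
        by (simp add: A.mul_sub_right)
    qed (use * x y bsD in \<open>auto intro!: A.nrm_nonneg\<close>)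
    ultimately have "(\<lambda>n. nrm (A n) (x n \<otimes>\<^bsub>A n\<^esub> y n \<ominus>\<^bsub>A n\<^esub> x' n \<otimes>\<^bsub>A n\<^esub> y' n)) \<longlonglongrightarrow> 0"
      by (rule null_add) (use * x y bs_mul in auto)
    then show ?thesis using * x y by (subst eq_commute) (simp add: cls_eq_iff bs_mul)
  qed
  then show ?thesis
    unfolding Q_raw by (intro cls_UN x y) blast
qed

lemma Q_sub: "x \<in> bs \<Longrightarrow> y \<in> bs \<Longrightarrow> cls A x \<ominus>\<^bsub>Q\<^esub> cls A y = cls A (\<lambda>n. x n \<ominus>\<^bsub>A n\<^esub> y n)"
  by (simp add: sub_def Q_scl Q_add bs_scl)

text \<open>The quotient norm is the limit superior of the norms: a null sequence changes norms by
  arbitrarily little in the long run, and any initial segment may be replaced by 0.\<close>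

lemma nrm_Q_le_iff:
  assumes x: "x \<in> bs"
  shows "nrm Q (cls A x) \<le> c \<longleftrightarrow> (\<forall>\<delta>>0. \<exists>N. \<forall>n\<ge>N. nrm (A n) (x n) \<le> c + \<delta>)"
proof -
  define S where "S y = (SUP n. nrm (A n) (y n))" for y
  have Q: "nrm Q (cls A x) = (INF y\<in>cls A x. S y)" by (simp add: seq_quotient_def S_def)
  have bdd: "bdd_above (range (\<lambda>n. nrm (A n) (y n)))" if yb: "y \<in> bs" for y
  proof -
    obtain K where "\<And>n. nrm (A n) (y n) \<le> K" using bsE[OF yb] by metis
    then show ?thesis by (intro bdd_aboveI2[of _ _ K]) auto
  qed
  have S: "nrm (A n) (y n) \<le> S y" if "y \<in> bs" for y n
    unfolding S_def by (rule cSUP_upper[OF UNIV_I bdd[OF that]])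
  have S0: "0 \<le> S y" if "y \<in> bs" for y
    using S[OF that, of 0] A.nrm_nonneg[OF bsD[OF that, of 0]] by simp
  have bb: "bdd_below (S ` cls A x)" using S0 x by (intro bdd_belowI2[of _ 0]) (auto simp: mem_cls)
  show ?thesis
  proof
    assume le: "nrm Q (cls A x) \<le> c"
    show "\<forall>\<delta>>0. \<exists>N. \<forall>n\<ge>N. nrm (A n) (x n) \<le> c + \<delta>"
    proof (intro allI impI)
      fix \<delta> :: real assume d: "\<delta> > 0"
      have "(INF y\<in>cls A x. S y) < c + \<delta> / 2" using le d Q by simp
      then obtain y where y: "y \<in> cls A x" "S y < c + \<delta> / 2"
        using cls_refl[OF x] bb by (subst (asm) cINF_less_iff) auto
      then have yb: "y \<in> bs" "(\<lambda>n. nrm (A n) (x n \<ominus>\<^bsub>A n\<^esub> y n)) \<longlonglongrightarrow> 0" using x by (auto simp: mem_cls)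
      obtain N where N: "\<And>n. n \<ge> N \<Longrightarrow> nrm (A n) (x n \<ominus>\<^bsub>A n\<^esub> y n) < \<delta> / 2"
        using order_tendstoD(2)[OF yb(2), of "\<delta> / 2"] d by (auto simp: eventually_sequentially)
      have "nrm (A n) (x n) \<le> c + \<delta>" if "n \<ge> N" for n
        using A.nrm_le_sub[OF bsD[OF x] bsD[OF yb(1)], of n] N[OF that] S[OF yb(1), of n] y(2) by linarith
      then show "\<exists>N. \<forall>n\<ge>N. nrm (A n) (x n) \<le> c + \<delta>" by blast
    qed
  next
    assume r: "\<forall>\<delta>>0. \<exists>N. \<forall>n\<ge>N. nrm (A n) (x n) \<le> c + \<delta>"
    show "nrm Q (cls A x) \<le> c"
    proof (rule field_le_epsilon)
      fix \<delta> :: real assume "\<delta> > 0"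
      then obtain N where N: "\<And>n. n \<ge> N \<Longrightarrow> nrm (A n) (x n) \<le> c + \<delta>" using r by blast
      then have c0: "0 \<le> c + \<delta>" using order_trans[OF A.nrm_nonneg[OF bsD[OF x, of N]] N[OF order_refl]] by simp
      \<comment> \<open>Clearing the initial segment yields a representative whose supremum is
        governed by the tail.\<close>
      define y where "y n = (if n < N then \<zero>\<^bsub>A n\<^esub> else x n)" for n
      have yn: "y n \<in> car (A n)" "nrm (A n) (y n) \<le> c + \<delta>" for n
        using N[of n] c0 by (auto simp: y_def bsD[OF x])
      have yb: "y \<in> bs" by (rule bsI[OF yn])
      have "(\<lambda>n. nrm (A n) (x n \<ominus>\<^bsub>A n\<^esub> y n)) \<longlonglongrightarrow> 0"
        by (rule tendsto_eventually) (auto simp: eventually_sequentially y_def bsD[OF x] intro!: exI[of _ N])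
      then have "y \<in> cls A x" using x yb by (simp add: mem_cls)
      then have "nrm Q (cls A x) \<le> S y" unfolding Q by (rule cINF_lower[OF bb])
      also have "S y \<le> c + \<delta>" unfolding S_def using yn(2) by (intro cSUP_least) auto
      finally show "nrm Q (cls A x) \<le> c + \<delta>" .
    qed
  qed
qed

lemma nrm_Q_ev:
  assumes "x \<in> bs" "\<delta> > 0"
  obtains N where "\<And>n. n \<ge> N \<Longrightarrow> nrm (A n) (x n) \<le> nrm Q (cls A x) + \<delta>"
  using nrm_Q_le_iff[OF assms(1), of "nrm Q (cls A x)"] assms(2) by auto

lemma nrm_Q_nonneg: assumes x: "x \<in> bs" shows "0 \<le> nrm Q (cls A x)"
proof (rule ccontr)
  assume *: "\<not> ?thesis"
  then obtain N where "nrm (A N) (x N) \<le> nrm Q (cls A x) + (- nrm Q (cls A x) / 2)"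
    using nrm_Q_ev[OF x, of "- nrm Q (cls A x) / 2"] by (metis linorder_not_le neg_0_less_iff_less half_gt_zero order_refl)
  then show False using * A.nrm_nonneg[OF bsD[OF x, of N]] by simp
qed

lemma nrm_Q_zero: assumes x: "x \<in> bs" shows "nrm Q (cls A x) = 0 \<longleftrightarrow> cls A x = \<zero>\<^bsub>Q\<^esub>"
proof -
  have "nrm Q (cls A x) = 0 \<longleftrightarrow> nrm Q (cls A x) \<le> 0" using nrm_Q_nonneg[OF x] by auto
  also have "\<dots> \<longleftrightarrow> (\<lambda>n. nrm (A n) (x n)) \<longlonglongrightarrow> 0"
    unfolding nrm_Q_le_iff[OF x] LIMSEQ_iff
  proof (intro iffI allI impI)
    fix r :: real assume "\<forall>\<delta>>0. \<exists>N. \<forall>n\<ge>N. nrm (A n) (x n) \<le> 0 + \<delta>" "0 < r"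
    then obtain N where "\<forall>n\<ge>N. nrm (A n) (x n) \<le> 0 + r / 2" using half_gt_zero by blast
    then show "\<exists>no. \<forall>n\<ge>no. norm (nrm (A n) (x n) - 0) < r"
      using \<open>0 < r\<close> A.nrm_nonneg[OF bsD[OF x]] by (intro exI[of _ N]) force
  next
    fix r :: real assume "\<forall>r>0. \<exists>no. \<forall>n\<ge>no. norm (nrm (A n) (x n) - 0) < r" "0 < r"
    then show "\<exists>N. \<forall>n\<ge>N. nrm (A n) (x n) \<le> 0 + r" by (force intro: less_imp_le)
  qed
  also have "\<dots> \<longleftrightarrow> cls A x = \<zero>\<^bsub>Q\<^esub>" unfolding Q_nul using x by (simp add: cls_eq_iff bs_nul bsD)
  finally show ?thesis .
qed

lemma nrm_Q_add:
  assumes x: "x \<in> bs" and y: "y \<in> bs" and z: "z \<in> bs"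
    and le: "\<And>n. nrm (A n) (z n) \<le> nrm (A n) (x n) + nrm (A n) (y n)"
  shows "nrm Q (cls A z) \<le> nrm Q (cls A x) + nrm Q (cls A y)"
  unfolding nrm_Q_le_iff[OF z]
proof (intro allI impI)
  fix \<delta> :: real assume d: "\<delta> > 0"
  obtain N where N: "\<And>n. n \<ge> N \<Longrightarrow> nrm (A n) (x n) \<le> nrm Q (cls A x) + \<delta> / 2" using nrm_Q_ev[OF x, of "\<delta>/2"] d by auto
  obtain M where M: "\<And>n. n \<ge> M \<Longrightarrow> nrm (A n) (y n) \<le> nrm Q (cls A y) + \<delta> / 2" using nrm_Q_ev[OF y, of "\<delta>/2"] d by auto
  have "nrm (A n) (z n) \<le> nrm Q (cls A x) + nrm Q (cls A y) + \<delta>" if "n \<ge> max N M" for n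
    using N[of n] M[of n] le[of n] that by simp
  then show "\<exists>N. \<forall>n\<ge>N. nrm (A n) (z n) \<le> nrm Q (cls A x) + nrm Q (cls A y) + \<delta>" by blast
qed

lemma nrm_Q_mul:
  assumes x: "x \<in> bs" and y: "y \<in> bs"
  shows "nrm Q (cls A (\<lambda>n. x n \<otimes>\<^bsub>A n\<^esub> y n)) \<le> nrm Q (cls A x) * nrm Q (cls A y)"
  unfolding nrm_Q_le_iff[OF bs_mul[OF x y]]
proof (intro allI impI)
  fix \<delta> :: real assume d: "\<delta> > 0"
  let ?a = "nrm Q (cls A x)" and ?b = "nrm Q (cls A y)"
  have ab: "0 \<le> ?a" "0 \<le> ?b" using nrm_Q_nonneg x y by auto
  \<comment> \<open>Chosen so that (a + \<eta>) (b + \<eta>) \<le> a b + \<delta> for the two norms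
    a, b: the minimum with 1 bounds the square of \<eta> by \<eta>, whence the summand 1 in the
    denominator.\<close>
  define \<eta> where "\<eta> = min 1 (\<delta> / (?a + ?b + 1))"
  have s: "?a + ?b + 1 > 0" using ab by simp
  have e: "\<eta> > 0" "\<eta> \<le> 1" using d s by (auto simp: \<eta>_def)
  have "\<eta> \<le> \<delta> / (?a + ?b + 1)" by (simp add: \<eta>_def)
  then have e3: "\<eta> * (?a + ?b + 1) \<le> \<delta>" using s by (simp only: pos_le_divide_eq)
  have "\<eta> * \<eta> \<le> \<eta> * 1" using e by (intro mult_left_mono) auto
  then have fin: "(?a + \<eta>) * (?b + \<eta>) \<le> ?a * ?b + \<delta>" using e3 by (simp add: algebra_simps)
  obtain N where N: "\<And>n. n \<ge> N \<Longrightarrow> nrm (A n) (x n) \<le> ?a + \<eta>" using nrm_Q_ev[OF x e(1)] by metis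
  obtain M where M: "\<And>n. n \<ge> M \<Longrightarrow> nrm (A n) (y n) \<le> ?b + \<eta>" using nrm_Q_ev[OF y e(1)] by metis
  have "nrm (A n) (x n \<otimes>\<^bsub>A n\<^esub> y n) \<le> ?a * ?b + \<delta>" if "n \<ge> max N M" for n
  proof -
    have "nrm (A n) (x n \<otimes>\<^bsub>A n\<^esub> y n) \<le> nrm (A n) (x n) * nrm (A n) (y n)" by (rule A.nrm_mul[OF bsD[OF x] bsD[OF y]])
    also have "\<dots> \<le> (?a + \<eta>) * (?b + \<eta>)"
      using N[of n] M[of n] that ab e A.nrm_nonneg[OF bsD[OF x, of n]] A.nrm_nonneg[OF bsD[OF y, of n]]
      by (intro mult_mono) auto
    finally show ?thesis using fin by simp
  qed
  then show "\<exists>N. \<forall>n\<ge>N. nrm (A n) (x n \<otimes>\<^bsub>A n\<^esub> y n) \<le> ?a * ?b + \<delta>" by blast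
qed

lemma nrm_Q_scl_le:
  assumes x: "x \<in> bs"
  shows "nrm Q (cls A (\<lambda>n. c \<odot>\<^bsub>A n\<^esub> x n)) \<le> cmod c * nrm Q (cls A x)"
  unfolding nrm_Q_le_iff[OF bs_scl[OF x]]
proof (intro allI impI)
  fix \<delta> :: real assume d: "\<delta> > 0"
  then have "\<delta> / (cmod c + 1) > 0" by (simp add: add_nonneg_pos)
  from nrm_Q_ev[OF x this] obtain N where
    N: "\<And>n. n \<ge> N \<Longrightarrow> nrm (A n) (x n) \<le> nrm Q (cls A x) + \<delta> / (cmod c + 1)" by metis
  have "cmod c * (\<delta> / (cmod c + 1)) \<le> \<delta>"
  proof -
    have "cmod c / (cmod c + 1) \<le> 1" 
    proof -
      have "0 < cmod c + 1" using norm_ge_zero[of c] by linarith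
      then show ?thesis by (simp add: divide_le_eq_1)
    qed
    from mult_left_mono[OF this, of \<delta>] d show ?thesis by (simp add: mult_ac)
  qed
  then have "nrm (A n) (c \<odot>\<^bsub>A n\<^esub> x n) \<le> cmod c * nrm Q (cls A x) + \<delta>" if "n \<ge> N" for n
    using mult_left_mono[OF N[OF that], of "cmod c"] x by (simp add: A.nrm_scl bsD distrib_left)
  then show "\<exists>N. \<forall>n\<ge>N. nrm (A n) (c \<odot>\<^bsub>A n\<^esub> x n) \<le> cmod c * nrm Q (cls A x) + \<delta>" by blast
qed

lemma nrm_Q_cong:
  assumes x: "x \<in> bs" and y: "y \<in> bs" and eq: "\<And>n. n \<ge> M \<Longrightarrow> nrm (A n) (x n) = nrm (A n) (y n)"
  shows "nrm Q (cls A x) = nrm Q (cls A y)"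
proof -
  have "nrm Q (cls A u) \<le> nrm Q (cls A v)"
    if u: "u \<in> bs" and v: "v \<in> bs" and uv: "\<And>n. n \<ge> M \<Longrightarrow> nrm (A n) (u n) = nrm (A n) (v n)" for u v
    unfolding nrm_Q_le_iff[OF u]
  proof (intro allI impI)
    fix \<delta> :: real assume d: "\<delta> > 0"
    obtain N where "\<And>n. n \<ge> N \<Longrightarrow> nrm (A n) (v n) \<le> nrm Q (cls A v) + \<delta>" using nrm_Q_ev[OF v d] by metis
    then show "\<exists>N. \<forall>n\<ge>N. nrm (A n) (u n) \<le> nrm Q (cls A v) + \<delta>"
      using uv by (intro exI[of _ "max M N"]) auto
  qed
  then show ?thesis using x y eq by (metis antisym)
qed

text \<open>A diagonal argument. A subsequence \<open>x\<close> has consecutive distances below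
  (1/2)^k, and these become estimates on coordinates from some index on. The limit \<open>y\<close>
  takes its n-th coordinate from the latest member of \<open>x\<close> for which all earlier
  estimates are already valid at n.\<close>

lemma Q_complete:
  assumes s: "\<And>n::nat. s n \<in> car Q" and c: "\<And>e. 0 < e \<Longrightarrow> \<exists>N. \<forall>m\<ge>N. \<forall>n\<ge>N. nrm Q (s m \<ominus>\<^bsub>Q\<^esub> s n) < e"
  shows "\<exists>l\<in>car Q. (\<lambda>n. nrm Q (s n \<ominus>\<^bsub>Q\<^esub> l)) \<longlonglongrightarrow> 0"
proof -
  obtain z where z: "\<And>n. z n \<in> bs" "\<And>n. s n = cls A (z n)" using s unfolding car_Q image_iff by metis
  have tri: "nrm Q (cls A u \<ominus>\<^bsub>Q\<^esub> cls A w) \<le> nrm Q (cls A u \<ominus>\<^bsub>Q\<^esub> cls A v) + nrm Q (cls A v \<ominus>\<^bsub>Q\<^esub> cls A w)"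
    if "u \<in> bs" "v \<in> bs" "w \<in> bs" for u v w
    unfolding Q_sub[OF that(1,2)] Q_sub[OF that(2,3)] Q_sub[OF that(1,3)]
    by (rule nrm_Q_add) (use that bs_sub in \<open>auto intro!: A.nrm_sub_triangle simp: bsD\<close>)
  have "\<exists>p. \<forall>m\<ge>p. \<forall>n\<ge>p. nrm Q (s m \<ominus>\<^bsub>Q\<^esub> s n) < (1/2) ^ k" for k by (rule c) simp
  then obtain p0 where p0: "\<And>k m n. m \<ge> p0 k \<Longrightarrow> n \<ge> p0 k \<Longrightarrow> nrm Q (s m \<ominus>\<^bsub>Q\<^esub> s n) < (1/2) ^ k" by metis
  \<comment> \<open>Partial sums dominate the thresholds and are monotone.\<close>
  define p where "p k = (\<Sum>j\<le>k. p0 j)" for k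
  have p: "p k \<ge> p0 k" "p (Suc k) \<ge> p k" for k by (auto simp: p_def member_le_sum)
  define x where "x k = z (p k)" for k
  have xb: "x k \<in> bs" for k by (simp add: x_def z)
  have "\<exists>N. \<forall>n\<ge>N. nrm (A n) (x (Suc k) n \<ominus>\<^bsub>A n\<^esub> x k n) \<le> (1/2) ^ k" for k
  proof -
    have "nrm Q (s (p (Suc k)) \<ominus>\<^bsub>Q\<^esub> s (p k)) < (1/2) ^ k" using p0[of k] p[of k] by simp
    then have 1: "nrm Q (cls A (\<lambda>n. x (Suc k) n \<ominus>\<^bsub>A n\<^esub> x k n)) < (1/2) ^ k"
      by (simp add: z Q_sub x_def)
    let ?m = "nrm Q (cls A (\<lambda>n. x (Suc k) n \<ominus>\<^bsub>A n\<^esub> x k n))"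
    have "0 < (1/2) ^ k - ?m" using 1 by simp
    then have "\<exists>N. \<forall>n\<ge>N. nrm (A n) (x (Suc k) n \<ominus>\<^bsub>A n\<^esub> x k n) \<le> ?m + ((1/2) ^ k - ?m)"
      using nrm_Q_le_iff[OF bs_sub[OF xb[of "Suc k"] xb[of k]], of ?m] by blast
    then show ?thesis by simp
  qed
  then have "\<forall>k. \<exists>N. \<forall>n\<ge>N. nrm (A n) (x (Suc k) n \<ominus>\<^bsub>A n\<^esub> x k n) \<le> (1/2) ^ k" by blast
  from choice[OF this] obtain N where N: "\<And>k n. n \<ge> N k \<Longrightarrow> nrm (A n) (x (Suc k) n \<ominus>\<^bsub>A n\<^esub> x k n) \<le> (1/2) ^ k"
    by blast
  \<comment> \<open>From index \<open>M l\<close> on, the estimates for all steps before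
    \<open>l\<close> hold. The \<open>Suc\<close> forces \<open>M l \<ge> l\<close>, so only
    finitely many \<open>l\<close> satisfy \<open>M l \<le> n\<close> and the maximum in
    \<open>K n\<close> exists.\<close>
  define M where "M l = (\<Sum>j<l. Suc (N j))" for l
  have M: "M 0 = 0" "\<And>l. M (Suc l) \<ge> N l" "\<And>l. M (Suc l) \<ge> M l" by (auto simp: M_def)
  have Ml: "M l \<ge> l" for l by (induction l) (auto simp: M_def)
  have est: "nrm (A n) (x (k + d) n \<ominus>\<^bsub>A n\<^esub> x k n) \<le> 2 * (1/2) ^ k - 2 * (1/2) ^ (k + d)"
    if "M (k + d) \<le> n" for k d n
    using that
  proof (induction d)
    case (Suc d)
    have "M (k + d) \<le> n" "N (k + d) \<le> n" using Suc.prems M(3)[of "k + d"] M(2)[of "k + d"] by auto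
    then have "nrm (A n) (x (k + d) n \<ominus>\<^bsub>A n\<^esub> x k n) \<le> 2 * (1/2) ^ k - 2 * (1/2) ^ (k + d)"
      "nrm (A n) (x (Suc (k + d)) n \<ominus>\<^bsub>A n\<^esub> x (k + d) n) \<le> (1/2) ^ (k + d)" using Suc.IH N by auto
    then show ?case
      using A.nrm_sub_triangle[OF bsD[OF xb[of "Suc (k + d)"]] bsD[OF xb[of "k + d"]] bsD[OF xb[of k]], of n] by simp
  qed (simp add: bsD[OF xb])
  define K where "K n = Max {k. M k \<le> n}" for n
  have fin: "finite {k. M k \<le> n}" for n
    by (rule finite_subset[of _ "{..n}"]) (use Ml order_trans in blast, simp)
  have K: "M (K n) \<le> n" for n
  proof -
    have "0 \<in> {k. M k \<le> n}" using M(1) by simp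
    then have "{k. M k \<le> n} \<noteq> {}" by blast
    then have "K n \<in> {k. M k \<le> n}" unfolding K_def by (rule Max_in[OF fin])
    then show ?thesis by simp
  qed
  have Kge: "K n \<ge> k" if "M k \<le> n" for k n unfolding K_def by (rule Max_ge[OF fin]) (use that in simp)
  define y where "y n = x (K n) n" for n
  have yc: "y n \<in> car (A n)" for n by (simp add: y_def bsD[OF xb])
  have yx: "nrm (A n) (y n \<ominus>\<^bsub>A n\<^esub> x k n) \<le> 2 * (1/2) ^ k" if "M k \<le> n" for n k
  proof -
    have "nrm (A n) (x (k + (K n - k)) n \<ominus>\<^bsub>A n\<^esub> x k n) \<le> 2 * (1/2) ^ k - 2 * (1/2) ^ (k + (K n - k))"
      by (rule est) (use K[of n] Kge[OF that] in simp)
    moreover have "0 \<le> (1/2::real) ^ (k + (K n - k))" by simp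
    ultimately have "nrm (A n) (x (k + (K n - k)) n \<ominus>\<^bsub>A n\<^esub> x k n) \<le> 2 * (1/2) ^ k" by linarith
    then show ?thesis using Kge[OF that] by (simp add: y_def)
  qed
  obtain L where L: "\<And>n. nrm (A n) (x 0 n) \<le> L" using bsE[OF xb[of 0]] by metis
  have yb: "y \<in> bs"
  proof (rule bsI[OF yc])
    fix n show "nrm (A n) (y n) \<le> 2 + L"
      using A.nrm_le_sub[OF yc bsD[OF xb], of n 0] yx[of 0 n] M(1) L[of n] by simp
  qed
  have lim: "nrm Q (cls A y \<ominus>\<^bsub>Q\<^esub> cls A (x k)) \<le> 2 * (1/2) ^ k" for k
    unfolding Q_sub[OF yb xb] nrm_Q_le_iff[OF bs_sub[OF yb xb]]
    using yx[of k] by (intro allI impI exI[of _ "M k"]) (auto intro: order_trans[OF yx])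
  have sym: "nrm Q (cls A u \<ominus>\<^bsub>Q\<^esub> cls A v) = nrm Q (cls A v \<ominus>\<^bsub>Q\<^esub> cls A u)" if "u \<in> bs" "v \<in> bs" for u v
    unfolding Q_sub[OF that] Q_sub[OF that(2,1)]
    by (rule nrm_Q_cong[OF bs_sub bs_sub, where M=0]) (use that in \<open>auto simp: A.nrm_sub_commute[OF bsD bsD]\<close>)
  have "(\<lambda>n. nrm Q (s n \<ominus>\<^bsub>Q\<^esub> cls A y)) \<longlonglongrightarrow> 0"
    unfolding LIMSEQ_iff
  proof (intro allI impI)
    fix r :: real assume r: "r > 0"
    obtain k where k: "(1/2::real) ^ k < r / 3" using real_arch_pow_inv[of "r/3" "1/2"] r by auto
    have "nrm Q (s n \<ominus>\<^bsub>Q\<^esub> cls A y) < r" if "n \<ge> p k" for n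
    proof -
      have "nrm Q (s n \<ominus>\<^bsub>Q\<^esub> cls A y) \<le> nrm Q (s n \<ominus>\<^bsub>Q\<^esub> cls A (x k)) + nrm Q (cls A (x k) \<ominus>\<^bsub>Q\<^esub> cls A y)"
        unfolding z(2) by (rule tri) (use z xb yb in auto)
      moreover have "nrm Q (s n \<ominus>\<^bsub>Q\<^esub> cls A (x k)) < (1/2) ^ k"
        using p0[of k n "p k"] p(1)[of k] that by (simp add: x_def z(2))
      ultimately show ?thesis using lim[of k] sym[OF yb xb, of k] k by linarith
    qed
    moreover have "0 \<le> nrm Q (s n \<ominus>\<^bsub>Q\<^esub> cls A y)" for n
      unfolding z(2) Q_sub[OF z(1) yb] by (rule nrm_Q_nonneg[OF bs_sub[OF z(1) yb]])
    ultimately show "\<exists>no. \<forall>n\<ge>no. norm (nrm Q (s n \<ominus>\<^bsub>Q\<^esub> cls A y) - 0) < r"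
      by (intro exI[of _ "p k"]) simp
  qed
  then show ?thesis using yb by (auto simp: car_Q)
qed

lemmas Q_ops = Q_nul Q_add Q_scl Q_mul Q_adj
lemmas bs_ops = bs_nul bs_add bs_scl bs_mul bs_adj

lemma cstar_Q: "cstar_algebra Q"
proof
  show "\<zero>\<^bsub>Q\<^esub> \<in> car Q" by (simp add: Q_nul car_Q bs_nul)
  fix X assume "X \<in> car Q" then obtain x where x: "x \<in> bs" "X = cls A x" by (rule Q_cases)
  note xc = bsD[OF x(1)]
  show "c \<odot>\<^bsub>Q\<^esub> X \<in> car Q" for c using x by (simp add: Q_scl car_Q bs_scl)
  show "adj Q X \<in> car Q" using x by (simp add: Q_adj car_Q bs_adj)
  show "\<zero>\<^bsub>Q\<^esub> \<oplus>\<^bsub>Q\<^esub> X = X" using x by (simp add: Q_ops bs_ops xc A.nul_add)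
  show "X \<oplus>\<^bsub>Q\<^esub> (-1) \<odot>\<^bsub>Q\<^esub> X = \<zero>\<^bsub>Q\<^esub>" using x by (simp add: Q_ops bs_ops xc A.add_inverse)
  show "(c + d) \<odot>\<^bsub>Q\<^esub> X = c \<odot>\<^bsub>Q\<^esub> X \<oplus>\<^bsub>Q\<^esub> d \<odot>\<^bsub>Q\<^esub> X" for c d using x by (simp add: Q_ops bs_ops xc A.scl_add_left)
  show "c \<odot>\<^bsub>Q\<^esub> (d \<odot>\<^bsub>Q\<^esub> X) = (c * d) \<odot>\<^bsub>Q\<^esub> X" for c d using x by (simp add: Q_ops bs_ops xc A.scl_scl)
  show "1 \<odot>\<^bsub>Q\<^esub> X = X" using x by (simp add: Q_ops bs_ops xc A.scl_one)
  show "adj Q (adj Q X) = X" using x by (simp add: Q_ops bs_ops xc A.adj_adj)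
  show "adj Q (c \<odot>\<^bsub>Q\<^esub> X) = cnj c \<odot>\<^bsub>Q\<^esub> adj Q X" for c using x by (simp add: Q_ops bs_ops xc A.adj_scl)
  show "0 \<le> nrm Q X" using x by (simp add: nrm_Q_nonneg)
  show "nrm Q X = 0 \<longleftrightarrow> X = \<zero>\<^bsub>Q\<^esub>" using x by (simp add: nrm_Q_zero)
  show "nrm Q (c \<odot>\<^bsub>Q\<^esub> X) = cmod c * nrm Q X" for c
  proof (cases "c = 0")
    case True
    then show ?thesis using x nrm_Q_scl_le[OF x(1), of 0] nrm_Q_nonneg[OF bs_scl[OF x(1)], of 0] by (simp add: Q_scl)
  next
    case False
    then have "(\<lambda>n. (1 / c) \<odot>\<^bsub>A n\<^esub> (c \<odot>\<^bsub>A n\<^esub> x n)) = x" by (simp add: A.scl_scl xc A.scl_one)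
    then have "nrm Q X \<le> cmod (1 / c) * nrm Q (c \<odot>\<^bsub>Q\<^esub> X)"
      using nrm_Q_scl_le[OF bs_scl[OF x(1)], of "1 / c" c] x by (simp add: Q_scl)
    then have "cmod c * nrm Q X \<le> nrm Q (c \<odot>\<^bsub>Q\<^esub> X)" using False by (simp add: norm_divide field_simps)
    then show ?thesis using nrm_Q_scl_le[OF x(1), of c] x by (simp add: Q_scl)
  qed
  show "nrm Q (adj Q X \<otimes>\<^bsub>Q\<^esub> X) = (nrm Q X)\<^sup>2"
  proof (rule antisym)
    have "nrm Q (adj Q X) = nrm Q X"
      using x by (simp add: Q_adj) (rule nrm_Q_cong[where M=0], auto simp: bs_adj xc)
    then show "nrm Q (adj Q X \<otimes>\<^bsub>Q\<^esub> X) \<le> (nrm Q X)\<^sup>2"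
      using nrm_Q_mul[OF bs_adj[OF x(1)] x(1)] x by (simp add: Q_ops bs_ops power2_eq_square)
    let ?m = "nrm Q (adj Q X \<otimes>\<^bsub>Q\<^esub> X)"
    have b: "(\<lambda>n. adj (A n) (x n) \<otimes>\<^bsub>A n\<^esub> x n) \<in> bs" by (intro bs_mul bs_adj x)
    have m: "?m = nrm Q (cls A (\<lambda>n. adj (A n) (x n) \<otimes>\<^bsub>A n\<^esub> x n))" using x by (simp add: Q_ops bs_ops)
    have m0: "0 \<le> ?m" unfolding m by (rule nrm_Q_nonneg[OF b])
    have "nrm Q X \<le> sqrt ?m"
      unfolding x(2) nrm_Q_le_iff[OF x(1)]
    proof (intro allI impI)
      fix \<delta> :: real assume d: "\<delta> > 0"
      \<comment> \<open>The tolerance is the square of \<delta> because a root is taken afterwards: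
        m + \<delta>^2 \<le> (sqrt m + \<delta>)^2.\<close>
      then obtain N where N: "\<And>n. n \<ge> N \<Longrightarrow> nrm (A n) (adj (A n) (x n) \<otimes>\<^bsub>A n\<^esub> x n) \<le> ?m + \<delta>\<^sup>2"
        using nrm_Q_ev[OF b, of "\<delta>\<^sup>2"] unfolding m by auto
      have "nrm (A n) (x n) \<le> sqrt ?m + \<delta>" if "n \<ge> N" for n
      proof (rule power2_le_imp_le)
        have "(nrm (A n) (x n))\<^sup>2 \<le> ?m + \<delta>\<^sup>2" using N[OF that] by (simp add: A.cstar_identity xc)
        also have "\<dots> \<le> (sqrt ?m + \<delta>)\<^sup>2" using m0 d by (simp add: power2_sum)
        finally show "(nrm (A n) (x n))\<^sup>2 \<le> (sqrt ?m + \<delta>)\<^sup>2" .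
      qed (use d m0 in simp)
      then show "\<exists>N. \<forall>n\<ge>N. nrm (A n) (x n) \<le> sqrt (nrm Q (adj Q (cls A x) \<otimes>\<^bsub>Q\<^esub> cls A x)) + \<delta>"
        unfolding x(2) by blast
    qed
    then have "(nrm Q X)\<^sup>2 \<le> (sqrt ?m)\<^sup>2"
      by (rule power_mono) (use x nrm_Q_nonneg in simp)
    then show "(nrm Q X)\<^sup>2 \<le> ?m" using m0 by simp
  qed
  fix Y assume "Y \<in> car Q" then obtain y where y: "y \<in> bs" "Y = cls A y" by (rule Q_cases)
  note yc = bsD[OF y(1)]
  show "X \<oplus>\<^bsub>Q\<^esub> Y \<in> car Q" "X \<otimes>\<^bsub>Q\<^esub> Y \<in> car Q" using x y by (simp_all add: Q_ops car_Q bs_ops)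
  show "X \<oplus>\<^bsub>Q\<^esub> Y = Y \<oplus>\<^bsub>Q\<^esub> X" using x y by (simp add: Q_ops A.add_commute[OF xc yc])
  show "c \<odot>\<^bsub>Q\<^esub> (X \<oplus>\<^bsub>Q\<^esub> Y) = c \<odot>\<^bsub>Q\<^esub> X \<oplus>\<^bsub>Q\<^esub> c \<odot>\<^bsub>Q\<^esub> Y" for c
    using x y by (simp add: Q_ops bs_ops xc yc A.scl_add_right)
  show "(c \<odot>\<^bsub>Q\<^esub> X) \<otimes>\<^bsub>Q\<^esub> Y = c \<odot>\<^bsub>Q\<^esub> (X \<otimes>\<^bsub>Q\<^esub> Y)" for c
    using x y by (simp add: Q_ops bs_ops xc yc A.scl_mul_left)
  show "X \<otimes>\<^bsub>Q\<^esub> (c \<odot>\<^bsub>Q\<^esub> Y) = c \<odot>\<^bsub>Q\<^esub> (X \<otimes>\<^bsub>Q\<^esub> Y)" for c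
    using x y by (simp add: Q_ops bs_ops xc yc A.scl_mul_right)
  show "adj Q (X \<oplus>\<^bsub>Q\<^esub> Y) = adj Q X \<oplus>\<^bsub>Q\<^esub> adj Q Y"
    using x y by (simp add: Q_ops bs_ops xc yc A.adj_add)
  show "adj Q (X \<otimes>\<^bsub>Q\<^esub> Y) = adj Q Y \<otimes>\<^bsub>Q\<^esub> adj Q X"
    using x y by (simp add: Q_ops bs_ops xc yc A.adj_mul)
  show "nrm Q (X \<oplus>\<^bsub>Q\<^esub> Y) \<le> nrm Q X + nrm Q Y"
    unfolding x(2) y(2) Q_add[OF x(1) y(1)]
    by (rule nrm_Q_add) (use x y bs_ops in \<open>auto intro: A.nrm_triangle xc yc\<close>)
  show "nrm Q (X \<otimes>\<^bsub>Q\<^esub> Y) \<le> nrm Q X * nrm Q Y" using nrm_Q_mul x y by (simp add: Q_mul)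
  fix Z assume "Z \<in> car Q" then obtain z where z: "z \<in> bs" "Z = cls A z" by (rule Q_cases)
  note zc = bsD[OF z(1)]
  show "X \<oplus>\<^bsub>Q\<^esub> Y \<oplus>\<^bsub>Q\<^esub> Z = X \<oplus>\<^bsub>Q\<^esub> (Y \<oplus>\<^bsub>Q\<^esub> Z)"
    using x y z by (simp add: Q_ops bs_ops xc yc zc A.add_assoc)
  show "X \<otimes>\<^bsub>Q\<^esub> Y \<otimes>\<^bsub>Q\<^esub> Z = X \<otimes>\<^bsub>Q\<^esub> (Y \<otimes>\<^bsub>Q\<^esub> Z)"
    using x y z by (simp add: Q_ops bs_ops xc yc zc A.mul_assoc)
  show "(X \<oplus>\<^bsub>Q\<^esub> Y) \<otimes>\<^bsub>Q\<^esub> Z = X \<otimes>\<^bsub>Q\<^esub> Z \<oplus>\<^bsub>Q\<^esub> Y \<otimes>\<^bsub>Q\<^esub> Z"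
    using x y z by (simp add: Q_ops bs_ops xc yc zc A.mul_add_left)
  show "X \<otimes>\<^bsub>Q\<^esub> (Y \<oplus>\<^bsub>Q\<^esub> Z) = X \<otimes>\<^bsub>Q\<^esub> Y \<oplus>\<^bsub>Q\<^esub> X \<otimes>\<^bsub>Q\<^esub> Z"
    using x y z by (simp add: Q_ops bs_ops xc yc zc A.mul_add_right)
qed (rule Q_complete)

end

lemma sub_cstar_closure_in:
  assumes Q: "cstar_algebra Q" and D: "D \<subseteq> car Q" "\<zero>\<^bsub>Q\<^esub> \<in> D"
    "\<And>x y. x \<in> D \<Longrightarrow> y \<in> D \<Longrightarrow> x \<oplus>\<^bsub>Q\<^esub> y \<in> D" "\<And>x y. x \<in> D \<Longrightarrow> y \<in> D \<Longrightarrow> x \<otimes>\<^bsub>Q\<^esub> y \<in> D"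
    "\<And>c x. x \<in> D \<Longrightarrow> c \<odot>\<^bsub>Q\<^esub> x \<in> D" "\<And>x. x \<in> D \<Longrightarrow> adj Q x \<in> D"
  shows "sub_cstar Q (closure_in Q D)"
proof -
  interpret iso_rep Q "emb Q" by (rule iso_rep_emb[OF Q])
  have sub: "closure_in Q D \<subseteq> car Q" by (auto simp: closure_in_def)
  have dc: "\<And>x. x \<in> D \<Longrightarrow> x \<in> car Q" using D(1) by blast
  show ?thesis
    unfolding sub_cstar_iff[OF sub] image_closure[OF D(1)]
  proof (rule csub_closure)
    show "0 \<in> emb Q ` D" using D(2) f_nul by (metis image_eqI)
  qed (use D dc in \<open>auto simp flip: f_add f_mul f_scl f_adj\<close>)
qed

section \<open>Inductive limits\<close>

locale ind_sys = seq_alg A for A :: "nat \<Rightarrow> 'a star_alg" +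
  fixes \<phi> :: "nat \<Rightarrow> 'a \<Rightarrow> 'a"
  assumes hom: "star_hom (A n) (A (Suc n)) (\<phi> n)" and inj: "inj_on (\<phi> n) (car (A n))"
begin

interpretation A: cstar_algebra "A n" for n by (rule A)
interpretation Q: cstar_algebra Q by (rule cstar_Q)

lemma connect:
  shows "a \<in> car (A m) \<Longrightarrow> connect \<phi> m k a \<in> car (A (m + k))"
    and "a \<in> car (A m) \<Longrightarrow> nrm (A (m + k)) (connect \<phi> m k a) = nrm (A m) a"
    and "a \<in> car (A m) \<Longrightarrow> b \<in> car (A m) \<Longrightarrow>
      connect \<phi> m k (a \<oplus>\<^bsub>A m\<^esub> b) = connect \<phi> m k a \<oplus>\<^bsub>A (m + k)\<^esub> connect \<phi> m k b"
    and "a \<in> car (A m) \<Longrightarrow> b \<in> car (A m) \<Longrightarrow>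
      connect \<phi> m k (a \<otimes>\<^bsub>A m\<^esub> b) = connect \<phi> m k a \<otimes>\<^bsub>A (m + k)\<^esub> connect \<phi> m k b"
    and "a \<in> car (A m) \<Longrightarrow> connect \<phi> m k (c \<odot>\<^bsub>A m\<^esub> a) = c \<odot>\<^bsub>A (m + k)\<^esub> connect \<phi> m k a"
    and "a \<in> car (A m) \<Longrightarrow> connect \<phi> m k (adj (A m) a) = adj (A (m + k)) (connect \<phi> m k a)"
proof -
  show c: "a \<in> car (A m) \<Longrightarrow> connect \<phi> m k a \<in> car (A (m + k))" for a k
    using hom by (induction k) (auto simp: star_hom_def)
  show "a \<in> car (A m) \<Longrightarrow> nrm (A (m + k)) (connect \<phi> m k a) = nrm (A m) a"
    by (induction k) (auto simp: star_hom_isometric[OF A A hom inj] c)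
  show "a \<in> car (A m) \<Longrightarrow> b \<in> car (A m) \<Longrightarrow>
      connect \<phi> m k (a \<oplus>\<^bsub>A m\<^esub> b) = connect \<phi> m k a \<oplus>\<^bsub>A (m + k)\<^esub> connect \<phi> m k b"
    using hom c by (induction k) (auto simp: star_hom_def)
  show "a \<in> car (A m) \<Longrightarrow> b \<in> car (A m) \<Longrightarrow>
      connect \<phi> m k (a \<otimes>\<^bsub>A m\<^esub> b) = connect \<phi> m k a \<otimes>\<^bsub>A (m + k)\<^esub> connect \<phi> m k b"
    using hom c by (induction k) (auto simp: star_hom_def)
  show "a \<in> car (A m) \<Longrightarrow> connect \<phi> m k (c \<odot>\<^bsub>A m\<^esub> a) = c \<odot>\<^bsub>A (m + k)\<^esub> connect \<phi> m k a"
    using hom c by (induction k) (auto simp: star_hom_def)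
  show "a \<in> car (A m) \<Longrightarrow> connect \<phi> m k (adj (A m) a) = adj (A (m + k)) (connect \<phi> m k a)"
    using hom c by (induction k) (auto simp: star_hom_def)
qed

lemma connect_Suc: "connect \<phi> m (Suc k) a = connect \<phi> (Suc m) k (\<phi> m a)"
  by (induction k) auto

definition cseq :: "nat \<Rightarrow> 'a \<Rightarrow> nat \<Rightarrow> 'a" where
  "cseq m a n = (if n < m then \<zero>\<^bsub>A n\<^esub> else connect \<phi> m (n - m) a)"

lemma canon_cseq: "canon A \<phi> m a = cls A (cseq m a)"
  by (simp add: canon_def cseq_def[abs_def])

lemma cseq_closed: "a \<in> car (A m) \<Longrightarrow> cseq m a n \<in> car (A n)"
  using connect(1)[of a m "n - m"] by (auto simp: cseq_def)

lemma nrm_cseq: "a \<in> car (A m) \<Longrightarrow> n \<ge> m \<Longrightarrow> nrm (A n) (cseq m a n) = nrm (A m) a"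
  using connect(2)[of a m "n - m"] by (auto simp: cseq_def)

lemma cseq_bs: assumes a: "a \<in> car (A m)" shows "cseq m a \<in> bs"
proof (rule bsI[OF cseq_closed[OF a], where K="nrm (A m) a"])
  show "nrm (A n) (cseq m a n) \<le> nrm (A m) a" for n
    using nrm_cseq[OF a, of n] A.nrm_nonneg[OF a] by (cases "n < m") (auto simp: cseq_def)
qed

lemma cseq_ops:
  "a \<in> car (A m) \<Longrightarrow> b \<in> car (A m) \<Longrightarrow> cseq m (a \<oplus>\<^bsub>A m\<^esub> b) = (\<lambda>n. cseq m a n \<oplus>\<^bsub>A n\<^esub> cseq m b n)"
  "a \<in> car (A m) \<Longrightarrow> b \<in> car (A m) \<Longrightarrow> cseq m (a \<otimes>\<^bsub>A m\<^esub> b) = (\<lambda>n. cseq m a n \<otimes>\<^bsub>A n\<^esub> cseq m b n)"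
  "a \<in> car (A m) \<Longrightarrow> cseq m (c \<odot>\<^bsub>A m\<^esub> a) = (\<lambda>n. c \<odot>\<^bsub>A n\<^esub> cseq m a n)"
  "a \<in> car (A m) \<Longrightarrow> cseq m (adj (A m) a) = (\<lambda>n. adj (A n) (cseq m a n))"
proof -
  have e: "A (m + (n - m)) = A n" if "\<not> n < m" for n using that by simp
  show "a \<in> car (A m) \<Longrightarrow> b \<in> car (A m) \<Longrightarrow> cseq m (a \<oplus>\<^bsub>A m\<^esub> b) = (\<lambda>n. cseq m a n \<oplus>\<^bsub>A n\<^esub> cseq m b n)"
    using connect(3)[of a m b] by (auto simp: cseq_def fun_eq_iff e)
  show "a \<in> car (A m) \<Longrightarrow> b \<in> car (A m) \<Longrightarrow> cseq m (a \<otimes>\<^bsub>A m\<^esub> b) = (\<lambda>n. cseq m a n \<otimes>\<^bsub>A n\<^esub> cseq m b n)"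
    using connect(4)[of a m b] by (auto simp: cseq_def fun_eq_iff e)
  show "a \<in> car (A m) \<Longrightarrow> cseq m (c \<odot>\<^bsub>A m\<^esub> a) = (\<lambda>n. c \<odot>\<^bsub>A n\<^esub> cseq m a n)"
    using connect(5)[of a m] by (auto simp: cseq_def fun_eq_iff e)
  show "a \<in> car (A m) \<Longrightarrow> cseq m (adj (A m) a) = (\<lambda>n. adj (A n) (cseq m a n))"
    using connect(6)[of a m] by (auto simp: cseq_def fun_eq_iff e)
qed

lemma canon:
  shows canon_closed: "a \<in> car (A m) \<Longrightarrow> canon A \<phi> m a \<in> car Q"
    and nrm_canon: "a \<in> car (A m) \<Longrightarrow> nrm Q (canon A \<phi> m a) = nrm (A m) a"
    and canon_add: "a \<in> car (A m) \<Longrightarrow> b \<in> car (A m) \<Longrightarrow> canon A \<phi> m (a \<oplus>\<^bsub>A m\<^esub> b) = canon A \<phi> m a \<oplus>\<^bsub>Q\<^esub> canon A \<phi> m b"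
    and canon_mul: "a \<in> car (A m) \<Longrightarrow> b \<in> car (A m) \<Longrightarrow> canon A \<phi> m (a \<otimes>\<^bsub>A m\<^esub> b) = canon A \<phi> m a \<otimes>\<^bsub>Q\<^esub> canon A \<phi> m b"
    and canon_scl: "a \<in> car (A m) \<Longrightarrow> canon A \<phi> m (c \<odot>\<^bsub>A m\<^esub> a) = c \<odot>\<^bsub>Q\<^esub> canon A \<phi> m a"
    and canon_adj: "a \<in> car (A m) \<Longrightarrow> canon A \<phi> m (adj (A m) a) = adj Q (canon A \<phi> m a)"
    and canon_step: "a \<in> car (A m) \<Longrightarrow> canon A \<phi> (Suc m) (\<phi> m a) = canon A \<phi> m a"
proof -
  show "a \<in> car (A m) \<Longrightarrow> canon A \<phi> m a \<in> car Q" by (simp add: canon_cseq car_Q cseq_bs)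
  show "a \<in> car (A m) \<Longrightarrow> b \<in> car (A m) \<Longrightarrow> canon A \<phi> m (a \<oplus>\<^bsub>A m\<^esub> b) = canon A \<phi> m a \<oplus>\<^bsub>Q\<^esub> canon A \<phi> m b"
    by (simp add: canon_cseq Q_add cseq_bs cseq_ops)
  show "a \<in> car (A m) \<Longrightarrow> b \<in> car (A m) \<Longrightarrow> canon A \<phi> m (a \<otimes>\<^bsub>A m\<^esub> b) = canon A \<phi> m a \<otimes>\<^bsub>Q\<^esub> canon A \<phi> m b"
    by (simp add: canon_cseq Q_mul cseq_bs cseq_ops)
  show "a \<in> car (A m) \<Longrightarrow> canon A \<phi> m (c \<odot>\<^bsub>A m\<^esub> a) = c \<odot>\<^bsub>Q\<^esub> canon A \<phi> m a"
    by (simp add: canon_cseq Q_scl cseq_bs cseq_ops)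
  show "a \<in> car (A m) \<Longrightarrow> canon A \<phi> m (adj (A m) a) = adj Q (canon A \<phi> m a)"
    by (simp add: canon_cseq Q_adj cseq_bs cseq_ops)
  assume a: "a \<in> car (A m)"
  have "nrm Q (cls A (cseq m a)) \<le> nrm (A m) a"
    unfolding nrm_Q_le_iff[OF cseq_bs[OF a]] using nrm_cseq[OF a] by (auto intro!: exI[of _ m])
  moreover have "nrm (A m) a \<le> nrm Q (cls A (cseq m a))"
  proof (rule field_le_epsilon)
    fix \<delta> :: real assume "\<delta> > 0"
    from nrm_Q_ev[OF cseq_bs[OF a] this] obtain N where
      "\<And>n. n \<ge> N \<Longrightarrow> nrm (A n) (cseq m a n) \<le> nrm Q (cls A (cseq m a)) + \<delta>" by metis
    from this[of "max N m"] show "nrm (A m) a \<le> nrm Q (cls A (cseq m a)) + \<delta>" by (simp add: nrm_cseq[OF a])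
  qed
  ultimately show "nrm Q (canon A \<phi> m a) = nrm (A m) a" by (simp add: canon_cseq)
  have pa: "\<phi> m a \<in> car (A (Suc m))" using hom a by (auto simp: star_hom_def)
  have "cseq (Suc m) (\<phi> m a) n = cseq m a n" if "n \<ge> Suc m" for n
  proof -
    have "n - m = Suc (n - Suc m)" using that by simp
    then show ?thesis using that by (simp add: cseq_def connect_Suc del: connect.simps)
  qed
  then have "(\<lambda>n. nrm (A n) (cseq (Suc m) (\<phi> m a) n \<ominus>\<^bsub>A n\<^esub> cseq m a n)) \<longlonglongrightarrow> 0"
    by (intro tendsto_eventually) (auto simp: eventually_sequentially cseq_closed[OF a] intro!: exI[of _ "Suc m"])
  then show "canon A \<phi> (Suc m) (\<phi> m a) = canon A \<phi> m a"
    by (simp add: canon_cseq cls_eq_iff cseq_bs a pa)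
qed

lemma canon_image_mono:
  assumes S: "\<And>n. S n \<subseteq> car (A n)" "\<And>n. \<phi> n ` S n \<subseteq> S (Suc n)" and mn: "m \<le> n"
  shows "canon A \<phi> m ` S m \<subseteq> canon A \<phi> n ` S n"
proof (rule lift_Suc_mono_le[OF _ mn, of "\<lambda>n. canon A \<phi> n ` S n"])
  fix n show "canon A \<phi> n ` S n \<subseteq> canon A \<phi> (Suc n) ` S (Suc n)"
  proof
    fix X assume "X \<in> canon A \<phi> n ` S n"
    then obtain a where "X = canon A \<phi> n a" "a \<in> S n" by blast
    then have "X = canon A \<phi> (Suc n) (\<phi> n a)" "\<phi> n a \<in> S (Suc n)" using canon_step S by blast+
    then show "X \<in> canon A \<phi> (Suc n) ` S (Suc n)" by blast
  qed
qed

definition "D = (\<Union>n. canon A \<phi> n ` car (A n))"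

lemma D_I: "a \<in> car (A m) \<Longrightarrow> canon A \<phi> m a \<in> D"
  by (auto simp: D_def)

lemma D_E: assumes "x \<in> D" obtains m a where "a \<in> car (A m)" "x = canon A \<phi> m a"
  using assms by (auto simp: D_def)

lemma phi_car: "\<phi> n ` car (A n) \<subseteq> car (A (Suc n))"
  using hom[of n] by (auto simp: star_hom_def)

lemma sub_cstar_lim: "sub_cstar Q (closure_in Q D)"
proof (rule sub_cstar_closure_in[OF cstar_Q])
  show "D \<subseteq> car Q" by (auto simp: D_def canon_closed)
  have "canon A \<phi> 0 \<zero>\<^bsub>A 0\<^esub> = \<zero>\<^bsub>Q\<^esub>" using nrm_canon[of "\<zero>\<^bsub>A 0\<^esub>" 0] canon_closed[of "\<zero>\<^bsub>A 0\<^esub>" 0] by (simp add: Q.nrm_eq_0)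
  then show "\<zero>\<^bsub>Q\<^esub> \<in> D" unfolding D_def using A.nul_closed by (metis UN_I UNIV_I image_eqI)
  show "c \<odot>\<^bsub>Q\<^esub> x \<in> D" if "x \<in> D" for c x
    using that by (auto simp: D_I simp flip: canon_scl elim!: D_E)
  show "adj Q x \<in> D" if "x \<in> D" for x
    using that by (auto simp: D_I simp flip: canon_adj elim!: D_E)
  fix x y assume "x \<in> D" "y \<in> D"
  then obtain m n where "x \<in> canon A \<phi> m ` car (A m)" "y \<in> canon A \<phi> n ` car (A n)" by (auto simp: D_def)
  then have "x \<in> canon A \<phi> (max m n) ` car (A (max m n))" "y \<in> canon A \<phi> (max m n) ` car (A (max m n))"
    using canon_image_mono[of "\<lambda>n. car (A n)" m "max m n", OF _ phi_car]
      canon_image_mono[of "\<lambda>n. car (A n)" n "max m n", OF _ phi_car] by auto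
  then show "x \<oplus>\<^bsub>Q\<^esub> y \<in> D" "x \<otimes>\<^bsub>Q\<^esub> y \<in> D"
    by (auto simp: D_I simp flip: canon_add canon_mul)
qed

abbreviation "L \<equiv> ind_lim A \<phi>"

lemma L_eq: "L = Q\<lparr>car := closure_in Q D\<rparr>" by (simp add: ind_lim_def D_def)

lemma cstar_L: "cstar_algebra L"
  unfolding L_eq by (rule cstar_algebra_sub[OF cstar_Q sub_cstar_lim])

lemma L_ops: "\<zero>\<^bsub>L\<^esub> = \<zero>\<^bsub>Q\<^esub>" "x \<oplus>\<^bsub>L\<^esub> y = x \<oplus>\<^bsub>Q\<^esub> y" "x \<otimes>\<^bsub>L\<^esub> y = x \<otimes>\<^bsub>Q\<^esub> y" "c \<odot>\<^bsub>L\<^esub> x = c \<odot>\<^bsub>Q\<^esub> x"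
  "adj L x = adj Q x" "nrm L x = nrm Q x" "x \<ominus>\<^bsub>L\<^esub> y = x \<ominus>\<^bsub>Q\<^esub> y"
  by (simp_all add: L_eq sub_def)

lemma closure_in_superset: "S \<subseteq> car Q \<Longrightarrow> S \<subseteq> closure_in Q S"
  by (force simp: closure_in_def)

lemma canon_L: "a \<in> car (A m) \<Longrightarrow> canon A \<phi> m a \<in> car L"
  using closure_in_superset[of D] canon_closed by (fastforce simp: L_eq D_def)

lemma car_L: "car L = closure_in L D"
proof -
  have "closure_in L D = closure_in Q D \<inter> car L" by (auto simp: closure_in_def sub_def L_eq)
  then show ?thesis by (simp add: L_eq)
qed

end

section \<open>Limits of subalgebras inside the limit\<close>

locale ind_sys_sub = ind_sys +
  fixes B :: "nat \<Rightarrow> 'a set"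
  assumes sub: "sub_cstar (A n) (B n)" and phi_B: "\<phi> n ` B n \<subseteq> B (Suc n)"
begin

interpretation A: cstar_algebra "A n" for n by (rule A)
interpretation Q: cstar_algebra Q by (rule cstar_Q)

definition "A' = (\<lambda>n. (A n)\<lparr>car := B n\<rparr>)"

lemma BA: "B n \<subseteq> car (A n)" using sub by (simp add: sub_cstar_def)

lemma A'_simps: "car (A' n) = B n" "nul (A' n) = nul (A n)" "add (A' n) = add (A n)" "scl (A' n) = scl (A n)"
  "mul (A' n) = mul (A n)" "adj (A' n) = adj (A n)" "nrm (A' n) = nrm (A n)" "Defs.sub (A' n) = Defs.sub (A n)"
  by (simp_all add: A'_def sub_def fun_eq_iff)

sublocale sub: ind_sys A' \<phi>
proof (intro ind_sys.intro seq_alg.intro ind_sys_axioms.intro)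
  show "cstar_algebra (A' n)" for n unfolding A'_def by (rule cstar_algebra_sub[OF A sub])
  show "star_hom (A' n) (A' (Suc n)) (\<phi> n)" for n
    using hom[of n] BA[of n] phi_B[of n] unfolding star_hom_def A'_simps by (auto simp: subset_iff)
  show "inj_on (\<phi> n) (car (A' n))" for n using inj BA unfolding A'_simps by (rule inj_on_subset)
qed

lemma bs_A': "x \<in> sub.bs \<Longrightarrow> x \<in> bs"
  using BA by (auto simp: bounded_seqs_def A'_simps)

lemma nrm_Q': "x \<in> sub.bs \<Longrightarrow> nrm sub.Q (cls A' x) = nrm Q (cls A x)"
proof -
  assume x: "x \<in> sub.bs"
  then have "nrm sub.Q (cls A' x) \<le> c \<longleftrightarrow> nrm Q (cls A x) \<le> c" for c
    by (simp add: nrm_Q_le_iff sub.nrm_Q_le_iff bs_A' A'_simps)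
  then show ?thesis by (meson order_antisym order_refl)
qed

lemma cls_A'_subset: "x \<in> sub.bs \<Longrightarrow> cls A' x \<subseteq> cls A x"
  by (auto simp: mem_cls sub.mem_cls bs_A' A'_simps)

lemma cseq_A': "sub.cseq = cseq"
  by (simp add: fun_eq_iff cseq_def sub.cseq_def A'_simps)

lemma cseq_B: "b \<in> B m \<Longrightarrow> cseq m b \<in> sub.bs"
  using sub.cseq_bs[of b m] by (simp add: A'_simps cseq_A')

definition "DB = (\<Union>n. canon A \<phi> n ` B n)"

lemma DB_D: "DB \<subseteq> D" using BA by (fastforce simp: DB_def D_def)

lemma nrm_diff_A':
  "x \<in> sub.bs \<Longrightarrow> y \<in> sub.bs \<Longrightarrow> nrm sub.Q (cls A' x \<ominus>\<^bsub>sub.Q\<^esub> cls A' y) = nrm Q (cls A x \<ominus>\<^bsub>Q\<^esub> cls A y)"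
  using nrm_Q'[OF sub.bs_sub, of x y] by (simp add: sub.Q_sub Q_sub bs_A' A'_simps)

text \<open>The norm of a class is a limit superior and hence the same among sequences in
  \<open>B n\<close> as among sequences in \<open>A n\<close>. So the canonical map between the two
  quotients is isometric, and it carries the closure of the stages of \<open>B\<close> onto a closed
  set.\<close>

lemma ind_lim_sub_eq: "ind_lim_sub A B \<phi> = closure_in Q DB"
proof (intro equalityI subsetI)
  fix Y assume "Y \<in> ind_lim_sub A B \<phi>"
  then obtain X where Y: "Y \<in> car L" and X: "X \<in> closure_in sub.Q sub.D" "X \<subseteq> Y"
    unfolding ind_lim_sub_def A'_def[symmetric] sub.L_eq by auto
  have "closure_in sub.Q sub.D \<subseteq> car sub.Q" "closure_in Q D \<subseteq> car Q" by (auto simp: closure_in_def)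
  then have "X \<in> car sub.Q" "Y \<in> car Q" using X Y unfolding L_eq by auto
  then obtain x y where x: "x \<in> sub.bs" "X = cls A' x" and y: "y \<in> bs" "Y = cls A y"
    unfolding car_Q sub.car_Q by blast
  have "x \<in> cls A y" using sub.cls_refl[OF x(1)] x y X(2) by blast
  then have Yx: "Y = cls A x" using y by (auto simp: cls_eq_iff mem_cls)
  show "Y \<in> closure_in Q DB"
    unfolding closure_in_def
  proof (clarsimp, intro conjI allI impI)
    show "Y \<in> car Q" using y by (auto simp: car_Q)
    fix e :: real assume "e > 0"
    then obtain m b where b: "b \<in> B m" "nrm sub.Q (X \<ominus>\<^bsub>sub.Q\<^esub> canon A' \<phi> m b) < e"
      using X(1) unfolding closure_in_def sub.D_def by (auto simp: A'_simps)
    then have "nrm Q (Y \<ominus>\<^bsub>Q\<^esub> canon A \<phi> m b) < e"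
      using nrm_diff_A'[OF x(1) cseq_B[OF b(1)]] x Yx by (simp add: canon_cseq sub.canon_cseq cseq_A')
    then show "\<exists>y\<in>DB. nrm Q (Y \<ominus>\<^bsub>Q\<^esub> y) < e" using b by (auto simp: DB_def)
  qed
next
  fix Y assume Y: "Y \<in> closure_in Q DB"
  then have YQ: "Y \<in> car Q" and YL: "Y \<in> car L" using DB_D unfolding L_eq by (simp_all add: closure_in_def) blast
  have "\<exists>m b. b \<in> B m \<and> nrm Q (Y \<ominus>\<^bsub>Q\<^esub> canon A \<phi> m b) < inverse (real (Suc k))" for k
  proof -
    have "inverse (real (Suc k)) > 0" by simp
    then obtain X where "X \<in> DB" "nrm Q (Y \<ominus>\<^bsub>Q\<^esub> X) < inverse (real (Suc k))"
      using Y unfolding closure_in_def by blast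
    then show ?thesis unfolding DB_def by blast
  qed
  then obtain m b where b: "\<And>k. b k \<in> B (m k)"
    "\<And>k. nrm Q (Y \<ominus>\<^bsub>Q\<^esub> canon A \<phi> (m k) (b k)) < inverse (real (Suc k))" by metis
  define s where "s k = cseq (m k) (b k)" for k
  have sb: "s k \<in> sub.bs" for k unfolding s_def by (rule cseq_B[OF b(1)])
  have sQ: "cls A (s k) \<in> car Q" for k using bs_A'[OF sb] by (simp add: car_Q)
  have "nrm Q (Y \<ominus>\<^bsub>Q\<^esub> cls A (s k)) \<le> inverse (real (Suc k))" for k
    using b(2)[of k] by (simp add: canon_cseq s_def)
  then have lim: "(\<lambda>k. nrm Q (Y \<ominus>\<^bsub>Q\<^esub> cls A (s k))) \<longlonglongrightarrow> 0"
    using YQ sQ by (intro null_squeeze[OF LIMSEQ_inverse_real_of_nat]) (auto intro!: Q.nrm_nonneg)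
  \<comment> \<open>\<open>Y\<close> is not yet known to have a representative with values in the
    \<open>B n\<close>. Its approximants have one and are Cauchy in the smaller quotient, whose
    completeness provides a limit there.\<close>
  have "\<exists>X\<in>car sub.Q. (\<lambda>k. nrm sub.Q (cls A' (s k) \<ominus>\<^bsub>sub.Q\<^esub> X)) \<longlonglongrightarrow> 0"
  proof (rule sub.Q_complete)
    show "cls A' (s k) \<in> car sub.Q" for k using sb by (simp add: sub.car_Q)
    fix e :: real assume "e > 0"
    then obtain N where N: "\<And>k. k \<ge> N \<Longrightarrow> nrm Q (Y \<ominus>\<^bsub>Q\<^esub> cls A (s k)) < e / 2"
      using order_tendstoD(2)[OF lim, of "e / 2"] by (auto simp: eventually_sequentially)
    have "nrm sub.Q (cls A' (s i) \<ominus>\<^bsub>sub.Q\<^esub> cls A' (s j)) < e" if "i \<ge> N" "j \<ge> N" for i j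
      using Q.nrm_sub_triangle[OF sQ YQ sQ, of i j] Q.nrm_sub_commute[OF sQ YQ, of i] N[OF that(1)] N[OF that(2)]
      by (simp add: nrm_diff_A'[OF sb sb])
    then show "\<exists>N. \<forall>i\<ge>N. \<forall>j\<ge>N. nrm sub.Q (cls A' (s i) \<ominus>\<^bsub>sub.Q\<^esub> cls A' (s j)) < e" by blast
  qed
  then obtain x where x: "x \<in> sub.bs" "(\<lambda>k. nrm sub.Q (cls A' (s k) \<ominus>\<^bsub>sub.Q\<^esub> cls A' x)) \<longlonglongrightarrow> 0"
    by (auto simp: sub.car_Q)
  then have lim2: "(\<lambda>k. nrm Q (cls A (s k) \<ominus>\<^bsub>Q\<^esub> cls A x)) \<longlonglongrightarrow> 0"
    by (simp add: nrm_diff_A'[OF sb x(1)])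
  have xQ: "cls A x \<in> car Q" using bs_A'[OF x(1)] by (simp add: car_Q)
  have "Y = cls A x"
    by (rule Q.lim_unique[OF sQ YQ xQ _ lim2]) (use lim in \<open>simp add: Q.nrm_sub_commute[OF sQ YQ]\<close>)
  moreover have "cls A' x \<in> closure_in sub.Q sub.D"
    unfolding closure_in_def
  proof (clarsimp, intro conjI allI impI)
    show "cls A' x \<in> car sub.Q" using x by (auto simp: sub.car_Q)
    fix e :: real assume "e > 0"
    then obtain k where "nrm Q (cls A (s k) \<ominus>\<^bsub>Q\<^esub> cls A x) < e"
      using order_tendstoD(2)[OF lim2] eventually_happens by fastforce
    then have "nrm sub.Q (cls A' x \<ominus>\<^bsub>sub.Q\<^esub> cls A' (s k)) < e"
      using nrm_diff_A'[OF x(1) sb] Q.nrm_sub_commute[OF xQ sQ] by simp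
    moreover have "cls A' (s k) = canon A' \<phi> (m k) (b k)" by (simp add: s_def sub.canon_cseq cseq_A')
    ultimately show "\<exists>y\<in>sub.D. nrm sub.Q (cls A' x \<ominus>\<^bsub>sub.Q\<^esub> y) < e"
      using b(1)[of k] unfolding sub.D_def by (auto simp: A'_simps)
  qed
  ultimately show "Y \<in> ind_lim_sub A B \<phi>"
    using YL cls_A'_subset[OF x(1)] unfolding ind_lim_sub_def A'_def[symmetric] sub.L_eq by auto
qed

end

section \<open>Almost-bimodule maps vanishing on a masa\<close>

lemma continuous_on_cexp: assumes "csub A" "cexp A B P" shows "continuous_on A P"
proof (rule continuous_onI)
  have diff: "P (x - y) = P x - P y" if "x \<in> A" "y \<in> A" for x y
  proof -
    have "x + cx (-1) * y = x - y" by (simp add: cx_minus)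
    moreover have "P (x + cx (-1) * y) = P x + cx (-1) * P y"
      using assms that csubD(5)[OF assms(1), of y "-1"] unfolding cexp_def by metis
    ultimately show ?thesis by (simp add: cx_minus)
  qed
  fix x and e :: real assume "x \<in> A" "e > 0"
  then show "\<exists>d>0. \<forall>x'\<in>A. dist x' x < d \<longrightarrow> dist (P x') (P x) \<le> e"
    using assms csubD(9)[OF assms(1)] unfolding cexp_def dist_norm
    by (intro exI[of _ e]) (metis diff less_imp_le order_trans)
qed

lemma continuous_on_seq:
  "continuous_on A E \<Longrightarrow> (\<And>k. f k \<in> A) \<Longrightarrow> f \<longlonglongrightarrow> x \<Longrightarrow> x \<in> A \<Longrightarrow> (\<lambda>k. E (f k)) \<longlonglongrightarrow> E x"
  for E :: "'a::metric_space \<Rightarrow> 'b::metric_space"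
  unfolding continuous_on_sequentially comp_def by auto

locale masa_apx =
  fixes A B :: "'u::cstar1 set"
  assumes A: "aug_csub A" and masa: "masa A B" and apx: "apx A B"
begin

sublocale A: aug_csub A by (rule A)

lemma B: "csub B" "B \<subseteq> A" "b \<in> B \<Longrightarrow> b' \<in> B \<Longrightarrow> b * b' = b' * b"
  and masaD: "x \<in> A \<Longrightarrow> (\<And>b. b \<in> B \<Longrightarrow> x * b = b * x) \<Longrightarrow> x \<in> B"
  using masa by (auto simp: masa_def)

sublocale B: abelian_csub B by standard (use B A.aug in auto)

lemma BA: "b \<in> B \<Longrightarrow> b \<in> A" using B by blast

text \<open>Being a normalizer only places \<open>star n * b * n\<close> in \<open>B\<close> for
  \<open>b\<close> in \<open>B\<close>. Letting \<open>b\<close> run through an approximate unit in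
  \<open>B\<close> gives \<open>star n * n\<close> in the limit.\<close>

lemma nz_square: assumes n: "n \<in> nz A B" shows "star n * n \<in> B" "n * star n \<in> B"
proof -
  have nA: "n \<in> A" "star n \<in> A" using n csubD(6)[OF A.csub] by (auto simp: nz_def)
  have "\<exists>e\<in>B. norm (e * n - n) < inverse (real (Suc k)) \<and> norm (e * star n - star n) < inverse (real (Suc k))" for k
  proof -
    have "finite {n, star n}" "{n, star n} \<subseteq> A" "inverse (real (Suc k)) > 0" using nA by auto
    then obtain e where "e \<in> B" "\<forall>a\<in>{n, star n}. norm (e * a - a) < inverse (real (Suc k))"
      using apx unfolding apx_def by meson
    then show ?thesis by auto
  qed
  then obtain e where e: "\<And>k. e k \<in> B" "\<And>k. norm (e k * n - n) < inverse (real (Suc k))"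
    "\<And>k. norm (e k * star n - star n) < inverse (real (Suc k))" by metis
  have lim: "(\<lambda>k. e k * x) \<longlonglongrightarrow> x" if "\<And>k. norm (e k * x - x) < inverse (real (Suc k))" for x
  proof -
    have "(\<lambda>k. norm (e k * x - x)) \<longlonglongrightarrow> 0"
      by (rule null_squeeze[OF LIMSEQ_inverse_real_of_nat]) (use that less_imp_le in auto)
    then show ?thesis by (simp add: tendsto_norm_zero_iff LIM_zero_iff)
  qed
  have "(\<lambda>k. star n * (e k * n)) \<longlonglongrightarrow> star n * n" "(\<lambda>k. n * (e k * star n)) \<longlonglongrightarrow> n * star n"
    by (intro tendsto_intros lim e)+
  moreover have "star n * (e k * n) \<in> B" "n * (e k * star n) \<in> B" for k
    using n e(1)[of k] by (auto simp: nz_def mult.assoc)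
  ultimately show "star n * n \<in> B" and "n * star n \<in> B"
    using closed_sequentially[OF csubD(1)[OF B(1)], of "\<lambda>k. star n * (e k * n)"]
      closed_sequentially[OF csubD(1)[OF B(1)], of "\<lambda>k. n * (e k * star n)"] by simp_all
qed

text \<open>
  In the groupoid picture, \<open>d = E (star n)\<close> measures \<open>E\<close> on the bisection of \<open>n\<close>, and the hypothesis
  says that \<open>d\<close> is small off the fixed points of the partial homeomorphism of \<open>n\<close>. Where
  \<open>d\<close> is large all points are hence fixed, so \<open>n\<close> commutes with \<open>B\<close> there and thus lies in the masa \<open>B\<close>,
  where \<open>E\<close> vanishes. Points are avoided as follows. For a unitary \<open>x\<close> near \<open>B\<close>,
  \<open>G x = star (c x) * c x\<close> plays the role of the squared distance of \<open>x\<close> from its translate by \<open>n\<close>.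
  The identity for \<open>G (x * x)\<close> makes this distance grow under squaring as long as it is small,
  while on the support of \<open>f\<close> it remains small for all unitaries, so it vanishes there.
\<close>

lemma key_estimate:
  assumes n: "n \<in> nz A B" and EB: "\<And>x. x \<in> A \<Longrightarrow> E x \<in> B"
    and EL: "\<And>b x. b \<in> B \<Longrightarrow> x \<in> A \<Longrightarrow> E (b * x) = b * E x" and E0: "\<And>b. b \<in> B \<Longrightarrow> E b = 0"
    and ER: "\<And>b. b \<in> B \<Longrightarrow> norm (E (star n * b) - E (star n) * b) \<le> \<delta> * norm b" and \<delta>: "\<delta> \<ge> 0"
  shows "norm (star n * n * E (star n)) \<le> 2 * norm (star n * n) * \<delta>"
proof -
  define w where "w = star n * n"
  define \<rho> where "\<rho> = n * star n"
  define d where "d = E (star n)"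
  \<comment> \<open>Under the groupoid picture \<open>\<theta> x\<close> is the translate of
    \<open>x\<close> by the partial homeomorphism, weighted by \<open>w\<close>; so
    \<open>c x\<close> is the weighted difference of \<open>x\<close> and its translate.\<close>
  define \<theta> where "\<theta> x = star n * x * n" for x
  define c where "c x = w * x - \<theta> x" for x
  define G where "G x = star (c x) * c x" for x
  have nA: "n \<in> A" "star n \<in> A" using n csubD(6)[OF A.csub] by (auto simp: nz_def)
  have wB: "w \<in> B" "\<rho> \<in> B" using nz_square[OF n] by (auto simp: w_def \<rho>_def)
  have dB: "d \<in> B" unfolding d_def by (rule EB[OF nA(2)])
  have B1: "b \<in> u1 B" if "b \<in> B" for b by (rule B.subset_u1[OF that])
  have w: "pos w" "star w = w" by (auto simp: w_def pos_star_mult star_mult)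
  have \<theta>b: "\<theta> b \<in> B" if "b \<in> B" for b using n that by (auto simp: nz_def \<theta>_def)
  have \<theta>add: "\<theta> (x + y) = \<theta> x + \<theta> y" for x y by (simp add: \<theta>_def algebra_simps)
  have \<theta>cx: "\<theta> (cx a * x) = cx a * \<theta> x" for a x
    by (simp add: \<theta>_def mult.assoc cx_left_commute)
  have \<theta>1: "\<theta> 1 = w" by (simp add: \<theta>_def w_def)
  have \<theta>B: "\<theta> x \<in> B" if x: "x \<in> u1 B" for x
  proof -
    obtain a b where "x = cx a * 1 + b" "b \<in> B" using B.u1_cases[OF x] by (metis mult.right_neutral)
    then show ?thesis unfolding \<open>x = _\<close> \<theta>add \<theta>cx \<theta>1 using csubD(3,5)[OF B(1)] wB \<theta>b by auto
  qed
  have n\<theta>: "n * \<theta> b = b * (n * w)" if "b \<in> B" for b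
  proof -
    have "n * \<theta> b = \<rho> * b * n" by (simp add: \<theta>_def \<rho>_def mult.assoc)
    also have "\<dots> = b * \<rho> * n" using B(3)[OF wB(2) that] by simp
    finally show ?thesis by (simp add: \<rho>_def w_def mult.assoc)
  qed
  have \<rho>1: "x * \<rho> = \<rho> * x" if "x \<in> u1 B" for x by (rule B.u1_comm[OF that B1[OF wB(2)]])
  have \<theta>mul: "\<theta> x * \<theta> y = w * \<theta> (x * y)" if x: "x \<in> u1 B" for x y
  proof -
    have "\<theta> x * \<theta> y = star n * (x * \<rho>) * y * n" by (simp add: \<theta>_def \<rho>_def mult.assoc)
    also have "\<dots> = w * \<theta> (x * y)" unfolding \<rho>1[OF x] by (simp add: \<theta>_def \<rho>_def w_def mult.assoc)
    finally show ?thesis .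
  qed
  have \<theta>star: "star (\<theta> x) = \<theta> (star x)" for x by (simp add: \<theta>_def star_mult mult.assoc)
  have cadd: "c (x + y) = c x + c y" for x y by (simp add: c_def \<theta>add algebra_simps)
  have ccx: "c (cx a * x) = cx a * c x" for a x
    by (simp add: c_def \<theta>cx cx_left_commute right_diff_distrib)
  have c1: "c 1 = 0" by (simp add: c_def \<theta>1)
  have cB: "c x \<in> B" if x: "x \<in> u1 B" for x
    unfolding c_def by (intro csubD(9)[OF B(1)] B.u1_mult_right \<theta>B wB x)
  define \<eta> where "\<eta> = 2 * norm w * \<delta>"
  have \<eta>0: "\<eta> \<ge> 0" using \<delta> by (simp add: \<eta>_def)
  \<comment> \<open>Left linearity turns \<open>\<theta> b * d\<close> into
    \<open>w * E (star n * b)\<close>, and right linearity up to \<delta> compares this with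
    \<open>w * d * b\<close>. The factor 2 in \<eta> pays for the removal of the scalar part of
    \<open>x\<close>, as |aug x| \<le> norm x.\<close>
  have est: "norm (c x * d) \<le> \<eta> * norm x" if x: "x \<in> u1 B" for x
  proof -
    define b where "b = x - cx (aug x)"
    have bB: "b \<in> B" using x by (simp add: b_def u1_def)
    have "x = cx (aug x) * 1 + b" by (simp add: b_def)
    then have cb: "c x = c b" using cadd ccx c1 by (metis add_0 mult_zero_right)
    have "\<theta> b * d = E (\<theta> b * star n)" unfolding d_def by (rule EL[OF \<theta>b[OF bB] nA(2), symmetric])
    also have "\<theta> b * star n = star n * (b * \<rho>)" by (simp add: \<theta>_def \<rho>_def mult.assoc)
    also have "\<dots> = w * (star n * b)" using B(3)[OF bB wB(2)] by (simp add: \<rho>_def w_def mult.assoc)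
    also have "E \<dots> = w * E (star n * b)"
      by (rule EL[OF wB(1)]) (use csubD(4)[OF A.csub] nA BA bB in auto)
    finally have "c b * d = w * (d * b - E (star n * b))"
      using B(3)[OF bB dB] by (simp add: c_def algebra_simps mult.assoc)
    then have "norm (c b * d) \<le> norm w * norm (d * b - E (star n * b))" by (metis norm_mult_ineq)
    also have "\<dots> \<le> norm w * (\<delta> * norm b)"
      using ER[OF bB] by (intro mult_left_mono) (auto simp: d_def norm_minus_commute)
    also have "\<dots> \<le> norm w * (\<delta> * (2 * norm x))"
    proof -
      have "norm b \<le> norm x + cmod (aug x)" unfolding b_def by (metis norm_triangle_ineq4 norm_cx)
      then have "norm b \<le> 2 * norm x" using aug_le[of x] by simp
      then show ?thesis using \<delta> by (intro mult_left_mono) auto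
    qed
    finally show ?thesis unfolding cb \<eta>_def by (simp add: mult_ac)
  qed
  have "norm (w * d) \<le> \<eta> + \<epsilon>" if \<epsilon>: "\<epsilon> > 0" for \<epsilon>
  proof -
    \<comment> \<open>The slack \<epsilon> keeps \<kappa> positive when \<eta> is 0, since \<kappa>
      is divided by.\<close>
    define \<kappa> where "\<kappa> = (\<eta> + \<epsilon>)\<^sup>2"
    have \<kappa>: "\<kappa> > 0" using \<epsilon> \<eta>0 by (simp add: \<kappa>_def)
    define D where "D = star d * d"
    have D: "pos D" "D \<in> B" using csubD(4,6)[OF B(1)] dB by (auto simp: D_def pos_star_mult)
    define t where "t = star (w * d) * (w * d)"
    have tD: "t = w * w * D"
    proof -
      have "t = star d * (w * w * d)" by (simp add: t_def D_def star_mult w mult.assoc)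
      also have "\<dots> = w * w * D"
        unfolding D_def using B(3)[OF csubD(6)[OF B(1) dB], of "w * w"] csubD(4)[OF B(1) wB(1) wB(1)]
        by (metis mult.assoc)
      finally show ?thesis .
    qed
    have tB: "t \<in> B" unfolding tD using csubD(4)[OF B(1)] wB D by blast
    have t1: "t - of_real \<kappa> \<in> u1 B" using B1[OF tB] B.u1_rsub(6,9) by blast
    have "sa (t - of_real \<kappa>)" unfolding t_def by (intro sa_intros)
    \<comment> \<open>The positive part \<open>f\<close> lives where the absolute value of
      \<open>w * d\<close> exceeds \<eta> + \<epsilon>; the aim is \<open>f = 0\<close>.\<close>
    then obtain f g where fg: "pos f" "pos g" "f * g = 0" "g * f = 0" "t - of_real \<kappa> = f - g"
      "\<And>T. rsub T \<Longrightarrow> t - of_real \<kappa> \<in> T \<Longrightarrow> f \<in> T \<and> g \<in> T" using pos_part by metis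
    have fB: "f \<in> u1 B" using fg(6)[OF B.rsub_u1 t1] by blast
    have "t = of_real \<kappa> + (f - g)" using fg(5) by (simp add: algebra_simps)
    then have "f * t = f * (of_real \<kappa> + (f - g))" by simp
    then have ft: "f * t = \<kappa> *\<^sub>R f + f * f" by (simp add: algebra_simps fg of_real_def)
    have mem: "w \<in> u1 B" "f \<in> u1 B" "D \<in> u1 B" "d \<in> u1 B" "star d \<in> u1 B" "t \<in> u1 B"
      using wB D dB fB tB B1 csubD(6)[OF B(1)] by auto
    note u1c = B.u1_comm B.u1_lcomm B.u1_mult B.u1_add B.u1_rsub(6)
    \<comment> \<open>On the support of \<open>f\<close> the element \<open>w * w * D = t\<close>
      exceeds \<kappa>, whereas \<open>G x * D\<close> is at most \<kappa> by \<open>est\<close>.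
      Hence \<open>G x\<close> is at most \<open>w * w\<close> there.\<close>
    have main: "pos (f * (w * w) - f * G x)" if x: "x \<in> u1 B" "star x * x = 1" for x
    proof -
      have "(norm x)\<^sup>2 = 1" using norm_star_mult[of x] x(2) by simp
      then have nx: "norm x = 1" by (metis norm_ge_zero one_power2 power2_eq_iff_nonneg zero_le_one)
      have cm: "c x \<in> u1 B" "star (c x) \<in> u1 B" "G x \<in> u1 B"
        using cB[OF x(1)] csubD(4,6)[OF B(1)] B1 by (auto simp: G_def)
      have pG: "pos (G x)" by (simp add: G_def pos_star_mult)
      have GD: "star (c x * d) * (c x * d) = G x * D"
        using cm mem by (simp add: star_mult G_def D_def mult.assoc u1c)
      have "norm (c x * d) \<le> \<eta> + \<epsilon>" using est[OF x(1)] nx \<epsilon> by simp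
      then have "norm (G x * D) \<le> \<kappa>"
        using norm_star_mult[of "c x * d"] unfolding GD \<kappa>_def by (simp add: power_mono)
      then have 1: "pos (of_real \<kappa> - G x * D)" unfolding GD[symmetric] by (intro pos_norm_minus sa_intros)
      have pww: "pos (w * w)" using pos_square pos_sa w by blast
      have pwf: "pos (w * w * f)"
        by (rule pos_mult_commute[OF pww fg(1)]) (rule B.u1_comm, use mem u1c in auto)
      have 2: "pos ((of_real \<kappa> - G x * D) * (w * w * f))"
        by (rule pos_mult_commute[OF 1 pwf], rule B.u1_comm)
          (use mem cm u1c B.u1_rsub(9) in auto)
      have "(of_real \<kappa> - G x * D) * (w * w * f) = \<kappa> *\<^sub>R (w * w * f) - f * t * G x"
        using cm mem by (simp add: left_diff_distrib of_real_def tD mult.assoc u1c)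
      also have "\<dots> = \<kappa> *\<^sub>R (f * (w * w) - f * G x) - f * f * G x"
        unfolding ft using mem by (simp add: algebra_simps mult.assoc u1c)
      finally have "pos (\<kappa> *\<^sub>R (f * (w * w) - f * G x) - f * f * G x)" using 2 by simp
      moreover have "pos (f * f * G x)"
        by (rule pos_mult_commute[OF pos_square[OF pos_sa[OF fg(1)]] pG], rule B.u1_comm)
          (use mem cm u1c in auto)
      ultimately have "pos (\<kappa> *\<^sub>R (f * (w * w) - f * G x))"
        using pos_add by (metis diff_add_cancel)
      from pos_scaleR[OF this, of "1 / \<kappa>"] \<kappa> show ?thesis by simp
    qed
    define H where "H x = f * (w * w) * G x" for x
    \<comment> \<open>Here p and q have absolute value w, and |p^2 - q^2|^2 = |p - q|^2 |p + q|^2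
      with |p + q|^2 = 4 w^2 - |p - q|^2 by the parallelogram law. On the support of
      \<open>f\<close> the second factor is at least 3 w^2 by \<open>main\<close>.\<close>
    have dbl: "3 * norm (H x) \<le> norm (H (x * x))" if x: "x \<in> u1 B" "star x * x = 1" for x
    proof -
      define p where "p = w * x"
      define q where "q = \<theta> x"
      have xs: "star x \<in> u1 B" "x * x \<in> u1 B" using x B.u1_star B.u1_mult by auto
      have m2: "p \<in> u1 B" "q \<in> u1 B" "star p \<in> u1 B" "star q \<in> u1 B" "G x \<in> u1 B" "G (x * x) \<in> u1 B"
        "c (x * x) \<in> u1 B" "star (c (x * x)) \<in> u1 B"
        using x(1) xs(2) mem B1 \<theta>B[OF x(1)] B.u1_mult B.u1_star cB csubD(4,6)[OF B(1)] by (auto simp: p_def q_def G_def)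
      have cpq: "c x = p - q" by (simp add: c_def p_def q_def)
      have pp: "star p * p = w * w"
      proof -
        have "star p * p = star x * x * (w * w)"
          using x xs mem by (simp add: p_def star_mult w mult.assoc u1c)
        then show ?thesis by (simp add: x(2))
      qed
      have qq: "star q * q = w * w"
        unfolding q_def \<theta>star by (simp add: \<theta>mul xs x(2) \<theta>1)
      have wc: "w * c (x * x) = p * p - q * q"
        unfolding c_def right_diff_distrib q_def \<theta>mul[OF x(1)]
        using x mem by (simp add: p_def mult.assoc u1c)
      have "star (w * c (x * x)) * (w * c (x * x)) = w * w * G (x * x)"
        using m2 mem by (simp add: G_def star_mult w mult.assoc u1c)
      moreover have "star (p * p - q * q) * (p * p - q * q) = G x * (4 *\<^sub>R (w * w) - G x)"
      proof -
        have "4 *\<^sub>R (w * w) - G x = star (p + q) * (p + q)"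
        proof -
          have "star (p + q) * (p + q) + G x = 2 *\<^sub>R (star p * p) + 2 *\<^sub>R (star q * q)"
            unfolding G_def cpq by (simp add: star_add star_diff algebra_simps scaleR_2)
          also have "\<dots> = 4 *\<^sub>R (w * w)" unfolding pp qq by (simp flip: scaleR_add_left)
          finally show ?thesis by (simp add: algebra_simps)
        qed
        moreover have "p * p - q * q = (p - q) * (p + q)"
          using m2 by (simp add: algebra_simps B.u1_comm)
        moreover have "star (p + q) \<in> u1 B" "p + q \<in> u1 B" "p - q \<in> u1 B" "star (p - q) \<in> u1 B"
          using m2 B.u1_star u1c by auto
        ultimately show ?thesis
          unfolding G_def cpq by (simp add: star_mult mult.assoc u1c)
      qed
      ultimately have e: "w * w * G (x * x) = G x * (4 *\<^sub>R (w * w) - G x)" using wc by simp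
      have pH: "pos (H x)"
      proof -
        have "pos (f * (w * w))"
          by (rule pos_mult_commute[OF fg(1) pos_square[OF pos_sa[OF w(1)]]], rule B.u1_comm) (use mem u1c in auto)
        then show ?thesis
          unfolding H_def by (rule pos_mult_commute) (auto simp: G_def pos_star_mult, simp add: G_def[symmetric], rule B.u1_comm, use mem m2 u1c in auto)
      qed
      have "H (x * x) = f * (w * w * G (x * x))" by (simp add: H_def mult.assoc)
      also have "\<dots> = 3 *\<^sub>R H x + G x * (f * (w * w) - f * G x)"
      proof -
        have "4 *\<^sub>R (w * w) = 3 *\<^sub>R (w * w) + w * w" by (simp flip: scaleR_add_left[of 3 1, simplified])
        then show ?thesis
          unfolding e H_def using m2 mem by (simp add: algebra_simps mult.assoc u1c)
      qed
      finally have "H (x * x) - 3 *\<^sub>R H x = G x * (f * (w * w) - f * G x)" by simp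
      also have "pos \<dots>"
        by (rule pos_mult_commute[OF _ main[OF x]], simp add: G_def pos_star_mult, rule B.u1_comm)
          (use mem m2 u1c in auto)
      finally have "norm (3 *\<^sub>R H x) \<le> norm (H (x * x))"
        by (intro norm_mono_pos pos_scaleR pH) auto
      then show ?thesis by simp
    qed
    define K where "K = norm f * (norm w * norm w) * (norm w + norm n * norm n)\<^sup>2"
    have HK: "norm (H x) \<le> K" if x: "x \<in> u1 B" "star x * x = 1" for x
    proof -
      have "(norm x)\<^sup>2 = 1" using norm_star_mult[of x] x(2) by simp
      then have nx: "norm x = 1" by (metis norm_ge_zero one_power2 power2_eq_iff_nonneg zero_le_one)
      have "norm (\<theta> x) \<le> norm (star n * x) * norm n" unfolding \<theta>_def by (rule norm_mult_ineq)
      also have "\<dots> \<le> norm n * norm n"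
        using norm_mult_ineq[of "star n" x] nx by (intro mult_right_mono) auto
      finally have "norm (c x) \<le> norm w + norm n * norm n"
        using norm_triangle_ineq4[of "w * x" "\<theta> x"] norm_mult_ineq[of w x] nx by (simp add: c_def)
      then have "norm (G x) \<le> (norm w + norm n * norm n)\<^sup>2"
        unfolding G_def norm_star_mult by (rule power_mono) simp
      then show ?thesis
        unfolding H_def K_def
        by (intro order_trans[OF norm_mult_ineq] mult_mono order_trans[OF norm_mult_ineq] mult_left_mono norm_mult_ineq)
          auto
    qed
    \<comment> \<open>Along x, x^2, x^4 and so on the norm of \<open>H\<close> at least triples each
      time, yet it is bounded by \<open>K\<close> on all unitaries.\<close>
    have "3 ^ k * norm (H x) \<le> K" if "x \<in> u1 B" "star x * x = 1" for k x
      using that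
    proof (induction k arbitrary: x)
      case (Suc k)
      have u: "star (x * x) * (x * x) = 1"
      proof -
        have "star (x * x) * (x * x) = star x * (star x * x) * x" by (simp add: star_mult mult.assoc)
        then show ?thesis by (simp add: Suc.prems)
      qed
      have "3 ^ Suc k * norm (H x) = 3 ^ k * (3 * norm (H x))" by simp
      also have "\<dots> \<le> 3 ^ k * norm (H (x * x))" by (intro mult_left_mono dbl Suc.prems) auto
      also have "\<dots> \<le> K" by (rule Suc.IH[OF B.u1_mult[OF Suc.prems(1,1)] u])
      finally show ?case .
    qed (use HK in simp)
    note HK3 = this
    have H0: "H x = 0" if x: "x \<in> u1 B" "star x * x = 1" for x
    proof (rule ccontr)
      assume "H x \<noteq> 0"
      then obtain k where "K / norm (H x) < 3 ^ k" using real_arch_pow[of 3 "K / norm (H x)"] by auto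
      then have "K < 3 ^ k * norm (H x)" using \<open>H x \<noteq> 0\<close> by (simp add: divide_less_eq)
      then show False using HK3[OF x, of k] by simp
    qed
    define Z where "Z = {x. w * c x * f = 0}"
    have Zadd: "x + y \<in> Z" if "x \<in> Z" "y \<in> Z" for x y
      using that by (simp add: Z_def cadd distrib_left distrib_right)
    have Zcx: "cx a * x \<in> Z" if "x \<in> Z" for a x
      using that by (simp add: Z_def ccx cx_left_commute mult.assoc)
    have fs: "star f = f" using pos_sa[OF fg(1)] by (simp add: sa_def)
    have Zu: "x \<in> Z" if x: "x \<in> u1 B" "star x * x = 1" for x
    proof -
      have cm: "c x \<in> u1 B" "star (c x) \<in> u1 B" using cB[OF x(1)] csubD(6)[OF B(1)] B1 by auto
      have "star (w * c x * f) * (w * c x * f) = H x * f"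
        using cm mem by (simp add: star_mult w fs H_def G_def mult.assoc u1c)
      then show ?thesis using H0[OF x] by (simp add: Z_def star_mult_eq_0)
    qed
    \<comment> \<open>A self-adjoint contraction b is the real part of the unitary b + i sqrt (1 -
      b^2), so the vanishing passes from unitaries to all of \<open>B\<close> by linearity.\<close>
    have Zsa1: "b \<in> Z" if b: "b \<in> B" "sa b" "norm b \<le> 1" for b
    proof -
      have nb: "norm (b * b) \<le> 1" using norm_sa_square[OF b(2)] b(3) by (simp add: power_le_one)
      have bb: "sa (b * b)" using b by (intro sa_intros) auto
      define s where "s = sqt (b * b)"
      have s: "s \<in> u1 B" "sa s" "s * s = 1 - b * b"
        unfolding s_def using sqt_in[OF nb B.rsub_u1] B1 csubD(4)[OF B(1)] b sa_sqt[OF nb bb] sqt_mult[OF nb] by auto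
      have bs: "b * s = s * b" by (rule B.u1_comm[OF B1[OF b(1)] s(1)])
      define x where "x = b + cx \<i> * s"
      note cf = cartesian_form[OF b(2) s(2) bs, folded x_def]
      have x: "x \<in> u1 B" unfolding x_def using B1[OF b(1)] s(1) B.cx_u1 u1c by auto
      have xx: "star x * x = 1" using cf(2) s(3) by simp
      then have xx': "star (star x) * star x = 1" using B.u1_comm[OF x B.u1_star[OF x]] by simp
      have "x + star x = 2 *\<^sub>R b" unfolding cf(1) by (simp add: x_def scaleR_2)
      then have "cx (1/2) * (x + star x) = b" using scaleR_cx[of "1/2" "x + star x"] by simp
      then show ?thesis using Zcx Zadd Zu[OF x xx] Zu[OF B.u1_star[OF x] xx'] by metis
    qed
    have Zsa: "b \<in> Z" if b: "b \<in> B" "sa b" for b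
    proof (cases "b = 0")
      case False
      have "(1 / norm b) *\<^sub>R b \<in> Z"
        by (rule Zsa1) (use b False csubD(7)[OF B(1)] in \<open>auto intro: sa_intros\<close>)
      from Zcx[OF this, of "complex_of_real (norm b)"] False show ?thesis by (simp flip: scaleR_cx)
    qed (simp add: Z_def c_def \<theta>_def)
    have ZB: "b \<in> Z" if "b \<in> B" for b
      by (rule sa_spanning[OF B(1) Zadd Zcx Zsa that])
    \<comment> \<open>Under the factors \<open>w\<close> and \<open>f\<close> the translate
      \<open>\<theta> b\<close> may be replaced by \<open>w * b\<close>, so this cut-down of
      \<open>n\<close> commutes with \<open>B\<close>. Maximality places it in \<open>B\<close>,
      where \<open>E\<close> vanishes.\<close>
    define m where "m = n * (w * w * f)"
    have wwf: "w * w * f \<in> B" "f * (w * w) \<in> B"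
      using B.u1_mult_right[OF fB] B.u1_mult_left[OF fB] csubD(4)[OF B(1) wB(1) wB(1)] by auto
    have "m \<in> B"
    proof (rule masaD)
      show "m \<in> A" unfolding m_def using csubD(4)[OF A.csub] nA wwf BA by auto
      fix b assume b: "b \<in> B"
      have "w * (w * b) * f = w * \<theta> b * f"
        using ZB[OF b] by (simp add: Z_def c_def left_diff_distrib right_diff_distrib)
      then have "w * (w * (f * b)) = \<theta> b * (w * f)"
        using B1[OF b] B1[OF \<theta>b[OF b]] mem by (simp add: mult.assoc u1c)
      then have "m * b = n * \<theta> b * (w * f)" by (simp add: m_def mult.assoc)
      also have "\<dots> = b * m" unfolding n\<theta>[OF b] by (simp add: m_def mult.assoc)
      finally show "m * b = b * m" .
    qed
    then have "star m \<in> B" by (rule csubD(6)[OF B(1)])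
    then have "E (star m) = 0" by (rule E0)
    also have "star m = f * (w * w) * star n" by (simp add: m_def star_mult w fs mult.assoc)
    finally have fd: "f * (w * w) * d = 0" unfolding d_def using EL[OF wwf(2) nA(2)] by simp
    \<comment> \<open>Since \<open>f * t\<close> is also \<kappa> f + f^2, its vanishing forces
      \<open>f = 0\<close>, so that \<open>t\<close> is at most \<kappa>.\<close>
    have "f * t = star d * (f * (w * w) * d)" unfolding tD D_def using mem by (simp add: mult.assoc u1c)
    then have "\<kappa> *\<^sub>R f + f * f = 0" using fd ft by simp
    then have "\<kappa> *\<^sub>R f = 0" by (rule pos_add_eq_0[rotated 2]) (use \<kappa> in \<open>auto intro: pos_scaleR pos_square pos_sa fg(1)\<close>)
    then have "of_real \<kappa> - t = g" using fg(5) \<kappa> by (simp add: algebra_simps)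
    then have "norm t \<le> \<kappa>" using fg(2) \<kappa> by (intro norm_le_of_pos) (auto simp: t_def pos_star_mult)
    then have "(norm (w * d))\<^sup>2 \<le> (\<eta> + \<epsilon>)\<^sup>2" by (simp add: t_def norm_star_mult \<kappa>_def)
    then show ?thesis using \<epsilon> \<eta>0 by (simp add: power2_le_iff_abs_le)
  qed
  then have "norm (w * d) \<le> \<eta>" by (rule field_le_epsilon)
  then show ?thesis by (simp add: w_def d_def \<eta>_def mult_ac)
qed

end

text \<open>With \<open>w\<close> the rescaled \<open>star n * n\<close>, the powers of
  \<open>1 - w\<close> have the form \<open>1 - b\<close> with \<open>b\<close> in \<open>B\<close>
  annihilating \<open>E (star n)\<close>. So E ((1 - w)^j star n) is the same for all j, while its
  argument tends to 0 by \<open>power_mult_star_tendsto_0\<close>; the scaling of \<open>n\<close>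
  to norm 1 serves that lemma.\<close>

lemma cancel_square:
  assumes A: "csub A" and B: "csub B" and n: "n \<in> A" "star n * n \<in> B" and cont: "continuous_on A E"
    and Ediff: "\<And>x y. x \<in> A \<Longrightarrow> y \<in> A \<Longrightarrow> E (x - y) = E x - E y"
    and EL: "\<And>b x. b \<in> B \<Longrightarrow> x \<in> A \<Longrightarrow> E (b * x) = b * E x" and BA: "B \<subseteq> A"
    and 0: "star n * n * E (star n) = (0::'u::cstar1)"
  shows "E (star n) = 0"
proof (cases "n = 0")
  case True
  then show ?thesis using EL[of 0 0] csubD(2)[OF A] csubD(2)[OF B] by simp
next
  case False
  define n' where "n' = (1 / norm n) *\<^sub>R n"
  define w where "w = star n' * n'"
  have w: "w = (1 / norm n * (1 / norm n)) *\<^sub>R (star n * n)" by (simp add: w_def n'_def star_scaleR)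
  have wB: "w \<in> B" unfolding w by (rule csubD(7)[OF B n(2)])
  have w0: "w * E (star n) = 0" unfolding w using 0 by simp
  have sn: "star n \<in> A" by (rule csubD(6)[OF A n(1)])
  have "\<exists>b\<in>B. (1 - w) ^ j = 1 - b \<and> b * E (star n) = 0" for j
  proof (induction j)
    case 0 then show ?case using csubD(2)[OF B] by (intro bexI[of _ 0]) auto
  next
    case (Suc j)
    then obtain b where b: "b \<in> B" "(1 - w) ^ j = 1 - b" "b * E (star n) = 0" by blast
    have "(1 - w) ^ Suc j = 1 - (w + (b - w * b))" by (simp add: b(2) algebra_simps)
    moreover have "w + (b - w * b) \<in> B" by (intro csubD(3)[OF B] csubD(9)[OF B] csubD(4)[OF B] wB b(1))
    moreover have "(w + (b - w * b)) * E (star n) = 0" using b w0 by (simp add: algebra_simps)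
    ultimately show ?case by blast
  qed
  then have "\<forall>j. \<exists>b. b \<in> B \<and> (1 - w) ^ j = 1 - b \<and> b * E (star n) = 0" by blast
  from choice[OF this] obtain b where b: "\<And>j. b j \<in> B" "\<And>j. (1 - w) ^ j = 1 - b j" "\<And>j. b j * E (star n) = 0" by blast
  have bn: "b j * star n \<in> A" for j using csubD(4)[OF A] b(1) BA sn by blast
  have mem: "(1 - w) ^ j * star n \<in> A" for j
    unfolding b(2) using csubD(9)[OF A sn bn] by (simp add: left_diff_distrib)
  have E: "E ((1 - w) ^ j * star n) = E (star n)" for j
    unfolding b(2) using Ediff[OF sn bn, of j] EL[OF b(1) sn, of j] b(3)[of j] by (simp add: left_diff_distrib)
  have "norm n' \<le> 1" by (simp add: n'_def)
  then have "(\<lambda>j. norm n *\<^sub>R ((1 - w) ^ j * star n')) \<longlonglongrightarrow> norm n *\<^sub>R 0"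
    unfolding w_def by (intro tendsto_intros power_mult_star_tendsto_0)
  then have "(\<lambda>j. (1 - w) ^ j * star n) \<longlonglongrightarrow> 0" using False by (simp add: n'_def star_scaleR)
  then have "(\<lambda>j. E ((1 - w) ^ j * star n)) \<longlonglongrightarrow> E 0"
    by (intro continuous_on_seq[OF cont] mem csubD(2)[OF A])
  then have "E (star n) = E 0" unfolding E using LIMSEQ_unique tendsto_const by blast
  then show ?thesis using EL[of 0 0] csubD(2)[OF A] csubD(2)[OF B] by simp
qed

lemma vanish_on_span:
  fixes E :: "'u::cstar1 \<Rightarrow> 'u"
  assumes A: "csub A" and N: "N \<subseteq> A" "A \<subseteq> closure (span N)" and cont: "continuous_on A E"
    and Eadd: "\<And>x y. x \<in> A \<Longrightarrow> y \<in> A \<Longrightarrow> E (x + y) = E x + E y"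
    and Escale: "\<And>r x. x \<in> A \<Longrightarrow> E (r *\<^sub>R x) = r *\<^sub>R E x"
    and 0: "\<And>n. n \<in> N \<Longrightarrow> E n = 0" and x: "x \<in> A"
  shows "E x = 0"
proof -
  have sp: "y \<in> A \<and> E y = 0" if "y \<in> span N" for y
    using that
  proof (induction rule: span_induct_alt)
    case base
    show ?case using Escale[of 0 0] csubD(2)[OF A] by simp
  next
    case (step r y z)
    then show ?case using Eadd[of "r *\<^sub>R y" z] Escale[of y r] 0 N csubD(3,7)[OF A] by (auto simp: subset_iff)
  qed
  obtain f where f: "\<And>k. f k \<in> span N" "f \<longlonglongrightarrow> x" using x N(2) closure_sequential[of x "span N"] by blast
  then have "(\<lambda>k. E (f k)) \<longlonglongrightarrow> E x"
    using f(2) x sp f(1) by (intro continuous_on_seq[OF cont]) auto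
  then have "(\<lambda>k. 0) \<longlonglongrightarrow> E x" using sp[OF f(1)] by simp
  then show ?thesis by (simp add: LIMSEQ_const_iff)
qed

section \<open>Closures of increasing unions of Cartan pairs\<close>

lemma cexpD:
  assumes "cexp A B P"
  shows "x \<in> A \<Longrightarrow> P x \<in> B" "x \<in> A \<Longrightarrow> y \<in> A \<Longrightarrow> P (x + y) = P x + P y"
    "x \<in> A \<Longrightarrow> P (cx c * x) = cx c * P x" "x \<in> A \<Longrightarrow> norm (P x) \<le> norm x"
    "x \<in> A \<Longrightarrow> pos x \<Longrightarrow> pos (P x)" "b \<in> B \<Longrightarrow> P b = b"
    "b \<in> B \<Longrightarrow> x \<in> A \<Longrightarrow> P (b * x) = b * P x" "b \<in> B \<Longrightarrow> x \<in> A \<Longrightarrow> P (x * b) = P x * b"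
    "x \<in> A \<Longrightarrow> P (r *\<^sub>R x) = r *\<^sub>R P x"
  using assms by (auto simp: cexp_def scaleR_cx)

lemma cexp_diff: "cexp A B P \<Longrightarrow> csub A \<Longrightarrow> x \<in> A \<Longrightarrow> y \<in> A \<Longrightarrow> P (x - y) = P x - P y"
  using cexpD(2)[of A B P x "cx (-1) * y"] cexpD(3)[of A B P y "-1"] csubD(5)[of A y "-1"]
  by (simp add: cx_minus)

lemma cartan_masa_apx: "cartan A B P \<Longrightarrow> masa_apx A B"
  by (simp add: cartan_def masa_apx_def)

text \<open>
  The left side is, up to \<open>\<rho> ^ 3\<close>, another \<open>B\<close>-bimodule expectation, and there is only one.
\<close>

lemma expectation_conj:
  assumes c: "cartan A B P" and n: "n \<in> nz A B" and x: "x \<in> A"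
  shows "n * (star n * n) * P (star n * x * n) * star n = (n * star n) * (n * star n) * (n * star n) * P x"
proof -
  interpret masa_apx A B by (rule cartan_masa_apx[OF c])
  have P: "cexp A B P" and gen: "A \<subseteq> closure (span (nz A B))" using c by (auto simp: cartan_def)
  define w where "w = star n * n"
  define \<rho> where "\<rho> = n * star n"
  have nA: "n \<in> A" "star n \<in> A" using n csubD(6)[OF A.csub] by (auto simp: nz_def)
  have wB: "w \<in> B" "\<rho> \<in> B" using nz_square[OF n] by (auto simp: w_def \<rho>_def)
  have r3: "\<rho> * \<rho> * \<rho> \<in> B" using csubD(4)[OF B(1)] wB by blast
  note Am = csubD(4)[OF A.csub]
  have cj: "star n * y * n \<in> A" if "y \<in> A" for y using Am nA that by blast
  have PB: "P y \<in> B" if "y \<in> A" for y by (rule cexpD(1)[OF P that])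
  have nB: "n * b * star n \<in> B" "star n * b * n \<in> B" if "b \<in> B" for b using n that by (auto simp: nz_def)
  have PC: "P y * b = b * P y" if "y \<in> A" "b \<in> B" for y b using B(3)[OF PB[OF that(1)] that(2)] .
  \<comment> \<open>The extra \<open>w\<close> makes this map B-bilinear:
    \<open>w * (star n * (b * y) * n)\<close> factors as
    \<open>(star n * b * n) * (star n * y * n)\<close>, and
    \<open>n * (star n * b * n) = b * (n * w)\<close>. Evaluation on \<open>B\<close> then accounts
    for the three factors \<open>\<rho>\<close>.\<close>
  define E where "E y = n * w * P (star n * y * n) * star n - \<rho> * \<rho> * \<rho> * P y" for y
  have EB: "E y \<in> B" if "y \<in> A" for y
  proof -
    have "w * P (star n * y * n) \<in> B" using csubD(4)[OF B(1)] wB PB[OF cj[OF that]] by blast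
    from nB(1)[OF this] show ?thesis
      unfolding E_def using csubD(9)[OF B(1)] csubD(4)[OF B(1) r3 PB[OF that]] by (simp add: mult.assoc)
  qed
  have nth: "n * (star n * b * n) = b * (n * w)" if "b \<in> B" for b
  proof -
    have "n * (star n * b * n) = \<rho> * b * n" by (simp add: \<rho>_def mult.assoc)
    also have "\<dots> = b * \<rho> * n" using B(3)[OF wB(2) that] by simp
    finally show ?thesis by (simp add: \<rho>_def w_def mult.assoc)
  qed
  have EL: "E (b * y) = b * E y" if b: "b \<in> B" and y: "y \<in> A" for b y
  proof -
    have bym: "b * y \<in> A" using Am BA b y by blast
    have "w * (star n * (b * y) * n) = star n * (\<rho> * b) * y * n" by (simp add: w_def \<rho>_def mult.assoc)
    also have "\<dots> = (star n * b * n) * (star n * y * n)"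
      unfolding B(3)[OF wB(2) b] by (simp add: \<rho>_def mult.assoc)
    finally have "w * P (star n * (b * y) * n) = (star n * b * n) * P (star n * y * n)"
      using cexpD(7)[OF P wB(1) cj[OF bym]] cexpD(7)[OF P nB(2)[OF b] cj[OF y]] by simp
    then have "n * w * P (star n * (b * y) * n) = b * (n * w) * P (star n * y * n)"
      using nth[OF b] by (metis mult.assoc)
    moreover have "\<rho> * \<rho> * \<rho> * (b * P y) = b * (\<rho> * \<rho> * \<rho> * P y)"
      using B(3)[OF r3 b] by (metis mult.assoc)
    ultimately show ?thesis
      by (simp add: E_def cexpD(7)[OF P b y] right_diff_distrib mult.assoc)
  qed
  have ER: "E (y * b) = E y * b" if b: "b \<in> B" and y: "y \<in> A" for b y
  proof -
    have yb: "y * b \<in> A" using Am BA b y by blast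
    have "star n * (y * b) * n * w = star n * y * (b * \<rho>) * n" by (simp add: w_def \<rho>_def mult.assoc)
    also have "\<dots> = (star n * y * n) * (star n * b * n)"
      unfolding B(3)[OF b wB(2)] by (simp add: \<rho>_def mult.assoc)
    finally have "P (star n * (y * b) * n) * w = P (star n * y * n) * (star n * b * n)"
      using cexpD(8)[OF P wB(1) cj[OF yb]] cexpD(8)[OF P nB(2)[OF b] cj[OF y]] by simp
    then have "n * w * P (star n * (y * b) * n) * star n = n * P (star n * y * n) * (star n * b * (n * star n))"
      using PC[OF cj[OF yb] wB(1)] by (metis mult.assoc)
    also have "star n * b * (n * star n) = w * (star n * b)"
      using B(3)[OF b wB(2)] unfolding \<rho>_def w_def by (metis mult.assoc)
    also have "n * P (star n * y * n) * (w * (star n * b)) = n * w * P (star n * y * n) * star n * b"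
      using PC[OF cj[OF y] wB(1)] by (metis mult.assoc)
    finally show ?thesis by (simp add: E_def cexpD(8)[OF P b y] left_diff_distrib mult.assoc)
  qed
  have E0: "E b = 0" if b: "b \<in> B" for b
  proof -
    have "n * w * (star n * b * n) * star n = \<rho> * \<rho> * (b * \<rho>)" by (simp add: w_def \<rho>_def mult.assoc)
    then show ?thesis using B(3)[OF b wB(2)] cexpD(6)[OF P b] cexpD(6)[OF P nB(2)[OF b]]
      by (simp add: E_def mult.assoc)
  qed
  have cP: "continuous_on A P" by (rule continuous_on_cexp[OF A.csub P])
  have cE: "continuous_on A E"
    unfolding E_def
    by (intro continuous_intros continuous_on_compose2[OF cP]) (use cj in auto)
  have Eadd: "E (y + z) = E y + E z" if "y \<in> A" "z \<in> A" for y z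
    using that cj cexpD(2)[OF P] by (simp add: E_def distrib_left distrib_right)
  have Escale: "E (r *\<^sub>R y) = r *\<^sub>R E y" if "y \<in> A" for r y
    using that cj cexpD(9)[OF P] by (simp add: E_def scaleR_right_diff_distrib)
  have Ediff: "E (y - z) = E y - E z" if "y \<in> A" "z \<in> A" for y z
    using Eadd[OF csubD(9)[OF A.csub that] that(2)] by simp
  \<comment> \<open>The estimate concerns the value at the adjoint of a normalizer, so
    \<open>k\<close> is written as \<open>star l\<close>; the defect \<delta> is 0.\<close>
  have "E k = 0" if k: "k \<in> nz A B" for k
  proof -
    define l where "l = star k"
    have l: "l \<in> nz A B" "k = star l" using nz_closed(3)[OF A.csub B(1) k k] by (auto simp: l_def)
    have lA: "l \<in> A" "star l \<in> A" using l k by (auto simp: nz_def)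
    have "norm (star l * l * E (star l)) \<le> 2 * norm (star l * l) * 0"
      by (rule key_estimate[OF l(1)]) (use EB EL E0 ER lA in auto)
    then have "star l * l * E (star l) = 0" by simp
    then show ?thesis unfolding l(2)
      by (intro cancel_square[OF A.csub B(1) lA(1) nz_square(1)[OF l(1)] cE]) (use Ediff EL B in auto)
  qed
  then have "E x = 0"
    by (intro vanish_on_span[OF A.csub _ gen cE Eadd Escale _ x]) (auto simp: nz_def)
  then show ?thesis by (simp add: E_def w_def \<rho>_def)
qed

text \<open>All stages lie in one algebra, and a single \<open>P\<close>, continuous on the closure,
  restricts to the expectation of each of them. Identities for \<open>P\<close> therefore pass from
  the stages to the limit.\<close>

locale lim_sys =
  fixes AA BB :: "nat \<Rightarrow> 'u::cstar1 set" and P :: "'u \<Rightarrow> 'u"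
  assumes cart: "cartan (AA m) (BB m) P"
    and AA_step: "AA m \<subseteq> AA (Suc m)" and BB_step: "BB m \<subseteq> BB (Suc m)"
    and nz_step: "nz (AA m) (BB m) \<subseteq> nz (AA (Suc m)) (BB (Suc m))"
    and P_cont: "continuous_on (closure (\<Union>m. AA m)) P"
begin

definition "U = (\<Union>m. AA m)"
definition "V = (\<Union>m. BB m)"
definition "A = closure U"
definition "B = closure V"
definition "N = (\<Union>m. nz (AA m) (BB m))"

interpretation st: masa_apx "AA m" "BB m" for m by (rule cartan_masa_apx[OF cart])

lemma P_AA: "cexp (AA m) (BB m) P" and faithful_AA: "faithful (AA m) P"
  and gen_AA: "AA m \<subseteq> closure (span (nz (AA m) (BB m)))"
  using cart[of m] by (auto simp: cartan_def)

lemma mono: "m \<le> k \<Longrightarrow> AA m \<subseteq> AA k" "m \<le> k \<Longrightarrow> BB m \<subseteq> BB k"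
  "m \<le> k \<Longrightarrow> nz (AA m) (BB m) \<subseteq> nz (AA k) (BB k)"
  by (rule lift_Suc_mono_le[of AA], rule AA_step, assumption)
    (rule lift_Suc_mono_le[of BB], rule BB_step, assumption,
      rule lift_Suc_mono_le[of "\<lambda>m. nz (AA m) (BB m)"], rule nz_step, assumption)

lemma UA: "x \<in> U \<Longrightarrow> x \<in> A" and VB: "x \<in> V \<Longrightarrow> x \<in> B"
  using closure_subset by (auto simp: A_def B_def)

lemma V_U: "V \<subseteq> U" using st.B(2) by (auto simp: U_def V_def)

lemma A_seq: assumes "x \<in> A" obtains f where "\<And>k. f k \<in> U" "f \<longlonglongrightarrow> x"
  using assms closure_sequential[of x U] unfolding A_def by blast

lemma B_seq: assumes "x \<in> B" obtains f where "\<And>k. f k \<in> V" "f \<longlonglongrightarrow> x"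
  using assms closure_sequential[of x V] unfolding B_def by blast

lemma A_lim: "(\<And>k. f k \<in> A) \<Longrightarrow> f \<longlonglongrightarrow> x \<Longrightarrow> x \<in> A"
  unfolding A_def by (rule closed_sequentially[OF closed_closure])

lemma B_lim: "(\<And>k. f k \<in> B) \<Longrightarrow> f \<longlonglongrightarrow> x \<Longrightarrow> x \<in> B"
  unfolding B_def by (rule closed_sequentially[OF closed_closure])

lemma P_lim: "(\<And>k. f k \<in> A) \<Longrightarrow> f \<longlonglongrightarrow> x \<Longrightarrow> x \<in> A \<Longrightarrow> (\<lambda>k. P (f k)) \<longlonglongrightarrow> P x"
  using P_cont by (intro continuous_on_seq[of A P]) (auto simp: A_def U_def)

lemma U_common: assumes "x \<in> U" "y \<in> U" obtains m where "m \<ge> k" "x \<in> AA m" "y \<in> AA m"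
proof -
  obtain i j where "x \<in> AA i" "y \<in> AA j" using assms by (auto simp: U_def)
  then have "x \<in> AA (max k (max i j))" "y \<in> AA (max k (max i j))"
    by (auto intro: subsetD[OF mono(1), rotated])
  then show ?thesis by (intro that) auto
qed

lemma V_common: assumes "x \<in> V" "y \<in> U" obtains m where "m \<ge> k" "x \<in> BB m" "y \<in> AA m"
proof -
  obtain i j where "x \<in> BB i" "y \<in> AA j" using assms by (auto simp: U_def V_def)
  then have "x \<in> BB (max k (max i j))" "y \<in> AA (max k (max i j))"
    by (auto intro: subsetD[OF mono(1), rotated] subsetD[OF mono(2), rotated])
  then show ?thesis by (intro that) auto
qed

lemma V_common2: assumes "x \<in> V" "y \<in> V" obtains m where "x \<in> BB m" "y \<in> BB m"
proof -
  obtain i j where "x \<in> BB i" "y \<in> BB j" using assms by (auto simp: V_def)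
  then have "x \<in> BB (max i j)" "y \<in> BB (max i j)"
    by (auto intro: subsetD[OF mono(2), rotated])
  then show ?thesis by (intro that) auto
qed

lemma AA_U: "x \<in> AA m \<Longrightarrow> x \<in> U" and BB_V: "x \<in> BB m \<Longrightarrow> x \<in> V" by (auto simp: U_def V_def)

lemma csub_A: "csub A"
  unfolding A_def
proof (rule csub_closure)
  show "0 \<in> U" using csubD(2)[OF st.A.csub] AA_U by blast
  fix x y assume "x \<in> U" "y \<in> U"
  then obtain m where "x \<in> AA m" "y \<in> AA m" using U_common by metis
  then have "x + y \<in> AA m" "x * y \<in> AA m" using csubD(3,4)[OF st.A.csub] by simp_all
  then show "x + y \<in> U" "x * y \<in> U" by (simp_all add: AA_U)
next
  fix x c assume "x \<in> U"
  then obtain m where "x \<in> AA m" by (auto simp: U_def)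
  then have "cx c * x \<in> AA m" "star x \<in> AA m" using csubD(5,6)[OF st.A.csub] by simp_all
  then show "cx c * x \<in> U" "star x \<in> U" by (simp_all add: AA_U)
qed

lemma csub_B: "csub B"
  unfolding B_def
proof (rule csub_closure)
  show "0 \<in> V" using csubD(2)[OF st.B(1)] BB_V by blast
  fix x y assume "x \<in> V" "y \<in> V"
  then obtain m where "x \<in> BB m" "y \<in> BB m" using V_common2 by metis
  then have "x + y \<in> BB m" "x * y \<in> BB m" using csubD(3,4)[OF st.B(1)] by simp_all
  then show "x + y \<in> V" "x * y \<in> V" by (simp_all add: BB_V)
next
  fix x c assume "x \<in> V"
  then obtain m where "x \<in> BB m" by (auto simp: V_def)
  then have "cx c * x \<in> BB m" "star x \<in> BB m" using csubD(5,6)[OF st.B(1)] by simp_all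
  then show "cx c * x \<in> V" "star x \<in> V" by (simp_all add: BB_V)
qed

sublocale A: aug_csub A
proof
  show "csub A" by (rule csub_A)
  fix x assume "x \<in> A"
  then obtain f where f: "\<And>k. f k \<in> U" "f \<longlonglongrightarrow> x" using A_seq by metis
  then have "(\<lambda>k. aug (f k)) \<longlonglongrightarrow> aug x" by (intro tendsto_intros)
  moreover have "aug (f k) = 0" for k using f(1)[of k] st.A.aug by (auto simp: U_def)
  ultimately show "aug x = 0" by (simp add: LIMSEQ_const_iff)
qed

lemma B_sub_A: "B \<subseteq> A" unfolding A_def B_def by (rule closure_mono[OF V_U])

lemma BA: "b \<in> B \<Longrightarrow> b \<in> A" using B_sub_A by blast

lemma B_comm: assumes "x \<in> B" "y \<in> B" shows "x * y = y * x"
proof -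
  obtain f g where f: "\<And>k. f k \<in> V" "f \<longlonglongrightarrow> x" and g: "\<And>k. g k \<in> V" "g \<longlonglongrightarrow> y"
    using assms B_seq by metis
  have "f k * g k = g k * f k" for k
    using V_common2[OF f(1)[of k] g(1)[of k]] st.B(3) by metis
  moreover have "(\<lambda>k. f k * g k) \<longlonglongrightarrow> x * y" "(\<lambda>k. g k * f k) \<longlonglongrightarrow> y * x" by (intro tendsto_intros f g)+
  ultimately show ?thesis using LIMSEQ_unique by fastforce
qed

lemma P_V: "x \<in> U \<Longrightarrow> P x \<in> V" using cexpD(1)[OF P_AA] BB_V by (auto simp: U_def)

lemma cexp_lim: "cexp A B P"
  unfolding cexp_def
proof (intro conjI ballI allI impI)
  fix x assume x: "x \<in> A"
  then obtain f where f: "\<And>k. f k \<in> U" "f \<longlonglongrightarrow> x" using A_seq by metis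
  have fA: "\<And>k. f k \<in> A" using f UA by blast
  have Pf: "(\<lambda>k. P (f k)) \<longlonglongrightarrow> P x" by (rule P_lim[OF fA f(2) x])
  show "P x \<in> B" by (rule B_lim[OF _ Pf]) (use P_V f VB in blast)
  have n: "norm (P (f k)) \<le> norm (f k)" for k using f(1)[of k] cexpD(4)[OF P_AA] by (auto simp: U_def)
  show "norm (P x) \<le> norm x"
    by (rule LIMSEQ_le[OF tendsto_norm[OF Pf] tendsto_norm[OF f(2)]]) (use n in auto)
  show "P (cx c * x) = cx c * P x" for c
  proof -
    have cf: "cx c * f k \<in> U" "P (cx c * f k) = cx c * P (f k)" for k
    proof -
      obtain j where "f k \<in> AA j" using f(1)[of k] by (auto simp: U_def)
      from AA_U[OF csubD(5)[OF st.A.csub this]] cexpD(3)[OF P_AA this]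
      show "cx c * f k \<in> U" "P (cx c * f k) = cx c * P (f k)" by simp_all
    qed
    have "(\<lambda>k. P (cx c * f k)) \<longlonglongrightarrow> P (cx c * x)"
      by (rule P_lim[OF UA[OF cf(1)] tendsto_mult_left[OF f(2)] csubD(5)[OF csub_A x]])
    moreover have "(\<lambda>k. P (cx c * f k)) \<longlonglongrightarrow> cx c * P x" unfolding cf by (intro tendsto_intros Pf)
    ultimately show ?thesis by (rule LIMSEQ_unique)
  qed
  show "pos (P x)" if px: "pos x"
  proof -
    \<comment> \<open>Approximating a root of \<open>x\<close> by elements of the stages gives
      approximants \<open>star (g k) * g k\<close> of \<open>x\<close> that are positive
      themselves.\<close>
    obtain s where s: "pos s" "s * s = x" "s \<in> A" using A.pos_sqrt_mem[OF px x] by metis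
    obtain g where g: "\<And>k. g k \<in> U" "g \<longlonglongrightarrow> s" using A_seq[OF s(3)] by metis
    have gg: "star (g k) * g k \<in> U" "pos (P (star (g k) * g k))" for k
    proof -
      obtain j where "g k \<in> AA j" using g(1)[of k] by (auto simp: U_def)
      then have "star (g k) * g k \<in> AA j" using csubD(4,6)[OF st.A.csub] by simp
      from AA_U[OF this] cexpD(5)[OF P_AA this pos_star_mult]
      show "star (g k) * g k \<in> U" "pos (P (star (g k) * g k))" by simp_all
    qed
    have "(\<lambda>k. star (g k) * g k) \<longlonglongrightarrow> star s * s" by (intro tendsto_intros g)
    then have "(\<lambda>k. star (g k) * g k) \<longlonglongrightarrow> x" using s pos_sa[OF s(1)] by (simp add: sa_def)
    then have "(\<lambda>k. P (star (g k) * g k)) \<longlonglongrightarrow> P x" by (intro P_lim x) (use gg UA in auto)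
    then show ?thesis using closed_sequentially[OF closed_pos, of "\<lambda>k. P (star (g k) * g k)"] gg by auto
  qed
  show "P (x + y) = P x + P y" if y: "y \<in> A" for y
  proof -
    obtain g where g: "\<And>k. g k \<in> U" "g \<longlonglongrightarrow> y" using A_seq[OF y] by metis
    have gA: "\<And>k. g k \<in> A" using g UA by blast
    have fg: "P (f k + g k) = P (f k) + P (g k)" for k
      using U_common[OF f(1)[of k] g(1)[of k]] cexpD(2)[OF P_AA] by metis
    have "(\<lambda>k. P (f k + g k)) \<longlonglongrightarrow> P (x + y)"
      by (rule P_lim[OF csubD(3)[OF csub_A fA gA] tendsto_add[OF f(2) g(2)] csubD(3)[OF csub_A x y]])
    moreover have "(\<lambda>k. P (f k + g k)) \<longlonglongrightarrow> P x + P y" unfolding fg by (intro tendsto_intros Pf P_lim[OF gA g(2) y])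
    ultimately show ?thesis by (rule LIMSEQ_unique)
  qed
  fix b assume b: "b \<in> B"
  then obtain g where g: "\<And>k. g k \<in> V" "g \<longlonglongrightarrow> b" using B_seq by metis
  have gA: "\<And>k. g k \<in> A" using g VB BA by blast
  have fg: "P (g k * f k) = g k * P (f k)" "P (f k * g k) = P (f k) * g k" for k
  proof -
    obtain m where "g k \<in> BB m" "f k \<in> AA m" using V_common[OF g(1)[of k] f(1)[of k]] by metis
    then show "P (g k * f k) = g k * P (f k)" "P (f k * g k) = P (f k) * g k"
      using cexpD(7,8)[OF P_AA] by simp_all
  qed
  have c1: "(\<lambda>k. P (g k * f k)) \<longlonglongrightarrow> P (b * x)"
    by (rule P_lim[OF csubD(4)[OF csub_A gA fA] tendsto_mult[OF g(2) f(2)] csubD(4)[OF csub_A BA[OF b] x]])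
  have c2: "(\<lambda>k. P (f k * g k)) \<longlonglongrightarrow> P (x * b)"
    by (rule P_lim[OF csubD(4)[OF csub_A fA gA] tendsto_mult[OF f(2) g(2)] csubD(4)[OF csub_A x BA[OF b]]])
  have c3: "(\<lambda>k. P (g k * f k)) \<longlonglongrightarrow> b * P x" and c4: "(\<lambda>k. P (f k * g k)) \<longlonglongrightarrow> P x * b"
    unfolding fg by (intro tendsto_intros Pf g)+
  show "P (b * x) = b * P x" by (rule LIMSEQ_unique[OF c1 c3])
  show "P (x * b) = P x * b" by (rule LIMSEQ_unique[OF c2 c4])
next
  fix b assume b: "b \<in> B"
  then obtain g where g: "\<And>k. g k \<in> V" "g \<longlonglongrightarrow> b" using B_seq by metis
  have "P (g k) = g k" for k
  proof -
    obtain m where "g k \<in> BB m" using g(1)[of k] by (auto simp: V_def)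
    from cexpD(6)[OF P_AA this] show ?thesis .
  qed
  moreover have "(\<lambda>k. P (g k)) \<longlonglongrightarrow> P b" by (rule P_lim) (use g VB BA b in auto)
  ultimately have "g \<longlonglongrightarrow> P b" by simp
  then show "P b = b" using g(2) by (rule LIMSEQ_unique)
qed

lemma apx_lim: "apx A B"
  unfolding apx_def
proof (intro allI impI)
  fix F and \<epsilon> :: real assume F: "finite F" "F \<subseteq> A" and \<epsilon>: "\<epsilon> > 0"
  have "\<exists>a'\<in>U. norm (a' - a) < \<epsilon> / 3" if "a \<in> F" for a
  proof -
    have "a \<in> closure U" using that F by (auto simp: A_def)
    moreover have "0 < \<epsilon> / 3" using \<epsilon> by simp
    ultimately show ?thesis unfolding closure_approachable dist_norm by blast
  qed
  then obtain h where h: "\<And>a. a \<in> F \<Longrightarrow> h a \<in> U" "\<And>a. a \<in> F \<Longrightarrow> norm (h a - a) < \<epsilon> / 3" by metis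
  have "\<exists>m. h ` F \<subseteq> AA m"
    using F(1) h(1)
  proof (induction F rule: finite_induct)
    case (insert a F)
    then obtain m where m: "h ` F \<subseteq> AA m" by auto
    obtain k where "h a \<in> AA k" using insert.prems[of a] by (auto simp: U_def)
    then have "h ` insert a F \<subseteq> AA (max m k)"
      using m mono(1)[of m "max m k"] mono(1)[of k "max m k"] by auto
    then show ?case by blast
  qed auto
  then obtain m where m: "h ` F \<subseteq> AA m" by blast
  have "finite (h ` F)" "\<epsilon> / 3 > 0" using F \<epsilon> by auto
  then obtain e where e: "e \<in> BB m" "pos e" "norm e \<le> 1"
    "\<forall>a\<in>h ` F. norm (e * a - a) < \<epsilon> / 3 \<and> norm (a * e - a) < \<epsilon> / 3"
    using st.apx[of m] m unfolding apx_def by meson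
  have "norm (e * a - a) < \<epsilon> \<and> norm (a * e - a) < \<epsilon>" if a: "a \<in> F" for a
  proof -
    have tri: "norm (u + v + z) \<le> norm u + norm v + norm z" for u v z :: 'u
      by (rule order_trans[OF norm_triangle_ineq add_right_mono[OF norm_triangle_ineq]])
    have e1: "norm e * norm (a - h a) \<le> norm (h a - a)"
      using mult_right_mono[OF e(3) norm_ge_zero[of "a - h a"]] norm_minus_commute[of a "h a"] by simp
    have 1: "norm (e * (a - h a)) \<le> norm (h a - a)"
      using norm_mult_ineq[of e "a - h a"] e1 by linarith
    have 2: "norm ((a - h a) * e) \<le> norm (h a - a)"
      using norm_mult_ineq[of "a - h a" e] e1 mult.commute[of "norm e" "norm (a - h a)"] by linarith
    have "e * (a - h a) + (e * h a - h a) + (h a - a) = e * a - a"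
      "(a - h a) * e + (h a * e - h a) + (h a - a) = a * e - a" by (simp_all add: algebra_simps)
    then have "norm (e * a - a) \<le> norm (e * (a - h a)) + norm (e * h a - h a) + norm (h a - a)"
      "norm (a * e - a) \<le> norm ((a - h a) * e) + norm (h a * e - h a) + norm (h a - a)"
      using tri[of "e * (a - h a)" "e * h a - h a" "h a - a"] tri[of "(a - h a) * e" "h a * e - h a" "h a - a"]
      by simp_all
    moreover have "norm (e * h a - h a) < \<epsilon> / 3" "norm (h a * e - h a) < \<epsilon> / 3" using e(4) a by auto
    ultimately show ?thesis using 1 2 h(2)[OF a] by linarith
  qed
  then show "\<exists>e\<in>B. pos e \<and> norm e \<le> 1 \<and> (\<forall>a\<in>F. norm (e * a - a) < \<epsilon> \<and> norm (a * e - a) < \<epsilon>)"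
    using e VB BB_V by blast
qed

text \<open>By \<open>nz_step\<close> a normalizer of one stage normalizes all later stages, hence
  the union \<open>V\<close> of the \<open>BB m\<close>, and by continuity its closure
  \<open>B\<close>.\<close>

lemma N_nz: "N \<subseteq> nz A B"
proof
  fix n assume "n \<in> N"
  then obtain m where n: "n \<in> nz (AA m) (BB m)" by (auto simp: N_def)
  have V: "n * b * star n \<in> V \<and> star n * b * n \<in> V" if bV: "b \<in> V" for b
  proof -
    obtain j where "b \<in> BB j" using bV by (auto simp: V_def)
    then have "b \<in> BB (max m j)" "n \<in> nz (AA (max m j)) (BB (max m j))"
      using mono(2)[of j "max m j"] mono(3)[of m "max m j"] n by auto
    then show ?thesis using BB_V by (auto simp: nz_def)
  qed
  have "n * b * star n \<in> B \<and> star n * b * n \<in> B" if b: "b \<in> B" for b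
  proof -
    obtain g where g: "\<And>k. g k \<in> V" "g \<longlonglongrightarrow> b" using B_seq[OF b] by metis
    have l1: "(\<lambda>k. n * g k * star n) \<longlonglongrightarrow> n * b * star n" and l2: "(\<lambda>k. star n * g k * n) \<longlonglongrightarrow> star n * b * n"
      by (intro tendsto_intros g)+
    show ?thesis
      by (rule conjI[OF B_lim[OF VB[OF conjunct1[OF V[OF g(1)]]] l1] B_lim[OF VB[OF conjunct2[OF V[OF g(1)]]] l2]])
  qed
  then show "n \<in> nz A B" using n AA_U UA by (auto simp: nz_def)
qed

lemma gen_N: "A \<subseteq> closure (span N)"
  unfolding A_def
proof (rule closure_minimal)
  show "U \<subseteq> closure (span N)"
  proof
    fix x assume "x \<in> U"
    then obtain m where "x \<in> AA m" by (auto simp: U_def)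
    then have "x \<in> closure (span (nz (AA m) (BB m)))" using gen_AA by blast
    moreover have "span (nz (AA m) (BB m)) \<subseteq> span N" by (rule span_mono) (auto simp: N_def)
    ultimately show "x \<in> closure (span N)" using closure_mono by blast
  qed
qed simp

lemma N_star: "n \<in> N \<Longrightarrow> star n \<in> N"
proof -
  assume "n \<in> N"
  then obtain m where "n \<in> nz (AA m) (BB m)" by (auto simp: N_def)
  then have "star n \<in> nz (AA m) (BB m)" using nz_closed(3)[OF st.A.csub st.B(1)] by blast
  then show ?thesis by (auto simp: N_def)
qed

lemma N_A: "n \<in> N \<Longrightarrow> n \<in> A" using N_nz by (auto simp: nz_def)

lemma N_sq: "n \<in> N \<Longrightarrow> star n * n \<in> B"
proof -
  assume "n \<in> N"
  then obtain m where "n \<in> nz (AA m) (BB m)" by (auto simp: N_def)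
  from st.nz_square(1)[OF this] show ?thesis by (rule VB[OF BB_V])
qed

lemma P_cont_A: "continuous_on A P" using P_cont by (simp add: A_def U_def)

lemma conj_lim:
  assumes n: "n \<in> N" and x: "x \<in> A"
  shows "n * (star n * n) * P (star n * x * n) * star n = (n * star n) * (n * star n) * (n * star n) * P x"
proof -
  obtain m where m: "n \<in> nz (AA m) (BB m)" using n by (auto simp: N_def)
  obtain f where f: "\<And>k. f k \<in> U" "f \<longlonglongrightarrow> x" using A_seq[OF x] by metis
  have fA: "\<And>k. f k \<in> A" using f UA by blast
  have eq: "n * (star n * n) * P (star n * f k * n) * star n = (n * star n) * (n * star n) * (n * star n) * P (f k)" for k
  proof -
    obtain j where "j \<ge> m" "f k \<in> AA j" using U_common[OF f(1)[of k] f(1)[of k]] by metis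
    then show ?thesis using expectation_conj[OF cart[of j]] mono(3)[of m j] m by blast
  qed
  have cj: "star n * y * n \<in> A" if "y \<in> A" for y
    using that csubD(4,6)[OF csub_A] N_A[OF n] by blast
  have "(\<lambda>k. n * (star n * n) * P (star n * f k * n) * star n) \<longlonglongrightarrow> n * (star n * n) * P (star n * x * n) * star n"
    by (intro tendsto_intros P_lim cj fA x f)
  moreover have "(\<lambda>k. (n * star n) * (n * star n) * (n * star n) * P (f k)) \<longlonglongrightarrow> (n * star n) * (n * star n) * (n * star n) * P x"
    by (intro tendsto_intros P_lim fA x f)
  ultimately show ?thesis unfolding eq by (rule LIMSEQ_unique)
qed

text \<open>\<open>conj_lim\<close> shows that the cube of \<open>w = star n * n\<close> annihilates
  \<open>e = P (star n * z * n)\<close>. Two factors \<open>w\<close> are removed by the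
  C*-identity, and the last one by \<open>cancel_square\<close> for the map y \<mapsto> P (y * (z *
  n)).\<close>

lemma null_conj:
  assumes n: "n \<in> N" and z: "z \<in> A" "P z = 0"
  shows "P (star n * z * n) = 0"
proof -
  define w where "w = star n * n"
  define e where "e = P (star n * z * n)"
  have nA: "n \<in> A" "star n \<in> A" "z * n \<in> A" using N_A[OF n] csubD(4,6)[OF csub_A] z by auto
  have wB: "w \<in> B" unfolding w_def by (rule N_sq[OF n])
  have ws: "star w = w" by (simp add: w_def star_mult)
  have "star n * z * n \<in> A" using csubD(4)[OF csub_A] nA z by blast
  then have eB: "e \<in> B" unfolding e_def by (rule cexpD(1)[OF cexp_lim])
  have we: "w * e = e * w" by (rule B_comm[OF wB eB])
  have "n * w * e * star n = 0" using conj_lim[OF n z(1)] z(2) by (simp add: w_def e_def)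
  then have "star n * (n * w * e * star n) * n = 0" by simp
  then have "w * w * e * w = 0" by (simp add: w_def mult.assoc)
  then have www: "w * w * w * e = 0" using we by (metis mult.assoc)
  have "star (w * w * e) * (w * w * e) = star e * w * (w * w * w * e)" by (simp add: star_mult ws mult.assoc)
  then have "w * w * e = 0" using www star_mult_eq_0 by fastforce
  moreover have "star (w * e) * (w * e) = star e * (w * w * e)" by (simp add: star_mult ws mult.assoc)
  ultimately have "w * e = 0" using star_mult_eq_0 by fastforce
  then have "star n * n * P (star n * (z * n)) = 0" by (simp add: w_def e_def mult.assoc)
  then have "P (star n * (z * n)) = 0"
  proof (rule cancel_square[OF csub_A csub_B nA(1) N_sq[OF n] _ _ _ B_sub_A, where E="\<lambda>y. P (y * (z * n))", rotated 3])
    show "continuous_on A (\<lambda>y. P (y * (z * n)))"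
      by (intro continuous_on_compose2[OF P_cont_A] continuous_intros) (use csubD(4)[OF csub_A] nA in auto)
    fix x y assume "x \<in> A" "y \<in> A"
    then show "P ((x - y) * (z * n)) = P (x * (z * n)) - P (y * (z * n))"
      using cexp_diff[OF cexp_lim csub_A] csubD(4)[OF csub_A _ nA(3)] by (simp add: left_diff_distrib)
  next
    fix b x assume "b \<in> B" "x \<in> A"
    then show "P (b * x * (z * n)) = b * P (x * (z * n))"
      using cexpD(7)[OF cexp_lim, of b "x * (z * n)"] csubD(4)[OF csub_A _ nA(3)] by (simp add: mult.assoc)
  qed
  then show ?thesis by (simp add: mult.assoc)
qed

section \<open>The left kernel of the limit expectation\<close>

definition "J = {x \<in> A. P (star x * x) = 0}"

text \<open>Additivity comes from the parallelogram identity: \<open>P\<close> maps the two positive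
  squares of \<open>x + y\<close> and \<open>x - y\<close> to positive elements with sum 0.\<close>

lemma J_subspace: "subspace J"
  unfolding subspace_def
proof (intro conjI ballI allI)
  note P = cexp_lim
  have sq: "star x * x \<in> A" if "x \<in> A" for x using csubD(4,6)[OF csub_A] that by blast
  have "P 0 = 0" using cexpD(9)[OF P, of 0 0] csubD(2)[OF csub_A] by simp
  then show "0 \<in> J" using csubD(2)[OF csub_A] by (simp add: J_def)
  fix x assume x: "x \<in> J"
  show "r *\<^sub>R x \<in> J" for r
    using x csubD(7)[OF csub_A] sq cexpD(9)[OF P] by (simp add: J_def star_scaleR)
  fix y assume y: "y \<in> J"
  have xy: "x \<in> A" "y \<in> A" "P (star x * x) = 0" "P (star y * y) = 0" using x y by (auto simp: J_def)
  have A: "x + y \<in> A" "x - y \<in> A" using xy csubD[OF csub_A] by auto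
  have "star (x + y) * (x + y) + star (x - y) * (x - y) = 2 *\<^sub>R (star x * x) + 2 *\<^sub>R (star y * y)"
    by (simp add: star_add star_diff algebra_simps scaleR_2)
  then have "P (star (x + y) * (x + y)) + P (star (x - y) * (x - y)) = P (2 *\<^sub>R (star x * x) + 2 *\<^sub>R (star y * y))"
    using cexpD(2)[OF P sq[OF A(1)] sq[OF A(2)]] by simp
  also have "\<dots> = 0"
    using cexpD(2,9)[OF P] sq xy csubD(7)[OF csub_A] by simp
  finally have "P (star (x + y) * (x + y)) = 0"
    by (rule pos_add_eq_0[rotated 2]) (intro cexpD(5)[OF P] sq A pos_star_mult)+
  then show "x + y \<in> J" using A by (simp add: J_def)
qed

lemma J_lim: assumes f: "\<And>k. f k \<in> J" "f \<longlonglongrightarrow> x" shows "x \<in> J"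
proof -
  have fA: "\<And>k. f k \<in> A" using f by (auto simp: J_def)
  have x: "x \<in> A" by (rule A_lim[OF fA f(2)])
  have sq: "star x * x \<in> A" if "x \<in> A" for x using csubD(4,6)[OF csub_A] that by blast
  have "(\<lambda>k. P (star (f k) * f k)) \<longlonglongrightarrow> P (star x * x)"
    by (intro P_lim sq x fA tendsto_intros f)
  moreover have "P (star (f k) * f k) = 0" for k using f(1)[of k] by (simp add: J_def)
  ultimately show ?thesis using x by (simp add: J_def LIMSEQ_const_iff)
qed

text \<open>A left kernel is in general stable only under multiplication from the left. Stability
  from the right holds at normalizers by \<open>null_conj\<close>, and these span a dense
  subspace.\<close>

lemma J_ideal: assumes x: "x \<in> J" and a: "a \<in> A" shows "x * a \<in> J"
proof -
  have xA: "x \<in> A" "star x * x \<in> A" using x csubD(4,6)[OF csub_A] by (auto simp: J_def)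
  have n: "x * n \<in> J" if n: "n \<in> N" for n
  proof -
    have "P (star n * (star x * x) * n) = 0" by (rule null_conj[OF n xA(2)]) (use x in \<open>simp add: J_def\<close>)
    then show ?thesis using csubD(4)[OF csub_A xA(1) N_A[OF n]] by (simp add: J_def star_mult mult.assoc)
  qed
  have "x * s \<in> J" if "s \<in> span N" for s
    using that
  proof (induction rule: span_induct_alt)
    case base then show ?case using subspace_0[OF J_subspace] by simp
  next
    case (step c y z)
    then have "c *\<^sub>R (x * y) + x * z \<in> J" using n subspace_add[OF J_subspace] subspace_scale[OF J_subspace] by blast
    then show ?case by (simp add: distrib_left)
  qed
  note s = this
  have "a \<in> closure (span N)" using a gen_N by blast
  then obtain f where f: "\<And>k. f k \<in> span N" "f \<longlonglongrightarrow> a" unfolding closure_sequential by blast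
  have "(\<lambda>k. x * f k) \<longlonglongrightarrow> x * a" by (intro tendsto_intros f)
  then show ?thesis by (rule J_lim[OF s[OF f(1)]])
qed

lemma faithful_lim: "faithful A P"
  unfolding faithful_def
proof (intro ballI impI, rule ccontr)
  fix x0 assume x0: "x0 \<in> A" "P (star x0 * x0) = 0" "x0 \<noteq> 0"
  note P = cexp_lim
  define x where "x = (1 / norm x0) *\<^sub>R x0"
  have xJ: "x \<in> J" unfolding x_def by (rule subspace_scale[OF J_subspace]) (use x0 in \<open>simp add: J_def\<close>)
  have xA: "x \<in> A" using xJ by (simp add: J_def)
  define h where "h = star x * x"
  have "norm x = 1" using x0(3) by (simp add: x_def)
  then have nh: "norm h = 1" by (simp add: h_def norm_star_mult)
  obtain f where f: "\<And>k. f k \<in> U" "f \<longlonglongrightarrow> x" using A_seq[OF xA] by metis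
  have "(\<lambda>k. norm (star (f k) * f k - h)) \<longlonglongrightarrow> norm (star x * x - h)" by (intro tendsto_intros f)
  then have "(\<lambda>k. norm (star (f k) * f k - h)) \<longlonglongrightarrow> 0" by (simp add: h_def)
  from order_tendstoD(2)[OF this, of "1/4"] obtain k where k: "norm (star (f k) * f k - h) < 1/4"
    using eventually_happens by fastforce
  define a where "a = star (f k) * f k"
  obtain m where m: "f k \<in> AA m" using f(1)[of k] by (auto simp: U_def)
  have aA: "a \<in> AA m" unfolding a_def by (intro csubD(4,6)[OF st.A.csub] m)
  have apos: "pos a" by (simp add: a_def pos_star_mult)
  have "sa (a - of_real (1/2))" by (intro sa_intros pos_sa apos)
  \<comment> \<open>As \<open>norm h = 1\<close> and \<open>a\<close> is within 1/4 of
    \<open>h\<close>, a cut at 1/2 fits: on the support of \<open>G\<close> the element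
    \<open>h\<close> is still at least 1/4, while \<open>norm a\<close> is at least 3/4, so
    \<open>G\<close> cannot vanish.\<close>
  then obtain G G' where G: "pos G" "pos G'" "G * G' = 0" "G' * G = 0" "a - of_real (1/2) = G - G'"
    "\<And>T. rsub T \<Longrightarrow> a - of_real (1/2) \<in> T \<Longrightarrow> G \<in> T \<and> G' \<in> T" using pos_part by metis
  have "a - of_real (1/2) \<in> u1 (AA m)" using st.A.subset_u1[OF aA] st.A.u1_rsub(6,9) by blast
  then have Gm: "G \<in> u1 (AA m)" using G(6)[OF st.A.rsub_u1] by blast
  have "a * (a - of_real (1/2)) = (a - of_real (1/2)) * a" by (simp add: algebra_simps of_real_def)
  then have aG: "a * G = G * a" using G(6)[OF rsub_commutant[of a]] by auto
  have Gs: "star G = G" "star a = a" using pos_sa[OF G(1)] pos_sa[OF apos] by (auto simp: sa_def)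
  \<comment> \<open>\<open>G\<close> lies only in the unitization of the stage; the factor
    \<open>a\<close> returns to \<open>AA m\<close>, on which \<open>P\<close> is faithful.\<close>
  define g where "g = a * G"
  have gm: "g \<in> AA m" unfolding g_def by (rule st.A.u1_mult_right[OF Gm aA])
  have gA: "g \<in> A" using gm AA_U UA by blast
  have gs: "star g = g" using aG by (simp add: g_def star_mult Gs)
  have 1: "pos (star g * (a - of_real (1/2)) * g)"
  proof -
    have "star g * (a - of_real (1/2)) * g = g * (G - G') * g" by (simp only: gs G(5))
    also have "\<dots> = (a * G) * (G - G') * (G * a)" by (simp only: g_def aG[symmetric])
    also have "\<dots> = a * (G * (G - G')) * (G * a)" by (simp only: mult.assoc)
    also have "\<dots> = star (G * a) * G * (G * a)" by (simp add: right_diff_distrib G(3) star_mult Gs mult.assoc)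
    finally show ?thesis using pos_conj[OF G(1)] by simp
  qed
  have "norm (a - h) \<le> 1/4" using k by (simp add: a_def)
  moreover have "sa (a - h)" unfolding h_def by (intro sa_intros pos_sa apos)
  ultimately have "pos (of_real (1/4) - (a - h))" by (intro pos_norm_minus)
  from pos_add[OF pos_conj[OF this, of g] 1]
  moreover have "of_real (1/4) - (a - h) + (a - of_real (1/2)) = h - of_real (1/4)"
  proof -
    have "of_real (1/2) = of_real (1/4) + (of_real (1/4) :: 'u)" by (simp flip: of_real_add)
    then show ?thesis by simp
  qed
  ultimately have 2: "pos (star g * h * g - (1/4) *\<^sub>R (star g * g))"
    by (simp flip: distrib_left distrib_right) (simp add: left_diff_distrib right_diff_distrib of_real_def)
  have xg: "x * g \<in> J" by (rule J_ideal[OF xJ gA])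
  have gg: "star g * g \<in> A" "star g * h * g \<in> A" using gA xA csubD(4,6)[OF csub_A] by (auto simp: h_def)
  have "P (star g * h * g) = 0" using xg by (simp add: J_def h_def star_mult mult.assoc)
  then have "P (star g * h * g - (1/4) *\<^sub>R (star g * g)) = - ((1/4) *\<^sub>R P (star g * g))"
    using cexp_diff[OF P csub_A gg(2) csubD(7)[OF csub_A gg(1)]] cexpD(9)[OF P gg(1)] by simp
  moreover have "pos (P (star g * h * g - (1/4) *\<^sub>R (star g * g)))"
    by (rule cexpD(5)[OF P csubD(9)[OF csub_A gg(2) csubD(7)[OF csub_A gg(1)]] 2])
  ultimately have "pos (- ((1/4) *\<^sub>R P (star g * g)))" by simp
  from pos_scaleR[OF this, of 4] have "pos (- P (star g * g))" by simp
  then have "P (star g * g) = 0" using pos_minus_imp_0 cexpD(5)[OF P gg(1) pos_star_mult] by blast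
  then have "g = 0" using faithful_AA[of m] gm by (simp add: faithful_def)
  have "G * G = (G - G') * G" by (simp add: left_diff_distrib G(4))
  also have "\<dots> = - ((1/2) *\<^sub>R G)" unfolding G(5)[symmetric] using \<open>g = 0\<close>
    by (simp add: left_diff_distrib g_def of_real_def)
  finally have "G * G + (1/2) *\<^sub>R G = 0" by simp
  then have "G * G = 0" by (rule pos_add_eq_0[rotated 2]) (use G(1) in \<open>auto intro: pos_square pos_sa pos_scaleR\<close>)
  then have "G = 0" by (rule sa_square_eq_0[OF pos_sa[OF G(1)]])
  then have "of_real (1/2) - a = G'" using G(5) by (simp add: algebra_simps)
  then have "norm a \<le> 1/2" using G(2) by (intro norm_le_of_pos[OF apos]) auto
  moreover have "norm h \<le> norm (a - h) + norm a" by (metis norm_triangle_sub norm_minus_commute add.commute)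
  ultimately show False using nh k by (simp add: a_def)
qed

lemma masa_lim: "masa A B"
  unfolding masa_def
proof (intro conjI ballI impI csub_B B_sub_A B_comm)
  note P = cexp_lim
  fix x assume x: "x \<in> A" "\<forall>b\<in>B. x * b = b * x"
  have PxB: "P x \<in> B" by (rule cexpD(1)[OF P x(1)])
  define y where "y = x - P x"
  have yA: "y \<in> A" unfolding y_def by (rule csubD(9)[OF csub_A x(1) BA[OF PxB]])
  have yb: "y * b = b * y" if "b \<in> B" for b
    using x(2) that B_comm[OF PxB that] by (simp add: y_def left_diff_distrib right_diff_distrib)
  have Py: "P y = 0"
    unfolding y_def using cexp_diff[OF P csub_A x(1) BA[OF PxB]] cexpD(6)[OF P PxB] by simp
  have mulA: "u * v \<in> A" if "u \<in> A" "v \<in> A" for u v using csubD(4)[OF csub_A that] .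
  have Pn: "norm (P u) \<le> norm u" if "u \<in> A" for u using cexpD(4)[OF P that] .
  have cE: "continuous_on A (\<lambda>z. P (z * y))"
    by (intro continuous_on_compose2[OF P_cont_A] continuous_intros) (use mulA yA in auto)
  have Pd: "P (u - v) = P u - P v" if "u \<in> A" "v \<in> A" for u v by (rule cexp_diff[OF P csub_A that])
  have zero: "P (star n * y) = 0" if n: "n \<in> N" for n
  proof (rule cancel_square[OF csub_A csub_B N_A[OF n] N_sq[OF n] cE _ _ B_sub_A])
    obtain m where m: "n \<in> nz (AA m) (BB m)" using n by (auto simp: N_def)
    have nA: "n \<in> A" "star n \<in> A" using N_A[OF n] csubD(6)[OF csub_A] by auto
    define w where "w = star n * n"
    define C where "C = norm w * norm n"
    have "norm (w * P (star n * y)) \<le> 0 + \<epsilon>" if \<epsilon>: "\<epsilon> > 0" for \<epsilon>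
    proof -
      \<comment> \<open>The estimate at \<open>a0\<close> contributes 8 C \<delta> and the
        replacement of \<open>a0\<close> by \<open>y\<close> another 2 C \<delta>; the summand 1
        avoids division by 0.\<close>
      define \<delta> where "\<delta> = \<epsilon> / (10 * (C + 1))"
      have C: "C \<ge> 0" by (simp add: C_def)
      have \<delta>: "\<delta> > 0" "10 * C * \<delta> \<le> \<epsilon>" using \<epsilon> C by (auto simp: \<delta>_def field_simps)
      have "y \<in> closure U" using yA by (simp add: A_def)
      then obtain a where a: "a \<in> U" "norm (a - y) < \<delta>" using \<delta>(1) unfolding closure_approachable dist_norm by blast
      obtain j where j: "j \<ge> m" "a \<in> AA j" using U_common[OF a(1) a(1)] by metis
      \<comment> \<open>The map z \<mapsto> P (z * a0) vanishes on \<open>BB j\<close> because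
        \<open>P a0 = 0\<close>. Since \<open>P y = 0\<close> and \<open>P\<close> is contractive,
        this correction at most doubles the distance to \<open>y\<close>.\<close>
      define a0 where "a0 = a - P a"
      have Pa: "P a \<in> BB j" by (rule cexpD(1)[OF P_AA j(2)])
      have a0: "a0 \<in> AA j" unfolding a0_def by (rule csubD(9)[OF st.A.csub j(2) st.BA[OF Pa]])
      have aA: "a \<in> A" "a0 \<in> A" using j a0 AA_U UA by auto
      have Pa0: "P a0 = 0"
        unfolding a0_def using cexp_diff[OF P_AA st.A.csub j(2) st.BA[OF Pa]] cexpD(6)[OF P_AA Pa] by simp
      have "a0 - y = (a - y) - P (a - y)" using Pd[OF aA(1) yA] Py by (simp add: a0_def)
      then have "norm (a0 - y) = norm (a - y - P (a - y))" by (rule arg_cong)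
      moreover have "norm (P (a - y)) \<le> norm (a - y)" by (rule Pn[OF csubD(9)[OF csub_A aA(1) yA]])
      ultimately have a0y: "norm (a0 - y) \<le> 2 * \<delta>"
        using norm_triangle_ineq4[of "a - y" "P (a - y)"] a(2) by linarith
      have nj: "n \<in> nz (AA j) (BB j)" using m mono(3)[OF j(1)] by blast
      have mulj: "u * v \<in> AA j" if "u \<in> AA j" "v \<in> AA j" for u v using csubD(4)[OF st.A.csub that] .
      have njA: "star n \<in> AA j" using nj csubD(6)[OF st.A.csub] by (auto simp: nz_def)
      \<comment> \<open>The defect is governed by the commutator of \<open>b\<close> with
        \<open>a0\<close>, which is that with \<open>a0 - y\<close> as \<open>y\<close> commutes
        with \<open>b\<close>. The norm of \<open>a0 - y\<close> is at most 2 \<delta>, hence the 4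
        \<delta>; the factor \<open>norm n\<close> belongs to \<open>star n\<close>.\<close>
      have "norm (star n * n * P (star n * a0)) \<le> 2 * norm (star n * n) * (norm n * (4 * \<delta>))"
      proof (rule st.key_estimate[OF nj, where E="\<lambda>z. P (z * a0)"])
        show "P (z * a0) \<in> BB j" if "z \<in> AA j" for z by (rule cexpD(1)[OF P_AA mulj[OF that a0]])
        show "P (b * z * a0) = b * P (z * a0)" if "b \<in> BB j" "z \<in> AA j" for b z
          using cexpD(7)[OF P_AA that(1) mulj[OF that(2) a0]] by (simp add: mult.assoc)
        show "P (b * a0) = 0" if "b \<in> BB j" for b using cexpD(7)[OF P_AA that a0] Pa0 by simp
        show "0 \<le> norm n * (4 * \<delta>)" using \<delta> by simp
        fix b assume b: "b \<in> BB j"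
        then have bB: "b \<in> B" using BB_V VB by blast
        have "P (star n * b * a0) - P (star n * a0) * b = P (star n * b * a0) - P (star n * a0 * b)"
          using cexpD(8)[OF P_AA b mulj[OF njA a0]] by simp
        also have "\<dots> = P (star n * b * a0 - star n * a0 * b)"
          using Pd nA aA BA[OF bB] mulA by simp
        also have "star n * b * a0 - star n * a0 * b = star n * (b * (a0 - y) - (a0 - y) * b)"
          using yb[OF bB] by (simp add: algebra_simps)
        finally have "norm (P (star n * b * a0) - P (star n * a0) * b) \<le> norm (star n * (b * (a0 - y) - (a0 - y) * b))"
          using Pn[of "star n * (b * (a0 - y) - (a0 - y) * b)"] nA aA yA BA[OF bB] mulA csubD(9)[OF csub_A] by simp
        also have "\<dots> \<le> norm n * norm (b * (a0 - y) - (a0 - y) * b)"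
          using norm_mult_ineq[of "star n"] by simp
        also have "\<dots> \<le> norm n * (4 * \<delta> * norm b)"
        proof (rule mult_left_mono)
          have "norm (b * (a0 - y)) \<le> norm b * (2 * \<delta>)" "norm ((a0 - y) * b) \<le> 2 * \<delta> * norm b"
            by (rule order_trans[OF norm_mult_ineq]; rule mult_mono; use a0y \<delta> in simp)+
          then show "norm (b * (a0 - y) - (a0 - y) * b) \<le> 4 * \<delta> * norm b"
            using norm_triangle_ineq4[of "b * (a0 - y)" "(a0 - y) * b"] by (simp add: algebra_simps)
        qed simp
        finally show "norm (P (star n * b * a0) - P (star n * a0) * b) \<le> norm n * (4 * \<delta>) * norm b"
          by (simp add: mult.assoc)
      qed
      then have 1: "norm (w * P (star n * a0)) \<le> 8 * C * \<delta>" by (simp add: w_def C_def mult_ac)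
      have "w * P (star n * y) = w * P (star n * a0) - w * P (star n * (a0 - y))"
        using Pd mulA nA aA yA by (simp add: right_diff_distrib)
      moreover have "norm (w * P (star n * (a0 - y))) \<le> norm w * (norm n * (2 * \<delta>))"
      proof (rule order_trans[OF norm_mult_ineq mult_left_mono])
        have "norm (P (star n * (a0 - y))) \<le> norm (star n * (a0 - y))"
          by (rule Pn) (use mulA nA aA yA csubD(9)[OF csub_A] in auto)
        also have "\<dots> \<le> norm n * norm (a0 - y)" using norm_mult_ineq[of "star n"] by simp
        also have "\<dots> \<le> norm n * (2 * \<delta>)" using a0y by (rule mult_left_mono) simp
        finally show "norm (P (star n * (a0 - y))) \<le> norm n * (2 * \<delta>)" .
      qed simp
      ultimately have "norm (w * P (star n * y)) \<le> 8 * C * \<delta> + norm w * (norm n * (2 * \<delta>))"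
        using 1 norm_triangle_ineq4[of "w * P (star n * a0)" "w * P (star n * (a0 - y))"] by simp
      also have "\<dots> = 10 * C * \<delta>" by (simp add: C_def)
      finally show ?thesis using \<delta>(2) by simp
    qed
    then have "norm (w * P (star n * y)) \<le> 0" by (rule field_le_epsilon)
    then show "star n * n * P (star n * y) = 0" by (simp add: w_def)
  next
    fix u v assume "u \<in> A" "v \<in> A"
    then show "P ((u - v) * y) = P (u * y) - P (v * y)" using Pd mulA yA by (simp add: left_diff_distrib)
  next
    fix b z assume "b \<in> B" "z \<in> A"
    then show "P (b * z * y) = b * P (z * y)"
      using cexpD(7)[OF P, of b "z * y"] mulA yA by (simp add: mult.assoc)
  qed
  \<comment> \<open>\<open>star y\<close> is a limit of linear combinations of normalizers, each of
    which is the adjoint of an element of \<open>N\<close>.\<close>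
  have "P (star y * y) = 0"
  proof (rule vanish_on_span[OF csub_A _ gen_N cE])
    show "N \<subseteq> A" using N_A by blast
    show "star y \<in> A" by (rule csubD(6)[OF csub_A yA])
    show "P (n * y) = 0" if "n \<in> N" for n using zero[OF N_star[OF that]] by simp
    show "P ((u + v) * y) = P (u * y) + P (v * y)" if "u \<in> A" "v \<in> A" for u v
      using cexpD(2)[OF P] mulA yA that by (simp add: distrib_right)
    show "P (r *\<^sub>R u * y) = r *\<^sub>R P (u * y)" if "u \<in> A" for r u
      using cexpD(9)[OF P] mulA yA that by simp
  qed
  then have "y = 0" using faithful_lim yA by (simp add: faithful_def)
  then show "x \<in> B" using PxB by (simp add: y_def)
qed

lemma cartan_lim: "cartan A B P"
proof -
  have "closure (span N) \<subseteq> closure (span (nz A B))" by (intro closure_mono span_mono N_nz)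
  then show ?thesis
    unfolding cartan_def
    using A.aug_csub_axioms masa_lim apx_lim gen_N cexp_lim faithful_lim by blast
qed

end

section \<open>Pure states and unique extension\<close>

definition tstate :: "'a::cstar1 set \<Rightarrow> ('a \<Rightarrow> complex) \<Rightarrow> bool" where
  "tstate S F \<longleftrightarrow> (\<forall>x\<in>S. \<forall>y\<in>S. F (x + y) = F x + F y) \<and> (\<forall>c. \<forall>x\<in>S. F (cx c * x) = c * F x) \<and>
    (\<forall>x\<in>S. pos x \<longrightarrow> Im (F x) = 0 \<and> 0 \<le> Re (F x)) \<and> (\<forall>x\<in>S. cmod (F x) \<le> norm x) \<and>
    (\<forall>c. (\<forall>x\<in>S. cmod (F x) \<le> c * norm x) \<longrightarrow> 1 \<le> c)"

definition tpure :: "'a::cstar1 set \<Rightarrow> ('a \<Rightarrow> complex) \<Rightarrow> bool" where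
  "tpure S F \<longleftrightarrow> tstate S F \<and> (\<forall>g h t. tstate S g \<and> tstate S h \<and> 0 < t \<and> t < 1 \<and>
       (\<forall>x\<in>S. F x = complex_of_real t * g x + complex_of_real (1 - t) * h x)
       \<longrightarrow> (\<forall>x\<in>S. g x = F x \<and> h x = F x))"

definition tunique :: "'a::cstar1 set \<Rightarrow> 'a set \<Rightarrow> ('a \<Rightarrow> complex) \<Rightarrow> bool" where
  "tunique A B F \<longleftrightarrow> (\<exists>G. tstate A G \<and> (\<forall>b\<in>B. G b = F b) \<and>
     (\<forall>H. tstate A H \<and> (\<forall>b\<in>B. H b = F b) \<longrightarrow> (\<forall>x\<in>A. H x = G x)))"

lemma tstateD:
  assumes "tstate S F"
  shows "x \<in> S \<Longrightarrow> y \<in> S \<Longrightarrow> F (x + y) = F x + F y" "x \<in> S \<Longrightarrow> F (cx c * x) = c * F x"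
    "x \<in> S \<Longrightarrow> pos x \<Longrightarrow> Im (F x) = 0" "x \<in> S \<Longrightarrow> pos x \<Longrightarrow> 0 \<le> Re (F x)" "x \<in> S \<Longrightarrow> cmod (F x) \<le> norm x"
    "(\<And>x. x \<in> S \<Longrightarrow> cmod (F x) \<le> K * norm x) \<Longrightarrow> 1 \<le> K"
  using assms by (auto simp: tstate_def)

lemma tstate_diff: "tstate S F \<Longrightarrow> csub S \<Longrightarrow> x \<in> S \<Longrightarrow> y \<in> S \<Longrightarrow> F (x - y) = F x - F y"
  using tstateD(1)[of S F x "cx (-1) * y"] tstateD(2)[of S F y "-1"] csubD(5)[of S y "-1"]
  by (simp add: cx_minus)

text \<open>Reality of the form at t = 1 and t = i forces \<open>c = cnj b\<close>. At t = - r * cnj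
  b both mixed terms equal - r |b|^2, and non-negativity for all real r is a statement about a
  quadratic polynomial in r.\<close>

lemma sesquilinear_bound:
  fixes a b c d :: complex
  assumes q: "\<And>t. Im (a + t * b + cnj t * c + t * cnj t * d) = 0 \<and> 0 \<le> Re (a + t * b + cnj t * c + t * cnj t * d)"
    and d0: "0 \<le> Re d"
  shows "(cmod b)\<^sup>2 \<le> Re a * Re d"
proof -
  have a: "Im a = 0" "0 \<le> Re a" using q[of 0] by auto
  have d: "Im d = 0" using q[of 1] q[of "-1"] a by simp
  have c: "c = cnj b" using q[of 1] q[of \<i>] a d by (simp add: complex_eq_iff)
  have bb: "b * cnj b = complex_of_real ((cmod b)\<^sup>2)" by (rule complex_norm_square[symmetric])
  have r: "0 \<le> Re a - 2 * r * (cmod b)\<^sup>2 + r\<^sup>2 * (cmod b)\<^sup>2 * Re d" for r :: real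
  proof -
    let ?t = "- complex_of_real r * cnj b"
    have "?t * b = - complex_of_real (r * (cmod b)\<^sup>2)" "cnj ?t * c = - complex_of_real (r * (cmod b)\<^sup>2)"
      "?t * cnj ?t = complex_of_real (r\<^sup>2 * (cmod b)\<^sup>2)"
      using bb by (simp_all add: c mult_ac power2_eq_square)
    then have "Re (a + ?t * b + cnj ?t * c + ?t * cnj ?t * d) = Re a - 2 * r * (cmod b)\<^sup>2 + r\<^sup>2 * (cmod b)\<^sup>2 * Re d"
      by (simp only: plus_complex.sel Re_complex_of_real uminus_complex.sel Re_divide times_complex.sel Im_complex_of_real)
    then show ?thesis using q[of ?t] by simp
  qed
  show ?thesis
  proof (cases "Re d = 0")
    case True
    have "(cmod b)\<^sup>2 = 0"
    proof (rule ccontr)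
      assume "(cmod b)\<^sup>2 \<noteq> 0"
      \<comment> \<open>Without a quadratic term this value of r makes the form - Re a - 2, which is
        negative.\<close>
      then have "2 * ((Re a + 1) / (cmod b)\<^sup>2) * (cmod b)\<^sup>2 = 2 * (Re a + 1)" by simp
      then show False using r[of "(Re a + 1) / (cmod b)\<^sup>2"] True a by simp
    qed
    then show ?thesis using True by simp
  next
    case False
    then have dp: "Re d > 0" using d0 by simp
    have "0 \<le> Re a - 2 * (1 / Re d) * (cmod b)\<^sup>2 + (1 / Re d)\<^sup>2 * (cmod b)\<^sup>2 * Re d" by (rule r)
    also have "\<dots> = Re a - (cmod b)\<^sup>2 / Re d" using dp by (simp add: power2_eq_square field_simps)
    finally show ?thesis using dp by (simp add: field_simps)
  qed
qed

lemma Cauchy_Schwarz: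
  assumes S: "csub S" and F: "tstate S F" and xy: "x \<in> S" "y \<in> S"
  shows "(cmod (F (star y * x)))\<^sup>2 \<le> Re (F (star y * y)) * Re (F (star x * x))"
proof (rule sesquilinear_bound[where c = "F (star x * y)"])
  show "0 \<le> Re (F (star x * x))"
    by (rule tstateD(4)[OF F csubD(4)[OF S csubD(6)[OF S xy(1)] xy(1)] pos_star_mult])
  fix t
  note m = csubD[OF S]
  let ?z = "y + cx t * x"
  have "star ?z * ?z = star y * y + cx t * (star y * x) + (cx (cnj t) * (star x * y) + cx (t * cnj t) * (star x * x))"
  proof -
    have "star ?z = star y + cx (cnj t) * star x" by (simp add: star_add star_mult star_cx cx_commute[of "star x"])
    moreover have "cx (cnj t) * star x * (cx t * x) = cx (t * cnj t) * (star x * x)"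
      by (metis cx_left_commute cx_mult mult.assoc)
    ultimately show ?thesis
      by (simp only: distrib_left distrib_right cx_left_commute[of "star y"] mult.assoc) (simp add: mult.assoc add_ac)
  qed
  then have "F (star ?z * ?z) = F (star y * y) + t * F (star y * x) + cnj t * F (star x * y) + t * cnj t * F (star x * x)"
    using xy by (simp add: tstateD(1,2)[OF F] m add.assoc)
  moreover have z: "?z \<in> S" by (intro m xy)
  have "star ?z * ?z \<in> S" by (rule m(4)[OF m(6)[OF z] z])
  ultimately show "Im (F (star y * y) + t * F (star y * x) + cnj t * F (star x * y) + t * cnj t * F (star x * x)) = 0 \<and>
    0 \<le> Re (F (star y * y) + t * F (star y * x) + cnj t * F (star x * y) + t * cnj t * F (star x * x))"
    using tstateD(3,4)[OF F _ pos_star_mult] by metis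
qed

text \<open>The positive and the negative part of a self-adjoint \<open>h\<close> lie in
  \<open>u1 S\<close>. Their augmentations are equal because \<open>aug h = 0\<close> and have
  product 0, so both vanish and the parts lie in \<open>S\<close>.\<close>

lemma (in aug_csub) pos_spanning:
  assumes add: "\<And>x y. x \<in> Z \<Longrightarrow> y \<in> Z \<Longrightarrow> x + y \<in> Z" and cx: "\<And>c x. x \<in> Z \<Longrightarrow> cx c * x \<in> Z"
    and p: "\<And>p. p \<in> S \<Longrightarrow> pos p \<Longrightarrow> p \<in> Z" and x: "x \<in> S"
  shows "x \<in> Z"
proof (rule sa_spanning[OF csub add cx _ x])
  fix h assume h: "h \<in> S" "sa h"
  obtain p q where pq: "pos p" "pos q" "p * q = 0" "h = p - q" "\<And>T. rsub T \<Longrightarrow> h \<in> T \<Longrightarrow> p \<in> T \<and> q \<in> T"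
    using pos_part[OF h(2)] by metis
  have u: "p \<in> u1 S" "q \<in> u1 S" using pq(5)[OF rsub_u1 subset_u1[OF h(1)]] by auto
  have "aug p * aug q = 0" using pq(3) by (metis aug_0 aug_mult)
  moreover have "aug p = aug q" using aug[OF h(1)] pq(4) by (simp add: aug_diff)
  ultimately have "p \<in> S" "q \<in> S" using u u1_aug_0 by auto
  then have "p + cx (-1) * q \<in> Z" using add cx p pq by blast
  then show "h \<in> Z" using pq(4) by (simp add: cx_minus)
qed

section \<open>Pure states of abelian algebras are characters\<close>

locale abelian_apx = abelian_csub B for B :: "'u::cstar1 set" +
  assumes apxB: "apx B B"
begin

lemmas m = csubD[OF csub]

lemma unit_for: assumes "finite F" "F \<subseteq> B" "\<epsilon> > 0"
  obtains e where "e \<in> B" "pos e" "norm e \<le> 1" "\<And>a. a \<in> F \<Longrightarrow> norm (e * a - a) < \<epsilon>"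
  using apxB assms unfolding apx_def by meson

text \<open>Pointwise this is a convex combination of x and y with weights b and 1 - b, and 1 -
  |z|^2 is the sum of b (1 - |x|^2), (1 - b) (1 - |y|^2) and the variance b (1 - b) |x -
  y|^2.\<close>

lemma norm_convex:
  assumes b: "b \<in> B" "pos b" "norm b \<le> 1" and xy: "x \<in> B" "y \<in> B" "norm x \<le> 1" "norm y \<le> 1"
  shows "norm (b * x + (y - b * y)) \<le> 1"
proof -
  have b1: "pos (1 - b)" using pos_norm_minus[OF pos_sa[OF b(2)] b(3)] by simp
  have bs: "star b = b" using pos_sa[OF b(2)] by (simp add: sa_def)
  have le: "pos (1 - star v * v)" if "norm v \<le> 1" for v :: 'u
    using pos_norm_minus[of "star v * v" 1] that by (simp add: sa_intros norm_star_mult power_le_one)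
  have mem: "b \<in> u1 B" "x \<in> u1 B" "y \<in> u1 B" "star x \<in> u1 B" "star y \<in> u1 B" "1 \<in> u1 B"
    "star (x - y) \<in> u1 B" "x - y \<in> u1 B"
    using subset_u1 b xy m u1_rsub(2) by auto
  note c = u1_comm u1_lcomm u1_mult u1_add u1_rsub(6)
  define z where "z = b * x + (y - b * y)"
  have 1: "pos (b * (1 - star x * x))"
    by (rule pos_mult_commute[OF b(2) le[OF xy(3)]], rule u1_comm) (use mem c in auto)
  have 2: "pos ((1 - b) * (1 - star y * y))"
    by (rule pos_mult_commute[OF b1 le[OF xy(4)]], rule u1_comm) (use mem c in auto)
  have "pos (b * (1 - b))" by (rule pos_mult_commute[OF b(2) b1]) (simp add: algebra_simps)
  then have 3: "pos (b * (1 - b) * (star (x - y) * (x - y)))"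
    by (rule pos_mult_commute[OF _ pos_star_mult], intro u1_comm) (use mem c in auto)
  have "1 - star z * z = b * (1 - star x * x) + (1 - b) * (1 - star y * y) + b * (1 - b) * (star (x - y) * (x - y))"
    using mem unfolding z_def
    by (simp add: star_add star_diff star_mult bs distrib_left distrib_right left_diff_distrib right_diff_distrib mult.assoc c)
  then have "pos (1 - star z * z)" using pos_add 1 2 3 by metis
  then have "norm (star z * z) \<le> 1" by (intro norm_le_of_pos pos_star_mult) auto
  then have "(norm z)\<^sup>2 \<le> 1\<^sup>2" by (simp add: norm_star_mult)
  then show ?thesis unfolding z_def by (rule power2_le_imp_le) simp
qed

text \<open>
  For \<open>0 \<le> b \<le> 1\<close> the functionals \<open>F (b * x)\<close> and \<open>F ((1 - b) * x)\<close> are positive and their norms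
  add up to 1, so by purity both are multiples of \<open>F\<close>.
\<close>

lemma pure_multiple:
  assumes F: "tpure B F" and b: "b \<in> B" "pos b" "norm b \<le> 1"
  obtains c where "\<And>x. x \<in> B \<Longrightarrow> F (b * x) = c * F x"
proof -
  have st: "tstate B F" using F by (simp add: tpure_def)
  note sD = tstateD[OF st]
  have bx: "b * x \<in> B" "x - b * x \<in> B" if "x \<in> B" for x using that b m by auto
  define p where "p x = F (b * x)" for x
  define q where "q x = F (x - b * x)" for x
  have pq: "F x = p x + q x" if "x \<in> B" for x
    using sD(1)[OF bx[OF that]] by (simp add: p_def q_def)
  have b1: "pos (1 - b)" using pos_norm_minus[OF pos_sa[OF b(2)] b(3)] by simp
  have lin: "p (x + y) = p x + p y" "q (x + y) = q x + q y" if "x \<in> B" "y \<in> B" for x y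
  proof -
    show "p (x + y) = p x + p y" using bx that sD(1) by (simp add: p_def distrib_left)
    have "x + y - b * (x + y) = (x - b * x) + (y - b * y)" by (simp add: algebra_simps)
    then have "q (x + y) = F ((x - b * x) + (y - b * y))" by (simp only: q_def)
    then show "q (x + y) = q x + q y" using bx that sD(1) by (simp add: q_def)
  qed
  have hom: "p (cx a * x) = a * p x" "q (cx a * x) = a * q x" if "x \<in> B" for a x
  proof -
    show "p (cx a * x) = a * p x" using bx that sD(2) by (simp add: p_def cx_left_commute)
    have "cx a * x - b * (cx a * x) = cx a * (x - b * x)" by (simp add: cx_left_commute right_diff_distrib)
    then show "q (cx a * x) = a * q x" using bx that sD(2) by (simp add: q_def)
  qed
  have ps: "Im (p x) = 0 \<and> 0 \<le> Re (p x)" "Im (q x) = 0 \<and> 0 \<le> Re (q x)" if x: "x \<in> B" "pos x" for x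
  proof -
    have "pos (b * x)" by (rule pos_mult_commute[OF b(2) x(2) comm[OF b(1) x(1)]])
    then show "Im (p x) = 0 \<and> 0 \<le> Re (p x)" using sD(3,4) bx x by (simp add: p_def)
    have "pos ((1 - b) * x)"
      by (rule pos_mult_commute[OF b1 x(2)]) (use comm[OF b(1) x(1)] in \<open>simp add: algebra_simps\<close>)
    then show "Im (q x) = 0 \<and> 0 \<le> Re (q x)" using sD(3,4) bx x by (simp add: q_def left_diff_distrib)
  qed
  define D where "D = {x \<in> B. norm x \<le> 1}"
  define \<alpha> where "\<alpha> = (SUP x\<in>D. cmod (p x))"
  define \<beta> where "\<beta> = (SUP x\<in>D. cmod (q x))"
  have D0: "0 \<in> D" using m by (simp add: D_def)
  \<comment> \<open>Phases turn \<open>p x\<close> and \<open>q y\<close> into non-negative numbers,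
    whose sum is the value of \<open>F\<close> at one combination of norm at most 1 by
    \<open>norm_convex\<close>.\<close>
  have sum1: "cmod (p x) + cmod (q y) \<le> 1" if xy: "x \<in> D" "y \<in> D" for x y
  proof -
    have unim: "\<exists>u. cmod u \<le> 1 \<and> u * z = complex_of_real (cmod z)" for z :: complex
    proof (cases "z = 0")
      case False
      have "cnj z * z / complex_of_real (cmod z) = complex_of_real (cmod z)"
        using False complex_norm_square[of z] by (simp add: field_simps power2_eq_square)
      then show ?thesis using False by (intro exI[of _ "cnj z / complex_of_real (cmod z)"]) (simp add: norm_divide)
    qed (auto intro: exI[of _ 0])
    obtain u v where u: "cmod u \<le> 1" "u * p x = complex_of_real (cmod (p x))"
      and v: "cmod v \<le> 1" "v * q y = complex_of_real (cmod (q y))" using unim by metis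
    have ux: "cx u * x \<in> B" "cx v * y \<in> B" "norm (cx u * x) \<le> 1" "norm (cx v * y) \<le> 1"
      using xy u v m by (auto simp: D_def norm_cx_mult intro: mult_le_one)
    have "F (b * (cx u * x) + (cx v * y - b * (cx v * y))) = p (cx u * x) + q (cx v * y)"
      using bx ux sD(1) by (simp add: p_def q_def)
    also have "\<dots> = complex_of_real (cmod (p x) + cmod (q y))" using hom xy u v by (simp add: D_def)
    finally have "cmod (complex_of_real (cmod (p x) + cmod (q y))) \<le> 1"
      using sD(5)[of "b * (cx u * x) + (cx v * y - b * (cx v * y))"] norm_convex[OF b ux] bx ux m(3) by simp
    then show ?thesis by (simp only: norm_of_real)
  qed
  have bp: "bdd_above ((\<lambda>x. cmod (p x)) ` D)" "bdd_above ((\<lambda>x. cmod (q x)) ` D)"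
  proof -
    have "cmod (p x) \<le> 1" if "x \<in> D" for x using sum1[OF that D0] norm_ge_zero[of "q 0"] by linarith
    then show "bdd_above ((\<lambda>x. cmod (p x)) ` D)" by (rule bdd_aboveI2)
    have "cmod (q x) \<le> 1" if "x \<in> D" for x using sum1[OF D0 that] norm_ge_zero[of "p 0"] by linarith
    then show "bdd_above ((\<lambda>x. cmod (q x)) ` D)" by (rule bdd_aboveI2)
  qed
  have le1: "\<alpha> + \<beta> \<le> 1"
  proof -
    have "\<alpha> \<le> 1 - cmod (q y)" if "y \<in> D" for y
      unfolding \<alpha>_def
    proof (rule cSUP_least)
      show "D \<noteq> {}" using D0 by blast
      show "cmod (p x) \<le> 1 - cmod (q y)" if "x \<in> D" for x using sum1[OF that \<open>y \<in> D\<close>] by simp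
    qed
    then have "\<beta> \<le> 1 - \<alpha>" unfolding \<beta>_def
    proof (intro cSUP_least)
      show "D \<noteq> {}" using D0 by blast
      show "cmod (q y) \<le> 1 - \<alpha>" if "\<And>y. y \<in> D \<Longrightarrow> \<alpha> \<le> 1 - cmod (q y)" "y \<in> D" for y using that(1)[OF that(2)] by simp
    qed
    then show ?thesis by simp
  qed
  have bound: "cmod (r x) \<le> (SUP x\<in>D. cmod (r x)) * norm x"
    if r: "\<And>a x. x \<in> B \<Longrightarrow> r (cx a * x) = a * r x" "bdd_above ((\<lambda>x. cmod (r x)) ` D)" and x: "x \<in> B"
    for r and x
  proof (cases "x = 0")
    case True
    then show ?thesis using r(1)[OF x, of 0] by simp
  next
    case False
    have xD: "cx (1 / complex_of_real (norm x)) * x \<in> D" using x m False by (simp add: D_def norm_cx_mult norm_divide)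
    have "cmod (r x) / norm x = cmod (r (cx (1 / complex_of_real (norm x)) * x))"
      using r(1)[OF x] by (simp add: norm_divide norm_mult)
    also have "\<dots> \<le> (SUP x\<in>D. cmod (r x))" by (rule cSUP_upper[OF xD r(2)])
    finally show ?thesis using False by (simp add: divide_le_eq)
  qed
  have pb: "cmod (p x) \<le> \<alpha> * norm x" if "x \<in> B" for x
    unfolding \<alpha>_def by (rule bound[OF hom(1) bp(1) that])
  have qb: "cmod (q x) \<le> \<beta> * norm x" if "x \<in> B" for x
    unfolding \<beta>_def by (rule bound[OF hom(2) bp(2) that])
  have ge1: "1 \<le> \<alpha> + \<beta>"
  proof (rule sD(6))
    fix x assume x: "x \<in> B"
    show "cmod (F x) \<le> (\<alpha> + \<beta>) * norm x"
      using pq[OF x] norm_triangle_ineq[of "p x" "q x"] pb[OF x] qb[OF x] by (simp add: distrib_right)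
  qed
  have sum: "\<alpha> + \<beta> = 1" using le1 ge1 by simp
  have nn: "0 \<le> \<alpha>" "0 \<le> \<beta>"
    unfolding \<alpha>_def \<beta>_def using cSUP_upper2[OF bp(1) D0] cSUP_upper2[OF bp(2) D0] by auto
  have stn: "tstate B (\<lambda>x. r x / complex_of_real \<gamma>)"
    if g: "\<gamma> > 0" and r: "\<And>x y. x \<in> B \<Longrightarrow> y \<in> B \<Longrightarrow> r (x + y) = r x + r y" "\<And>a x. x \<in> B \<Longrightarrow> r (cx a * x) = a * r x"
      "\<And>x. x \<in> B \<Longrightarrow> pos x \<Longrightarrow> Im (r x) = 0 \<and> 0 \<le> Re (r x)" "\<And>x. x \<in> B \<Longrightarrow> cmod (r x) \<le> \<gamma> * norm x"
      and sup: "\<gamma> = (SUP x\<in>D. cmod (r x))" for \<gamma> r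
    unfolding tstate_def
  proof (intro conjI ballI allI impI)
    fix c assume c: "\<forall>x\<in>B. cmod (r x / complex_of_real \<gamma>) \<le> c * norm x"
    have c0: "c \<ge> 0"
    proof (rule ccontr)
      assume "\<not> c \<ge> 0"
      then have "r x = 0" if "x \<in> B" for x
        using c that g mult_nonpos_nonneg[of c "norm x"] by (smt (verit) norm_ge_zero norm_le_zero_iff divide_eq_0_iff of_real_eq_0_iff)
      then have "\<gamma> = (SUP x\<in>D. 0)" unfolding sup by (intro SUP_cong) (auto simp: D_def)
      moreover have "(SUP x\<in>D. 0::real) = 0" using D0 by (intro cSUP_const) blast
      ultimately show False using g by linarith
    qed
    have "\<gamma> \<le> c * \<gamma>"
      unfolding sup
    proof (rule cSUP_least)
      show "D \<noteq> {}" using D0 by blast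
      fix x assume x: "x \<in> D"
      then have "cmod (r x) \<le> c * norm x * \<gamma>" using c g by (simp add: D_def norm_divide divide_le_eq)
      also have "\<dots> \<le> c * 1 * \<gamma>" using x c0 g by (intro mult_right_mono mult_left_mono) (auto simp: D_def)
      finally show "cmod (r x) \<le> c * (SUP x\<in>D. cmod (r x))" by (simp add: sup)
    qed
    then show "1 \<le> c" using g by simp
  qed (use g r in \<open>auto simp: norm_divide divide_le_eq add_divide_distrib mult.commute\<close>)
  \<comment> \<open>If one of the functionals is 0 it cannot be normalized to a state, but then the
    other one is \<open>F\<close>.\<close>
  consider "\<alpha> = 0" | "\<beta> = 0" | "\<alpha> > 0" "\<beta> > 0" using nn by fastforce
  then show ?thesis
  proof cases
    case 1
    then have "p x = 0" if "x \<in> B" for x using pb[OF that] by simp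
    then show ?thesis by (intro that[of 0]) (simp add: p_def)
  next
    case 2
    then have "q x = 0" if "x \<in> B" for x using qb[OF that] by simp
    then show ?thesis using pq by (intro that[of 1]) (simp add: p_def)
  next
    case 3
    have 1: "tstate B (\<lambda>x. p x / complex_of_real \<alpha>)"
      by (rule stn) (use 3 lin hom ps pb \<alpha>_def in auto)
    have 2: "tstate B (\<lambda>x. q x / complex_of_real \<beta>)"
      by (rule stn) (use 3 lin hom ps qb \<beta>_def in auto)
    have eq: "F x = complex_of_real \<alpha> * (p x / complex_of_real \<alpha>) + complex_of_real (1 - \<alpha>) * (q x / complex_of_real \<beta>)"
      if "x \<in> B" for x
    proof -
      have "1 - \<alpha> = \<beta>" using sum by simp
      then show ?thesis using pq[OF that] 3 by simp
    qed
    have "\<alpha> < 1" using sum 3 by simp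
    then have "p x / complex_of_real \<alpha> = F x" if "x \<in> B" for x
      using F 1 2 eq 3 that unfolding tpure_def by blast
    then have "F (b * x) = complex_of_real \<alpha> * F x" if "x \<in> B" for x
      using that 3 by (simp add: p_def field_simps)
    then show ?thesis by (rule that)
  qed
qed

lemma pure_mult:
  assumes F: "tpure B F" and xy: "b \<in> B" "y \<in> B"
  shows "F (b * y) = F b * F y"
proof -
  have st: "tstate B F" using F by (simp add: tpure_def)
  note sD = tstateD[OF st]
  \<comment> \<open>Proportionality of x \<mapsto> F (b * x) to \<open>F\<close>, with the factor
    eliminated by cross-multiplication. In this form the condition is linear in \<open>b\<close> and
    extends from positive elements to all of \<open>B\<close>.\<close>
  define Z where "Z = {b \<in> B. \<forall>x\<in>B. \<forall>y\<in>B. F (b * x) * F y = F x * F (b * y)}"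
  have ZB: "b \<in> Z" if "b \<in> B" for b
  proof (rule pos_spanning[OF _ _ _ that])
    fix x y assume "x \<in> Z" "y \<in> Z"
    then show "x + y \<in> Z" using m sD(1) by (simp add: Z_def distrib_right distrib_left)
  next
    fix c x assume "x \<in> Z"
    then show "cx c * x \<in> Z" using m sD(2) by (simp add: Z_def mult.assoc)
  next
    fix p assume p: "p \<in> B" "pos p"
    show "p \<in> Z"
    proof (cases "p = 0")
      case True
      then show ?thesis using sD(2)[of 0 0] m by (simp add: Z_def)
    next
      case False
      let ?p = "(1 / norm p) *\<^sub>R p"
      have pp: "?p \<in> B" "pos ?p" "norm ?p \<le> 1" using p m False pos_scaleR[OF p(2), of "1 / norm p"] by auto
      obtain c where c: "\<And>x. x \<in> B \<Longrightarrow> F (?p * x) = c * F x" using pure_multiple[OF F pp] by metis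
      have "F (p * x) = complex_of_real (norm p) * (c * F x)" if "x \<in> B" for x
      proof -
        have "p * x = cx (complex_of_real (norm p)) * (?p * x)" using False by (simp flip: scaleR_cx)
        then have "F (p * x) = F (cx (complex_of_real (norm p)) * (?p * x))" by (rule arg_cong)
        also have "\<dots> = complex_of_real (norm p) * F (?p * x)" by (rule sD(2)[OF m(4)[OF pp(1) that]])
        finally show ?thesis unfolding c[OF that] .
      qed
      then show ?thesis using p by (simp add: Z_def)
    qed
  qed
  text \<open>It remains to take \<open>x = e * e\<close> for an approximate unit \<open>e\<close> of \<open>B\<close>; the norm 1 of \<open>F\<close> forces
    \<open>F (e * e)\<close> to tend to 1.\<close>
  define M where "M = 6 * ((norm b + 1) * (norm y + 1))"
  have "norm b + 1 > 0" "norm y + 1 > 0" by (simp_all add: add_nonneg_pos)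
  then have M: "M > 0" unfolding M_def by simp
  have "cmod (F (b * y) - F b * F y) \<le> 0 + \<epsilon>" if \<epsilon>: "\<epsilon> > 0" for \<epsilon>
  proof -
    \<comment> \<open>The bound 1/2 makes 1 - 2 \<delta> non-negative, so that an inequality with
      this factor can be squared.\<close>
    define \<delta> where "\<delta> = min (1/2) (\<epsilon> / M)"
    have d: "\<delta> > 0" "\<delta> \<le> 1/2" unfolding \<delta>_def using \<epsilon> M by (simp, intro min.cobounded1)
    have "\<delta> \<le> \<epsilon> / M" by (simp add: \<delta>_def)
    then have dM: "\<delta> * M \<le> \<epsilon>" using M by (simp only: pos_le_divide_eq)
    have "\<exists>z\<in>B. cmod (F z) > (1 - \<delta>) * norm z"
    proof (rule ccontr)
      assume "\<not> ?thesis"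
      then have "1 \<le> 1 - \<delta>" by (intro sD(6)) auto
      then show False using d by simp
    qed
    then obtain z where z: "z \<in> B" "cmod (F z) > (1 - \<delta>) * norm z" by blast
    then have z0: "z \<noteq> 0" using sD(2)[of z 0] by auto
    have "finite {z, b}" "{z, b} \<subseteq> B" "\<delta> * min 1 (norm z) > 0" using z xy z0 d by auto
    then obtain e where e: "e \<in> B" "pos e" "norm e \<le> 1" "\<And>a. a \<in> {z, b} \<Longrightarrow> norm (e * a - a) < \<delta> * min 1 (norm z)"
      using unit_for by metis
    have es: "star e = e" using pos_sa[OF e(2)] by (simp add: sa_def)
    have ez: "norm (e * z - z) \<le> \<delta> * norm z" and eb: "norm (e * b - b) \<le> \<delta>"
    proof -
      have "\<delta> * min 1 (norm z) \<le> \<delta> * norm z" "\<delta> * min 1 (norm z) \<le> \<delta> * 1"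
        by (rule mult_left_mono; use d in simp)+
      then show "norm (e * z - z) \<le> \<delta> * norm z" "norm (e * b - b) \<le> \<delta>"
        using e(4)[of z] e(4)[of b] by auto
    qed
    have ee: "e * e \<in> B" "pos (e * e)" "norm (e * e) \<le> 1"
      using m(4)[OF e(1,1)] pos_square[OF pos_sa[OF e(2)]] norm_mult_ineq[of e e] e(3) mult_le_one[of "norm e" "norm e"] by auto
    have fee: "Im (F (e * e)) = 0" "0 \<le> Re (F (e * e))" "Re (F (e * e)) \<le> 1"
      using sD(3,4)[OF ee(1,2)] sD(5)[OF ee(1)] ee(3) complex_Re_le_cmod[of "F (e * e)"] by auto
    have "cmod (F z) - cmod (F (e * z)) \<le> cmod (F (e * z) - F z)" by (metis norm_minus_commute norm_triangle_ineq2)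
    also have "\<dots> = cmod (F (e * z - z))" using tstate_diff[OF st csub m(4)[OF e(1) z(1)] z(1)] by simp
    also have "\<dots> \<le> \<delta> * norm z" using sD(5)[OF m(9)[OF m(4)[OF e(1) z(1)] z(1)]] ez by simp
    finally have "(1 - 2 * \<delta>) * norm z \<le> cmod (F (e * z))" using z(2) by (simp add: algebra_simps)
    then have "((1 - 2 * \<delta>) * norm z)\<^sup>2 \<le> (cmod (F (star e * z)))\<^sup>2"
      using d by (intro power_mono) (auto simp: es)
    also have "\<dots> \<le> Re (F (star e * e)) * Re (F (star z * z))" by (rule Cauchy_Schwarz[OF csub st z(1) e(1)])
    also have "\<dots> \<le> Re (F (e * e)) * (norm z)\<^sup>2"
    proof -
      have "Re (F (star z * z)) \<le> (norm z)\<^sup>2"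
        using complex_Re_le_cmod[of "F (star z * z)"] sD(5)[of "star z * z"] m z(1) norm_star_mult[of z] by fastforce
      then show ?thesis unfolding es by (rule mult_left_mono[OF _ fee(2)])
    qed
    finally have "(1 - 2 * \<delta>)\<^sup>2 \<le> Re (F (e * e))" using z0 by (simp add: power_mult_distrib)
    moreover have "1 - 4 * \<delta> \<le> (1 - 2 * \<delta>)\<^sup>2" by (simp add: power2_eq_square algebra_simps)
    ultimately have "\<bar>Re (F (e * e)) - 1\<bar> \<le> 4 * \<delta>" using fee(3) by linarith
    moreover have "cmod (F (e * e) - 1) = \<bar>Re (F (e * e)) - 1\<bar>"
      using fee(1) by (simp add: cmod_def)
    ultimately have f1: "cmod (1 - F (e * e)) \<le> 4 * \<delta>" by (simp add: norm_minus_commute)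
    have beb: "norm (b * (e * e) - b) \<le> 2 * \<delta>"
    proof -
      have "b * (e * e) - b = e * (e * b - b) + (e * b - b)"
        using comm[OF xy(1) e(1)] comm[OF xy(1) ee(1)] by (simp add: right_diff_distrib mult.assoc)
      then have "norm (b * (e * e) - b) \<le> norm (e * (e * b - b)) + norm (e * b - b)" by (metis norm_triangle_ineq)
      moreover have "norm (e * (e * b - b)) \<le> 1 * norm (e * b - b)"
        using norm_mult_ineq[of e "e * b - b"] mult_right_mono[OF e(3) norm_ge_zero[of "e * b - b"]] by linarith
      ultimately show ?thesis using eb by linarith
    qed
    have key: "F (b * (e * e)) * F y = F (e * e) * F (b * y)" using ZB[OF xy(1)] ee(1) xy(2) by (simp add: Z_def)
    have "F (b * y) - F b * F y = (1 - F (e * e)) * F (b * y) + F (b * (e * e) - b) * F y"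
      unfolding tstate_diff[OF st csub m(4)[OF xy(1) ee(1)] xy(1)] by (simp add: left_diff_distrib key)
    then have "cmod (F (b * y) - F b * F y) \<le> cmod (1 - F (e * e)) * cmod (F (b * y)) + cmod (F (b * (e * e) - b)) * cmod (F y)"
      by (metis norm_triangle_ineq norm_mult)
    also have "\<dots> \<le> (4 * \<delta>) * (norm b * norm y) + (2 * \<delta>) * norm y"
    proof (intro add_mono mult_mono)
      show "cmod (F (b * y)) \<le> norm b * norm y" using sD(5)[OF m(4)[OF xy]] norm_mult_ineq[of b y] by linarith
      show "cmod (F (b * (e * e) - b)) \<le> 2 * \<delta>"
        using sD(5)[OF m(9)[OF m(4)[OF xy(1) ee(1)] xy(1)]] beb by linarith
    qed (use f1 sD(5)[OF xy(2)] d in auto)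
    also have "\<dots> \<le> \<delta> * M"
    proof -
      have "4 * (norm b * norm y) + 2 * norm y \<le> M" by (simp add: M_def algebra_simps add_increasing)
      from mult_left_mono[OF this, of \<delta>] d show ?thesis by (simp add: algebra_simps)
    qed
    finally show ?thesis using dM by simp
  qed
  then have "cmod (F (b * y) - F b * F y) \<le> 0" by (rule field_le_epsilon)
  then show ?thesis by simp
qed

text \<open>Where \<open>e * x\<close> is close to \<open>x\<close>, the number \<open>F e\<close>
  is close to 1 because \<open>F e * F x = F (e * x)\<close> and \<open>F x\<close> is nonzero. So
  an approximate unit attests norm one.\<close>

lemma character_state:
  assumes add: "\<And>x y. x \<in> B \<Longrightarrow> y \<in> B \<Longrightarrow> F (x + y) = F x + F y" and hom: "\<And>c x. x \<in> B \<Longrightarrow> F (cx c * x) = c * F x"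
    and ps: "\<And>x. x \<in> B \<Longrightarrow> pos x \<Longrightarrow> Im (F x) = 0 \<and> 0 \<le> Re (F x)" and le: "\<And>x. x \<in> B \<Longrightarrow> cmod (F x) \<le> norm x"
    and mult: "\<And>x y. x \<in> B \<Longrightarrow> y \<in> B \<Longrightarrow> F (x * y) = F x * F y" and x: "x \<in> B" "F x \<noteq> 0"
  shows "tstate B F"
  unfolding tstate_def
proof (intro conjI ballI allI impI)
  fix c assume c: "\<forall>x\<in>B. cmod (F x) \<le> c * norm x"
  have c0: "c \<ge> 0"
  proof (rule ccontr)
    assume "\<not> c \<ge> 0"
    then have "c * norm x \<le> 0" by (simp add: mult_nonpos_nonneg)
    moreover have "cmod (F x) \<le> c * norm x" using c x by blast
    ultimately show False using x(2) norm_le_zero_iff[of "F x"] by linarith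
  qed
  show "1 \<le> c"
  proof (rule field_le_epsilon)
    fix \<epsilon> :: real assume \<epsilon>: "\<epsilon> > 0"
    have "finite {x}" "{x} \<subseteq> B" "\<epsilon> * cmod (F x) > 0" using x \<epsilon> by auto
    then obtain e where e: "e \<in> B" "norm e \<le> 1" "norm (e * x - x) < \<epsilon> * cmod (F x)"
      using unit_for by (metis singletonI)
    have "F (e * x) = F (e * x - x) + F x" using add[of "e * x - x" x] e x m by simp
    then have "(F e - 1) * F x = F (e * x - x)" using mult[OF e(1) x(1)] by (simp add: algebra_simps)
    then have "cmod (F e - 1) * cmod (F x) \<le> norm (e * x - x)"
      using le[OF m(9)[OF m(4)[OF e(1) x(1)] x(1)]] by (metis norm_mult)
    then have "cmod (F e - 1) * cmod (F x) \<le> \<epsilon> * cmod (F x)" using e(3) by simp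
    then have "cmod (F e - 1) \<le> \<epsilon>" using x(2) by simp
    then have "1 \<le> cmod (F e) + \<epsilon>" using norm_triangle_ineq2[of 1 "F e"] by (simp add: norm_minus_commute)
    moreover have "cmod (F e) \<le> c" using c e c0 mult_left_mono[OF e(2) c0] by fastforce
    ultimately show "1 \<le> c + \<epsilon>" by simp
  qed
qed (use assms in auto)

text \<open>If \<open>F z = 0\<close> then \<open>F (star z * z) = 0\<close> by multiplicativity, so
  \<open>g (star z * z) = 0\<close>, and Cauchy-Schwarz with an approximate unit gives
  \<open>g z = 0\<close>. As \<open>g\<close> vanishes on the kernel of \<open>F\<close> it is a
  multiple of \<open>F\<close>, and the factor is 1 since both have norm one.\<close>

lemma character_dominates:
  assumes F: "tstate B F" and mult: "\<And>x y. x \<in> B \<Longrightarrow> y \<in> B \<Longrightarrow> F (x * y) = F x * F y"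
    and g: "tstate B g" and null: "\<And>x. x \<in> B \<Longrightarrow> pos x \<Longrightarrow> F x = 0 \<Longrightarrow> g x = 0" and x: "x \<in> B"
  shows "g x = F x"
proof -
  note sF = tstateD[OF F] and sg = tstateD[OF g]
  have ker: "g z = 0" if z: "z \<in> B" "F z = 0" for z
  proof -
    have zz: "star z * z \<in> B" using m(4)[OF m(6)[OF z(1)] z(1)] .
    have "F (star z * z) = 0" using mult[of "star z" z] z m by simp
    then have gz: "g (star z * z) = 0" using null zz pos_star_mult by blast
    have "cmod (g z) \<le> 0 + \<epsilon>" if "\<epsilon> > 0" for \<epsilon>
    proof -
      have "finite {z}" "{z} \<subseteq> B" using z by auto
      then obtain e where e: "e \<in> B" "pos e" "norm (e * z - z) < \<epsilon>" using unit_for \<open>\<epsilon> > 0\<close> by (metis singletonI)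
      have es: "star e = e" using pos_sa[OF e(2)] by (simp add: sa_def)
      have "(cmod (g (star e * z)))\<^sup>2 \<le> Re (g (star e * e)) * Re (g (star z * z))"
        by (rule Cauchy_Schwarz[OF csub g z(1) e(1)])
      then have "g (e * z) = 0" using gz es by simp
      then have "g (e * z - z) = - g z" using tstate_diff[OF g csub m(4)[OF e(1) z(1)] z(1)] by simp
      then show ?thesis using sg(5)[OF m(9)[OF m(4)[OF e(1) z(1)] z(1)]] e(3) by simp
    qed
    then have "cmod (g z) \<le> 0" by (rule field_le_epsilon)
    then show ?thesis by simp
  qed
  have "\<exists>p\<in>B. pos p \<and> F p \<noteq> 0"
  proof (rule ccontr)
    assume no: "\<not> ?thesis"
    have "z \<in> {z \<in> B. F z = 0}" if "z \<in> B" for z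
      by (rule pos_spanning[OF _ _ _ that]) (use no m sF(1,2) in auto)
    then have "1 \<le> (0::real)" by (intro sF(6)) auto
    then show False by simp
  qed
  then obtain p where p: "p \<in> B" "pos p" "F p \<noteq> 0" by blast
  define l where "l = g p / F p"
  have gl: "g z = l * F z" if z: "z \<in> B" for z
  proof -
    have zp: "cx (F z / F p) * p \<in> B" using p m by blast
    have "F (z - cx (F z / F p) * p) = 0" using tstate_diff[OF F csub z zp] sF(2)[OF p(1)] p(3) by simp
    then have "g (z - cx (F z / F p) * p) = 0" using ker m(9)[OF z zp] by blast
    then show ?thesis using tstate_diff[OF g csub z zp] sg(2)[OF p(1)] by (simp add: l_def)
  qed
  have real: "Im (F p) = 0" "Re (F p) > 0" "Im (g p) = 0" "Re (g p) \<ge> 0"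
    using sF(3,4)[OF p(1,2)] sg(3,4)[OF p(1,2)] p(3) by (auto simp: complex_eq_iff less_le)
  then have lr: "l = complex_of_real (Re (g p) / Re (F p))" by (simp add: l_def complex_eq_iff complex_is_Real_iff Re_divide_Reals)
  define k where "k = Re (g p) / Re (F p)"
  have k0: "k \<ge> 0" using real by (simp add: k_def)
  have nk: "cmod (g z) = k * cmod (F z)" if "z \<in> B" for z
    using gl[OF that] k0 by (simp add: lr norm_mult flip: k_def)
  have k1: "1 \<le> k" by (rule sg(6)) (use nk sF(5) k0 in \<open>auto intro: mult_left_mono\<close>)
  have "1 \<le> 1 / k" by (rule sF(6)) (use nk sg(5) k1 in \<open>auto simp: field_simps\<close>)
  then have "k = 1" using k1 by simp
  then show ?thesis using gl[OF x] by (simp add: lr k_def)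
qed

text \<open>Both components of a convex decomposition are non-negative on positive elements, so they
  vanish on those where \<open>F\<close> does, and \<open>character_dominates\<close> applies to
  each.\<close>

lemma character_pure:
  assumes F: "tstate B F" and mult: "\<And>x y. x \<in> B \<Longrightarrow> y \<in> B \<Longrightarrow> F (x * y) = F x * F y"
  shows "tpure B F"
  unfolding tpure_def
proof (intro conjI F allI impI, elim conjE)
  fix g h t assume g: "tstate B g" and h: "tstate B h" and t: "0 < t" "t < 1"
    and eq: "\<forall>x\<in>B. F x = complex_of_real t * g x + complex_of_real (1 - t) * h x"
  have "g x = 0 \<and> h x = 0" if x: "x \<in> B" "pos x" "F x = 0" for x
  proof -
    have "Im (g x) = 0" "Re (g x) \<ge> 0" "Im (h x) = 0" "Re (h x) \<ge> 0"
      using tstateD(3,4)[OF g x(1,2)] tstateD(3,4)[OF h x(1,2)] by auto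
    moreover have "Re (complex_of_real t * g x + complex_of_real (1 - t) * h x) = 0" using eq x by simp
    then have "t * Re (g x) + (1 - t) * Re (h x) = 0" by simp
    then have "t * Re (g x) = 0 \<and> (1 - t) * Re (h x) = 0"
      using calculation t by (intro add_nonneg_eq_0_iff[THEN iffD1]) auto
    ultimately show ?thesis using t by (simp add: complex_eq_iff)
  qed
  then show "\<forall>x\<in>B. g x = F x \<and> h x = F x"
    using character_dominates[OF F mult g] character_dominates[OF F mult h] by blast
qed

end

section \<open>Unique extension of pure states in the limit\<close>

context lim_sys
begin

lemma tunique_lim:
  assumes diag: "\<And>m F. tpure (BB m) F \<Longrightarrow> tunique (AA m) (BB m) F" and F: "tpure B F"
  shows "tunique A B F"
proof -
  note P = cexp_lim and lim_BA = BA
  have B_apx: "apx T T" if "apx S T" "T \<subseteq> S" for S T :: "'u set"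
    using that unfolding apx_def by (meson order_trans)
  interpret C: abelian_apx B
    by unfold_locales (use csub_B B_comm B_apx[OF apx_lim B_sub_A] A.aug[OF BA] in auto)
  have stm: "masa_apx (AA m) (BB m)" for m by (rule cartan_masa_apx[OF cart])
  have Cm: "abelian_apx (BB m)" for m
  proof -
    interpret masa_apx "AA m" "BB m" by (rule stm)
    show ?thesis
      by unfold_locales (use B(1) B(3) B_apx[OF apx B(2)] B.aug in auto)
  qed
  have st: "tstate B F" using F by (simp add: tpure_def)
  note sF = tstateD[OF st]
  have mult: "F (x * y) = F x * F y" if "x \<in> B" "y \<in> B" for x y by (rule C.pure_mult[OF F that])
  have BBm: "x \<in> B" if "x \<in> BB m" for x m using BB_V[OF that] VB by blast
  have AAm: "x \<in> A" if "x \<in> AA m" for x m using AA_U[OF that] UA by blast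
  have PB: "P x \<in> B" if "x \<in> A" for x by (rule cexpD(1)[OF P that])
  \<comment> \<open>Existence of an extension: composition with the expectation is a state because
    \<open>P\<close> is positive, contractive and the identity on \<open>B\<close>.\<close>
  define G where "G x = F (P x)" for x
  have G: "tstate A G"
    unfolding tstate_def
  proof (intro conjI ballI allI impI)
    fix x y c assume "x \<in> A"
    then show "G (cx c * x) = c * G x" "cmod (G x) \<le> norm x"
      using cexpD(3)[OF P] sF(2) PB order_trans[OF sF(5)[OF PB] cexpD(4)[OF P]] by (auto simp: G_def)
    show "Im (G x) = 0" "0 \<le> Re (G x)" if "pos x"
      using cexpD(5)[OF P] sF(3,4) PB that \<open>x \<in> A\<close> by (auto simp: G_def)
    assume "y \<in> A"
    then show "G (x + y) = G x + G y" using cexpD(2)[OF P] sF(1) PB \<open>x \<in> A\<close> by (simp add: G_def)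
  next
    fix c assume c: "\<forall>x\<in>A. cmod (G x) \<le> c * norm x"
    show "1 \<le> c"
    proof (rule sF(6))
      fix x assume "x \<in> B"
      then show "cmod (F x) \<le> c * norm x" using c BA cexpD(6)[OF P] by (metis G_def)
    qed
  qed
  have GB: "G b = F b" if "b \<in> B" for b using cexpD(6)[OF P that] by (simp add: G_def)
  have "H x = G x" if H: "tstate A H" and HB: "\<forall>b\<in>B. H b = F b" and x: "x \<in> A" for H x
  proof -
    note sH = tstateD[OF H] and sG = tstateD[OF G]
    have stage: "H a = G a" if a: "a \<in> AA m" for a m
    proof (cases "\<forall>b\<in>BB m. F b = 0")
      case True
      interpret masa_apx "AA m" "BB m" by (rule stm)
      have aA: "a \<in> A" by (rule AAm[OF a])
      have Pa: "P a \<in> BB m" by (rule cexpD(1)[OF P_AA a])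
      \<comment> \<open>Here \<open>G a = F (P a)\<close> is 0. Cauchy-Schwarz annihilates
        \<open>H (a * e)\<close> for every \<open>e\<close> in \<open>BB m\<close>, and for suitable
        \<open>e\<close> the product is close to \<open>a\<close>.\<close>
      have "cmod (H a) \<le> 0 + \<epsilon>" if "\<epsilon> > 0" for \<epsilon>
      proof -
        have "finite {a}" "{a} \<subseteq> AA m" using a by auto
        then obtain e where e: "e \<in> BB m" "norm (a * e - a) < \<epsilon>"
          using apx \<open>\<epsilon> > 0\<close> unfolding apx_def by (metis singletonI)
        have eA: "e \<in> A" using BBm[OF e(1)] lim_BA by blast
        have "star e * e \<in> BB m" using csubD(4,6)[OF B(1)] e by blast
        then have "H (star e * e) = 0" using True HB BBm by metis
        moreover have "(cmod (H (star (star a) * e)))\<^sup>2 \<le> Re (H (star (star a) * star a)) * Re (H (star e * e))"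
          by (rule Cauchy_Schwarz[OF csub_A H eA csubD(6)[OF csub_A aA]])
        ultimately have "H (a * e) = 0" by simp
        then have "H (a * e - a) = - H a" using tstate_diff[OF H csub_A csubD(4)[OF csub_A aA eA] aA] by simp
        then show ?thesis
          using sH(5)[OF csubD(9)[OF csub_A csubD(4)[OF csub_A aA eA] aA]] e(2) by simp
      qed
      then have "cmod (H a) \<le> 0" by (rule field_le_epsilon)
      then show ?thesis using True Pa by (simp add: G_def)
    next
      case False
      then obtain b where b: "b \<in> BB m" "F b \<noteq> 0" by blast
      interpret Cm: abelian_apx "BB m" by (rule Cm)
      have sm: "tstate (BB m) F"
        by (rule Cm.character_state[where x = b]) (use sF mult BBm b in auto)
      have "tpure (BB m) F" by (rule Cm.character_pure[OF sm]) (use mult BBm in auto)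
      \<comment> \<open>Both \<open>H\<close> and \<open>G\<close> restrict to states of
        \<open>AA m\<close> that extend the pure state \<open>F\<close> of \<open>BB m\<close>, so
        both agree there with the same \<open>K\<close>.\<close>
      from diag[OF this] obtain K where K: "\<And>T. tstate (AA m) T \<Longrightarrow> (\<And>b. b \<in> BB m \<Longrightarrow> T b = F b) \<Longrightarrow> (\<forall>x\<in>AA m. T x = K x)"
        unfolding tunique_def by blast
      have res: "tstate (AA m) T" if T: "tstate A T" "\<And>b. b \<in> BB m \<Longrightarrow> T b = F b" for T
        unfolding tstate_def
      proof (intro conjI ballI allI impI)
        fix c assume c: "\<forall>x\<in>AA m. cmod (T x) \<le> c * norm x"
        have sub: "BB m \<subseteq> AA m" using stm[of m] masa_apx.B(2) by blast
        show "1 \<le> c" by (rule tstateD(6)[OF sm]) (use c T(2) sub in \<open>metis subsetD\<close>)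
      qed (use tstateD[OF T(1)] AAm in auto)
      have "\<forall>x\<in>AA m. H x = K x" by (rule K[OF res[OF H]]) (use HB BBm in auto)
      moreover have "\<forall>x\<in>AA m. G x = K x" by (rule K[OF res[OF G]]) (use GB BBm in auto)
      ultimately show ?thesis using a by simp
    qed
    have "cmod (H x - G x) \<le> 0 + \<epsilon>" if "\<epsilon> > 0" for \<epsilon>
    proof -
      have "x \<in> closure U" using x by (simp add: A_def)
      moreover have "\<epsilon> / 2 > 0" using that by simp
      ultimately obtain a where a: "a \<in> U" "norm (a - x) < \<epsilon> / 2"
        unfolding closure_approachable dist_norm by blast
      have aA: "a \<in> A" "a - x \<in> A" using UA[OF a(1)] csubD(9)[OF csub_A _ x] by auto
      have "H a = G a" using a(1) stage by (auto simp: U_def)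
      then have "H x - G x = G (a - x) - H (a - x)"
        using tstate_diff[OF H csub_A aA(1) x] tstate_diff[OF G csub_A aA(1) x] by simp
      then show ?thesis
        using norm_triangle_ineq4[of "G (a - x)" "H (a - x)"] sG(5)[OF aA(2)] sH(5)[OF aA(2)] a(2) by simp
    qed
    then have "cmod (H x - G x) \<le> 0" by (rule field_le_epsilon)
    then show ?thesis by simp
  qed
  then show ?thesis unfolding tunique_def using G GB by blast
qed

end

section \<open>Transfer of states along isometric representations\<close>

context iso_rep
begin

lemma iso_rep_sub:
  assumes S: "sub_cstar A S"
  shows "iso_rep (A\<lparr>car := S\<rparr>) f"
proof -
  have "\<And>x. x \<in> S \<Longrightarrow> x \<in> car A" using S by (auto simp: sub_cstar_def)
  then show ?thesis
    by (intro iso_rep.intro iso_rep_axioms.intro cstar_algebra_sub[OF cstar_algebra_axioms S])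
      (auto simp: f_add f_scl f_mul f_adj norm_f aug_f)
qed

lemma functional_lift: "\<exists>G. \<forall>x\<in>car A. G (f x) = g x"
proof -
  have "inj_on f (car A)" by (auto intro!: inj_onI simp: f_eq_iff)
  then have "\<forall>x\<in>car A. g (inv_into (car A) f (f x)) = g x" by simp
  then show ?thesis by (rule exI[of _ "\<lambda>y. g (inv_into (car A) f y)"])
qed

lemma state_iff:
  assumes G: "\<And>x. x \<in> car A \<Longrightarrow> G (f x) = g x"
  shows "state A g \<longleftrightarrow> tstate (f ` car A) G"
proof -
  have "(\<forall>x\<in>car A. \<forall>y\<in>car A. g (x \<oplus> y) = g x + g y) \<longleftrightarrow>
    (\<forall>x\<in>f ` car A. \<forall>y\<in>f ` car A. G (x + y) = G x + G y)"
    by (auto simp: f_add[symmetric] G add_closed)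
  moreover have "(\<forall>c. \<forall>x\<in>car A. g (c \<odot> x) = c * g x) \<longleftrightarrow> (\<forall>c. \<forall>x\<in>f ` car A. G (cx c * x) = c * G x)"
    by (auto simp: f_scl[symmetric] G scl_closed)
  moreover have "(\<forall>x\<in>car A. Defs.positive A x \<longrightarrow> Im (g x) = 0 \<and> 0 \<le> Re (g x)) \<longleftrightarrow>
    (\<forall>x\<in>f ` car A. pos x \<longrightarrow> Im (G x) = 0 \<and> 0 \<le> Re (G x))"
    by (auto simp: positive_iff G)
  moreover have "(\<forall>x\<in>car A. cmod (g x) \<le> c * nrm A x) \<longleftrightarrow> (\<forall>x\<in>f ` car A. cmod (G x) \<le> c * norm x)" for c
    by (auto simp: norm_f G)
  moreover have "(\<forall>x\<in>car A. cmod (g x) \<le> nrm A x) \<longleftrightarrow> (\<forall>x\<in>f ` car A. cmod (G x) \<le> norm x)"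
    by (auto simp: norm_f G)
  ultimately show ?thesis unfolding state_def tstate_def by (simp only:)
qed

lemma pure_state_iff:
  assumes G: "\<And>x. x \<in> car A \<Longrightarrow> G (f x) = g x"
  shows "pure_state A g \<longleftrightarrow> tpure (f ` car A) G"
proof
  assume g: "pure_state A g"
  show "tpure (f ` car A) G"
    unfolding tpure_def
  proof (intro conjI allI impI; (elim conjE)?)
    show "tstate (f ` car A) G" using g state_iff[of G g, OF G] by (simp add: pure_state_def)
    fix H K t assume H: "tstate (f ` car A) H" and K: "tstate (f ` car A) K" and t: "0 < t" "t < 1"
      and eq: "\<forall>x\<in>f ` car A. G x = complex_of_real t * H x + complex_of_real (1 - t) * K x"
    have "state A (\<lambda>x. H (f x))" "state A (\<lambda>x. K (f x))"
      using state_iff[of H "\<lambda>x. H (f x)"] state_iff[of K "\<lambda>x. K (f x)"] H K by simp_all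
    moreover have "\<forall>x\<in>car A. g x = complex_of_real t * H (f x) + complex_of_real (1 - t) * K (f x)"
      using eq by (simp add: G)
    ultimately have "\<forall>x\<in>car A. H (f x) = g x \<and> K (f x) = g x" using g t unfolding pure_state_def by blast
    then show "\<forall>x\<in>f ` car A. H x = G x \<and> K x = G x" by (simp add: G)
  qed
next
  assume p: "tpure (f ` car A) G"
  show "pure_state A g"
    unfolding pure_state_def
  proof (intro conjI allI impI; (elim conjE)?)
    show "state A g" using p state_iff[of G g, OF G] by (simp add: tpure_def)
    fix h k t assume h: "state A h" and k: "state A k" and t: "0 < t" "t < 1"
      and eq: "\<forall>x\<in>car A. g x = complex_of_real t * h x + complex_of_real (1 - t) * k x"
    obtain H where H: "\<And>x. x \<in> car A \<Longrightarrow> H (f x) = h x" using functional_lift[of h] by blast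
    obtain K where K: "\<And>x. x \<in> car A \<Longrightarrow> K (f x) = k x" using functional_lift[of k] by blast
    have "tstate (f ` car A) H" "tstate (f ` car A) K" using state_iff[of H h, OF H] state_iff[of K k, OF K] h k by simp_all
    moreover have "\<forall>x\<in>f ` car A. G x = complex_of_real t * H x + complex_of_real (1 - t) * K x"
      using eq by (simp add: G H K)
    ultimately have "\<forall>x\<in>f ` car A. H x = G x \<and> K x = G x" using p t unfolding tpure_def by blast
    then show "\<forall>x\<in>car A. h x = g x \<and> k x = g x" by (simp add: G H K)
  qed
qed

lemma extends_uniquely_iff:
  assumes B: "B \<subseteq> car A" and F: "\<And>b. b \<in> B \<Longrightarrow> F (f b) = g b"
  shows "extends_uniquely A B g \<longleftrightarrow> tunique (f ` car A) (f ` B) F"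
proof
  have Bc: "b \<in> B \<Longrightarrow> b \<in> car A" for b using B by blast
  {
    assume "extends_uniquely A B g"
    then obtain h where h: "state A h" "\<forall>b\<in>B. h b = g b"
      and u: "\<And>k. state A k \<Longrightarrow> \<forall>b\<in>B. k b = g b \<Longrightarrow> \<forall>x\<in>car A. k x = h x"
      unfolding extends_uniquely_def by blast
    obtain H where H: "\<And>x. x \<in> car A \<Longrightarrow> H (f x) = h x" using functional_lift[of h] by blast
    have "\<forall>x\<in>f ` car A. K x = H x" if K: "tstate (f ` car A) K" "\<forall>b\<in>f ` B. K b = F b" for K
    proof -
      have "state A (\<lambda>x. K (f x))" using state_iff[of K "\<lambda>x. K (f x)"] K by simp
      then have "\<forall>x\<in>car A. K (f x) = h x" using u K(2) by (simp add: F)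
      then show ?thesis by (simp add: H)
    qed
    moreover have "tstate (f ` car A) H" using state_iff[of H h, OF H] h by simp
    moreover have "\<forall>b\<in>f ` B. H b = F b" using h by (simp add: H F Bc)
    ultimately show "tunique (f ` car A) (f ` B) F" unfolding tunique_def by blast
  next
    assume "tunique (f ` car A) (f ` B) F"
    then obtain H where H: "tstate (f ` car A) H \<and> (\<forall>b\<in>f ` B. H b = F b) \<and>
      (\<forall>K. tstate (f ` car A) K \<and> (\<forall>b\<in>f ` B. K b = F b) \<longrightarrow> (\<forall>x\<in>f ` car A. K x = H x))"
      unfolding tunique_def ..
    then have h: "tstate (f ` car A) H" "\<forall>b\<in>f ` B. H b = F b"
      and u: "\<And>K. tstate (f ` car A) K \<Longrightarrow> \<forall>b\<in>f ` B. K b = F b \<Longrightarrow> \<forall>x\<in>f ` car A. K x = H x" by blast+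
    have "\<forall>x\<in>car A. k x = H (f x)" if k: "state A k" "\<forall>b\<in>B. k b = g b" for k
    proof -
      obtain K where K: "\<And>x. x \<in> car A \<Longrightarrow> K (f x) = k x" using functional_lift[of k] by blast
      have "\<forall>x\<in>f ` car A. K x = H x" using u[of K] state_iff[of K k, OF K] k by (simp add: K F Bc)
      then show ?thesis by (simp add: K)
    qed
    moreover have "state A (\<lambda>x. H (f x))" using state_iff[of H "\<lambda>x. H (f x)"] h by simp
    moreover have "\<forall>b\<in>B. H (f b) = g b" using h by (simp add: F)
    ultimately show "extends_uniquely A B g" unfolding extends_uniquely_def by blast
  }
qed

end

section \<open>Inductive systems of Cartan pairs\<close>

locale cartan_sys = ind_sys_sub +
  fixes P :: "nat \<Rightarrow> 'a \<Rightarrow> 'a"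
  assumes pair: "cartan_pair (A n) (B n)" and fce: "faithful_cond_exp (A n) (B n) (P n)"
    and phi_nz: "\<phi> n ` normalizers (A n) (B n) \<subseteq> normalizers (A (Suc n)) (B (Suc n))"
    and P_phi: "a \<in> car (A n) \<Longrightarrow> P (Suc n) (\<phi> n a) = \<phi> n (P n a)"
begin

interpretation A: cstar_algebra "A n" for n by (rule A)
interpretation E: iso_rep L "emb L" by (rule iso_rep_emb[OF cstar_L])

text \<open>Each stage is represented through the limit rather than by its own embedding. Thus all
  images lie in one algebra and increase with \<open>m\<close>, as \<open>lim_sys\<close>
  requires.\<close>

definition "j m a = emb L (canon A \<phi> m a)"

lemma iso_rep_j: "iso_rep (A m) (j m)"
proof (intro iso_rep.intro A iso_rep_axioms.intro)
  fix x y c assume x: "x \<in> car (A m)"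
  show "j m (c \<odot>\<^bsub>A m\<^esub> x) = cx c * j m x"
    using E.f_scl[OF canon_L[OF x]] by (simp add: j_def canon_scl[OF x] L_ops)
  show "j m (adj (A m) x) = star (j m x)"
    using E.f_adj[OF canon_L[OF x]] by (simp add: j_def canon_adj[OF x] L_ops)
  show "norm (j m x) = nrm (A m) x"
    using E.norm_f[OF canon_L[OF x]] by (simp add: j_def nrm_canon[OF x] L_ops)
  show "aug (j m x) = 0"
    using E.aug_f[OF canon_L[OF x]] by (simp add: j_def)
  assume y: "y \<in> car (A m)"
  show "j m (x \<oplus>\<^bsub>A m\<^esub> y) = j m x + j m y"
    using E.f_add[OF canon_L[OF x] canon_L[OF y]] by (simp add: j_def canon_add[OF x y] L_ops)
  show "j m (x \<otimes>\<^bsub>A m\<^esub> y) = j m x * j m y"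
    using E.f_mul[OF canon_L[OF x] canon_L[OF y]] by (simp add: j_def canon_mul[OF x y] L_ops)
qed

interpretation J: iso_rep "A m" "j m" for m by (rule iso_rep_j)

lemma j_step: "a \<in> car (A m) \<Longrightarrow> j (Suc m) (\<phi> m a) = j m a"
  by (simp add: j_def canon_step)

lemma j_connect: "a \<in> car (A m) \<Longrightarrow> j (m + k) (connect \<phi> m k a) = j m a"
  by (induction k) (simp_all add: j_step connect(1))

lemma P_car: "a \<in> car (A m) \<Longrightarrow> P m a \<in> car (A m)"
  using fce[of m] BA[of m] by (auto simp: faithful_cond_exp_def cond_exp_def)

lemma P_connect: "a \<in> car (A m) \<Longrightarrow> P (m + k) (connect \<phi> m k a) = connect \<phi> m k (P m a)"
  by (induction k) (simp_all add: P_phi connect(1))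

lemma nrm_P_diff:
  assumes "a \<in> car (A m)" "b \<in> car (A m)"
  shows "nrm (A m) (P m a \<ominus>\<^bsub>A m\<^esub> P m b) \<le> nrm (A m) (a \<ominus>\<^bsub>A m\<^esub> b)"
proof -
  have "P m (a \<ominus>\<^bsub>A m\<^esub> b) = P m a \<ominus>\<^bsub>A m\<^esub> P m b"
    using fce[of m] assms by (simp add: faithful_cond_exp_def cond_exp_def sub_def A.scl_closed)
  moreover have "nrm (A m) (P m (a \<ominus>\<^bsub>A m\<^esub> b)) \<le> nrm (A m) (a \<ominus>\<^bsub>A m\<^esub> b)"
    using fce[of m] A.sub_closed[OF assms] by (simp add: faithful_cond_exp_def cond_exp_def)
  ultimately show ?thesis by simp
qed

lemma j_common:
  assumes "a \<in> car (A m)" "b \<in> car (A n)"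
  obtains k a' b' where "a' \<in> car (A k)" "b' \<in> car (A k)" "j k a' = j m a" "j k b' = j n b"
    "j k (P k a') = j m (P m a)" "j k (P k b') = j n (P n b)"
proof -
  obtain p where p: "max m n = m + p" by (metis le_Suc_ex max.cobounded1)
  obtain q where q: "max m n = n + q" by (metis le_Suc_ex max.cobounded2)
  show ?thesis
  proof (rule that)
    show "connect \<phi> m p a \<in> car (A (max m n))" "j (max m n) (connect \<phi> m p a) = j m a"
      "j (max m n) (P (max m n) (connect \<phi> m p a)) = j m (P m a)"
      unfolding p using assms by (simp_all add: connect(1) j_connect P_connect P_car)
    show "connect \<phi> n q b \<in> car (A (max m n))" "j (max m n) (connect \<phi> n q b) = j n b"
      "j (max m n) (P (max m n) (connect \<phi> n q b)) = j n (P n b)"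
      unfolding q using assms by (simp_all add: connect(1) j_connect P_connect P_car)
  qed
qed

text \<open>At a common later stage this is contractivity of the expectation. It shows at once that
  the expectation on the union of the stages is well defined and that it is uniformly
  continuous.\<close>

lemma norm_j_P_diff:
  assumes "a \<in> car (A m)" "b \<in> car (A n)"
  shows "norm (j m (P m a) - j n (P n b)) \<le> norm (j m a - j n b)"
proof -
  obtain k a' b' where k: "a' \<in> car (A k)" "b' \<in> car (A k)" "j k a' = j m a" "j k b' = j n b"
    "j k (P k a') = j m (P m a)" "j k (P k b') = j n (P n b)"
    using j_common[OF assms] by metis
  show ?thesis
    using nrm_P_diff[OF k(1,2)] J.norm_f_sub[OF k(1,2)] J.norm_f_sub[OF P_car[OF k(1)] P_car[OF k(2)]]
    by (simp add: k)
qed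

abbreviation "AJ m \<equiv> j m ` car (A m)"
abbreviation "BJ m \<equiv> j m ` B m"

lemma limit_expectation:
  "\<exists>p. continuous_on (closure (\<Union>m. AJ m)) p \<and> (\<forall>m. \<forall>a\<in>car (A m). p (j m a) = j m (P m a))"
proof -
  \<comment> \<open>The chosen value does not depend on the stage or on the preimage, by
    \<open>norm_j_P_diff\<close> for two descriptions of the same point.\<close>
  define r where "r x = (SOME y. \<exists>m a. a \<in> car (A m) \<and> x = j m a \<and> y = j m (P m a))" for x
  have r: "r (j m a) = j m (P m a)" if a: "a \<in> car (A m)" for m a
    unfolding r_def
  proof (rule some_equality)
    show "\<exists>n b. b \<in> car (A n) \<and> j m a = j n b \<and> j m (P m a) = j n (P n b)" using a by blast
    fix y assume "\<exists>n b. b \<in> car (A n) \<and> j m a = j n b \<and> y = j n (P n b)"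
    then show "y = j m (P m a)" using norm_j_P_diff[OF a] by fastforce
  qed
  have "uniformly_continuous_on (\<Union>m. AJ m) r"
    unfolding uniformly_continuous_on_def dist_norm
  proof (intro allI impI)
    fix \<epsilon> :: real assume "\<epsilon> > 0"
    moreover have "norm (r x - r y) \<le> norm (x - y)" if "x \<in> (\<Union>m. AJ m)" "y \<in> (\<Union>m. AJ m)" for x y
      using that norm_j_P_diff by (auto simp: r)
    ultimately show "\<exists>d>0. \<forall>x\<in>\<Union>m. AJ m. \<forall>x'\<in>\<Union>m. AJ m. norm (x' - x) < d \<longrightarrow> norm (r x' - r x) < \<epsilon>"
      by (intro exI[of _ \<epsilon>]) (meson le_less_trans)
  qed
  then obtain p where "uniformly_continuous_on (closure (\<Union>m. AJ m)) p" and rp: "\<And>x. x \<in> (\<Union>m. AJ m) \<Longrightarrow> r x = p x"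
    by (rule uniformly_continuous_on_extension_on_closure) blast
  then have "continuous_on (closure (\<Union>m. AJ m)) p" by (intro uniformly_continuous_imp_continuous)
  moreover have "p (j m a) = j m (P m a)" if "a \<in> car (A m)" for m a
  proof -
    have "j m a \<in> (\<Union>m. AJ m)" using that by blast
    then show ?thesis using rp r[OF that] by simp
  qed
  ultimately show ?thesis by (intro exI[of _ p]) simp
qed

lemma lim_sys_j:
  assumes p: "continuous_on (closure (\<Union>m. AJ m)) p" "\<And>m a. a \<in> car (A m) \<Longrightarrow> p (j m a) = j m (P m a)"
  shows "lim_sys AJ BJ p"
proof
  have step: "j m ` S \<subseteq> j (Suc m) ` T" if "S \<subseteq> car (A m)" "\<phi> m ` S \<subseteq> T" for m S T
  proof
    fix x assume "x \<in> j m ` S"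
    then obtain a where "a \<in> S" "x = j m a" by blast
    then show "x \<in> j (Suc m) ` T" using j_step[of a m] that by (intro image_eqI[of _ _ "\<phi> m a"]) auto
  qed
  show "cartan (AJ m) (BJ m) p" for m by (rule J.cartan_image[OF pair fce]) (rule p(2))
  show "AJ m \<subseteq> AJ (Suc m)" for m by (rule step[OF _ phi_car]) simp
  show "BJ m \<subseteq> BJ (Suc m)" for m by (rule step[OF BA phi_B])
  show "nz (AJ m) (BJ m) \<subseteq> nz (AJ (Suc m)) (BJ (Suc m))" for m
    unfolding J.image_normalizers[OF BA, symmetric]
    by (rule step[OF _ phi_nz]) (auto simp: normalizers_def)
qed (rule p(1))

abbreviation "BL \<equiv> ind_lim_sub A B \<phi>"

lemma BL_L: "BL \<subseteq> car L"
  by (auto simp: ind_lim_sub_def)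

lemma emb_car_L: "emb L ` car L = closure (\<Union>m. AJ m)"
proof -
  have "D \<subseteq> car L" by (auto simp: D_def canon_L)
  then have "emb L ` car L = closure (emb L ` D)" by (metis E.image_closure car_L)
  then show ?thesis by (simp add: D_def image_UN image_image j_def)
qed

lemma emb_BL: "emb L ` BL = closure (\<Union>m. BJ m)"
proof -
  have "DB \<subseteq> car L" using BA by (auto simp: DB_def intro!: canon_L)
  moreover have "closure_in L DB = BL"
    using BL_L by (auto simp: ind_lim_sub_eq closure_in_def L_ops) (auto simp: L_eq closure_in_def)
  ultimately show ?thesis
    using E.image_closure[of DB] by (simp add: DB_def image_UN image_image j_def)
qed

lemma cartan_pair_lim: "cartan_pair L BL"
proof -
  obtain p where p: "continuous_on (closure (\<Union>m. AJ m)) p" "\<And>m a. a \<in> car (A m) \<Longrightarrow> p (j m a) = j m (P m a)"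
    using limit_expectation by blast
  interpret M: lim_sys AJ BJ p by (rule lim_sys_j[OF p(1)]) (rule p(2))
  have "cartan (emb L ` car L) (emb L ` BL) p"
    using M.cartan_lim by (simp add: emb_car_L emb_BL M.A_def M.B_def M.U_def M.V_def)
  then show ?thesis by (rule E.cartan_pair_if_cartan[OF BL_L])
qed

lemma cstar_diagonal_lim:
  assumes diag: "\<And>n. cstar_diagonal (A n) (B n)"
  shows "cstar_diagonal L BL"
  unfolding cstar_diagonal_def
proof (intro conjI cartan_pair_lim allI impI)
  fix g assume g: "pure_state (L\<lparr>car := BL\<rparr>) g"
  obtain p where p: "continuous_on (closure (\<Union>m. AJ m)) p" "\<And>m a. a \<in> car (A m) \<Longrightarrow> p (j m a) = j m (P m a)"
    using limit_expectation by blast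
  interpret M: lim_sys AJ BJ p by (rule lim_sys_j[OF p(1)]) (rule p(2))
  have "sub_cstar L BL"
    using cartan_pair_lim by (simp add: cartan_pair_def maximal_abelian_def abelian_sub_cstar_def)
  note EB = E.iso_rep_sub[OF this]
  obtain F where F: "\<And>x. x \<in> car L \<Longrightarrow> F (emb L x) = g x" using E.functional_lift[of g] by blast
  then have FB: "\<And>x. x \<in> BL \<Longrightarrow> F (emb L x) = g x" using BL_L by blast
  have "tpure (emb L ` BL) F" using iso_rep.pure_state_iff[OF EB, of F g] FB g by simp
  then have F': "tpure M.B F" by (simp add: emb_BL M.B_def M.V_def)
  have "tunique M.A M.B F"
  proof (rule M.tunique_lim[OF _ F'])
    fix m H assume H: "tpure (BJ m) H"
    have "pure_state ((A m)\<lparr>car := B m\<rparr>) (\<lambda>x. H (j m x))"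
      using iso_rep.pure_state_iff[OF J.iso_rep_sub[OF sub], of m H "\<lambda>x. H (j m x)"] H by simp
    then have "extends_uniquely (A m) (B m) (\<lambda>x. H (j m x))"
      using diag[of m] unfolding cstar_diagonal_def by blast
    then show "tunique (AJ m) (BJ m) H" using J.extends_uniquely_iff[OF BA, of m H "\<lambda>x. H (j m x)"] by simp
  qed
  then have "tunique (emb L ` car L) (emb L ` BL) F" by (simp add: emb_car_L emb_BL M.A_def M.B_def M.U_def M.V_def)
  then show "extends_uniquely L BL g" using E.extends_uniquely_iff[OF BL_L, of F g] FB by simp
qed

end

theorem theorem1p10:
  fixes A :: "nat \<Rightarrow> 'a star_alg"
    and B :: "nat \<Rightarrow> 'a set"
    and P \<phi> :: "nat \<Rightarrow> 'a \<Rightarrow> 'a"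
  assumes "\<And>n. cartan_pair (A n) (B n)"
    and "\<And>n. faithful_cond_exp (A n) (B n) (P n)"
    and "\<And>n. star_hom (A n) (A (Suc n)) (\<phi> n)"
    and "\<And>n. inj_on (\<phi> n) (car (A n))"
    and "\<And>n. \<phi> n ` B n \<subseteq> B (Suc n)"
    and "\<And>n. \<phi> n ` normalizers (A n) (B n) \<subseteq> normalizers (A (Suc n)) (B (Suc n))"
    and "\<And>n a. a \<in> car (A n) \<Longrightarrow> P (Suc n) (\<phi> n a) = \<phi> n (P n a)"
  shows "cartan_pair (ind_lim A \<phi>) (ind_lim_sub A B \<phi>) \<and>
    ((\<forall>n. cstar_diagonal (A n) (B n)) \<longrightarrow>
       cstar_diagonal (ind_lim A \<phi>) (ind_lim_sub A B \<phi>))"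
proof -
  have st: "cstar_algebra (A n)" "sub_cstar (A n) (B n)" for n
    using assms(1)[of n] by (simp_all add: cartan_pair_def maximal_abelian_def abelian_sub_cstar_def)
  interpret cartan_sys A \<phi> B P
    by (intro cartan_sys.intro ind_sys_sub.intro ind_sys.intro seq_alg.intro
        ind_sys_axioms.intro ind_sys_sub_axioms.intro cartan_sys_axioms.intro; fact st assms)
  show ?thesis using cartan_pair_lim cstar_diagonal_lim by blast
qed

end
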